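(* Let $p,q\in\mathbb Z_+$ and let $f\in\mathcal L_p$ and $g\in\mathcal L_q$ be symmetric functions. Suppose there exists a probability measure $m$ equivalent to $\mu$, with $\psi=d\mu/dm\in(0,\infty)$ $m$-a.e., such that $f\cdot(\psi^{\otimes p})^{1/\alpha}\in\mathcal L_{p,+}^\alpha(m)$ and $g\cdot(\psi^{\otimes q})^{1/\alpha}\in\mathcal L_{q,+}^\alpha(m)$. Then the multiple extremal integrals $I_p^e(f)$ and $I_q^e(g)$ are independent if and only if there exist disjoint measurable sets $A,B\in\mathcal E$ such that $\operatorname{supp}\{f\}\subset A^p$ modulo $\mu^p$ and $\operatorname{supp}\{g\}\subset B^q$ modulo $\mu^q$.
   Context: $\mathbb Z_+=\{1,2,\dots\}$, $\alpha\in(0,\infty)$, $\bigvee$ denotes supremum. $(E,\mathcal E)$ is a Borel space (there is a measurable bijection, with measurable inverse, onto a Borel subset of $[0,1]$) and $\mu$ is a nonzero $\sigma$-finite measure on it. Notation: $\ln_+x=\ln(x\vee1)$; $\psi^{\otimes k}(x_1,\dots,x_k)=\psi(x_1)\cdots\psi(x_k)$; $\operatorname{supp}\{f\}=\{f>0\}$, and "$S\subset A^p$ modulo $\mu^p$" means $\mu^p(S\setminus A^p)=0$. Symmetric means invariant under permutations of the coordinates. For a measure $\nu$ on $E$, $\mathcal L_{k,+}^\alpha(\nu)$ is the class of $h\in\mathcal L_k$ with $\int_{E^k}h^\alpha(1+(\ln_+h)^{k-1})\,d\nu^k<\infty$ if $k>2$; $\int_{E^2}h^\alpha\bigl(1+(\ln_+h)\cdot\ln_+|\ln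 h|\bigr)\,d\nu^2<\infty$ if $k=2$; and $\int_Eh^\alpha\,d\nu<\infty$ if $k=1$. $M_\alpha=(M_\alpha(A))_{A\in\mathcal E}$ is an independently scattered $\alpha$-Fréchet random sup measure with control measure $\mu$: $[0,\infty]$-valued random variables such that (i) $M_\alpha(A_1),\dots,M_\alpha(A_n)$ are independent for disjoint $A_i\in\mathcal E$; (ii) $\mathbb P(M_\alpha(A)\le x)=\exp\{-\mu(A)x^{-\alpha}\}$, $x\in(0,\infty)$ (so $M_\alpha(A)=\infty$ a.s. if $\mu(A)=\infty$); (iii) $M_\alpha(\bigcup_{j\ge1}A_j)=\bigvee_{j\ge1}M_\alpha(A_j)$ a.s. for $A_j\in\mathcal E$. Off-diagonal space: $D^{(k)}=\{(x_1,\dots,x_k)\in E^k:x_i=x_j\text{ for some }i\ne j\}$, $E^{(k)}=E^k\setminus D^{(k)}$, $\mathcal E^{(k)}=\{A\cap E^{(k)}:A\in\mathcal E^k\}$. $\mathcal L_k$ is the class of measurable $f:E^k\to[0,\infty]$ vanishing on $D^{(k)}$. Product random sup measure $M_\alpha^{(k)}$ on $\mathcal E^{(k)}$: when the control measure is finite, $M_\alpha^{(k)}(A_1\times\cdots\times A_k)=M_\alpha(A_1)\cdots M_\alpha(A_k)$ for pairwise disjoint $A_i\in\mathcal E$; $M_\alpha^{(k)}(\bigcup_{i=1}^mB_i)=\bigvee_{i=1}^mM_\alpha^{(k)}(B_i)$ for such off-diagonal rectangles $B_i$; and for $A\in\mathcal E^{(k)}$, $M_\alpha^{(k)}(A)$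 is the $L^\gamma$-limit ($\gamma\in(0,\alpha)$) of $M_\alpha^{(k)}(A_n)$ for finite unions $A_n$ of off-diagonal rectangles with $\mu^k(A_n\Delta A)\to0$. For $\sigma$-finite $\mu$, take $E_n\uparrow E$ with $\mu(E_n)\in(0,\infty)$, let $M_{\alpha,E_n}(\cdot)=M_\alpha(\cdot\cap E_n)$ and $M_\alpha^{(k)}(A)=\bigvee_nM_{\alpha,E_n}^{(k)}(A)$. All of this is a.s. independent of choices. Multiple extremal integral: for simple $f=\sum_{i=1}^Na_i\mathbf 1_{A_i}$ with $a_i\in(0,\infty)$ and disjoint $A_i\in\mathcal E^{(k)}$, $I_k^e(f)=\bigvee_{i=1}^Na_iM_\alpha^{(k)}(A_i)$. For $f\in\mathcal L_k$, $I_k^e(f)$ is the a.s. limit of $I_k^e(f_n)$ for any such simple $f_n\le f_{n+1}$ with $f_n\to f$ $\mu^k$-a.e. (a.s. independent of the choice). Both integrals in the claim are with respect to the same $M_\alpha$. Equivalently in law (LePage representation), jointly over $f\in\mathcal L_k$ and $k\in\mathbb Z_+$ and for any probability measure $m$ equivalent to $\mu$ with $\psi=d\mu/dm\in(0,\infty)$ $m$-a.e., $I_k^e(f)\overset d=\bigvee_{\boldsymbol j}f(T_{j_1},\dots,T_{j_k})\prod_{r=1}^k\Gamma_{j_r}^{-1/\alpha}\psi(T_{j_r})^{1/\alpha}$, the supremum being over $\boldsymbol j\in\mathbb Z_+^k$ with distinct entries, $(\Gamma_i)$ the arrival times of a standard Poisson process, and $(T_i)$ i.i.d. with law $m$ independent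 of $(\Gamma_i)$. *)

theory Defs
  imports "HOL-Probability.Probability" "HOL-Combinatorics.Permutations"
begin

text \<open>
  A measure \<open>\<mu> :: 'a measure\<close> carries both the measurable space \<open>(E, \<E>)\<close>, as
  \<open>(space \<mu>, sets \<mu>)\<close>, and the control measure. Points of \<open>E\<^sup>k\<close> are the extensional functions on
  \<open>{..<k}\<close>, so coordinates are numbered from \<open>0\<close>.
\<close>

definition is_borel_space :: "'a measure \<Rightarrow> bool" where
  "is_borel_space E \<longleftrightarrow>
     (\<exists>S \<phi>. S \<in> sets (borel :: real measure) \<and> S \<subseteq> {0..1} \<and>
        bij_betw \<phi> (space E) S \<and>
        \<phi> \<in> measurable E (restrict_space borel S) \<and>
        the_inv_into (space E) \<phi> \<in> measurable (restrict_space borel S) E)"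

abbreviation power_measure :: "'a measure \<Rightarrow> nat \<Rightarrow> (nat \<Rightarrow> 'a) measure" where
  "power_measure \<mu> k \<equiv> PiM {..<k} (\<lambda>_. \<mu>)"

definition diagonals :: "'a measure \<Rightarrow> nat \<Rightarrow> (nat \<Rightarrow> 'a) set" where
  "diagonals E k = {x \<in> space (power_measure E k). \<exists>i<k. \<exists>j<k. i \<noteq> j \<and> x i = x j}"

definition off_diagonal :: "'a measure \<Rightarrow> nat \<Rightarrow> (nat \<Rightarrow> 'a) set" where
  "off_diagonal E k = space (power_measure E k) - diagonals E k"

definition off_diagonal_sets :: "'a measure \<Rightarrow> nat \<Rightarrow> (nat \<Rightarrow> 'a) set set" where
  "off_diagonal_sets E k = sets (restrict_space (power_measure E k) (off_diagonal E k))"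

definition class_L :: "'a measure \<Rightarrow> nat \<Rightarrow> ((nat \<Rightarrow> 'a) \<Rightarrow> ennreal) set" where
  "class_L E k = {f \<in> borel_measurable (power_measure E k). \<forall>x\<in>diagonals E k. f x = 0}"

definition symmetric_fun :: "'a measure \<Rightarrow> nat \<Rightarrow> ((nat \<Rightarrow> 'a) \<Rightarrow> ennreal) \<Rightarrow> bool" where
  "symmetric_fun E k f \<longleftrightarrow>
     (\<forall>\<pi>. \<pi> permutes {..<k} \<longrightarrow> (\<forall>x\<in>space (power_measure E k). f (x \<circ> \<pi>) = f x))"

text \<open>Powers with positive exponent and logarithms on \<open>[0,\<infinity>]\<close>; here \<open>ln 0 = -\<infinity>\<close>, so
  \<open>\<bar>ln 0\<bar> = \<bar>ln \<infinity>\<bar> = \<infinity>\<close>.\<close>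

definition enn_powr :: "ennreal \<Rightarrow> real \<Rightarrow> ennreal" where
  "enn_powr x a = (if x = \<infinity> then \<infinity> else ennreal (enn2real x powr a))"

definition enn_ln_plus :: "ennreal \<Rightarrow> ennreal" where
  "enn_ln_plus x = (if x = \<infinity> then \<infinity> else ennreal (ln (max (enn2real x) 1)))"

definition enn_abs_ln :: "ennreal \<Rightarrow> ennreal" where
  "enn_abs_ln x = (if x = 0 \<or> x = \<infinity> then \<infinity> else ennreal \<bar>ln (enn2real x)\<bar>)"

definition class_L_plus :: "real \<Rightarrow> 'a measure \<Rightarrow> nat \<Rightarrow> ((nat \<Rightarrow> 'a) \<Rightarrow> ennreal) set" where
  "class_L_plus \<alpha> \<nu> k = {h \<in> class_L \<nu> k.
     (\<integral>\<^sup>+ x. enn_powr (h x) \<alpha> *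
        (if k = 1 then 1
         else if k = 2 then 1 + enn_ln_plus (h x) * enn_ln_plus (enn_abs_ln (h x))
         else 1 + enn_ln_plus (h x) ^ (k - 1)) \<partial>power_measure \<nu> k) < \<infinity>}"

text \<open>An independently scattered \<open>\<alpha>\<close>-Frechet random sup measure with control measure \<open>\<mu>\<close>, defined
  on the probability space \<open>P\<close>.\<close>

definition frechet_sup_measure ::
    "'w measure \<Rightarrow> 'a measure \<Rightarrow> real \<Rightarrow> ('a set \<Rightarrow> 'w \<Rightarrow> ennreal) \<Rightarrow> bool" where
  "frechet_sup_measure P \<mu> \<alpha> M \<longleftrightarrow>
     (\<forall>A\<in>sets \<mu>. M A \<in> borel_measurable P) \<and>
     (\<forall>n A. A ` {..<n::nat} \<subseteq> sets \<mu> \<and> disjoint_family_on A {..<n} \<longrightarrow>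
        prob_space.indep_vars P (\<lambda>_. borel) (\<lambda>i. M (A i)) {..<n}) \<and>
     (\<forall>A\<in>sets \<mu>. emeasure \<mu> A < \<infinity> \<longrightarrow>
        (\<forall>x::real. 0 < x \<longrightarrow>
           measure P {\<omega>\<in>space P. M A \<omega> \<le> ennreal x} = exp (- measure \<mu> A * x powr (- \<alpha>)))) \<and>
     (\<forall>A\<in>sets \<mu>. emeasure \<mu> A = \<infinity> \<longrightarrow> (AE \<omega> in P. M A \<omega> = \<infinity>)) \<and>
     (\<forall>A. range A \<subseteq> sets \<mu> \<longrightarrow>
        (AE \<omega> in P. M (\<Union>j::nat. A j) \<omega> = (SUP j. M (A j) \<omega>)))"

text \<open>
  \<open>B :: nat \<Rightarrow> nat \<Rightarrow> 'a set\<close> encodes the off-diagonal rectangles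
  \<open>B i 0 \<times> \<dots> \<times> B i (k - 1)\<close>, \<open>i < n\<close>.
\<close>

definition off_diagonal_rectangles ::
    "'a measure \<Rightarrow> nat \<Rightarrow> nat \<Rightarrow> (nat \<Rightarrow> nat \<Rightarrow> 'a set) \<Rightarrow> bool" where
  "off_diagonal_rectangles E k n B \<longleftrightarrow>
     (\<forall>i<n. (\<forall>r<k. B i r \<in> sets E) \<and> disjoint_family_on (B i) {..<k})"

definition rectangle_union :: "nat \<Rightarrow> nat \<Rightarrow> (nat \<Rightarrow> nat \<Rightarrow> 'a set) \<Rightarrow> (nat \<Rightarrow> 'a) set" where
  "rectangle_union k n B = (\<Union>i<n. PiE {..<k} (B i))"

definition rectangle_union_value ::
    "('a set \<Rightarrow> 'w \<Rightarrow> ennreal) \<Rightarrow> nat \<Rightarrow> nat \<Rightarrow> (nat \<Rightarrow> nat \<Rightarrow> 'a set) \<Rightarrow> 'w \<Rightarrow> ennreal" where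
  "rectangle_union_value M k n B \<omega> = (SUP i\<in>{..<n}. \<Prod>r<k. M (B i r) \<omega>)"

text \<open>
  The random variables \<open>M\<^sup>(\<^sup>k\<^sup>)(A)\<close> and \<open>I\<^sub>k(f)\<close> are defined only up to almost sure equality. They
  are therefore introduced by predicates stating that a random variable \<open>X\<close> is a version of them.

  In the next definition the control measure is finite. The truncated differences of \<open>ennreal\<close>
  give \<open>\<bar>Y - X\<bar> = (Y - X) + (X - Y)\<close>.
\<close>

definition has_product_sup_measure_finite ::
    "'w measure \<Rightarrow> 'a measure \<Rightarrow> real \<Rightarrow> ('a set \<Rightarrow> 'w \<Rightarrow> ennreal) \<Rightarrow> nat \<Rightarrow> (nat \<Rightarrow> 'a) set \<Rightarrow>
     ('w \<Rightarrow> ennreal) \<Rightarrow> bool" where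
  "has_product_sup_measure_finite P \<mu> \<alpha> M k A X \<longleftrightarrow>
     X \<in> borel_measurable P \<and>
     (\<exists>(n :: nat \<Rightarrow> nat) (B :: nat \<Rightarrow> nat \<Rightarrow> nat \<Rightarrow> 'a set).
        (\<forall>l. off_diagonal_rectangles \<mu> k (n l) (B l)) \<and>
        (\<lambda>l. emeasure (power_measure \<mu> k)
               ((rectangle_union k (n l) (B l) - A) \<union> (A - rectangle_union k (n l) (B l))))
           \<longlonglongrightarrow> 0 \<and>
        (\<forall>\<gamma>. 0 < \<gamma> \<and> \<gamma> < \<alpha> \<longrightarrow>
           (\<lambda>l. \<integral>\<^sup>+ \<omega>. enn_powr ((rectangle_union_value M k (n l) (B l) \<omega> - X \<omega>) +
                                  (X \<omega> - rectangle_union_value M k (n l) (B l) \<omega>)) \<gamma> \<partial>P)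
              \<longlonglongrightarrow> 0))"

text \<open>\<open>M\<^sub>F = M (\<cdot> \<inter> F)\<close> has the control measure \<open>\<mu> (\<cdot> \<inter> F)\<close>, which is the density of \<open>indicator F\<close>
  with respect to \<open>\<mu>\<close>. For finite \<open>\<mu>\<close> one may take \<open>F n = space \<mu>\<close>.\<close>

definition has_product_sup_measure ::
    "'w measure \<Rightarrow> 'a measure \<Rightarrow> real \<Rightarrow> ('a set \<Rightarrow> 'w \<Rightarrow> ennreal) \<Rightarrow> nat \<Rightarrow> (nat \<Rightarrow> 'a) set \<Rightarrow>
     ('w \<Rightarrow> ennreal) \<Rightarrow> bool" where
  "has_product_sup_measure P \<mu> \<alpha> M k A X \<longleftrightarrow>
     X \<in> borel_measurable P \<and>
     (\<exists>(F :: nat \<Rightarrow> 'a set) (Y :: nat \<Rightarrow> 'w \<Rightarrow> ennreal).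
        range F \<subseteq> sets \<mu> \<and> incseq F \<and> (\<Union>n. F n) = space \<mu> \<and>
        (\<forall>n. 0 < emeasure \<mu> (F n) \<and> emeasure \<mu> (F n) < \<infinity>) \<and>
        (\<forall>n. has_product_sup_measure_finite P (density \<mu> (indicator (F n))) \<alpha>
               (\<lambda>C. M (C \<inter> F n)) k A (Y n)) \<and>
        (AE \<omega> in P. X \<omega> = (SUP n. Y n \<omega>)))"

definition has_simple_extremal_integral ::
    "'w measure \<Rightarrow> 'a measure \<Rightarrow> real \<Rightarrow> ('a set \<Rightarrow> 'w \<Rightarrow> ennreal) \<Rightarrow> nat \<Rightarrow>
     ((nat \<Rightarrow> 'a) \<Rightarrow> ennreal) \<Rightarrow> ('w \<Rightarrow> ennreal) \<Rightarrow> bool" where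
  "has_simple_extremal_integral P \<mu> \<alpha> M k f X \<longleftrightarrow>
     X \<in> borel_measurable P \<and>
     (\<exists>(N::nat) (a :: nat \<Rightarrow> ennreal) (A :: nat \<Rightarrow> (nat \<Rightarrow> 'a) set) (Y :: nat \<Rightarrow> 'w \<Rightarrow> ennreal).
        (\<forall>i<N. 0 < a i \<and> a i < \<infinity>) \<and>
        (\<forall>i<N. A i \<in> off_diagonal_sets \<mu> k) \<and> disjoint_family_on A {..<N} \<and>
        (\<forall>x\<in>space (power_measure \<mu> k). f x = (\<Sum>i<N. a i * indicator (A i) x)) \<and>
        (\<forall>i<N. has_product_sup_measure P \<mu> \<alpha> M k (A i) (Y i)) \<and>
        (AE \<omega> in P. X \<omega> = (SUP i\<in>{..<N}. a i * Y i \<omega>)))"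

definition has_extremal_integral ::
    "'w measure \<Rightarrow> 'a measure \<Rightarrow> real \<Rightarrow> ('a set \<Rightarrow> 'w \<Rightarrow> ennreal) \<Rightarrow> nat \<Rightarrow>
     ((nat \<Rightarrow> 'a) \<Rightarrow> ennreal) \<Rightarrow> ('w \<Rightarrow> ennreal) \<Rightarrow> bool" where
  "has_extremal_integral P \<mu> \<alpha> M k f X \<longleftrightarrow>
     X \<in> borel_measurable P \<and>
     (\<exists>(s :: nat \<Rightarrow> (nat \<Rightarrow> 'a) \<Rightarrow> ennreal) (Z :: nat \<Rightarrow> 'w \<Rightarrow> ennreal).
        (\<forall>n. has_simple_extremal_integral P \<mu> \<alpha> M k (s n) (Z n)) \<and>
        (\<forall>n. \<forall>x\<in>space (power_measure \<mu> k). s n x \<le> s (Suc n) x) \<and>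
        (AE x in power_measure \<mu> k. (\<lambda>n. s n x) \<longlonglongrightarrow> f x) \<and>
        (AE \<omega> in P. (\<lambda>n. Z n \<omega>) \<longlonglongrightarrow> X \<omega>))"

definition support_within ::
    "'a measure \<Rightarrow> nat \<Rightarrow> ((nat \<Rightarrow> 'a) \<Rightarrow> ennreal) \<Rightarrow> 'a set \<Rightarrow> bool" where
  "support_within \<mu> k f A \<longleftrightarrow>
     emeasure (power_measure \<mu> k)
       ({x \<in> space (power_measure \<mu> k). f x > 0} - PiE {..<k} (\<lambda>_. A)) = 0"

end

theory Submission
  imports Defs
begin

text \<open>
  If \<open>supp f \<subseteq> A\<^sup>p\<close> and \<open>supp g \<subseteq> B\<^sup>q\<close>, then the integrals are almost surely functions of the
  restrictions of \<open>M\<close> to \<open>A\<close> and to \<open>B\<close>, which are independent for disjoint \<open>A\<close> and \<open>B\<close>.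

  Conversely, let \<open>A\<^sub>0\<close> and \<open>B\<^sub>0\<close> be the sets of those points over which the sections of the two supports
  are not null. If \<open>A\<^sub>0 \<inter> B\<^sub>0\<close> has positive measure, a single large value of \<open>M\<close> on it makes both
  integrals large, so that their joint tail is at least of order \<open>y\<close> to the power \<open>-\<alpha>\<close>. By the
  integrability assumption each marginal tail is of order at most \<open>y\<close> to the power \<open>-3\<alpha>/4\<close>; hence the
  product of the marginal tails is of smaller order than the joint tail, and the integrals are not
  independent.
\<close>

subsection \<open>Tails of products of independent variables\<close>

text \<open>The integrals are accessible only through a tower of limits: finite unions of
  rectangles, limits in \<open>L^\<gamma>\<close>, suprema over sets of finite measure, simple
  functions, increasing limits. Each estimate is therefore proved first for a finite family of
  weighted rectangles, with constants that do not depend on the number of rectangles and in a form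
  that survives these limits. The uniformity comes from refining the sides into disjoint cells: the
  values of \<open>M\<close> on cells are independent, the value on a side is a maximum of cell
  values, and summing over tuples of cells gives an integral of the step function, whatever the
  partition. For the upper tail a union bound over tuples suffices once very large cell values are
  cut off. For the joint lower tail the events of different tuples overlap; the overlap is
  controlled by the number of cells whose value exceeds 1. The density \<psi> need not be bounded or
  bounded away from 0: it is restricted to sets where it lies between powers of 2, and its dyadic
  levels are absorbed into the scales of the cell values.\<close>

lemma dyadic_levels:
  fixes n :: "nat \<Rightarrow> real"
  assumes n: "\<And>t. t < Suc d \<Longrightarrow> 0 \<le> n t \<and> n t \<le> K" and y: "0 < y" "y < (\<Prod>t<Suc d. n t)" and K: "0 < K"
  shows "\<exists>e\<in>PiE {..<d} (\<lambda>_. {..nat \<lfloor>log 2 (K ^ Suc d / y)\<rfloor>}).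
           (\<forall>t<d. K / 2 ^ Suc (e t) < n t) \<and> y / (\<Prod>t<d. K / 2 ^ e t) < n d"
proof -
  have pos: "0 < n t" if "t < Suc d" for t
  proof (rule ccontr)
    assume "\<not> 0 < n t"
    then have "n t = 0" using n[OF that] by simp
    then have "(\<Prod>t<Suc d. n t) = 0" using that by (intro prod_zero) auto
    then show False using y by linarith
  qed
  \<comment> \<open>The factor \<open>n t\<close> lies in the dyadic shell from
    \<open>K / 2 ^ Suc (e t)\<close> (excluded) to \<open>K / 2 ^ e t\<close>. Only the first
    \<open>d\<close> factors are discretized; the last one absorbs the constraint on the
    product.\<close>
  define e where "e = (\<lambda>t\<in>{..<d}. nat \<lfloor>log 2 (K / n t)\<rfloor>)"
  have e1: "2 ^ e t \<le> K / n t" and e2: "K / n t < 2 ^ Suc (e t)" if t: "t < d" for t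
  proof -
    have p: "0 < n t" "n t \<le> K" using n[of t] pos[of t] t by auto
    then have l0: "0 \<le> log 2 (K / n t)" by (simp add: zero_le_log_cancel_iff)
    have r: "real (e t) = of_int \<lfloor>log 2 (K / n t)\<rfloor>" using l0 t by (simp add: e_def)
    have q: "K / n t = 2 powr (log 2 (K / n t))" using p K by simp
    have "2 ^ e t = 2 powr (real (e t))" by (simp add: powr_realpow)
    also have "\<dots> \<le> 2 powr (log 2 (K / n t))" unfolding r by (intro powr_mono) auto
    finally show "2 ^ e t \<le> K / n t" using q by simp
    have "2 powr (log 2 (K / n t)) < 2 powr (real (Suc (e t)))"
      unfolding of_nat_Suc r by (intro powr_less_mono) (linarith, simp)
    also have "\<dots> = 2 ^ Suc (e t)" by (rule powr_realpow) simp
    finally show "K / n t < 2 ^ Suc (e t)" using q by simp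
  qed
  \<comment> \<open>The other \<open>d\<close> factors are at most \<open>K\<close>, so no factor
    falls below \<open>y / K ^ d\<close>; this limits the number of shells.\<close>
  have "e t \<le> nat \<lfloor>log 2 (K ^ Suc d / y)\<rfloor>" if t: "t < d" for t
  proof -
    have p: "0 < n t" using pos[of t] t by auto
    have "y < n t * (\<Prod>i\<in>{..<Suc d}-{t}. n i)" using y t by (subst prod.remove[symmetric]) auto
    also have "(\<Prod>i\<in>{..<Suc d}-{t}. n i) \<le> (\<Prod>i\<in>{..<Suc d}-{t}. K)"
      using n by (intro prod_mono) auto
    also have "\<dots> = K ^ d" using t by simp
    finally have "y < n t * K ^ d" using p by simp
    then have "K / n t \<le> K ^ Suc d / y" using p y K by (simp add: field_simps)
    then have "log 2 (K / n t) \<le> log 2 (K ^ Suc d / y)" using p K y by simp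
    then show ?thesis using t by (simp add: e_def nat_mono floor_mono)
  qed
  then have "e \<in> PiE {..<d} (\<lambda>_. {..nat \<lfloor>log 2 (K ^ Suc d / y)\<rfloor>})" by (auto simp: e_def)
  moreover have "\<forall>t<d. K / 2 ^ Suc (e t) < n t"
    using e2 pos by (auto simp: field_simps)
  moreover have "y / (\<Prod>t<d. K / 2 ^ e t) < n d"
  proof -
    have Q: "0 < (\<Prod>t<d. K / 2 ^ e t)" using K by (intro prod_pos) auto
    have "(\<Prod>t<d. n t) \<le> (\<Prod>t<d. K / 2 ^ e t)"
    proof (intro prod_mono conjI)
      fix t assume "t \<in> {..<d}"
      then have t: "t < d" by simp
      then show "0 \<le> n t" using n[of t] by simp
      show "n t \<le> K / 2 ^ e t" using e1[OF t] pos[of t] t by (simp add: field_simps)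
    qed
    then have "y < (\<Prod>t<d. K / 2 ^ e t) * n d"
      using y(2) pos[of d] by (simp add: less_le_trans mult_right_mono)
    then show ?thesis using Q by (simp add: field_simps)
  qed
  ultimately show ?thesis by blast
qed

text \<open>Union bound over dyadic vectors. For every vector the thresholds of the
  \<open>Suc d\<close> factors multiply to \<open>y / 2 ^ d\<close>, with \<open>y = x / h\<close>,
  so all vectors contribute the same power of \<open>h / x\<close>. Since only \<open>d\<close>
  levels are free, the logarithm appears with an exponent one below the number of factors, as in the
  integrability class.\<close>

lemma (in prob_space) product_tail:
  fixes N :: "nat \<Rightarrow> 'a \<Rightarrow> ennreal"
  assumes indep: "indep_vars (\<lambda>_. borel) N {..<Suc d}"
    and pos: "0 < \<alpha>" "0 < K" "0 < x" "0 < a" "\<And>t. t < Suc d \<Longrightarrow> 0 < b t" "\<And>t. t < Suc d \<Longrightarrow> 0 \<le> c t"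
    and tail: "\<And>t u. t < Suc d \<Longrightarrow> 0 < u \<Longrightarrow>
      prob {\<omega>\<in>space M. ennreal (b t * u) < N t \<omega>} \<le> c t * u powr (- \<alpha>)"
    and h: "h = a * (\<Prod>t<Suc d. b t)"
  shows "prob {\<omega>\<in>space M. (\<forall>t<Suc d. N t \<omega> \<le> ennreal (b t * K)) \<and> ennreal x < ennreal a * (\<Prod>t<Suc d. N t \<omega>)}
     \<le> (\<Prod>t<Suc d. c t) * (2 powr (\<alpha> * d) * (h / x) powr \<alpha> * (1 + 2 * ln (max 1 (K ^ Suc d * h / x))) ^ d)"
    (is "prob ?E \<le> ?rhs")
proof -
  have Nm[measurable]: "t < Suc d \<Longrightarrow> N t \<in> borel_measurable M" for t
    using indep unfolding indep_vars_def2 by auto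
  have bp: "0 < (\<Prod>t<Suc d. b t)" using pos(5) by (intro prod_pos) auto
  have hp: "0 < h" using bp pos h by simp
  have ln1: "0 \<le> ln (max 1 (K ^ Suc d * h / x))" by simp
  have rhs0: "0 \<le> ?rhs" using pos ln1 by (intro mult_nonneg_nonneg prod_nonneg zero_le_power) auto
  define y where "y = x / h"
  have yp: "0 < y" using hp pos by (simp add: y_def)
  define L where "L = nat \<lfloor>log 2 (K ^ Suc d / y)\<rfloor>"
  \<comment> \<open>Dividing by \<open>b t\<close> gives all factors the same cutoff
    \<open>K\<close>. On the event considered \<open>N t\<close> is finite, so passing to its real
    value loses nothing.\<close>
  define n where "n t \<omega> = enn2real (N t \<omega>) / b t" for t \<omega>
  have nN: "N t \<omega> = ennreal (b t * n t \<omega>)" "0 \<le> n t \<omega>" "n t \<omega> \<le> K"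
    if "N t \<omega> \<le> ennreal (b t * K)" "t < Suc d" for t \<omega>
  proof -
    have bt: "0 < b t" using pos that by auto
    have "N t \<omega> < top" using that(1) by (metis ennreal_less_top le_less_trans)
    then have E: "ennreal (enn2real (N t \<omega>)) = N t \<omega>" by (simp add: less_top)
    then show "N t \<omega> = ennreal (b t * n t \<omega>)" using bt by (simp add: n_def)
    show "0 \<le> n t \<omega>" using bt by (simp add: n_def)
    have "enn2real (N t \<omega>) \<le> b t * K" using that(1) bt pos by (intro enn2real_leI) auto
    then show "n t \<omega> \<le> K" using bt by (simp add: n_def field_simps)
  qed
  have En: "y < (\<Prod>t<Suc d. n t \<omega>)" if "\<omega> \<in> ?E" for \<omega>
  proof -
    have A: "\<And>t. t < Suc d \<Longrightarrow> N t \<omega> = ennreal (b t * n t \<omega>)" "\<And>t. t < Suc d \<Longrightarrow> 0 \<le> n t \<omega>"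
      using that nN by blast+
    have "(\<Prod>t<Suc d. N t \<omega>) = (\<Prod>t<Suc d. ennreal (b t * n t \<omega>))"
      using A by (intro prod.cong) auto
    also have "\<dots> = ennreal (\<Prod>t<Suc d. b t * n t \<omega>)"
      using A(2) pos(5) by (intro prod_ennreal mult_nonneg_nonneg) (simp_all add: less_imp_le)
    finally have P: "(\<Prod>t<Suc d. N t \<omega>) = ennreal ((\<Prod>t<Suc d. b t) * (\<Prod>t<Suc d. n t \<omega>))"
      by (simp add: prod.distrib)
    have np: "0 \<le> (\<Prod>t<Suc d. n t \<omega>)" using A by (intro prod_nonneg) auto
    have "ennreal x < ennreal a * (\<Prod>t<Suc d. N t \<omega>)" using that by blast
    also have "\<dots> = ennreal (h * (\<Prod>t<Suc d. n t \<omega>))"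
      unfolding P h using pos(4) bp np
      by (subst ennreal_mult[symmetric]) (simp_all del: prod.lessThan_Suc add: mult.assoc less_imp_le)
    finally have "x < h * (\<Prod>t<Suc d. n t \<omega>)" using pos by (simp add: ennreal_less_iff)
    then show ?thesis using hp by (simp add: y_def field_simps)
  qed
  show ?thesis
  proof (cases "K ^ Suc d \<le> y")
    case True
    have "\<omega> \<notin> ?E" for \<omega>
    proof
      assume E: "\<omega> \<in> ?E"
      have "(\<Prod>t<Suc d. n t \<omega>) \<le> (\<Prod>t<Suc d. K)" using E nN by (intro prod_mono) auto
      then show False using En[OF E] True by simp
    qed
    then have "?E = {}" by blast
    then have "prob ?E = 0" by (metis measure_empty)
    then show ?thesis using rhs0 by linarith
  next
    case False
    \<comment> \<open>For a fixed vector of levels the condition is a conjunction of one exceedance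
      per factor, to which independence applies directly.\<close>
    define Ev where "Ev e = {\<omega>\<in>space M. (\<forall>t<d. ennreal (b t * (K / 2 ^ Suc (e t))) < N t \<omega>) \<and>
      ennreal (b d * (y / (\<Prod>t<d. K / 2 ^ e t))) < N d \<omega>}" for e :: "nat \<Rightarrow> nat"
    have Evm[measurable]: "Ev e \<in> events" for e unfolding Ev_def by measurable
    let ?X = "PiE {..<d} (\<lambda>_. {..L})"
    have sub: "?E \<subseteq> (\<Union>e\<in>?X. Ev e)"
    proof
      fix \<omega> assume E: "\<omega> \<in> ?E"
      then have "\<And>t. t < Suc d \<Longrightarrow> N t \<omega> \<le> ennreal (b t * K)" by blast
      note nn = nN[OF this]
      obtain e where e: "e \<in> ?X" "\<forall>t<d. K / 2 ^ Suc (e t) < n t \<omega>" "y / (\<Prod>t<d. K / 2 ^ e t) < n d \<omega>"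
        using dyadic_levels[of d "\<lambda>t. n t \<omega>" K y] nn(2,3) yp En[OF E] pos(2) unfolding L_def by blast
      have W: "ennreal (b t * z) < N t \<omega>" if "z < n t \<omega>" "t < Suc d" "0 \<le> z" for z t
        using that nn(1)[of t] pos(5)[of t] by (simp add: ennreal_less_iff)
      have Q: "0 \<le> y / (\<Prod>t<d. K / 2 ^ e t)" using yp pos by (intro divide_nonneg_nonneg prod_nonneg) auto
      have "\<omega> \<in> Ev e" unfolding Ev_def
      proof (intro CollectI conjI allI impI)
        show "\<omega> \<in> space M" using E by blast
        show "ennreal (b t * (K / 2 ^ Suc (e t))) < N t \<omega>" if "t < d" for t
          by (intro W) (use e(2) that pos(2) in auto)
        show "ennreal (b d * (y / (\<Prod>t<d. K / 2 ^ e t))) < N d \<omega>"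
          by (intro W) (use e(3) Q in auto)
      qed
      then show "\<omega> \<in> (\<Union>e\<in>?X. Ev e)" using e by blast
    qed
    have fX: "finite ?X" by (intro finite_PiE) auto
    have cX: "card ?X = Suc L ^ d" by (simp add: card_PiE)
    let ?C = "(\<Prod>t<Suc d. c t) * 2 powr (\<alpha> * d) * y powr (- \<alpha>)"
    have Ev: "prob (Ev e) \<le> ?C" for e
    proof -
      define u where "u t = (if t < d then K / 2 ^ Suc (e t) else y / (\<Prod>t<d. K / 2 ^ e t))" for t
      have up: "0 < u t" for t using pos yp by (auto simp: u_def intro!: divide_pos_pos prod_pos)
      have u: "\<And>t. t < d \<Longrightarrow> u t = K / 2 ^ Suc (e t)" "u d = y / (\<Prod>t<d. K / 2 ^ e t)"
        by (auto simp: u_def)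
      have "Ev e = {\<omega>\<in>space M. (\<forall>t<d. ennreal (b t * u t) < N t \<omega>) \<and> ennreal (b d * u d) < N d \<omega>}"
        unfolding Ev_def u(2)[symmetric] by (intro Collect_cong conj_cong refl all_cong) (simp only: u(1))
      also have "\<dots> = (\<Inter>t\<in>{..<Suc d}. N t -` {ennreal (b t * u t) <..} \<inter> space M)"
        by (auto simp: less_Suc_eq)
      finally have "Ev e = (\<Inter>t\<in>{..<Suc d}. N t -` {ennreal (b t * u t) <..} \<inter> space M)" .
      then have "prob (Ev e) = (\<Prod>t<Suc d. prob (N t -` {ennreal (b t * u t) <..} \<inter> space M))"
        using indep_varsD_finite[OF indep, of "\<lambda>t. {ennreal (b t * u t) <..}"] by auto
      also have "\<dots> \<le> (\<Prod>t<Suc d. c t * u t powr (- \<alpha>))"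
      proof (intro prod_mono conjI)
        fix t assume t: "t \<in> {..<Suc d}"
        have "N t -` {ennreal (b t * u t) <..} \<inter> space M = {\<omega>\<in>space M. ennreal (b t * u t) < N t \<omega>}" by auto
        then show "prob (N t -` {ennreal (b t * u t) <..} \<inter> space M) \<le> c t * u t powr (- \<alpha>)"
          using tail[of t "u t"] up t by auto
      qed auto
      also have "\<dots> = (\<Prod>t<Suc d. c t) * (\<Prod>t<Suc d. u t powr (- \<alpha>))" by (simp only: prod.distrib)
      also have "(\<Prod>t<Suc d. u t powr (- \<alpha>)) = (\<Prod>t<Suc d. u t) powr (- \<alpha>)"
        using up by (subst prod_powr_distrib) (auto intro: less_imp_le)
      also have "(\<Prod>t<Suc d. u t) = (\<Prod>t<d. K / 2 ^ Suc (e t)) * (y / (\<Prod>t<d. K / 2 ^ e t))"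
        by (simp add: u_def)
      also have "(\<Prod>t<d. K / 2 ^ Suc (e t)) = (\<Prod>t<d. K / 2 ^ e t) / 2 ^ d"
        by (simp add: prod_dividef prod.distrib)
      \<comment> \<open>The levels cancel against the threshold of the last factor, and the bound no
        longer depends on \<open>e\<close>.\<close>
      also have "(\<Prod>t<d. K / 2 ^ e t) / 2 ^ d * (y / (\<Prod>t<d. K / 2 ^ e t)) = y / 2 ^ d"
        using pos by simp
      also have "(y / 2 ^ d) powr (- \<alpha>) = 2 powr (\<alpha> * d) * y powr (- \<alpha>)"
      proof -
        have "(y / 2 ^ d) powr (- \<alpha>) = y powr (- \<alpha>) / (2 powr d) powr (- \<alpha>)"
          using yp by (subst powr_divide) (auto simp: powr_realpow)
        also have "(2 powr real d) powr (- \<alpha>) = 1 / 2 powr (\<alpha> * d)"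
          by (simp add: powr_powr powr_minus_divide mult.commute)
        finally show ?thesis by simp
      qed
      finally show ?thesis by (simp add: mult.assoc)
    qed
    have "prob ?E \<le> prob (\<Union>e\<in>?X. Ev e)" using sub fX by (intro finite_measure_mono) auto
    also have "\<dots> \<le> (\<Sum>e\<in>?X. prob (Ev e))" using fX
      by (intro finite_measure_subadditive_finite) (simp_all only: image_subset_iff Evm Ball_def simp_thms)
    also have "\<dots> \<le> (\<Sum>e\<in>?X. ?C)" by (intro sum_mono Ev)
    also have "\<dots> = real (Suc L) ^ d * ?C" by (simp add: cX)
    also have "\<dots> \<le> (1 + 2 * ln (max 1 (K ^ Suc d * h / x))) ^ d * ?C"
    proof (intro mult_right_mono power_mono)
      have eq: "K ^ Suc d / y = K ^ Suc d * h / x" using pos hp by (simp add: y_def)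
      have g: "1 < K ^ Suc d / y" using False yp by (simp add: field_simps)
      \<comment> \<open>Source of the factor 2 in front of the logarithm: passing from base 2 to the
        natural logarithm costs \<open>1 / ln 2 \<le> 2\<close>.\<close>
      have l2: "1/2 \<le> ln (2::real)" using ln2_ge_two_thirds by simp
      have "real L \<le> log 2 (K ^ Suc d / y)" using g unfolding L_def by simp
      also have "\<dots> = ln (K ^ Suc d / y) / ln 2" by (simp add: log_def)
      also have "\<dots> \<le> ln (K ^ Suc d / y) / (1/2)" using g l2 by (intro divide_left_mono) auto
      also have "\<dots> = 2 * ln (max 1 (K ^ Suc d * h / x))" using g unfolding eq[symmetric] by (simp add: max_def)
      finally show "real (Suc L) \<le> 1 + 2 * ln (max 1 (K ^ Suc d * h / x))" by simp
      show "0 \<le> ?C" using pos by (intro mult_nonneg_nonneg prod_nonneg) auto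
    qed simp
    also have "y powr (- \<alpha>) = (h / x) powr \<alpha>"
      using pos hp by (simp add: y_def powr_minus_divide powr_divide)
    also have "(1 + 2 * ln (max 1 (K ^ Suc d * h / x))) ^ d *
      (prod c {..<Suc d} * 2 powr (\<alpha> * d) * (h / x) powr \<alpha>) = ?rhs" by (simp only: mult_ac)
    finally show ?thesis .
  qed
qed

subsection \<open>Random sup measures and families of rectangles\<close>

text \<open>Independence of \<open>M\<close> on disjoint sets is postulated for index sets
  \<open>{..<n}\<close>. The cells below are indexed by pairs, so it has to be carried along an
  enumeration.\<close>

lemma (in prob_space) indep_vars_bij_betw:
  assumes h: "bij_betw h I J" and X: "indep_vars (\<lambda>_. N) (\<lambda>i. X (h i)) I"
  shows "indep_vars (\<lambda>_. N) X J"
proof -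
  have hJ: "h ` I = J" and inj: "inj_on h I" using h by (auto simp: bij_betw_def)
  have rv: "\<forall>i\<in>J. random_variable N (X i)" using X hJ unfolding indep_vars_def2 by auto
  let ?F = "\<lambda>i. {X i -` A \<inter> space M |A. A \<in> sets N}"
  have "indep_sets ?F J"
  proof (rule indep_setsI)
    show "?F i \<subseteq> events" if "i \<in> J" for i using rv that by (auto intro: measurable_sets)
    fix A K assume K: "K \<noteq> {}" "K \<subseteq> J" "finite K" and A: "\<forall>j\<in>K. A j \<in> ?F j"
    define K' where "K' = {i\<in>I. h i \<in> K}"
    have K': "h ` K' = K" "inj_on h K'" "K' \<subseteq> I"
      using K hJ inj by (auto simp: K'_def inj_on_def)
    then have "finite K'" "K' \<noteq> {}" using K finite_imageD by blast+
    then have "prob (\<Inter>j\<in>K'. A (h j)) = (\<Prod>j\<in>K'. prob (A (h j)))"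
      using A K' by (intro indep_setsD[OF X[unfolded indep_vars_def2, THEN conjunct2]]) auto
    moreover have "(\<Inter>j\<in>K'. A (h j)) = (\<Inter>j\<in>K. A j)" using K' by blast
    moreover have "(\<Prod>j\<in>K'. prob (A (h j))) = (\<Prod>j\<in>K. prob (A j))"
      using prod.reindex[OF K'(2), of "\<lambda>j. prob (A j)"] K' by simp
    ultimately show "prob (\<Inter>j\<in>K. A j) = (\<Prod>j\<in>K. prob (A j))" by simp
  qed
  then show ?thesis using rv by (auto simp: indep_vars_def2)
qed

locale sup_measure = P: prob_space P + mu: sigma_finite_measure \<mu>
  for P :: "'w measure" and \<mu> :: "'a measure" +
  fixes \<alpha> :: real and M :: "'a set \<Rightarrow> 'w \<Rightarrow> ennreal"
  assumes alpha_pos: "0 < \<alpha>" and sup_measure: "frechet_sup_measure P \<mu> \<alpha> M"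
begin

sublocale mu: product_sigma_finite "\<lambda>_::nat. \<mu>" by standard

lemma M_measurable[measurable]: "A \<in> sets \<mu> \<Longrightarrow> M A \<in> borel_measurable P"
  using sup_measure by (simp add: frechet_sup_measure_def)

lemma M_indep:
  assumes "finite I" "disjoint_family_on D I" "\<And>i. i \<in> I \<Longrightarrow> D i \<in> sets \<mu>"
  shows "P.indep_vars (\<lambda>_. borel) (\<lambda>i. M (D i)) I"
proof -
  obtain h where h: "bij_betw h {..<card I} I"
    using ex_bij_betw_nat_finite[OF assms(1)] by (auto simp: atLeast0LessThan)
  then have "inj_on h {..<card I}" "h ` {..<card I} = I" by (auto simp: bij_betw_def)
  then have "\<And>i. i < card I \<Longrightarrow> h i \<in> I" "\<And>i j. i < card I \<Longrightarrow> j < card I \<Longrightarrow> i \<noteq> j \<Longrightarrow> h i \<noteq> h j"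
    by (auto simp: inj_on_def)
  then have "disjoint_family_on (D \<circ> h) {..<card I}" "(D \<circ> h) ` {..<card I} \<subseteq> sets \<mu>"
    using assms(2,3) by (simp_all add: disjoint_family_on_def image_subset_iff)
  then have "P.indep_vars (\<lambda>_. borel) (\<lambda>i. M ((D \<circ> h) i)) {..<card I}"
    using sup_measure unfolding frechet_sup_measure_def by blast
  then show ?thesis by (intro P.indep_vars_bij_betw[OF h]) simp
qed

lemma M_tail:
  assumes "A \<in> sets \<mu>" "emeasure \<mu> A < \<infinity>" "0 < x"
  shows "P.prob {\<omega>\<in>space P. ennreal x < M A \<omega>} = 1 - exp (- measure \<mu> A * x powr (- \<alpha>))"
proof -
  have "P.prob {\<omega>\<in>space P. M A \<omega> \<le> ennreal x} = exp (- measure \<mu> A * x powr (- \<alpha>))"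
    using sup_measure assms unfolding frechet_sup_measure_def by blast
  moreover have "{\<omega>\<in>space P. ennreal x < M A \<omega>} = space P - {\<omega>\<in>space P. M A \<omega> \<le> ennreal x}" by auto
  ultimately show ?thesis using assms by (simp add: P.prob_compl)
qed

lemma M_tail_le:
  assumes "A \<in> sets \<mu>" "emeasure \<mu> A < \<infinity>" "0 < x"
  shows "P.prob {\<omega>\<in>space P. ennreal x < M A \<omega>} \<le> measure \<mu> A * x powr (- \<alpha>)"
  using exp_ge_add_one_self[of "- measure \<mu> A * x powr (- \<alpha>)"] by (simp add: M_tail[OF assms])

text \<open>The union law is postulated for infinite sequences. Finite unions are padded with empty
  sets, which must not contribute to the supremum.\<close>

lemma M_empty: "AE \<omega> in P. M {} \<omega> = 0"
proof -
  have "AE \<omega> in P. M {} \<omega> \<le> ennreal (1 / Suc n)" for n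
  proof -
    have "P.prob {\<omega>\<in>space P. ennreal (1 / Suc n) < M {} \<omega>} = 0" by (subst M_tail) auto
    then have "AE \<omega> in P. \<omega> \<notin> {\<omega>\<in>space P. ennreal (1 / Suc n) < M {} \<omega>}"
      by (intro AE_not_in) (simp add: null_sets_def P.emeasure_eq_measure)
    then show ?thesis using AE_space by eventually_elim (auto simp: not_less)
  qed
  then have "AE \<omega> in P. \<forall>n. M {} \<omega> \<le> ennreal (1 / Suc n)" by (simp add: AE_all_countable)
  then show ?thesis
  proof eventually_elim
    case (elim \<omega>)
    have "(\<lambda>n. ennreal (1 / Suc n)) \<longlonglongrightarrow> ennreal 0"
      by (intro tendsto_ennrealI) (real_asymp)
    then have "M {} \<omega> \<le> ennreal 0" using elim by (intro LIMSEQ_le_const) auto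
    then show ?case by simp
  qed
qed

lemma M_UN:
  assumes "finite I" "\<And>i. i \<in> I \<Longrightarrow> D i \<in> sets \<mu>"
  shows "AE \<omega> in P. M (\<Union>i\<in>I. D i) \<omega> = (SUP i\<in>I. M (D i) \<omega>)"
proof -
  obtain n and h :: "nat \<Rightarrow> _" where h: "I = h ` {i. i < n}"
    using finite_imp_nat_seg_image_inj_on[OF assms(1)] by blast
  define A where "A j = (if j < n then D (h j) else {})" for j
  have "range A \<subseteq> sets \<mu>" using assms h by (auto simp: A_def)
  then have "AE \<omega> in P. M (\<Union>j. A j) \<omega> = (SUP j. M (A j) \<omega>)"
    using sup_measure unfolding frechet_sup_measure_def by blast
  moreover have "(\<Union>j. A j) = (\<Union>i\<in>I. D i)" by (auto simp: A_def h split: if_splits)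
  ultimately have "AE \<omega> in P. M (\<Union>i\<in>I. D i) \<omega> = (SUP j. M (A j) \<omega>)" by simp
  with M_empty show ?thesis
  proof eventually_elim
    case (elim \<omega>)
    have "(SUP j. M (A j) \<omega>) = (SUP i\<in>I. M (D i) \<omega>)"
    proof (rule antisym)
      show "(SUP j. M (A j) \<omega>) \<le> (SUP i\<in>I. M (D i) \<omega>)"
        using elim by (intro SUP_least) (auto simp: A_def h intro!: SUP_upper)
      show "(SUP i\<in>I. M (D i) \<omega>) \<le> (SUP j. M (A j) \<omega>)"
      proof (intro SUP_least)
        fix i assume "i \<in> I"
        then obtain j where "j < n" "i = h j" using h by auto
        then have "M (D i) \<omega> = M (A j) \<omega>" by (simp add: A_def)
        then show "M (D i) \<omega> \<le> (SUP j. M (A j) \<omega>)" by (metis SUP_upper UNIV_I)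
      qed
    qed
    then show ?case using elim by simp
  qed
qed

end

section \<open>Weighted families of off-diagonal rectangles\<close>

definition rect_family :: "'a measure \<Rightarrow> nat \<Rightarrow> 'a set \<Rightarrow> (real \<times> (nat \<Rightarrow> 'a set)) set \<Rightarrow> bool" where
  "rect_family \<mu> k F W \<longleftrightarrow> finite W \<and>
     (\<forall>w\<in>W. 0 < fst w \<and> (\<forall>r<k. snd w r \<in> sets \<mu> \<and> snd w r \<subseteq> F) \<and> disjoint_family_on (snd w) {..<k})"

definition fam_val :: "('a set \<Rightarrow> 'w \<Rightarrow> ennreal) \<Rightarrow> nat \<Rightarrow> (real \<times> (nat \<Rightarrow> 'a set)) set \<Rightarrow> 'w \<Rightarrow> ennreal" where
  "fam_val M k W \<omega> = (SUP w\<in>W. ennreal (fst w) * (\<Prod>r<k. M (snd w r) \<omega>))"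

text \<open>Rectangles may overlap, so the family is read through maxima and not through sums.
  Unions and positive multiples of families then match maxima and multiples of both
  \<open>fam_step\<close> and \<open>fam_val\<close>, in accordance with the max-linearity of the
  integral.\<close>

definition fam_step :: "nat \<Rightarrow> (real \<times> (nat \<Rightarrow> 'a set)) set \<Rightarrow> (nat \<Rightarrow> 'a) \<Rightarrow> ennreal" where
  "fam_step k W x = (SUP w\<in>W. ennreal (fst w) * indicator (PiE {..<k} (snd w)) x)"

lemma finite_SUP_attained:
  fixes f :: "'b \<Rightarrow> 'c :: complete_linorder"
  assumes "finite I" "I \<noteq> {}" shows "\<exists>i\<in>I. (SUP i\<in>I. f i) = f i"
proof -
  have "(SUP i\<in>I. f i) = Max (f ` I)" using assms by (simp add: Max_Sup)
  moreover have "Max (f ` I) \<in> f ` I" using assms by (intro Max_in) auto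
  ultimately show ?thesis by auto
qed

text \<open>Each finite maximum is attained, and the attaining indices are collected into one tuple.
  The strict inequality rules out an empty \<open>J r\<close>, whose supremum 0 would annihilate the
  product.\<close>

lemma prod_SUP_attained:
  fixes V :: "'i \<Rightarrow> ennreal"
  assumes "finite R" "\<And>r. r \<in> R \<Longrightarrow> finite (J r)" "c < a * (\<Prod>r\<in>R. SUP i\<in>J r. V i)"
  shows "\<exists>j\<in>PiE R J. c < a * (\<Prod>r\<in>R. V (j r))"
proof -
  have "J r \<noteq> {}" if "r \<in> R" for r
  proof
    assume "J r = {}"
    then have *: "(\<Prod>r\<in>R. SUP i\<in>J r. V i) = 0" using assms(1) that
      by (intro prod_zero) (auto simp: bot_ennreal intro!: bexI[of _ r])
    show False using assms(3) unfolding * by simp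
  qed
  then have "\<forall>r\<in>R. \<exists>i\<in>J r. (SUP i\<in>J r. V i) = V i" using finite_SUP_attained assms(2) by blast
  then obtain j where j: "\<And>r. r \<in> R \<Longrightarrow> j r \<in> J r \<and> (SUP i\<in>J r. V i) = V (j r)" by metis
  have "(\<Prod>r\<in>R. SUP i\<in>J r. V i) = (\<Prod>r\<in>R. V (restrict j R r))" using j by (intro prod.cong) auto
  then show ?thesis using j assms(3) by (intro bexI[of _ "restrict j R"]) auto
qed

lemma fam_val_measurable[measurable]:
  assumes "\<And>A. A \<in> sets \<mu> \<Longrightarrow> M A \<in> borel_measurable P" "rect_family \<mu> k F W"
  shows "fam_val M k W \<in> borel_measurable P"
proof -
  have "countable W" "\<And>w r. w \<in> W \<Longrightarrow> r < k \<Longrightarrow> M (snd w r) \<in> borel_measurable P"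
    using assms by (auto simp: rect_family_def intro: countable_finite)
  then show ?thesis unfolding fam_val_def[abs_def]
    by (intro borel_measurable_SUP borel_measurable_times borel_measurable_prod_ennreal) auto
qed

lemma fam_step_measurable[measurable]:
  assumes "rect_family \<mu> k F W"
  shows "fam_step k W \<in> borel_measurable (power_measure \<mu> k)"
proof -
  have "countable W" "\<And>w. w \<in> W \<Longrightarrow> PiE {..<k} (snd w) \<in> sets (power_measure \<mu> k)"
    using assms by (auto simp: rect_family_def intro: countable_finite intro!: sets_PiM_I_finite)
  then show ?thesis unfolding fam_step_def[abs_def]
    by (intro borel_measurable_SUP borel_measurable_times) auto
qed

subsection \<open>Tail bound for families of rectangles\<close>

text \<open>The weight that the union bound over dyadic levels produces. For
  \<open>d \<ge> 2\<close> it is the weight of the integrability class for \<open>Suc d\<close>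
  coordinates; for \<open>d \<le> 1\<close> it is dominated by a multiple of that weight.\<close>

definition phi :: "real \<Rightarrow> nat \<Rightarrow> ennreal \<Rightarrow> ennreal" where
  "phi \<alpha> d h = enn_powr h \<alpha> * (1 + enn_ln_plus h ^ d)"

lemma enn_powr_mono:
  assumes "0 \<le> a" "x \<le> y" shows "enn_powr x a \<le> enn_powr y a"
proof (cases "y = \<infinity>")
  case False
  then have "y < top" by (simp add: less_top)
  then have "x < top" using assms(2) by (rule le_less_trans[rotated])
  then show ?thesis using assms False \<open>y < top\<close>
    by (auto simp: enn_powr_def intro!: ennreal_leI powr_mono2 enn2real_mono)
qed (simp add: enn_powr_def)

lemma enn_ln_plus_mono:
  assumes "x \<le> y" shows "enn_ln_plus x \<le> enn_ln_plus y"
proof (cases "y = \<infinity>")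
  case False
  then have "y < top" by (simp add: less_top)
  moreover from this have "x < top" using assms by (rule le_less_trans[rotated])
  ultimately have "enn2real x \<le> enn2real y" using assms by (intro enn2real_mono) auto
  then have "ln (max (enn2real x) 1) \<le> ln (max (enn2real y) 1)" by (subst ln_le_cancel_iff) auto
  then show ?thesis using \<open>x < top\<close> False by (auto simp: enn_ln_plus_def intro!: ennreal_leI)
qed (simp add: enn_ln_plus_def)

lemma phi_mono: "0 \<le> \<alpha> \<Longrightarrow> x \<le> y \<Longrightarrow> phi \<alpha> d x \<le> phi \<alpha> d y"
  unfolding phi_def by (intro mult_mono enn_powr_mono add_mono power_mono enn_ln_plus_mono) auto

lemma phi_ennreal:
  "0 \<le> h \<Longrightarrow> phi \<alpha> d (ennreal h) = ennreal (h powr \<alpha> * (1 + ln (max 1 h) ^ d))"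
  by (simp add: phi_def enn_powr_def enn_ln_plus_def ennreal_mult ennreal_plus[symmetric] ennreal_power max.commute
      del: ennreal_plus flip: ennreal_1)

lemma enn_powr_measurable[measurable]: "(\<lambda>x. enn_powr x a) \<in> borel_measurable borel"
  unfolding enn_powr_def[abs_def] by measurable

lemma enn_ln_plus_measurable[measurable]: "enn_ln_plus \<in> borel_measurable borel"
  unfolding enn_ln_plus_def[abs_def] by measurable

lemma phi_measurable[measurable]: "phi \<alpha> d \<in> borel_measurable borel"
  unfolding phi_def[abs_def] by measurable

text \<open>Separates the level \<open>x\<close> from the size \<open>h\<close>, so that the part
  depending on \<open>h\<close> can be integrated. The positive part of the logarithm is subadditive
  on products, which gives a product of \<open>1 + 2 * w\<close> and \<open>1 + 2 * v\<close>, and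
  \<open>(1 + 2 * v) ^ d\<close> is at most \<open>4 ^ d * (1 + v ^ d)\<close> by distinguishing
  \<open>v \<le> 1\<close> from \<open>v > 1\<close>.\<close>

lemma tail_weight_le_phi:
  fixes h u x :: real
  assumes "0 < h" "0 < x" "0 < u"
  shows "(h / x) powr \<alpha> * (1 + 2 * ln (max 1 (u * h / x))) ^ d
    \<le> (4 ^ d * x powr (- \<alpha>) * (1 + 2 * ln (max 1 (u / x))) ^ d) * (h powr \<alpha> * (1 + ln (max 1 h) ^ d))"
proof -
  define v where "v = ln (max 1 h)"
  define w where "w = ln (max 1 (u / x))"
  have v: "0 \<le> v" "0 \<le> w" by (auto simp: v_def w_def)
  have "max 1 (u * h / x) \<le> max 1 (u / x) * max 1 h"
  proof -
    have "1 * 1 \<le> max 1 (u / x) * max 1 h" by (intro mult_mono) auto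
    moreover have "u / x * h \<le> max 1 (u / x) * max 1 h" using assms by (intro mult_mono) auto
    ultimately show ?thesis by simp
  qed
  then have "ln (max 1 (u * h / x)) \<le> ln (max 1 (u / x) * max 1 h)" by (subst ln_le_cancel_iff) auto
  also have "\<dots> = w + v" unfolding v_def w_def by (subst ln_mult) auto
  finally have "1 + 2 * ln (max 1 (u * h / x)) \<le> (1 + 2 * w) * (1 + 2 * v)"
    using mult_nonneg_nonneg[OF v] by (simp add: algebra_simps)
  then have 1: "(1 + 2 * ln (max 1 (u * h / x))) ^ d \<le> ((1 + 2 * w) * (1 + 2 * v)) ^ d"
    by (intro power_mono) auto
  have 2: "(1 + 2 * v) ^ d \<le> 4 ^ d * (1 + v ^ d)"
  proof (cases "v \<le> 1")
    case True
    then have "(1 + 2 * v) ^ d \<le> 4 ^ d" using v by (intro power_mono) auto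
    also have "\<dots> \<le> 4 ^ d * (1 + v ^ d)" using v by simp
    finally show ?thesis .
  next
    case False
    then have "(1 + 2 * v) ^ d \<le> (4 * v) ^ d" by (intro power_mono) auto
    also have "\<dots> \<le> 4 ^ d * (1 + v ^ d)" by (simp add: power_mult_distrib)
    finally show ?thesis .
  qed
  have "(1 + 2 * ln (max 1 (u * h / x))) ^ d \<le> (1 + 2 * w) ^ d * (1 + 2 * v) ^ d"
    using 1 by (simp only: power_mult_distrib)
  also have "\<dots> \<le> (1 + 2 * w) ^ d * (4 ^ d * (1 + v ^ d))"
    using 2 v by (intro mult_left_mono zero_le_power) auto
  finally have "(h / x) powr \<alpha> * (1 + 2 * ln (max 1 (u * h / x))) ^ d \<le>
      (h / x) powr \<alpha> * ((1 + 2 * w) ^ d * (4 ^ d * (1 + v ^ d)))" by (intro mult_left_mono) auto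
  also have "\<dots> = (4 ^ d * x powr (- \<alpha>) * (1 + 2 * w) ^ d) * (h powr \<alpha> * (1 + v ^ d))"
    using assms by (simp add: powr_divide powr_minus_divide)
  finally show ?thesis unfolding v_def w_def .
qed

text \<open>Once the \<open>D i\<close> resolve all sides, the products of cells indexed by these
  tuples are pairwise disjoint and tile the support of \<open>fam_step k W\<close>.\<close>

definition fam_cells :: "nat \<Rightarrow> 'i set \<Rightarrow> ('i \<Rightarrow> 'a set) \<Rightarrow> (real \<times> (nat \<Rightarrow> 'a set)) set \<Rightarrow> (nat \<Rightarrow> 'i) set" where
  "fam_cells k I D W = (\<Union>w\<in>W. PiE {..<k} (\<lambda>r. {i\<in>I. D i \<subseteq> snd w r}))"

text \<open>Cells are required to be nonempty because the sides of one rectangle are disjoint: a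
  nonempty cell fits into at most one of them, so the tuples in \<open>fam_cells\<close> are
  injective and the cell values along a tuple are independent.\<close>

definition partition_for :: "'a measure \<Rightarrow> nat \<Rightarrow> (real \<times> (nat \<Rightarrow> 'a set)) set \<Rightarrow> 'i set \<Rightarrow> ('i \<Rightarrow> 'a set) \<Rightarrow> bool" where
  "partition_for \<mu> k W I D \<longleftrightarrow> finite I \<and> disjoint_family_on D I \<and> (\<forall>i\<in>I. D i \<in> sets \<mu> \<and> D i \<noteq> {}) \<and>
     (\<forall>w\<in>W. \<forall>r<k. snd w r = (\<Union>i\<in>{i\<in>I. D i \<subseteq> snd w r}. D i))"

text \<open>The cells are the atoms of the finite algebra generated by \<open>B\<close> inside
  \<open>F\<close>, cut further along the values of \<open>lv\<close>. An atom is named by the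
  members of \<open>B\<close> containing it together with its level, so the level can be read off as
  \<open>snd i\<close>.\<close>

lemma partition_exists:
  fixes lv :: "'a \<Rightarrow> int"
  assumes B: "finite B" "B \<subseteq> sets \<mu>" "\<And>b. b \<in> B \<Longrightarrow> b \<subseteq> F" and F: "F \<in> sets \<mu>"
    and l: "lv \<in> measurable \<mu> (count_space UNIV)" "finite (lv ` F)"
  obtains I :: "('a set set \<times> int) set" and D where "finite I" "disjoint_family_on D I"
    "\<And>i. i \<in> I \<Longrightarrow> D i \<in> sets \<mu>" "\<And>i. i \<in> I \<Longrightarrow> D i \<noteq> {}" "(\<Union>i\<in>I. D i) = F"
    "\<And>b. b \<in> B \<Longrightarrow> b = (\<Union>i\<in>{i\<in>I. D i \<subseteq> b}. D i)" "\<And>i z. i \<in> I \<Longrightarrow> z \<in> D i \<Longrightarrow> lv z = snd i"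
proof -
  define \<kappa> where "\<kappa> z = ({b\<in>B. z \<in> b}, lv z)" for z
  define D where "D i = {z\<in>F. \<kappa> z = i}" for i
  define I where "I = \<kappa> ` F"
  have "I \<subseteq> Pow B \<times> lv ` F" by (auto simp: I_def \<kappa>_def)
  then have 1: "finite I" by (rule finite_subset) (simp add: B l)
  have 2: "disjoint_family_on D I" by (auto simp: disjoint_family_on_def D_def)
  have 3: "D i \<noteq> {}" if "i \<in> I" for i using that by (auto simp: I_def D_def)
  have 4: "(\<Union>i\<in>I. D i) = F" by (auto simp: I_def D_def)
  have 5: "b = (\<Union>i\<in>{i\<in>I. D i \<subseteq> b}. D i)" if b: "b \<in> B" for b
  proof
    show "b \<subseteq> (\<Union>i\<in>{i\<in>I. D i \<subseteq> b}. D i)"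
    proof
      fix z assume z: "z \<in> b"
      then have zF: "z \<in> F" using B(3)[OF b] by auto
      have "D (\<kappa> z) \<subseteq> b" using z b by (auto simp: D_def \<kappa>_def)
      moreover have "z \<in> D (\<kappa> z)" "\<kappa> z \<in> I" using zF by (auto simp: D_def I_def)
      ultimately show "z \<in> (\<Union>i\<in>{i\<in>I. D i \<subseteq> b}. D i)" by blast
    qed
  qed blast
  have 6: "lv z = snd i" if "z \<in> D i" for i z using that by (auto simp: D_def \<kappa>_def)
  have 7: "D i \<in> sets \<mu>" if i: "i \<in> I" for i
  proof -
    obtain z0 where z0: "i = \<kappa> z0" using i unfolding I_def by blast
    have "D i = F \<inter> {z\<in>space \<mu>. (\<forall>b\<in>B. z \<in> b \<longleftrightarrow> z0 \<in> b) \<and> lv z = lv z0}"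
      using sets.sets_into_space[OF F] by (auto simp: z0 D_def \<kappa>_def)
    also have "\<dots> \<in> sets \<mu>"
    proof -
      have [measurable]: "\<And>b. b \<in> B \<Longrightarrow> b \<in> sets \<mu>" using B by auto
      have [measurable]: "{z\<in>space \<mu>. \<forall>b\<in>B. z \<in> b \<longleftrightarrow> z0 \<in> b} \<in> sets \<mu>"
        using B(1) by (intro sets.sets_Collect_finite_All) measurable
      note l(1)[measurable] F[measurable]
      show ?thesis by measurable
    qed
    finally show ?thesis .
  qed
  show ?thesis using that[of I D] 1 2 3 4 5 6 7 by blast
qed

lemma fam_cells_props:
  assumes W: "rect_family \<mu> k F W" and D: "partition_for \<mu> k W I D" and j: "j \<in> fam_cells k I D W"
  shows "j \<in> PiE {..<k} (\<lambda>_. I)" "disjoint_family_on (\<lambda>t. D (j t)) {..<k}" "inj_on j {..<k}"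
    "\<exists>w\<in>W. \<forall>r<k. D (j r) \<subseteq> snd w r"
proof -
  obtain w where w: "w \<in> W" "j \<in> PiE {..<k} (\<lambda>r. {i\<in>I. D i \<subseteq> snd w r})"
    using j by (auto simp: fam_cells_def)
  have ds: "disjoint_family_on (snd w) {..<k}" using w W by (auto simp: rect_family_def)
  show "j \<in> PiE {..<k} (\<lambda>_. I)" using w by (auto simp: PiE_iff)
  show dd: "disjoint_family_on (\<lambda>t. D (j t)) {..<k}"
    unfolding disjoint_family_on_def
  proof (intro ballI impI)
    fix s t assume *: "s \<in> {..<k}" "t \<in> {..<k}" "s \<noteq> t"
    then have "D (j s) \<subseteq> snd w s" "D (j t) \<subseteq> snd w t" using w(2) by (auto simp: PiE_iff)
    moreover have "snd w s \<inter> snd w t = {}" using ds * by (auto simp: disjoint_family_on_def)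
    ultimately show "D (j s) \<inter> D (j t) = {}" by blast
  qed
  show "inj_on j {..<k}"
  proof (rule inj_onI, rule ccontr)
    fix s t assume *: "s \<in> {..<k}" "t \<in> {..<k}" "j s = j t" "s \<noteq> t"
    then have "D (j s) \<inter> D (j t) = {}" using dd unfolding disjoint_family_on_def by blast
    moreover have "D (j s) \<noteq> {}" using D w(2) *(1) by (auto simp: PiE_iff partition_for_def)
    ultimately show False using *(3) by auto
  qed
  show "\<exists>w\<in>W. \<forall>r<k. D (j r) \<subseteq> snd w r" using w by (auto simp: PiE_iff)
qed

lemma finite_fam_cells:
  assumes "rect_family \<mu> k F W" "finite I" shows "finite (fam_cells k I D W)"
  using assms unfolding fam_cells_def by (intro finite_UN_I finite_PiE) (auto simp: rect_family_def)

context sup_measure begin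

lemma fam_val_cells:
  assumes W: "rect_family \<mu> k F W" and D: "partition_for \<mu> k W I D"
  shows "AE \<omega> in P. \<forall>w\<in>W. \<forall>r<k. M (snd w r) \<omega> = (SUP i\<in>{i\<in>I. D i \<subseteq> snd w r}. M (D i) \<omega>)"
proof -
  have "AE \<omega> in P. M (snd w r) \<omega> = (SUP i\<in>{i\<in>I. D i \<subseteq> snd w r}. M (D i) \<omega>)" if "w \<in> W" "r < k" for w r
  proof -
    have "AE \<omega> in P. M (\<Union>i\<in>{i\<in>I. D i \<subseteq> snd w r}. D i) \<omega> = (SUP i\<in>{i\<in>I. D i \<subseteq> snd w r}. M (D i) \<omega>)"
      using D by (intro M_UN) (auto simp: partition_for_def)
    moreover have "(\<Union>i\<in>{i\<in>I. D i \<subseteq> snd w r}. D i) = snd w r"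
      using D that unfolding partition_for_def by blast
    ultimately show ?thesis by simp
  qed
  then show ?thesis
    using W by (intro AE_finite_allI) (auto simp: rect_family_def AE_all_countable)
qed

text \<open>The estimate behind all upper bounds. Where \<open>lv = n\<close>, the measure \<mu> is
  at most \<open>2 * 2 powr n\<close> times \<open>m\<close>; hence \<open>M (D i)\<close> divided
  by \<open>2 powr (n / \<alpha>)\<close> has a tail governed by \<open>2 * measure m (D i)\<close>,
  and the scales multiply to the weight that accompanies the step function in the integral. The
  first term on the right pays for cutting the scaled cell values off at \<open>K\<close>; the
  second is the sum of \<open>product_tail\<close> over the tuples of cells, and it is an integral
  that does not see the partition.\<close>

lemma fam_val_tail:
  fixes lv :: "'a \<Rightarrow> int" and m :: "'a measure" and K x :: real
  assumes W: "rect_family \<mu> (Suc d) F W" and F: "F \<in> sets \<mu>"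
    and m: "sigma_finite_measure m" "sets m = sets \<mu>" "emeasure m F < \<infinity>"
    and l: "lv \<in> measurable \<mu> (count_space UNIV)" "finite (lv ` F)"
    and dom: "\<And>n A. A \<in> sets \<mu> \<Longrightarrow> A \<subseteq> F \<inter> lv -` {n} \<Longrightarrow> emeasure \<mu> A \<le> ennreal (2 * 2 powr n) * emeasure m A"
    and pos: "0 < K" "0 < x"
  shows "emeasure P {\<omega>\<in>space P. ennreal x < fam_val M (Suc d) W \<omega>} \<le> ennreal (2 * measure m F * K powr (- \<alpha>)) +
    ennreal (2 ^ Suc d * 2 powr (\<alpha> * d) * (4 ^ d * x powr (- \<alpha>) * (1 + 2 * ln (max 1 (K ^ Suc d / x))) ^ d)) *
    (\<integral>\<^sup>+ z. phi \<alpha> d (fam_step (Suc d) W z * ennreal (\<Prod>r<Suc d. 2 powr (lv (z r) / \<alpha>))) \<partial>PiM {..<Suc d} (\<lambda>_. m))"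
proof -
  let ?k = "Suc d"
  interpret m: product_sigma_finite "\<lambda>_::nat. m" using m(1) by (simp add: product_sigma_finite_def)
  obtain I :: "('a set set \<times> int) set" and D where D: "finite I" "disjoint_family_on D I"
    "\<And>i. i \<in> I \<Longrightarrow> D i \<in> sets \<mu>" "\<And>i. i \<in> I \<Longrightarrow> D i \<noteq> {}" "(\<Union>i\<in>I. D i) = F"
    "\<And>b. b \<in> (\<Union>w\<in>W. snd w ` {..<?k}) \<Longrightarrow> b = (\<Union>i\<in>{i\<in>I. D i \<subseteq> b}. D i)" "\<And>i z. i \<in> I \<Longrightarrow> z \<in> D i \<Longrightarrow> lv z = snd i"
  proof (rule partition_exists[of "\<Union>w\<in>W. snd w ` {..<?k}" \<mu> F lv])
    show "finite (\<Union>w\<in>W. snd w ` {..<?k})" using W by (auto simp: rect_family_def)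
    show "(\<Union>w\<in>W. snd w ` {..<?k}) \<subseteq> sets \<mu>" using W by (auto simp: rect_family_def)
    show "b \<subseteq> F" if "b \<in> (\<Union>w\<in>W. snd w ` {..<?k})" for b using W that by (auto simp: rect_family_def)
  qed (use F l in blast)+
  have part: "partition_for \<mu> ?k W I D" unfolding partition_for_def
  proof (intro conjI ballI allI impI)
    show "snd w r = (\<Union>i\<in>{i\<in>I. D i \<subseteq> snd w r}. D i)" if "w \<in> W" "r < ?k" for w r
      by (rule D(6)) (use that in blast)
  qed (simp_all add: D(1-4))
  define b where "b i = 2 powr (real_of_int (snd i) / \<alpha>)" for i :: "'a set set \<times> int"
  define c where "c i = 2 * measure m (D i)" for i
  \<comment> \<open>\<open>a j\<close> is the value of the step function on the product of the cells
    of \<open>j\<close>, so \<open>h j\<close> is the argument of \<open>phi\<close> in the integral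
    on the right-hand side there.\<close>
  define a where "a j = Max (fst ` {w\<in>W. \<forall>r<?k. D (j r) \<subseteq> snd w r})" for j :: "nat \<Rightarrow> 'a set set \<times> int"
  define h where "h j = a j * (\<Prod>t<?k. b (j t))" for j
  let ?J = "fam_cells ?k I D W"
  have b0: "0 < b i" for i by (simp add: b_def)
  have c0: "0 \<le> c i" for i by (simp add: c_def)
  have Wf: "finite W" and Wp: "\<And>w. w \<in> W \<Longrightarrow> 0 < fst w" using W by (auto simp: rect_family_def)
  have aw: "a j \<in> fst ` {w\<in>W. \<forall>r<?k. D (j r) \<subseteq> snd w r}" if "j \<in> ?J" for j
    unfolding a_def
  proof (rule Max_in)
    show "finite (fst ` {w\<in>W. \<forall>r<?k. D (j r) \<subseteq> snd w r})" using Wf by simp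
    show "fst ` {w\<in>W. \<forall>r<?k. D (j r) \<subseteq> snd w r} \<noteq> {}" using fam_cells_props(4)[OF W part that] by blast
  qed
  have age: "fst w \<le> a j" if "w \<in> W" "\<forall>r<?k. D (j r) \<subseteq> snd w r" for w j
    unfolding a_def by (rule Max_ge) (use Wf that in \<open>simp, blast\<close>)
  have a0: "0 < a j" if "j \<in> ?J" for j using aw[OF that] Wp by auto
  have h0: "0 < h j" if "j \<in> ?J" for j     by (simp add: h_def a0[OF that] b0 prod_pos del: prod.lessThan_Suc)
  have fJ: "finite ?J" using finite_fam_cells[OF W D(1)] .
  have DF: "D i \<subseteq> F" if "i \<in> I" for i using D(5) that by blast
  have mD: "emeasure m (D i) < \<infinity>" if "i \<in> I" for i
    using emeasure_mono[OF DF[OF that], of m] F m by (auto intro: le_less_trans)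
  have domD: "emeasure \<mu> (D i) \<le> ennreal (2 * 2 powr real_of_int (snd i)) * emeasure m (D i)" if "i \<in> I" for i
    by (rule dom) (use DF[OF that] D(7)[OF that] D(3)[OF that] in \<open>simp, blast\<close>)
  have muD: "emeasure \<mu> (D i) < \<infinity>" if "i \<in> I" for i
    by (rule le_less_trans[OF domD[OF that]]) (use mD[OF that] in \<open>simp add: ennreal_mult_less_top less_top\<close>)
  have muE: "emeasure \<mu> (D i) = ennreal (measure \<mu> (D i))" "emeasure m (D i) = ennreal (measure m (D i))"
    if "i \<in> I" for i
    using muD[OF that] mD[OF that] by (intro emeasure_eq_ennreal_measure; simp add: less_top)+
  have dom': "measure \<mu> (D i) \<le> 2 powr real_of_int (snd i) * c i" if "i \<in> I" for i
  proof -
    have "ennreal (measure \<mu> (D i)) \<le> ennreal (2 * 2 powr real_of_int (snd i)) * ennreal (measure m (D i))"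
      using domD[OF that] unfolding muE[OF that] .
    also have "\<dots> = ennreal (2 powr real_of_int (snd i) * c i)" by (simp add: c_def ennreal_mult[symmetric] mult_ac)
    finally show ?thesis by (simp add: c_def)
  qed
  have tail: "P.prob {\<omega>\<in>space P. ennreal (b i * u) < M (D i) \<omega>} \<le> c i * u powr (- \<alpha>)"
    if "i \<in> I" "0 < u" for i u
  proof -
    have "P.prob {\<omega>\<in>space P. ennreal (b i * u) < M (D i) \<omega>} \<le> measure \<mu> (D i) * (b i * u) powr (- \<alpha>)"
      by (rule M_tail_le[OF D(3)[OF that(1)] muD[OF that(1)]]) (simp add: that(2) b0)
    also have "\<dots> \<le> 2 powr real_of_int (snd i) * c i * (b i * u) powr (- \<alpha>)"
      using dom'[OF that(1)] by (intro mult_right_mono) auto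
    \<comment> \<open>The scale \<open>b i\<close> was chosen so that this power cancels the factor
      \<open>2 powr n\<close> of the domination by \<open>m\<close>.\<close>
    also have "(b i * u) powr (- \<alpha>) = 2 powr (- real_of_int (snd i)) * u powr (- \<alpha>)"
      using that(2) alpha_pos unfolding b_def by (subst powr_mult) (simp_all add: powr_powr)
    also have "2 powr real_of_int (snd i) * c i * (2 powr (- real_of_int (snd i)) * u powr (- \<alpha>)) = c i * u powr (- \<alpha>)"
      by (simp add: powr_minus)
    finally show ?thesis .
  qed
  \<comment> \<open>A large family value has one of two causes: some cell exceeds its cutoff, or
    some tuple of cells below their cutoffs already produces the large product.\<close>
  define Bad where "Bad i = {\<omega>\<in>space P. ennreal (b i * K) < M (D i) \<omega>}" for i
  define Ev where "Ev j = {\<omega>\<in>space P. (\<forall>t<?k. M (D (j t)) \<omega> \<le> ennreal (b (j t) * K)) \<and>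
      ennreal x < ennreal (a j) * (\<Prod>t<?k. M (D (j t)) \<omega>)}" for j
  have Badm[measurable]: "i \<in> I \<Longrightarrow> Bad i \<in> sets P" for i using D(3) unfolding Bad_def by measurable
  have JI: "j t \<in> I" if "j \<in> ?J" "t < ?k" for j t using fam_cells_props(1)[OF W part that(1)] that by auto
  have Evm[measurable]: "j \<in> ?J \<Longrightarrow> Ev j \<in> sets P" for j
  proof -
    assume j: "j \<in> ?J"
    have [measurable]: "t \<in> {..<?k} \<Longrightarrow> M (D (j t)) \<in> borel_measurable P" for t using D(3)[OF JI[OF j]] by simp
    show "Ev j \<in> sets P" unfolding Ev_def by measurable
  qed
  let ?C = "2 ^ ?k * 2 powr (\<alpha> * d) * (4 ^ d * x powr (- \<alpha>) * (1 + 2 * ln (max 1 (K ^ ?k / x))) ^ d)"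
  have C0: "0 \<le> ?C" by (intro mult_nonneg_nonneg zero_le_power) auto
  have Ev_le: "emeasure P (Ev j) \<le> ennreal ?C * (emeasure (PiM {..<?k} (\<lambda>_. m)) (PiE {..<?k} (\<lambda>t. D (j t))) * phi \<alpha> d (ennreal (h j)))"
    if j: "j \<in> ?J" for j
  proof -
    have "P.prob (Ev j) \<le> (\<Prod>t<?k. c (j t)) * (2 powr (\<alpha> * d) * (h j / x) powr \<alpha> * (1 + 2 * ln (max 1 (K ^ ?k * h j / x))) ^ d)"
      unfolding Ev_def
    proof (rule P.product_tail)
      show "P.indep_vars (\<lambda>_. borel) (\<lambda>t. M (D (j t))) {..<?k}"
        using fam_cells_props(2)[OF W part j] D(3) JI[OF j] by (intro M_indep) auto
      show "P.prob {\<omega>\<in>space P. ennreal (b (j t) * u) < M (D (j t)) \<omega>} \<le> c (j t) * u powr (- \<alpha>)"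
        if "t < ?k" "0 < u" for t u by (rule tail[OF JI[OF j that(1)] that(2)])
    qed (simp_all only: alpha_pos pos a0[OF j] b0 c0 h_def)
    also have "\<dots> = 2 powr (\<alpha> * d) * (\<Prod>t<?k. c (j t)) * ((h j / x) powr \<alpha> * (1 + 2 * ln (max 1 (K ^ ?k * h j / x))) ^ d)"
      by (simp only: mult_ac)
    also have "\<dots> \<le> 2 powr (\<alpha> * d) * (\<Prod>t<?k. c (j t)) * ((4 ^ d * x powr (- \<alpha>) * (1 + 2 * ln (max 1 (K ^ ?k / x))) ^ d) * (h j powr \<alpha> * (1 + ln (max 1 (h j)) ^ d)))"
      by (intro mult_left_mono tail_weight_le_phi mult_nonneg_nonneg prod_nonneg) (simp_all add: h0[OF j] pos c0)
    also have "(\<Prod>t<?k. c (j t)) = 2 ^ ?k * (\<Prod>t<?k. measure m (D (j t)))" by (simp add: c_def prod.distrib del: prod.lessThan_Suc)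
    finally have "P.prob (Ev j) \<le> ?C * ((\<Prod>t<?k. measure m (D (j t))) * (h j powr \<alpha> * (1 + ln (max 1 (h j)) ^ d)))"
      by (simp only: mult_ac)
    then have "emeasure P (Ev j) \<le> ennreal (?C * ((\<Prod>t<?k. measure m (D (j t))) * (h j powr \<alpha> * (1 + ln (max 1 (h j)) ^ d))))"
      by (simp only: P.emeasure_eq_measure ennreal_leI)
    also have "\<dots> = ennreal ?C * (ennreal (\<Prod>t<?k. measure m (D (j t))) * phi \<alpha> d (ennreal (h j)))"
      using h0[OF j] C0 by (subst phi_ennreal) (simp_all add: ennreal_mult prod_nonneg del: prod.lessThan_Suc)
    also have "ennreal (\<Prod>t<?k. measure m (D (j t))) = emeasure (PiM {..<?k} (\<lambda>_. m)) (PiE {..<?k} (\<lambda>t. D (j t)))"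
    proof -
      have "emeasure (PiM {..<?k} (\<lambda>_. m)) (PiE {..<?k} (\<lambda>t. D (j t))) = (\<Prod>t<?k. emeasure m (D (j t)))"
        using D(3)[OF JI[OF j]] m(2) by (intro m.emeasure_PiM) auto
      also have "\<dots> = (\<Prod>t<?k. ennreal (measure m (D (j t))))"
        using muE(2)[OF JI[OF j]] by (intro prod.cong refl) blast
      also have "\<dots> = ennreal (\<Prod>t<?k. measure m (D (j t)))" by (intro prod_ennreal) auto
      finally show ?thesis by simp
    qed
    finally show ?thesis .
  qed
  have UBad: "(\<Union>i\<in>I. Bad i) \<in> sets P" and UEv: "(\<Union>j\<in>?J. Ev j) \<in> sets P"
    by (intro sets.finite_UN D(1) Badm fJ Evm; assumption)+
  have sub: "AE \<omega> in P. \<omega> \<in> {\<omega>\<in>space P. ennreal x < fam_val M ?k W \<omega>} \<longrightarrow> \<omega> \<in> (\<Union>i\<in>I. Bad i) \<union> (\<Union>j\<in>?J. Ev j)"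
    using fam_val_cells[OF W part]
  proof eventually_elim
    case (elim \<omega>)
    show ?case
    proof
    assume om: "\<omega> \<in> {\<omega>\<in>space P. ennreal x < fam_val M ?k W \<omega>}"
    then have "\<exists>w\<in>W. ennreal x < ennreal (fst w) * (\<Prod>r<?k. M (snd w r) \<omega>)"
      by (simp add: fam_val_def less_SUP_iff del: prod.lessThan_Suc)
    then obtain w where w: "w \<in> W" "ennreal x < ennreal (fst w) * (\<Prod>r<?k. M (snd w r) \<omega>)" by blast
    have w3: "(\<Prod>r<?k. M (snd w r) \<omega>) = (\<Prod>r<?k. SUP i\<in>{i\<in>I. D i \<subseteq> snd w r}. M (D i) \<omega>)"
      using elim w(1) by (intro prod.cong refl) blast
    have "\<exists>j\<in>PiE {..<?k} (\<lambda>r. {i\<in>I. D i \<subseteq> snd w r}). ennreal x < ennreal (fst w) * (\<Prod>r<?k. M (D (j r)) \<omega>)"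
    proof (rule prod_SUP_attained)
      show "ennreal x < ennreal (fst w) * (\<Prod>r<?k. SUP i\<in>{i\<in>I. D i \<subseteq> snd w r}. M (D i) \<omega>)"
        using w(2) unfolding w3 .
    qed (simp_all add: D(1))
    then obtain j where j: "j \<in> PiE {..<?k} (\<lambda>r. {i\<in>I. D i \<subseteq> snd w r})"
      "ennreal x < ennreal (fst w) * (\<Prod>r<?k. M (D (j r)) \<omega>)"
      by blast
    have jJ: "j \<in> ?J" using j w by (auto simp: fam_cells_def)
    have "ennreal (fst w) \<le> ennreal (a j)" using j(1) w(1) by (intro ennreal_leI age) (auto simp: PiE_iff)
    then have "ennreal x < ennreal (a j) * (\<Prod>r<?k. M (D (j r)) \<omega>)"
      using j(2) by (meson less_le_trans mult_right_mono zero_le)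
    then have "\<omega> \<in> Ev j" if "\<forall>t<?k. M (D (j t)) \<omega> \<le> ennreal (b (j t) * K)"
      using that om by (simp add: Ev_def del: prod.lessThan_Suc)
    moreover have "\<omega> \<in> Bad (j t)" if "\<not> M (D (j t)) \<omega> \<le> ennreal (b (j t) * K)" for t
      using that om by (simp add: Bad_def not_le)
    ultimately show "\<omega> \<in> (\<Union>i\<in>I. Bad i) \<union> (\<Union>j\<in>?J. Ev j)"
      using jJ JI[OF jJ] by blast
    qed
  qed
  define R where "R = (\<integral>\<^sup>+ z. phi \<alpha> d (fam_step ?k W z * ennreal (\<Prod>r<?k. 2 powr (lv (z r) / \<alpha>))) \<partial>PiM {..<?k} (\<lambda>_. m))"
  define C where "C = ennreal ?C"
  define q where "q j = emeasure (PiM {..<?k} (\<lambda>_. m)) (PiE {..<?k} (\<lambda>t. D (j t))) * phi \<alpha> d (ennreal (h j))" for j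
    have "P.prob (\<Union>i\<in>I. Bad i) \<le> (\<Sum>i\<in>I. P.prob (Bad i))"
      using D(1) Badm by (intro P.finite_measure_subadditive_finite) blast+
    also have "\<dots> \<le> (\<Sum>i\<in>I. c i * K powr (- \<alpha>))"
      using tail pos unfolding Bad_def by (intro sum_mono) auto
    also have "\<dots> = 2 * (\<Sum>i\<in>I. measure m (D i)) * K powr (- \<alpha>)" by (simp add: c_def sum_distrib_left sum_distrib_right)
    also have "(\<Sum>i\<in>I. measure m (D i)) = measure m F"
      unfolding D(5)[symmetric] using D mD m(2) by (intro measure_finite_Union[symmetric]) (auto simp: less_top)
    finally have B1: "emeasure P (\<Union>i\<in>I. Bad i) \<le> ennreal (2 * measure m F * K powr (- \<alpha>))"
      by (simp only: P.emeasure_eq_measure ennreal_leI)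
    let ?cell = "\<lambda>j. PiE {..<?k} (\<lambda>t. D (j t))"
    have cm: "?cell j \<in> sets (PiM {..<?k} (\<lambda>_. m))" if "j \<in> ?J" for j
      using D(3)[OF JI[OF that]] m(2) by (intro sets_PiM_I_finite) auto
    have a1: "emeasure P (\<Union>j\<in>?J. Ev j) \<le> (\<Sum>j\<in>?J. emeasure P (Ev j))"
      using fJ Evm by (intro emeasure_subadditive_finite) blast+
    have a2: "(\<Sum>j\<in>?J. emeasure P (Ev j)) \<le> (\<Sum>j\<in>?J. C * q j)"
      unfolding q_def C_def by (intro sum_mono Ev_le)
    have a3: "(\<Sum>j\<in>?J. q j) \<le> R"
    proof -
    have "(\<Sum>j\<in>?J. q j) = (\<Sum>j\<in>?J. \<integral>\<^sup>+ z. phi \<alpha> d (ennreal (h j)) * indicator (?cell j) z \<partial>PiM {..<?k} (\<lambda>_. m))"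
      unfolding q_def using cm by (intro sum.cong refl) (simp add: nn_integral_cmult_indicator mult.commute)
    also have "\<dots> = (\<integral>\<^sup>+ z. (\<Sum>j\<in>?J. phi \<alpha> d (ennreal (h j)) * indicator (?cell j) z) \<partial>PiM {..<?k} (\<lambda>_. m))"
      using cm by (intro nn_integral_sum[symmetric]) auto
    also have "\<dots> \<le> R"
      unfolding R_def
    proof (rule nn_integral_mono)
      fix z
      \<comment> \<open>At most one product of cells contains \<open>z\<close>, so the sum over
        tuples has at most one nonzero term at each point.\<close>
      show "(\<Sum>j\<in>?J. phi \<alpha> d (ennreal (h j)) * indicator (?cell j) z) \<le> phi \<alpha> d (fam_step ?k W z * ennreal (\<Prod>r<?k. 2 powr (lv (z r) / \<alpha>)))"
      proof (cases "\<exists>j\<in>?J. z \<in> ?cell j")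
        case True
        then obtain j where j: "j \<in> ?J" "z \<in> ?cell j" by blast
        have uniq: "j' = j" if "j' \<in> ?J" "z \<in> ?cell j'" for j'
        proof (rule PiE_ext)
          show "j' \<in> PiE {..<?k} (\<lambda>_. I)" "j \<in> PiE {..<?k} (\<lambda>_. I)"
            by (rule fam_cells_props(1)[OF W part], fact)+
          fix t assume t: "t \<in> {..<?k}"
          then have "z t \<in> D (j t)" "z t \<in> D (j' t)" "j t \<in> I" "j' t \<in> I"
            using j that(2) JI[OF j(1)] JI[OF that(1)] by (simp_all add: PiE_iff)
          then show "j' t = j t" using D(2) unfolding disjoint_family_on_def by blast
        qed
        have "(\<Sum>j\<in>?J. phi \<alpha> d (ennreal (h j)) * indicator (?cell j) z) = (\<Sum>i\<in>?J. if i = j then phi \<alpha> d (ennreal (h j)) else 0)"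
        proof (intro sum.cong refl)
          fix i assume i: "i \<in> ?J"
          have "z \<notin> ?cell i" if "i \<noteq> j" using uniq[OF i] that by blast
          then show "phi \<alpha> d (ennreal (h i)) * indicator (?cell i) z = (if i = j then phi \<alpha> d (ennreal (h j)) else 0)"
            using j(2) by (cases "i = j") simp_all
        qed
        also have "\<dots> = phi \<alpha> d (ennreal (h j))" using j fJ by simp
        also have "\<dots> \<le> phi \<alpha> d (fam_step ?k W z * ennreal (\<Prod>r<?k. 2 powr (lv (z r) / \<alpha>)))"
        proof (rule phi_mono)
          show "0 \<le> \<alpha>" using alpha_pos by simp
          obtain w where w: "a j = fst w" "w \<in> W" "\<forall>r<?k. D (j r) \<subseteq> snd w r" using aw[OF j(1)] by auto
          have e1: "(\<Prod>r<?k. 2 powr (lv (z r) / \<alpha>)) = (\<Prod>r<?k. b (j r))"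
          proof (intro prod.cong refl)
            fix r assume "r \<in> {..<?k}"
            then have "lv (z r) = snd (j r)" using j by (intro D(7) JI) (auto simp: PiE_iff)
            then show "2 powr (lv (z r) / \<alpha>) = b (j r)" by (simp add: b_def)
          qed
          have e2: "ennreal (a j) \<le> fam_step ?k W z"
          proof -
            have "z \<in> PiE {..<?k} (snd w)" using j(2) w(3) by (auto simp: PiE_iff)
            then have "ennreal (a j) = ennreal (fst w) * indicator (PiE {..<?k} (snd w)) z" using w by simp
            also have "\<dots> \<le> fam_step ?k W z" unfolding fam_step_def using w(2) by (rule SUP_upper)
            finally show ?thesis .
          qed
          have e3: "ennreal (h j) = ennreal (a j) * ennreal (\<Prod>r<?k. b (j r))"
            unfolding h_def by (intro ennreal_mult prod_nonneg ballI less_imp_le a0 j(1) b0)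
          show "ennreal (h j) \<le> fam_step ?k W z * ennreal (\<Prod>r<?k. 2 powr (lv (z r) / \<alpha>))"
            unfolding e3 e1 by (rule mult_right_mono[OF e2 zero_le])
        qed
        finally show ?thesis .
      next
        case False
        then have "(\<Sum>j\<in>?J. phi \<alpha> d (ennreal (h j)) * indicator (?cell j) z) = 0"
          by (intro sum.neutral) (auto simp: indicator_def)
        then show ?thesis by simp
      qed
    qed
    finally show ?thesis .
    qed
    have a4: "(\<Sum>j\<in>?J. C * q j) \<le> C * R"
      using mult_left_mono[OF a3 zero_le, of C] by (simp only: sum_distrib_left)
    have B2: "emeasure P (\<Union>j\<in>?J. Ev j) \<le> C * R"
      by (rule order_trans[OF order_trans[OF a1 a2] a4])
    have B0: "emeasure P {\<omega>\<in>space P. ennreal x < fam_val M ?k W \<omega>} \<le> emeasure P ((\<Union>i\<in>I. Bad i) \<union> (\<Union>j\<in>?J. Ev j))"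
    using sub sets.Un[OF UBad UEv] by (rule emeasure_mono_AE)
  show ?thesis
    using order_trans[OF B0 order_trans[OF emeasure_subadditive[OF UBad UEv] add_mono[OF B1 B2]]]
    unfolding R_def C_def .
qed

end

section \<open>Product measures and densities\<close>

lemma indicator_PiE_prod:
  assumes "finite I" "x \<in> extensional I"
  shows "(indicator (PiE I A) x :: ennreal) = (\<Prod>i\<in>I. indicator (A i) (x i))"
proof (cases "x \<in> PiE I A")
  case True
  then show ?thesis by (auto simp: indicator_def PiE_iff intro!: prod.neutral[symmetric])
next
  case False
  then obtain i where "i \<in> I" "x i \<notin> A i" using assms by (auto simp: PiE_iff)
  then have "(\<Prod>i\<in>I. indicator (A i) (x i) :: ennreal) = 0"
    using assms by (intro prod_zero) (auto intro!: bexI[of _ i])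
  then show ?thesis using False by simp
qed

lemma PiM_density:
  assumes I: "finite I" and s: "sigma_finite_measure \<mu>" "sigma_finite_measure (density \<mu> f)"
    and f[measurable]: "f \<in> borel_measurable \<mu>"
  shows "PiM I (\<lambda>_. density \<mu> f) = density (PiM I (\<lambda>_. \<mu>)) (\<lambda>x. \<Prod>i\<in>I. f (x i))"
proof -
  interpret A: product_sigma_finite "\<lambda>_. density \<mu> f" using s by (simp add: product_sigma_finite_def)
  interpret B: product_sigma_finite "\<lambda>_. \<mu>" using s by (simp add: product_sigma_finite_def)
  have [measurable]: "(\<lambda>x. \<Prod>i\<in>I. f (x i)) \<in> borel_measurable (PiM I (\<lambda>_. \<mu>))"
  proof (rule borel_measurable_prod_ennreal)
    fix i assume "i \<in> I"
    then have [measurable]: "(\<lambda>x. x i) \<in> measurable (PiM I (\<lambda>_. \<mu>)) \<mu>" by (rule measurable_component_singleton)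
    show "(\<lambda>x. f (x i)) \<in> borel_measurable (PiM I (\<lambda>_. \<mu>))" by measurable
  qed
  show ?thesis
  proof (rule A.PiM_eqI[OF I, symmetric])
    show "sets (density (PiM I (\<lambda>_. \<mu>)) (\<lambda>x. \<Prod>i\<in>I. f (x i))) = sets (PiM I (\<lambda>_. density \<mu> f))"
      unfolding sets_density by (rule sets_PiM_cong) simp_all
    fix X assume X: "\<And>i. i \<in> I \<Longrightarrow> X i \<in> sets (density \<mu> f)"
    then have Xm: "\<And>i. i \<in> I \<Longrightarrow> X i \<in> sets \<mu>" by simp
    have "emeasure (density (PiM I (\<lambda>_. \<mu>)) (\<lambda>x. \<Prod>i\<in>I. f (x i))) (PiE I X)
        = (\<integral>\<^sup>+ x. (\<Prod>i\<in>I. f (x i)) * indicator (PiE I X) x \<partial>PiM I (\<lambda>_. \<mu>))"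
      using I Xm by (intro emeasure_density) (auto intro!: sets_PiM_I_finite)
    also have "\<dots> = (\<integral>\<^sup>+ x. (\<Prod>i\<in>I. f (x i) * indicator (X i) (x i)) \<partial>PiM I (\<lambda>_. \<mu>))"
      using I by (intro nn_integral_cong) (simp add: indicator_PiE_prod prod.distrib space_PiM PiE_iff)
    also have "\<dots> = (\<Prod>i\<in>I. \<integral>\<^sup>+ x. f x * indicator (X i) x \<partial>\<mu>)"
      using I Xm by (intro B.product_nn_integral_prod) auto
    also have "\<dots> = (\<Prod>i\<in>I. emeasure (density \<mu> f) (X i))"
      using Xm by (intro prod.cong) (simp_all add: emeasure_density)
    finally show "emeasure (density (PiM I (\<lambda>_. \<mu>)) (\<lambda>x. \<Prod>i\<in>I. f (x i))) (PiE I X) = (\<Prod>i\<in>I. emeasure (density \<mu> f) (X i))" .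
  qed
qed

text \<open>\<open>has_product_sup_measure_finite\<close> measures approximation errors under the
  restricted control measure; this translates them into the power of \<mu> itself, where all
  estimates are carried out.\<close>

lemma emeasure_PiM_density_indicator:
  fixes k :: nat
  assumes s: "sigma_finite_measure \<mu>" and F: "F \<in> sets \<mu>" and X: "X \<in> sets (power_measure \<mu> k)"
  shows "emeasure (PiM {..<k} (\<lambda>_. density \<mu> (indicator F))) X =
    emeasure (power_measure \<mu> k) (X \<inter> PiE {..<k} (\<lambda>_. F))"
proof -
  have "sigma_finite_measure (density \<mu> (indicator F))"
    by (subst sigma_finite_measure.sigma_finite_iff_density_finite[OF s]) (use F in \<open>auto simp: indicator_def\<close>)
  then have E: "PiM {..<k} (\<lambda>_. density \<mu> (indicator F)) = density (power_measure \<mu> k) (\<lambda>x. \<Prod>i<k. indicator F (x i))"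
    using F by (intro PiM_density s) auto
  have FF: "PiE {..<k} (\<lambda>_. F) \<in> sets (power_measure \<mu> k)" using F by (intro sets_PiM_I_finite) auto
  have "emeasure (PiM {..<k} (\<lambda>_. density \<mu> (indicator F))) X =
     (\<integral>\<^sup>+ x. (\<Prod>i<k. indicator F (x i)) * indicator X x \<partial>power_measure \<mu> k)"
    unfolding E using X F
    by (intro emeasure_density borel_measurable_prod_ennreal measurable_compose[OF measurable_component_singleton[of _ "{..<k}" "\<lambda>_. \<mu>"]]) auto
  also have "\<dots> = (\<integral>\<^sup>+ x. indicator (X \<inter> PiE {..<k} (\<lambda>_. F)) x \<partial>power_measure \<mu> k)"
    by (intro nn_integral_cong)
      (simp add: indicator_PiE_prod[symmetric] space_PiM PiE_iff indicator_inter_arith mult.commute)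
  also have "\<dots> = emeasure (power_measure \<mu> k) (X \<inter> PiE {..<k} (\<lambda>_. F))" using X FF by simp
  finally show ?thesis .
qed

text \<open>Distance at most \<open>e\<close>, phrased without subtraction on
  \<open>[0,\<infinity>]\<close>: an infinite value is close only to an infinite one, and the
  relation passes through suprema.\<close>

definition close :: "real \<Rightarrow> ennreal \<Rightarrow> ennreal \<Rightarrow> bool" where
  "close e u v \<longleftrightarrow> u \<le> v + ennreal e \<and> v \<le> u + ennreal e"

lemma close_SUP:
  assumes "\<And>t. t \<in> T \<Longrightarrow> close e (u t) (v t)"
  shows "close e (SUP t\<in>T. u t) (SUP t\<in>T. v t)"
  unfolding close_def
proof (intro conjI SUP_least)
  fix t assume t: "t \<in> T"
  have "u t \<le> v t + ennreal e" using assms[OF t] by (simp add: close_def)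
  also have "\<dots> \<le> (SUP t\<in>T. v t) + ennreal e" using t by (intro add_right_mono SUP_upper)
  finally show "u t \<le> (SUP t\<in>T. v t) + ennreal e" .
  have "v t \<le> u t + ennreal e" using assms[OF t] by (simp add: close_def)
  also have "\<dots> \<le> (SUP t\<in>T. u t) + ennreal e" using t by (intro add_right_mono SUP_upper)
  finally show "v t \<le> (SUP t\<in>T. u t) + ennreal e" .
qed

lemma close_mult:
  assumes "close e u v" "0 \<le> a" "0 \<le> e" "a * e \<le> e'"
  shows "close e' (ennreal a * u) (ennreal a * v)"
proof -
  have "ennreal a * x \<le> ennreal a * y + ennreal e'" if "x \<le> y + ennreal e" for x y
  proof -
    have "ennreal a * x \<le> ennreal a * (y + ennreal e)" using that by (intro mult_left_mono) auto
    also have "\<dots> = ennreal a * y + ennreal (a * e)" using assms by (simp add: distrib_left ennreal_mult)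
    also have "\<dots> \<le> ennreal a * y + ennreal e'" using assms by (intro add_left_mono ennreal_leI)
    finally show ?thesis .
  qed
  then show ?thesis using assms(1) by (simp add: close_def)
qed

lemma close_measurable[measurable (raw)]:
  assumes "f \<in> borel_measurable P" "g \<in> borel_measurable P"
  shows "Measurable.pred P (\<lambda>\<omega>. close e (f \<omega>) (g \<omega>))"
  using assms unfolding close_def by measurable

section \<open>Continuity of family values with respect to the step function\<close>

context sup_measure begin

text \<open>Continuity at 0, uniformly over the families inside \<open>F\<close>: bounded weights
  and a support of small measure give a value that is small in probability.
  \<open>fam_val_tail\<close> is used with \<open>m = \<mu>\<close> and the constant level 0. First
  \<open>K\<close> makes the cutoff term small, then \<delta> makes the integral small, since its
  integrand is at most \<open>phi\<close> of \<open>b\<close> on the support and 0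
  elsewhere.\<close>

lemma fam_val_small:
  assumes F: "F \<in> sets \<mu>" "emeasure \<mu> F < \<infinity>" and pos: "0 < e" "0 < \<eta>" "0 < b"
  shows "\<exists>\<delta>>0. \<forall>W. rect_family \<mu> (Suc d) F W \<longrightarrow> (\<forall>w\<in>W. fst w \<le> b) \<longrightarrow>
    emeasure (power_measure \<mu> (Suc d)) {x\<in>space (power_measure \<mu> (Suc d)). 0 < fam_step (Suc d) W x} \<le> ennreal \<delta> \<longrightarrow>
    emeasure P {\<omega>\<in>space P. ennreal e < fam_val M (Suc d) W \<omega>} \<le> ennreal \<eta>"
proof -
  let ?k = "Suc d"
  have "((\<lambda>K. 2 * measure \<mu> F * K powr (- \<alpha>)) \<longlongrightarrow> 0) at_top"
    using alpha_pos by (intro tendsto_mult_right_zero tendsto_neg_powr filterlim_ident) auto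
  then have "\<forall>\<^sub>F K in at_top. 2 * measure \<mu> F * K powr (- \<alpha>) < \<eta> / 2"
    using pos by (intro order_tendstoD) auto
  then have "\<forall>\<^sub>F K in at_top. 2 * measure \<mu> F * K powr (- \<alpha>) < \<eta> / 2 \<and> 0 < K"
    using eventually_gt_at_top[of 0] by (rule eventually_conj)
  then have "\<exists>K. 2 * measure \<mu> F * K powr (- \<alpha>) < \<eta> / 2 \<and> 0 < K"
    by (rule eventually_happens'[rotated]) simp
  then obtain K where K: "2 * measure \<mu> F * K powr (- \<alpha>) < \<eta> / 2" "0 < K" by blast
  define C where "C = 2 ^ ?k * 2 powr (\<alpha> * d) * (4 ^ d * e powr (- \<alpha>) * (1 + 2 * ln (max 1 (K ^ ?k / e))) ^ d)"
  have C0: "0 \<le> C" unfolding C_def by (intro mult_nonneg_nonneg zero_le_power) auto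
  define p where "p = b powr \<alpha> * (1 + ln (max 1 b) ^ d)"
  have p0: "0 \<le> p" by (simp add: p_def)
  have pp: "phi \<alpha> d (ennreal b) = ennreal p" using pos by (simp add: phi_ennreal p_def)
  \<comment> \<open>Solves \<open>C * p * \<delta> \<le> \<eta> / 2\<close>, the other half of
    \<eta> being spent on the cutoff; the summand 1 keeps the denominator positive.\<close>
  define \<delta> where "\<delta> = \<eta> / (2 * (C * p + 1))"
  have CP: "0 < C * p + 1" using C0 p0 by (simp add: add_nonneg_pos)
  then have d0: "0 < \<delta>" using pos by (simp add: \<delta>_def)
  have Cd: "C * p * \<delta> \<le> \<eta> / 2"
  proof -
    have "C * p * \<delta> \<le> (C * p + 1) * \<delta>" using d0 by (intro mult_right_mono) auto
    also have "\<dots> = \<eta> / 2" using CP by (simp add: \<delta>_def field_simps)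
    finally show ?thesis .
  qed
  show ?thesis
  proof (intro exI conjI allI impI)
    show "0 < \<delta>" by fact
    fix W assume W: "rect_family \<mu> ?k F W" and b: "\<forall>w\<in>W. fst w \<le> b"
    let ?S = "{x\<in>space (power_measure \<mu> ?k). 0 < fam_step ?k W x}"
    assume S: "emeasure (power_measure \<mu> ?k) ?S \<le> ennreal \<delta>"
    have [measurable]: "fam_step ?k W \<in> borel_measurable (power_measure \<mu> ?k)" by (rule fam_step_measurable[OF W])
    have "emeasure P {\<omega>\<in>space P. ennreal e < fam_val M ?k W \<omega>} \<le> ennreal (2 * measure \<mu> F * K powr (- \<alpha>)) +
      ennreal C * (\<integral>\<^sup>+ z. phi \<alpha> d (fam_step ?k W z * ennreal (\<Prod>r<?k. 2 powr (real_of_int ((\<lambda>_. 0) (z r)) / \<alpha>))) \<partial>power_measure \<mu> ?k)"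
      unfolding C_def
    proof (rule fam_val_tail[OF W F(1) mu.sigma_finite_measure_axioms refl F(2)])
      show "emeasure \<mu> A \<le> ennreal (2 * 2 powr (real_of_int n)) * emeasure \<mu> A"
        if "A \<subseteq> F \<inter> (\<lambda>_. 0) -` {n}" for n A
      proof (cases "n = 0")
        case True
        have "ennreal 1 \<le> ennreal (2 * 2 powr (real_of_int n))" using True by (intro ennreal_leI) simp
        then have "ennreal 1 * emeasure \<mu> A \<le> ennreal (2 * 2 powr (real_of_int n)) * emeasure \<mu> A"
          by (rule mult_right_mono) simp
        then show ?thesis by simp
      next
        case False
        then have "A = {}" using that by auto
        then show ?thesis by simp
      qed
      show "finite ((\<lambda>_. 0 :: int) ` F)" by (rule finite_subset[of _ "{0}"]) auto
    qed (use K pos in simp_all)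
    also have "\<dots> \<le> ennreal (\<eta> / 2) + ennreal C * (ennreal p * ennreal \<delta>)"
    proof (intro add_mono mult_left_mono)
      have "(\<integral>\<^sup>+ z. phi \<alpha> d (fam_step ?k W z * ennreal (\<Prod>r<?k. 2 powr (real_of_int ((\<lambda>_. 0) (z r)) / \<alpha>))) \<partial>power_measure \<mu> ?k)
         \<le> (\<integral>\<^sup>+ z. ennreal p * indicator ?S z \<partial>power_measure \<mu> ?k)"
      proof (rule nn_integral_mono)
        fix z assume z: "z \<in> space (power_measure \<mu> ?k)"
        have le: "fam_step ?k W z \<le> ennreal b" unfolding fam_step_def
        proof (rule SUP_least)
          fix w assume w: "w \<in> W"
          have "ennreal (fst w) * indicator (PiE {..<?k} (snd w)) z \<le> ennreal (fst w)" by (simp add: indicator_def)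
          also have "\<dots> \<le> ennreal b" using b w by (intro ennreal_leI) auto
          finally show "ennreal (fst w) * indicator (PiE {..<?k} (snd w)) z \<le> ennreal b" .
        qed
        show "phi \<alpha> d (fam_step ?k W z * ennreal (\<Prod>r<?k. 2 powr (real_of_int ((\<lambda>_. 0) (z r)) / \<alpha>))) \<le> ennreal p * indicator ?S z"
        proof (cases "0 < fam_step ?k W z")
          case True
          then show ?thesis using phi_mono[OF _ le, of \<alpha> d] alpha_pos z by (simp add: pp)
        next
          case False
          then have "fam_step ?k W z = 0" by simp
          then show ?thesis using alpha_pos by (simp add: phi_def enn_powr_def)
        qed
      qed
      also have "\<dots> = ennreal p * emeasure (power_measure \<mu> ?k) ?S" by (intro nn_integral_cmult_indicator) measurable
      also have "\<dots> \<le> ennreal p * ennreal \<delta>" using S by (intro mult_left_mono) auto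
      finally show "(\<integral>\<^sup>+ z. phi \<alpha> d (fam_step ?k W z * ennreal (\<Prod>r<?k. 2 powr (real_of_int ((\<lambda>_. 0) (z r)) / \<alpha>))) \<partial>power_measure \<mu> ?k) \<le> ennreal p * ennreal \<delta>" .
      show "ennreal (2 * measure \<mu> F * K powr (- \<alpha>)) \<le> ennreal (\<eta> / 2)" using K by (intro ennreal_leI) auto
    qed simp
    also have "\<dots> = ennreal (\<eta> / 2 + C * p * \<delta>)"
      using C0 p0 d0 pos by (simp add: ennreal_mult mult.assoc)
    also have "\<dots> \<le> ennreal \<eta>" using Cd by (intro ennreal_leI) auto
    finally show "emeasure P {\<omega>\<in>space P. ennreal e < fam_val M ?k W \<omega>} \<le> ennreal \<eta>" .
  qed
qed

text \<open>The form in which a function \<open>s\<close> and a random variable \<open>Z\<close> are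
  known to belong together: the same families approximate \<open>s\<close> up to sets of vanishing
  measure and \<open>Z\<close> in probability. The common frame \<open>F\<close> and the common
  bound \<open>b\<close> make \<open>fam_val_small\<close> applicable with one \<delta> for all
  \<open>l\<close>.\<close>

definition elem_approx :: "nat \<Rightarrow> ((nat \<Rightarrow> 'a) \<Rightarrow> ennreal) \<Rightarrow> ('w \<Rightarrow> ennreal) \<Rightarrow> bool" where
  "elem_approx k s Z \<longleftrightarrow> s \<in> borel_measurable (power_measure \<mu> k) \<and> Z \<in> borel_measurable P \<and>
     (\<exists>F b W. F \<in> sets \<mu> \<and> emeasure \<mu> F < \<infinity> \<and> 0 < b \<and>
        (\<forall>l::nat. rect_family \<mu> k F (W l) \<and> (\<forall>w\<in>W l. fst w \<le> b)) \<and>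
        (\<lambda>l. emeasure (power_measure \<mu> k) {x\<in>space (power_measure \<mu> k). fam_step k (W l) x \<noteq> s x}) \<longlonglongrightarrow> 0 \<and>
        (\<forall>e>0. (\<lambda>l. emeasure P {\<omega>\<in>space P. \<not> close e (fam_val M k (W l) \<omega>) (Z \<omega>)}) \<longlonglongrightarrow> 0))"

end

subsection \<open>Approximation of extremal integrals\<close>

text \<open>This is where the Borel space enters: in the real coordinate \<phi> the condition
  \<open>x i = x j\<close> becomes equality of two measurable real functions.\<close>

lemma off_diagonal_measurable:
  assumes "is_borel_space E"
  shows "off_diagonal E k \<in> sets (PiM {..<k} (\<lambda>_. E))"
proof -
  obtain S \<phi> where S: "bij_betw \<phi> (space E) S" "\<phi> \<in> measurable E (restrict_space borel (S :: real set))"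
    using assms unfolding is_borel_space_def by blast
  have [measurable]: "\<phi> \<in> borel_measurable E" using S(2) by (simp add: measurable_restrict_space2_iff)
  have inj: "inj_on \<phi> (space E)" using S(1) by (simp add: bij_betw_def)
  have eq: "diagonals E k = {x\<in>space (PiM {..<k} (\<lambda>_. E)). \<exists>i\<in>{..<k}. \<exists>j\<in>{..<k}. i \<noteq> j \<and> \<phi> (x i) = \<phi> (x j)}"
    unfolding diagonals_def
  proof (rule Collect_cong, rule conj_cong[OF refl])
    fix x assume x: "x \<in> space (PiM {..<k} (\<lambda>_. E))"
    then have "(\<phi> (x i) = \<phi> (x j)) = (x i = x j)" if "i < k" "j < k" for i j
      using that inj_on_eq_iff[OF inj] by (auto simp: space_PiM PiE_iff)
    then show "(\<exists>i<k. \<exists>j<k. i \<noteq> j \<and> x i = x j) = (\<exists>i\<in>{..<k}. \<exists>j\<in>{..<k}. i \<noteq> j \<and> \<phi> (x i) = \<phi> (x j))"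
      by (metis lessThan_iff)
  qed
  have "{x\<in>space (PiM {..<k} (\<lambda>_. E)). \<exists>i\<in>{..<k}. \<exists>j\<in>{..<k}. i \<noteq> j \<and> \<phi> (x i) = \<phi> (x j)} \<in> sets (PiM {..<k} (\<lambda>_. E))"
  proof (intro sets.sets_Collect_finite_Ex finite_lessThan sets.sets_Collect_conj sets.sets_Collect_const)
    fix i j assume "i \<in> {..<k}" "j \<in> {..<k}"
    then have [measurable]: "(\<lambda>x. x i) \<in> measurable (PiM {..<k} (\<lambda>_. E)) E" "(\<lambda>x. x j) \<in> measurable (PiM {..<k} (\<lambda>_. E)) E"
      by (auto intro: measurable_component_singleton)
    show "{x\<in>space (PiM {..<k} (\<lambda>_. E)). \<phi> (x i) = \<phi> (x j)} \<in> sets (PiM {..<k} (\<lambda>_. E))" by measurable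
  qed
  then show ?thesis unfolding off_diagonal_def eq by (rule sets.compl_sets)
qed

lemma off_diagonal_sets_measurable:
  assumes "is_borel_space E" "A \<in> off_diagonal_sets E k"
  shows "A \<in> sets (PiM {..<k} (\<lambda>_. E))"
  using assms(2) off_diagonal_measurable[OF assms(1), of k]
  unfolding off_diagonal_sets_def by (auto simp: sets_restrict_space)

definition scale_fam :: "real \<Rightarrow> (real \<times> (nat \<Rightarrow> 'a set)) set \<Rightarrow> (real \<times> (nat \<Rightarrow> 'a set)) set" where
  "scale_fam a W = (\<lambda>w. (a * fst w, snd w)) ` W"

lemma rect_family_scale: "rect_family \<mu> k F W \<Longrightarrow> 0 < a \<Longrightarrow> rect_family \<mu> k F (scale_fam a W)"
  by (auto simp: rect_family_def scale_fam_def)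

lemma rect_family_UN:
  "finite T \<Longrightarrow> (\<And>t. t \<in> T \<Longrightarrow> rect_family \<mu> k F (W t)) \<Longrightarrow> rect_family \<mu> k F (\<Union>t\<in>T. W t)"
  unfolding rect_family_def by blast

lemma rect_family_mono: "rect_family \<mu> k F W \<Longrightarrow> F \<subseteq> G \<Longrightarrow> rect_family \<mu> k G W"
  unfolding rect_family_def by blast

lemma fam_val_UN: "fam_val M k (\<Union>t\<in>T. W t) \<omega> = (SUP t\<in>T. fam_val M k (W t) \<omega>)"
  unfolding fam_val_def by (rule SUP_UNION)

lemma fam_step_UN: "fam_step k (\<Union>t\<in>T. W t) x = (SUP t\<in>T. fam_step k (W t) x)"
  unfolding fam_step_def by (rule SUP_UNION)

lemma fam_val_scale:
  assumes "rect_family \<mu> k F W" "0 \<le> a"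
  shows "fam_val M k (scale_fam a W) \<omega> = ennreal a * fam_val M k W \<omega>"
proof -
  have "\<And>w. w \<in> W \<Longrightarrow> 0 \<le> fst w" using assms by (auto simp: rect_family_def intro: less_imp_le)
  then have "fam_val M k (scale_fam a W) \<omega> = (SUP w\<in>W. ennreal a * (ennreal (fst w) * (\<Prod>r<k. M (snd w r) \<omega>)))"
    using assms(2) unfolding fam_val_def scale_fam_def image_image
    by (intro SUP_cong refl) (simp add: ennreal_mult mult.assoc)
  then show ?thesis unfolding fam_val_def by (simp add: SUP_mult_left_ennreal)
qed

lemma fam_step_scale:
  assumes "rect_family \<mu> k F W" "0 \<le> a"
  shows "fam_step k (scale_fam a W) x = ennreal a * fam_step k W x"
proof -
  have "\<And>w. w \<in> W \<Longrightarrow> 0 \<le> fst w" using assms by (auto simp: rect_family_def intro: less_imp_le)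
  then have "fam_step k (scale_fam a W) x = (SUP w\<in>W. ennreal a * (ennreal (fst w) * indicator (PiE {..<k} (snd w)) x))"
    using assms(2) unfolding fam_step_def scale_fam_def image_image
    by (intro SUP_cong refl) (simp add: ennreal_mult mult.assoc)
  then show ?thesis unfolding fam_step_def by (simp add: SUP_mult_left_ennreal)
qed

lemma close_if_edist_le:
  assumes "(u - v) + (v - u) \<le> ennreal e"
  shows "close e u v"
proof -
  have "u - v \<le> ennreal e" "v - u \<le> ennreal e"
    using assms by (auto intro: order_trans[OF _ assms])
  then show ?thesis by (auto simp: close_def ennreal_minus_le_iff)
qed

context sup_measure begin

text \<open>Building block of \<open>elem_approx\<close>: a single set, observed inside
  \<open>F\<close>, with unit weights. Other weights are introduced afterwards by
  \<open>scale_fam\<close>.\<close>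

definition basic_approx where
  "basic_approx k F A Y W \<longleftrightarrow> Y \<in> borel_measurable P \<and>
     (\<forall>l::nat. rect_family \<mu> k F (W l) \<and> (\<forall>w\<in>W l. fst w = 1)) \<and>
     (\<lambda>l. emeasure (power_measure \<mu> k) {x\<in>space (power_measure \<mu> k).
         fam_step k (W l) x \<noteq> indicator (A \<inter> PiE {..<k} (\<lambda>_. F)) x}) \<longlonglongrightarrow> 0 \<and>
     (\<forall>e>0. (\<lambda>l. emeasure P {\<omega>\<in>space P. \<not> close e (fam_val M k (W l) \<omega>) (Y \<omega>)}) \<longlonglongrightarrow> 0)"

text \<open>The rectangle unions from the definition of the product sup measure, with all sides cut
  down to \<open>F\<close>, serve as families. Convergence in \<open>L^\<gamma>\<close> yields
  convergence in probability by Markov's inequality.\<close>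

lemma product_sup_finite_approx:
  assumes Y: "has_product_sup_measure_finite P (density \<mu> (indicator F)) \<alpha> (\<lambda>C. M (C \<inter> F)) k A Y"
    and F: "F \<in> sets \<mu>" and A: "A \<in> sets (power_measure \<mu> k)"
  shows "\<exists>W. basic_approx k F A Y W"
proof -
  let ?Pi = "power_measure \<mu> k" and ?Fk = "PiE {..<k} (\<lambda>_. F)"
  obtain n :: "nat \<Rightarrow> nat" and B :: "nat \<Rightarrow> nat \<Rightarrow> nat \<Rightarrow> 'a set" where
    Ym[measurable]: "Y \<in> borel_measurable P" and
    B0: "\<forall>l. off_diagonal_rectangles (density \<mu> (indicator F)) k (n l) (B l)" and
    lim: "(\<lambda>l. emeasure (PiM {..<k} (\<lambda>_. density \<mu> (indicator F)))
               ((rectangle_union k (n l) (B l) - A) \<union> (A - rectangle_union k (n l) (B l)))) \<longlonglongrightarrow> 0" and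
    L: "\<forall>\<gamma>. 0 < \<gamma> \<and> \<gamma> < \<alpha> \<longrightarrow>
      (\<lambda>l. \<integral>\<^sup>+ \<omega>. enn_powr ((rectangle_union_value (\<lambda>C. M (C \<inter> F)) k (n l) (B l) \<omega> - Y \<omega>) +
                (Y \<omega> - rectangle_union_value (\<lambda>C. M (C \<inter> F)) k (n l) (B l) \<omega>)) \<gamma> \<partial>P) \<longlonglongrightarrow> 0"
    using Y unfolding has_product_sup_measure_finite_def by (elim conjE exE)
  have B: "off_diagonal_rectangles (density \<mu> (indicator F)) k (n l) (B l)" for l using B0 by (rule spec)
  have Bm: "B l i r \<in> sets \<mu>" if "i < n l" "r < k" for l i r
    using B[of l] that by (auto simp: off_diagonal_rectangles_def)
  have Bd: "disjoint_family_on (B l i) {..<k}" if "i < n l" for l i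
    using B[of l] that by (auto simp: off_diagonal_rectangles_def)
  define U where "U l = rectangle_union k (n l) (B l)" for l
  define W where "W l = (\<lambda>i. (1 :: real, \<lambda>r. B l i r \<inter> F)) ` {..<n l}" for l
  have W: "rect_family \<mu> k F (W l)" "\<forall>w\<in>W l. fst w = 1" for l
  proof -
    have "disjoint_family_on (\<lambda>r. B l i r \<inter> F) {..<k}" if "i < n l" for i
      using Bd[OF that] unfolding disjoint_family_on_def by blast
    then show "rect_family \<mu> k F (W l)" using Bm F by (auto simp: rect_family_def W_def)
    show "\<forall>w\<in>W l. fst w = 1" by (auto simp: W_def)
  qed
  have val: "fam_val M k (W l) \<omega> = rectangle_union_value (\<lambda>C. M (C \<inter> F)) k (n l) (B l) \<omega>" for l \<omega>
    by (simp add: fam_val_def rectangle_union_value_def W_def image_image)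
  have PF: "?Fk \<in> sets ?Pi" using F by (intro sets_PiM_I_finite) auto
  have UM: "U l \<in> sets ?Pi" for l
    unfolding U_def rectangle_union_def using Bm by (intro sets.finite_UN sets_PiM_I_finite) auto
  have step: "fam_step k (W l) x = indicator (U l \<inter> ?Fk) x" for l x
  proof (cases "x \<in> U l \<inter> ?Fk")
    case True
    then obtain i where i: "i < n l" "x \<in> PiE {..<k} (\<lambda>r. B l i r \<inter> F)"
      by (auto simp: U_def rectangle_union_def PiE_iff)
    have "(1, \<lambda>r. B l i r \<inter> F) \<in> W l" using i by (auto simp: W_def)
    from SUP_upper[OF this, of "\<lambda>w. ennreal (fst w) * indicator (PiE {..<k} (snd w)) x"]
    have "1 \<le> fam_step k (W l) x" using i(2) by (simp add: fam_step_def)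
    moreover have "fam_step k (W l) x \<le> 1"
      unfolding fam_step_def
    proof (rule SUP_least)
      fix w assume "w \<in> W l"
      then have "fst w = 1" using W(2) by blast
      then show "ennreal (fst w) * indicator (PiE {..<k} (snd w)) x \<le> 1" by (simp add: indicator_def)
    qed
    ultimately show ?thesis using True by simp
  next
    case False
    have no0: "x \<notin> PiE {..<k} (\<lambda>r. B l i r \<inter> F)" if "i < n l" for i
    proof
      assume "x \<in> PiE {..<k} (\<lambda>r. B l i r \<inter> F)"
      then have x: "x \<in> PiE {..<k} (B l i)" "x \<in> ?Fk" by (simp_all add: PiE_iff)
      then have "x \<in> U l" using that unfolding U_def rectangle_union_def by blast
      then show False using False x(2) by blast
    qed
    have no: "x \<notin> PiE {..<k} (snd w)" if "w \<in> W l" for w using that no0 unfolding W_def by auto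
    have "fam_step k (W l) x \<le> 0"
      unfolding fam_step_def by (rule SUP_least) (simp add: no)
    then have "fam_step k (W l) x = 0" by simp
    then show ?thesis using False by simp
  qed
  have b1: "(\<lambda>l. emeasure ?Pi {x\<in>space ?Pi. fam_step k (W l) x \<noteq> indicator (A \<inter> ?Fk) x}) \<longlonglongrightarrow> 0"
  proof (rule tendsto_sandwich[OF _ _ tendsto_const lim])
    show "\<forall>\<^sub>F l in sequentially. emeasure ?Pi {x\<in>space ?Pi. fam_step k (W l) x \<noteq> indicator (A \<inter> ?Fk) x}
       \<le> emeasure (PiM {..<k} (\<lambda>_. density \<mu> (indicator F)))
               ((rectangle_union k (n l) (B l) - A) \<union> (A - rectangle_union k (n l) (B l)))"
    proof (intro always_eventually allI)
      fix l
      have X: "(U l - A) \<union> (A - U l) \<in> sets ?Pi" using UM[of l] A by auto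
      show "emeasure ?Pi {x\<in>space ?Pi. fam_step k (W l) x \<noteq> indicator (A \<inter> ?Fk) x}
       \<le> emeasure (PiM {..<k} (\<lambda>_. density \<mu> (indicator F)))
               ((rectangle_union k (n l) (B l) - A) \<union> (A - rectangle_union k (n l) (B l)))"
        unfolding U_def[symmetric] emeasure_PiM_density_indicator[OF mu.sigma_finite_measure_axioms F X]
      proof (rule emeasure_mono)
        show "(U l - A \<union> (A - U l)) \<inter> ?Fk \<in> sets ?Pi" using X PF by (rule sets.Int)
        show "{x\<in>space ?Pi. fam_step k (W l) x \<noteq> indicator (A \<inter> ?Fk) x} \<subseteq> (U l - A \<union> (A - U l)) \<inter> ?Fk"
        proof
          fix x assume "x \<in> {x\<in>space ?Pi. fam_step k (W l) x \<noteq> indicator (A \<inter> ?Fk) x}"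
          then have ne: "(indicator (U l \<inter> ?Fk) x :: ennreal) \<noteq> indicator (A \<inter> ?Fk) x"
            unfolding step mem_Collect_eq by (rule conjunct2)
          have "(x \<in> U l \<inter> ?Fk) \<noteq> (x \<in> A \<inter> ?Fk)"
          proof
            assume eq: "(x \<in> U l \<inter> ?Fk) = (x \<in> A \<inter> ?Fk)"
            show False using ne unfolding indicator_def eq by (rule notE) (rule refl)
          qed
          then show "x \<in> (U l - A \<union> (A - U l)) \<inter> ?Fk" by blast
        qed
      qed
    qed
  qed simp
  have b2: "(\<lambda>l. emeasure P {\<omega>\<in>space P. \<not> close e (fam_val M k (W l) \<omega>) (Y \<omega>)}) \<longlonglongrightarrow> 0" if e: "0 < e" for e
  proof -
    \<comment> \<open>Convergence is given for every exponent in \<open>(0, \<alpha>)\<close>;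
      Markov's inequality takes one of them.\<close>
    define \<gamma> where "\<gamma> = \<alpha> / 2"
    have g: "0 < \<gamma>" "\<gamma> < \<alpha>" using alpha_pos by (auto simp: \<gamma>_def)
    define d where "d l \<omega> = (fam_val M k (W l) \<omega> - Y \<omega>) + (Y \<omega> - fam_val M k (W l) \<omega>)" for l \<omega>
    have [measurable]: "fam_val M k (W l) \<in> borel_measurable P" for l
      by (rule fam_val_measurable[OF _ W(1)]) simp
    have [measurable]: "d l \<in> borel_measurable P" for l unfolding d_def by measurable
    define c where "c = e powr \<gamma>"
    have c: "0 < c" using e by (simp add: c_def)
    have lim0: "(\<lambda>l. ennreal (1 / c) * (\<integral>\<^sup>+ \<omega>. enn_powr (d l \<omega>) \<gamma> \<partial>P)) \<longlonglongrightarrow> ennreal (1 / c) * 0"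
      using L g unfolding d_def val by (intro ennreal_tendsto_cmult) auto
    show ?thesis
    proof (rule tendsto_sandwich[OF _ _ tendsto_const lim0[simplified]])
      show "\<forall>\<^sub>F l in sequentially. emeasure P {\<omega>\<in>space P. \<not> close e (fam_val M k (W l) \<omega>) (Y \<omega>)}
          \<le> ennreal (1 / c) * (\<integral>\<^sup>+ \<omega>. enn_powr (d l \<omega>) \<gamma> \<partial>P)"
      proof (intro always_eventually allI)
        fix l
        let ?S = "{\<omega>\<in>space P. \<not> close e (fam_val M k (W l) \<omega>) (Y \<omega>)}"
        have "?S \<in> sets P" by measurable
        then have "ennreal c * emeasure P ?S = (\<integral>\<^sup>+ \<omega>. ennreal c * indicator ?S \<omega> \<partial>P)"
          by (simp add: nn_integral_cmult_indicator)
        also have "\<dots> \<le> (\<integral>\<^sup>+ \<omega>. enn_powr (d l \<omega>) \<gamma> \<partial>P)"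
        proof (rule nn_integral_mono)
          fix \<omega>
          show "ennreal c * indicator ?S \<omega> \<le> enn_powr (d l \<omega>) \<gamma>"
          proof (cases "\<omega> \<in> ?S")
            case True
            then have "\<not> d l \<omega> \<le> ennreal e" using close_if_edist_le unfolding d_def by blast
            then have "enn_powr (ennreal e) \<gamma> \<le> enn_powr (d l \<omega>) \<gamma>" using g by (intro enn_powr_mono) auto
            then show ?thesis using True e by (simp add: enn_powr_def c_def)
          qed simp
        qed
        finally have "ennreal (1 / c) * (ennreal c * emeasure P ?S) \<le> ennreal (1 / c) * (\<integral>\<^sup>+ \<omega>. enn_powr (d l \<omega>) \<gamma> \<partial>P)"
          by (rule mult_left_mono) simp
        moreover have "ennreal (1 / c) * (ennreal c * emeasure P ?S) = emeasure P ?S"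
          using c by (simp add: mult.assoc[symmetric] ennreal_mult[symmetric])
        ultimately show "emeasure P ?S \<le> ennreal (1 / c) * (\<integral>\<^sup>+ \<omega>. enn_powr (d l \<omega>) \<gamma> \<partial>P)" by simp
      qed
    qed simp
  qed
  have "basic_approx k F A Y W"
    unfolding basic_approx_def using Ym W b1 b2 by (intro conjI allI impI)
  then show ?thesis by (rule exI[of _ W])
qed

text \<open>Max-linearity at the level of approximations: families are scaled and united, which
  scales and maximizes step functions and values alike. The sets on which something goes wrong are
  contained in a finite union over \<open>T\<close>.\<close>

lemma elem_approx_SUP:
  fixes a :: "'t \<Rightarrow> real"
  assumes T: "finite T" and a: "\<And>t. t \<in> T \<Longrightarrow> 0 < a t"
    and b: "\<And>t. t \<in> T \<Longrightarrow> basic_approx k (F t) (A t) (Y t) (W t)"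
    and F: "\<And>t. t \<in> T \<Longrightarrow> F t \<in> sets \<mu> \<and> emeasure \<mu> (F t) < \<infinity>"
    and A: "\<And>t. t \<in> T \<Longrightarrow> A t \<in> sets (power_measure \<mu> k)"
  shows "elem_approx k (\<lambda>x. SUP t\<in>T. ennreal (a t) * indicator (A t \<inter> PiE {..<k} (\<lambda>_. F t)) x)
           (\<lambda>\<omega>. SUP t\<in>T. ennreal (a t) * Y t \<omega>)"
proof -
  let ?Pi = "power_measure \<mu> k"
  define V where "V l = (\<Union>t\<in>T. scale_fam (a t) (W t l))" for l
  define G where "G = (\<Union>t\<in>T. F t)"
  \<comment> \<open>\<open>c\<close> dominates every \<open>a t\<close> and is positive even for
    empty \<open>T\<close>. An error \<open>e / c\<close> in each single value becomes an error of
    at most \<open>e\<close> after scaling.\<close>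
  define c where "c = 1 + (\<Sum>t\<in>T. a t)"
  have Wr: "rect_family \<mu> k (F t) (W t l)" "\<And>w. w \<in> W t l \<Longrightarrow> fst w = 1" if "t \<in> T" for t l
    using b[OF that] by (auto simp: basic_approx_def)
  have Ym[measurable]: "Y t \<in> borel_measurable P" if "t \<in> T" for t using b[OF that] by (auto simp: basic_approx_def)
  have ac: "a t \<le> c" if "t \<in> T" for t
  proof -
    have "a t \<le> sum a T" using that a T by (intro member_le_sum) (auto intro: less_imp_le)
    then show ?thesis by (simp add: c_def)
  qed
  have "0 \<le> sum a T" by (intro sum_nonneg less_imp_le a)
  then have c0: "0 < c" by (simp add: c_def)
  have G: "G \<in> sets \<mu>" "emeasure \<mu> G < \<infinity>"
  proof -
    show "G \<in> sets \<mu>" using T F by (auto simp: G_def)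
    have "emeasure \<mu> G \<le> (\<Sum>t\<in>T. emeasure \<mu> (F t))"
      unfolding G_def using T F by (intro emeasure_subadditive_finite) auto
    also have "\<dots> < \<infinity>" using F T by simp
    finally show "emeasure \<mu> G < \<infinity>" .
  qed
  have PF: "PiE {..<k} (\<lambda>_. F t) \<in> sets ?Pi" if "t \<in> T" for t using F[OF that] by (intro sets_PiM_I_finite) auto
  have AF[measurable]: "A t \<inter> PiE {..<k} (\<lambda>_. F t) \<in> sets ?Pi" if "t \<in> T" for t using A[OF that] PF[OF that] by auto
  have V: "rect_family \<mu> k G (V l)" for l
    unfolding V_def
  proof (rule rect_family_UN[OF T])
    fix t assume t: "t \<in> T"
    show "rect_family \<mu> k G (scale_fam (a t) (W t l))"
      by (rule rect_family_mono[OF rect_family_scale[OF Wr(1)[OF t] a[OF t]]]) (use t in \<open>auto simp: G_def\<close>)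
  qed
  have Vb: "fst w \<le> c" if "w \<in> V l" for l w
  proof -
    obtain t v where "t \<in> T" "v \<in> W t l" "w = (a t * fst v, snd v)"
      using \<open>w \<in> V l\<close> unfolding V_def scale_fam_def by blast
    then show ?thesis using ac Wr(2) by simp
  qed
  have val: "fam_val M k (V l) \<omega> = (SUP t\<in>T. ennreal (a t) * fam_val M k (W t l) \<omega>)" for l \<omega>
    unfolding V_def fam_val_UN using a Wr(1) by (intro SUP_cong refl fam_val_scale) (auto intro: less_imp_le)
  have step: "fam_step k (V l) x = (SUP t\<in>T. ennreal (a t) * fam_step k (W t l) x)" for l x
    unfolding V_def fam_step_UN using a Wr(1) by (intro SUP_cong refl fam_step_scale) (auto intro: less_imp_le)
  let ?s = "\<lambda>x. SUP t\<in>T. ennreal (a t) * indicator (A t \<inter> PiE {..<k} (\<lambda>_. F t)) x"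
  let ?Z = "\<lambda>\<omega>. SUP t\<in>T. ennreal (a t) * Y t \<omega>"
  have sm: "?s \<in> borel_measurable ?Pi"
    using T AF by (intro borel_measurable_SUP countable_finite) (auto intro!: borel_measurable_times)
  have Zm: "?Z \<in> borel_measurable P"
    using T Ym by (intro borel_measurable_SUP countable_finite) (auto intro!: borel_measurable_times)
  have stm[measurable]: "fam_step k (W t l) \<in> borel_measurable ?Pi" if "t \<in> T" for t l
    by (rule fam_step_measurable[OF Wr(1)[OF that]])
  have vm[measurable]: "fam_val M k (W t l) \<in> borel_measurable P" if "t \<in> T" for t l
    by (rule fam_val_measurable[OF _ Wr(1)[OF that]]) simp
  let ?D = "\<lambda>t l. {x\<in>space ?Pi. fam_step k (W t l) x \<noteq> indicator (A t \<inter> PiE {..<k} (\<lambda>_. F t)) x}"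
  have Dm: "?D t l \<in> sets ?Pi" if "t \<in> T" for t l
  proof -
    have "(indicator (A t \<inter> PiE {..<k} (\<lambda>_. F t)) :: _ \<Rightarrow> ennreal) \<in> borel_measurable ?Pi"
      using AF[OF that] by simp
    then show ?thesis by (rule borel_measurable_neq[OF stm[OF that]])
  qed
  have lim1: "(\<lambda>l. emeasure ?Pi {x\<in>space ?Pi. fam_step k (V l) x \<noteq> ?s x}) \<longlonglongrightarrow> 0"
  proof (rule tendsto_sandwich[OF _ _ tendsto_const])
    have "(\<lambda>l. \<Sum>t\<in>T. emeasure ?Pi (?D t l)) \<longlonglongrightarrow> (\<Sum>t\<in>T. 0)"
      using b by (intro tendsto_sum) (auto simp: basic_approx_def)
    then show "(\<lambda>l. \<Sum>t\<in>T. emeasure ?Pi (?D t l)) \<longlonglongrightarrow> 0" by simp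
    show "\<forall>\<^sub>F l in sequentially. emeasure ?Pi {x\<in>space ?Pi. fam_step k (V l) x \<noteq> ?s x} \<le> (\<Sum>t\<in>T. emeasure ?Pi (?D t l))"
    proof (intro always_eventually allI)
      fix l
      have "{x\<in>space ?Pi. fam_step k (V l) x \<noteq> ?s x} \<subseteq> (\<Union>t\<in>T. ?D t l)"
      proof (rule ccontr)
        assume "\<not> ?thesis"
        then obtain x where x: "x \<in> space ?Pi" "fam_step k (V l) x \<noteq> ?s x" "x \<notin> (\<Union>t\<in>T. ?D t l)" by blast
        then have "fam_step k (V l) x = ?s x" unfolding step by (intro SUP_cong refl arg_cong2[where f="(*)"]) blast
        then show False using x by blast
      qed
      then have "emeasure ?Pi {x\<in>space ?Pi. fam_step k (V l) x \<noteq> ?s x} \<le> emeasure ?Pi (\<Union>t\<in>T. ?D t l)"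
        using T Dm by (intro emeasure_mono sets.finite_UN) auto
      also have "\<dots> \<le> (\<Sum>t\<in>T. emeasure ?Pi (?D t l))"
        using T Dm by (intro emeasure_subadditive_finite) auto
      finally show "emeasure ?Pi {x\<in>space ?Pi. fam_step k (V l) x \<noteq> ?s x} \<le> (\<Sum>t\<in>T. emeasure ?Pi (?D t l))" .
    qed
  qed simp
  have lim2: "(\<lambda>l. emeasure P {\<omega>\<in>space P. \<not> close e (fam_val M k (V l) \<omega>) (?Z \<omega>)}) \<longlonglongrightarrow> 0" if e: "0 < e" for e
  proof (rule tendsto_sandwich[OF _ _ tendsto_const])
    let ?E = "\<lambda>t l. {\<omega>\<in>space P. \<not> close (e / c) (fam_val M k (W t l) \<omega>) (Y t \<omega>)}"
    have Em: "?E t l \<in> sets P" if "t \<in> T" for t l using that by measurable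
    have "(\<lambda>l. \<Sum>t\<in>T. emeasure P (?E t l)) \<longlonglongrightarrow> (\<Sum>t\<in>T. 0)"
      using b e c0 by (intro tendsto_sum) (auto simp: basic_approx_def)
    then show "(\<lambda>l. \<Sum>t\<in>T. emeasure P (?E t l)) \<longlonglongrightarrow> 0" by simp
    show "\<forall>\<^sub>F l in sequentially. emeasure P {\<omega>\<in>space P. \<not> close e (fam_val M k (V l) \<omega>) (?Z \<omega>)} \<le> (\<Sum>t\<in>T. emeasure P (?E t l))"
    proof (intro always_eventually allI)
      fix l
      have "{\<omega>\<in>space P. \<not> close e (fam_val M k (V l) \<omega>) (?Z \<omega>)} \<subseteq> (\<Union>t\<in>T. ?E t l)"
      proof (rule ccontr)
        assume "\<not> ?thesis"
        then obtain \<omega> where x: "\<omega> \<in> space P" "\<not> close e (fam_val M k (V l) \<omega>) (?Z \<omega>)" "\<omega> \<notin> (\<Union>t\<in>T. ?E t l)" by blast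
        have "close e (fam_val M k (V l) \<omega>) (?Z \<omega>)" unfolding val
        proof (rule close_SUP)
          fix t assume t: "t \<in> T"
          have "a t * (e / c) \<le> c * (e / c)" using ac[OF t] e c0 by (intro mult_right_mono) auto
          then show "close e (ennreal (a t) * fam_val M k (W t l) \<omega>) (ennreal (a t) * Y t \<omega>)"
            using x t a[OF t] e c0 by (intro close_mult[of "e / c"]) (auto intro: less_imp_le)
        qed
        then show False using x by blast
      qed
      then have "emeasure P {\<omega>\<in>space P. \<not> close e (fam_val M k (V l) \<omega>) (?Z \<omega>)} \<le> emeasure P (\<Union>t\<in>T. ?E t l)"
        using T Em by (intro emeasure_mono sets.finite_UN) auto
      also have "\<dots> \<le> (\<Sum>t\<in>T. emeasure P (?E t l))"
        using T Em by (intro emeasure_subadditive_finite) auto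
      finally show "emeasure P {\<omega>\<in>space P. \<not> close e (fam_val M k (V l) \<omega>) (?Z \<omega>)} \<le> (\<Sum>t\<in>T. emeasure P (?E t l))" .
    qed
  qed simp
  show ?thesis
    unfolding elem_approx_def
    by (rule conjI[OF sm conjI[OF Zm]], intro exI[of _ G] exI[of _ c] exI[of _ V] conjI allI ballI impI)
      (use G c0 V Vb lim1 lim2 in blast)+
qed

text \<open>A simple function may live on sets of infinite measure, so it is approached from below
  by its restrictions to sets of finite measure. At a fixed point the restriction is exact from some
  \<open>R\<close> on, because the finitely many coordinates of the point are eventually all
  captured.\<close>

lemma simple_integral_approx:
  assumes E: "is_borel_space \<mu>" and X: "has_simple_extremal_integral P \<mu> \<alpha> M k f X"
  shows "f \<in> borel_measurable (power_measure \<mu> k) \<and> (\<exists>s Z. (\<forall>R::nat. elem_approx k (s R) (Z R)) \<and>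
    (\<forall>x\<in>space (power_measure \<mu> k). (\<forall>R. s R x \<le> f x) \<and> (\<exists>R0. \<forall>R\<ge>R0. s R x = f x)) \<and>
    (\<forall>\<omega>. mono (\<lambda>R. Z R \<omega>)) \<and> (AE \<omega> in P. X \<omega> = (SUP R. Z R \<omega>)))"
proof -
  let ?Pi = "power_measure \<mu> k"
  obtain N :: nat and a :: "nat \<Rightarrow> ennreal" and A Y where
    a0: "\<forall>i<N. 0 < a i \<and> a i < \<infinity>" and A0: "\<forall>i<N. A i \<in> off_diagonal_sets \<mu> k"
    and Ad: "disjoint_family_on A {..<N}"
    and f0: "\<forall>x\<in>space ?Pi. f x = (\<Sum>i<N. a i * indicator (A i) x)"
    and Y0: "\<forall>i<N. has_product_sup_measure P \<mu> \<alpha> M k (A i) (Y i)"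
    and XY: "AE \<omega> in P. X \<omega> = (SUP i\<in>{..<N}. a i * Y i \<omega>)"
    using X unfolding has_simple_extremal_integral_def by (elim conjE exE)
  have a: "0 < a i \<and> a i < \<infinity>" if "i < N" for i using a0 that by blast
  have A: "A i \<in> off_diagonal_sets \<mu> k" if "i < N" for i using A0 that by blast
  have Y: "has_product_sup_measure P \<mu> \<alpha> M k (A i) (Y i)" if "i < N" for i using Y0 that by blast
  have f: "f x = (\<Sum>i<N. a i * indicator (A i) x)" if "x \<in> space ?Pi" for x using f0 that by (rule bspec)
  have Am[measurable]: "A i \<in> sets ?Pi" if "i < N" for i using off_diagonal_sets_measurable[OF E A[OF that]] .
  define QF where "QF i F y \<longleftrightarrow> (range F \<subseteq> sets \<mu> \<and> incseq F \<and> (\<Union>n. F n) = space \<mu> \<and> (\<forall>n::nat. emeasure \<mu> (F n) < \<infinity>) \<and>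
      (\<forall>r. \<exists>W. basic_approx k (F r) (A i) (y r) W) \<and> (AE \<omega> in P. Y i \<omega> = (SUP r. y r \<omega>)))" for i F y
  have "\<forall>i. \<exists>F y. i < N \<longrightarrow> QF i F y"
  proof (intro allI)
    fix i
    show "\<exists>F y. i < N \<longrightarrow> QF i F y"
    proof (cases "i < N")
      case True
      obtain F :: "nat \<Rightarrow> 'a set" and y where
        F: "range F \<subseteq> sets \<mu>" "incseq F" "(\<Union>n. F n) = space \<mu>" "\<forall>n. 0 < emeasure \<mu> (F n) \<and> emeasure \<mu> (F n) < \<infinity>"
        and y: "\<forall>n. has_product_sup_measure_finite P (density \<mu> (indicator (F n))) \<alpha> (\<lambda>C. M (C \<inter> F n)) k (A i) (y n)"
        "AE \<omega> in P. Y i \<omega> = (SUP n. y n \<omega>)"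
        using Y[OF True] unfolding has_product_sup_measure_def by blast
      have "\<exists>W. basic_approx k (F r) (A i) (y r) W" for r
        using y(1) F(1) Am[OF True] by (intro product_sup_finite_approx) auto
      then have "QF i F y" unfolding QF_def using F y(2) by blast
      then show ?thesis by blast
    qed blast
  qed
  then obtain F y where QF: "\<And>i. i < N \<Longrightarrow> QF i (F i) (y i)" by metis
  note Fy = QF[unfolded QF_def]
  have "\<forall>i r. \<exists>W. i < N \<longrightarrow> basic_approx k (F i r) (A i) (y i r) W" using Fy by blast
  then obtain W where W: "\<And>i r. i < N \<Longrightarrow> basic_approx k (F i r) (A i) (y i r) (W i r)" by metis
  define c where "c i = enn2real (a i)" for i
  have c: "0 < c i" "ennreal (c i) = a i" if "i < N" for i
    using a[OF that] by (auto simp: c_def enn2real_positive_iff)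
  \<comment> \<open>Every \<open>A i\<close> comes with its own exhaustion \<open>F i\<close>.
    Collecting all stages up to \<open>R\<close>, instead of stage \<open>R\<close> alone, makes
    \<open>Z\<close> increasing in \<open>R\<close> for every \<omega>, not merely almost
    surely.\<close>
  define T where "T R = {..<N} \<times> {..R}" for R :: nat
  define s where "s R x = (SUP t\<in>T R. ennreal (c (fst t)) * indicator (A (fst t) \<inter> PiE {..<k} (\<lambda>_. F (fst t) (snd t))) x)" for R x
  define Z where "Z R \<omega> = (SUP t\<in>T R. ennreal (c (fst t)) * y (fst t) (snd t) \<omega>)" for R \<omega>
  have r1: "elem_approx k (s R) (Z R)" for R
    unfolding s_def[abs_def] Z_def[abs_def]
  proof (rule elem_approx_SUP)
    show "finite (T R)" by (simp add: T_def)
    fix t assume "t \<in> T R"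
    then have t: "fst t < N" by (auto simp: T_def)
    show "0 < c (fst t)" "A (fst t) \<in> sets ?Pi" using c Am t by auto
    show "F (fst t) (snd t) \<in> sets \<mu> \<and> emeasure \<mu> (F (fst t) (snd t)) < \<infinity>" using Fy[OF t] by auto
    show "basic_approx k (F (fst t) (snd t)) (A (fst t)) (y (fst t) (snd t)) (W (fst t) (snd t))" by (rule W[OF t])
  qed
  have r2: "s R x \<le> f x" if x: "x \<in> space ?Pi" for R x
    unfolding s_def
  proof (rule SUP_least)
    fix t assume "t \<in> T R"
    then have t: "fst t < N" by (auto simp: T_def)
    have "ennreal (c (fst t)) * indicator (A (fst t) \<inter> PiE {..<k} (\<lambda>_. F (fst t) (snd t))) x \<le> a (fst t) * indicator (A (fst t)) x"
      using c(2)[OF t] by (auto simp: indicator_def)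
    also have "\<dots> \<le> (\<Sum>i<N. a i * indicator (A i) x)" using t by (intro member_le_sum) auto
    finally show "ennreal (c (fst t)) * indicator (A (fst t) \<inter> PiE {..<k} (\<lambda>_. F (fst t) (snd t))) x \<le> f x"
      using f[OF x] by simp
  qed
  have r3: "\<exists>R0. \<forall>R\<ge>R0. s R x = f x" if x: "x \<in> space ?Pi" for x
  proof (cases "\<exists>i<N. x \<in> A i")
    case True
    then obtain i where i: "i < N" "x \<in> A i" by blast
    have "f x = (\<Sum>j<N. if j = i then a i else 0)" unfolding f[OF x]
    proof (intro sum.cong refl)
      fix j assume "j \<in> {..<N}"
      then have "x \<notin> A j" if "j \<noteq> i" using Ad i that unfolding disjoint_family_on_def by blast
      then show "a j * indicator (A j) x = (if j = i then a i else 0)" using i by auto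
    qed
    then have fx: "f x = a i" using i by simp
    have "\<exists>n. x r \<in> F i n" if "r < k" for r
    proof -
      have "x r \<in> space \<mu>" using x that by (auto simp: space_PiM PiE_iff)
      moreover have "(\<Union>n. F i n) = space \<mu>" using Fy[OF i(1)] by blast
      ultimately show ?thesis by blast
    qed
    then obtain n where n: "\<And>r. r < k \<Longrightarrow> x r \<in> F i (n r)" by metis
    define R0 where "R0 = Max (insert 0 (n ` {..<k}))"
    have nR: "n r \<le> R0" if "r < k" for r using that by (simp add: R0_def)
    have eq: "s R x = f x" if R: "R0 \<le> R" for R
    proof (rule antisym)
      show "s R x \<le> f x" by (rule r2[OF x])
      have "x \<in> PiE {..<k} (\<lambda>_. F i R)"
      proof -
        have "x r \<in> F i R" if "r < k" for r
          using n[OF that] nR[OF that] R Fy[OF i(1)] by (meson incseqD order_trans subsetD)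
        then show ?thesis using x by (auto simp: space_PiM PiE_iff)
      qed
      then have v1: "f x = ennreal (c i) * indicator (A i \<inter> PiE {..<k} (\<lambda>_. F i R)) x" using fx c i by simp
      have v2: "ennreal (c i) * indicator (A i \<inter> PiE {..<k} (\<lambda>_. F i R)) x \<le> s R x"
      proof -
        have "(i, R) \<in> T R" using i by (simp add: T_def)
        then show ?thesis
          using SUP_upper[of "(i, R)" "T R" "\<lambda>t. ennreal (c (fst t)) * indicator (A (fst t) \<inter> PiE {..<k} (\<lambda>_. F (fst t) (snd t))) x"]
          by (simp add: s_def)
      qed
      show "f x \<le> s R x" using v2 unfolding v1 .
    qed
    show ?thesis by (intro exI[of _ R0] allI impI eq)
  next
    case False
    then have "f x = 0" unfolding f[OF x] by (intro sum.neutral) auto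
    then have eq: "s R x = f x" for R using r2[OF x, of R] by simp
    show ?thesis by (intro exI[of _ 0] allI impI eq)
  qed
  have r4: "mono (\<lambda>R. Z R \<omega>)" for \<omega>
    unfolding Z_def by (intro monoI SUP_subset_mono) (auto simp: T_def)
  have r5: "AE \<omega> in P. X \<omega> = (SUP R. Z R \<omega>)"
  proof -
    have "AE \<omega> in P. \<forall>i\<in>{..<N}. Y i \<omega> = (SUP r. y i r \<omega>)"
      using Fy by (intro AE_finite_allI) auto
    with XY show ?thesis
    proof eventually_elim
      case (elim \<omega>)
      have "X \<omega> = (SUP i\<in>{..<N}. SUP r. ennreal (c i) * y i r \<omega>)"
        unfolding elim(1)
      proof (rule SUP_cong[OF refl])
        fix i assume i: "i \<in> {..<N}"
        have "a i * Y i \<omega> = ennreal (c i) * (SUP r. y i r \<omega>)" using elim(2) c(2)[of i] i by simp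
        also have "\<dots> = (SUP r. ennreal (c i) * y i r \<omega>)" by (rule SUP_mult_left_ennreal)
        finally show "a i * Y i \<omega> = (SUP r. ennreal (c i) * y i r \<omega>)" .
      qed
      moreover have "(SUP i\<in>{..<N}. SUP r. ennreal (c i) * y i r \<omega>) \<le> (SUP R. Z R \<omega>)"
      proof (rule SUP_least, rule SUP_least)
        fix i r assume i: "i \<in> {..<N}"
        have ir: "(i, r) \<in> T r" using i by (simp add: T_def)
        have "ennreal (c i) * y i r \<omega> \<le> Z r \<omega>"
          using SUP_upper[OF ir, of "\<lambda>t. ennreal (c (fst t)) * y (fst t) (snd t) \<omega>"] by (simp add: Z_def)
        moreover have "Z r \<omega> \<le> (SUP R. Z R \<omega>)" using SUP_upper[of r UNIV "\<lambda>R. Z R \<omega>"] by simp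
        ultimately show "ennreal (c i) * y i r \<omega> \<le> (SUP R. Z R \<omega>)" by (rule order_trans)
      qed
      moreover have "(SUP R. Z R \<omega>) \<le> (SUP i\<in>{..<N}. SUP r. ennreal (c i) * y i r \<omega>)"
      proof (rule SUP_least)
        fix R
        show "Z R \<omega> \<le> (SUP i\<in>{..<N}. SUP r. ennreal (c i) * y i r \<omega>)" unfolding Z_def
        proof (rule SUP_least)
          fix t assume "t \<in> T R"
          then have t: "fst t \<in> {..<N}" by (auto simp: T_def)
          have "ennreal (c (fst t)) * y (fst t) (snd t) \<omega> \<le> (SUP r. ennreal (c (fst t)) * y (fst t) r \<omega>)"
            using SUP_upper[of "snd t" UNIV "\<lambda>r. ennreal (c (fst t)) * y (fst t) r \<omega>"] by simp
          moreover have "(SUP r. ennreal (c (fst t)) * y (fst t) r \<omega>) \<le> (SUP i\<in>{..<N}. SUP r. ennreal (c i) * y i r \<omega>)"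
            using SUP_upper[OF t, of "\<lambda>i. SUP r. ennreal (c i) * y i r \<omega>"] .
          ultimately show "ennreal (c (fst t)) * y (fst t) (snd t) \<omega> \<le> (SUP i\<in>{..<N}. SUP r. ennreal (c i) * y i r \<omega>)"
            by (rule order_trans)
        qed
      qed
      ultimately show "X \<omega> = (SUP R. Z R \<omega>)" by (metis antisym)
    qed
  qed
  have r6: "f \<in> borel_measurable ?Pi"
  proof -
    have "(\<lambda>x. \<Sum>i<N. a i * indicator (A i) x) \<in> borel_measurable ?Pi"
      using Am by (intro borel_measurable_sum borel_measurable_times) auto
    then show ?thesis using f by (subst measurable_cong[where g="\<lambda>x. \<Sum>i<N. a i * indicator (A i) x"]) auto
  qed
  show ?thesis
    by (intro conjI exI[of _ s] exI[of _ Z] allI ballI r1 r2 r3 r4 r5 r6; assumption)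
qed

text \<open>Two indices remain: \<open>n\<close> runs through the simple functions and
  \<open>R\<close> through the exhaustion by sets of finite measure. The limit in \<open>R\<close>
  is a monotone supremum, while for \<open>n\<close> only the almost sure convergence of
  \<open>Z n\<close> is recorded; the limit passages below treat the two differently for this
  reason.\<close>

lemma extremal_integral_approx:
  assumes E: "is_borel_space \<mu>" and X: "has_extremal_integral P \<mu> \<alpha> M k f X"
  obtains s Z s' Z' where
    "\<And>n R::nat. elem_approx k (s' (n::nat) R) (Z' n R)"
    "\<And>n. s n \<in> borel_measurable (power_measure \<mu> k)"
    "\<And>n x R. x \<in> space (power_measure \<mu> k) \<Longrightarrow> s' n R x \<le> s n x"
    "\<And>n x. x \<in> space (power_measure \<mu> k) \<Longrightarrow> \<exists>R0. \<forall>R\<ge>R0. s' n R x = s n x"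
    "\<And>n. AE x in power_measure \<mu> k. s n x \<le> f x"
    "AE x in power_measure \<mu> k. (\<lambda>n. s n x) \<longlonglongrightarrow> f x"
    "\<And>n. Z n \<in> borel_measurable P"
    "\<And>n \<omega>. mono (\<lambda>R. Z' n R \<omega>)"
    "\<And>n. AE \<omega> in P. Z n \<omega> = (SUP R. Z' n R \<omega>)"
    "AE \<omega> in P. (\<lambda>n. Z n \<omega>) \<longlonglongrightarrow> X \<omega>"
proof -
  let ?Pi = "power_measure \<mu> k"
  obtain s Z where sZ0: "\<forall>n::nat. has_simple_extremal_integral P \<mu> \<alpha> M k (s n) (Z n)"
    and inc0: "\<forall>n. \<forall>x\<in>space ?Pi. s n x \<le> s (Suc n) x"
    and lim: "AE x in ?Pi. (\<lambda>n. s n x) \<longlonglongrightarrow> f x" and limZ: "AE \<omega> in P. (\<lambda>n. Z n \<omega>) \<longlonglongrightarrow> X \<omega>"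
    using X unfolding has_extremal_integral_def by (elim conjE exE)
  have sZ: "has_simple_extremal_integral P \<mu> \<alpha> M k (s n) (Z n)" for n using sZ0 by (rule spec)
  have inc: "s n x \<le> s (Suc n) x" if "x \<in> space ?Pi" for n x using inc0 that by blast
  define Q where "Q n s' Z' \<longleftrightarrow> (\<forall>R::nat. elem_approx k (s' R) (Z' R)) \<and>
    (\<forall>x\<in>space ?Pi. (\<forall>R. s' R x \<le> s n x) \<and> (\<exists>R0. \<forall>R\<ge>R0. s' R x = s n x)) \<and>
    (\<forall>\<omega>. mono (\<lambda>R. Z' R \<omega>)) \<and> (AE \<omega> in P. Z n \<omega> = (SUP R. Z' R \<omega>))" for n s' Z'
  have "\<exists>s' Z'. Q n s' Z'" for n
    using simple_integral_approx[OF E sZ[of n]] unfolding Q_def by (rule conjunct2)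
  then obtain s' Z' where A: "\<And>n. Q n (s' n) (Z' n)" by metis
  have sf: "AE x in ?Pi. s n x \<le> f x" for n
    using lim AE_space
  proof eventually_elim
    case (elim x)
    have "incseq (\<lambda>n. s n x)" using inc[OF elim(2)] by (rule incseq_SucI)
    then show ?case using elim(1) by (rule incseq_le)
  qed
  have Zm: "Z n \<in> borel_measurable P" for n
    using sZ[of n] unfolding has_simple_extremal_integral_def by blast
  have sm: "s n \<in> borel_measurable ?Pi" for n using simple_integral_approx[OF E sZ] by blast
  show ?thesis
  proof (rule that[of s' Z' s Z])
    show "elem_approx k (s' n R) (Z' n R)" for n R using A[of n] unfolding Q_def by blast
    show "s' n R x \<le> s n x" "\<exists>R0. \<forall>R\<ge>R0. s' n R x = s n x" if "x \<in> space ?Pi" for n R x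
      using A[of n] that unfolding Q_def by blast+
    show "mono (\<lambda>R. Z' n R \<omega>)" for n \<omega> using A[of n] unfolding Q_def by blast
    show "AE \<omega> in P. Z n \<omega> = (SUP R. Z' n R \<omega>)" for n using A[of n] unfolding Q_def by blast
  qed (fact sm sf lim Zm limZ)+
qed

end

subsection \<open>Restriction of families to a set\<close>

definition cap_fam :: "'a set \<Rightarrow> (real \<times> (nat \<Rightarrow> 'a set)) set \<Rightarrow> (real \<times> (nat \<Rightarrow> 'a set)) set" where
  "cap_fam A W = (\<lambda>w. (fst w, \<lambda>r. snd w r \<inter> A)) ` W"

text \<open>The part of a rectangle outside the power of \<open>A\<close> is the union, over the
  coordinates \<open>t\<close>, of the rectangles whose side \<open>t\<close> is moved outside
  \<open>A\<close>. So it is again described by a finite family.\<close>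

definition out_fam :: "nat \<Rightarrow> 'a set \<Rightarrow> (real \<times> (nat \<Rightarrow> 'a set)) set \<Rightarrow> (real \<times> (nat \<Rightarrow> 'a set)) set" where
  "out_fam k A W = (\<lambda>(w, t). (fst w, (snd w)(t := snd w t - A))) ` (W \<times> {..<k})"

lemma rect_family_cap:
  assumes W: "rect_family \<mu> k F W" and A: "A \<in> sets \<mu>"
  shows "rect_family \<mu> k (F \<inter> A) (cap_fam A W)"
proof -
  have "disjoint_family_on (\<lambda>r. snd w r \<inter> A) {..<k}" if "w \<in> W" for w
    using W that unfolding rect_family_def disjoint_family_on_def by blast
  moreover have "0 < fst w" "\<forall>r<k. snd w r \<in> sets \<mu> \<and> snd w r \<subseteq> F" if "w \<in> W" for w
    using W that unfolding rect_family_def by blast+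
  moreover have "finite W" using W by (simp add: rect_family_def)
  ultimately show ?thesis using A unfolding rect_family_def cap_fam_def by fastforce
qed

lemma rect_family_out:
  assumes W: "rect_family \<mu> k F W" and A: "A \<in> sets \<mu>"
  shows "rect_family \<mu> k F (out_fam k A W)"
proof -
  have *: "disjoint_family_on ((snd w)(t := snd w t - A)) {..<k}" if "w \<in> W" for w t
    using W that unfolding rect_family_def disjoint_family_on_def by auto blast+
  have "finite (out_fam k A W)" using W by (simp add: rect_family_def out_fam_def)
  moreover have "0 < fst v \<and> (\<forall>r<k. snd v r \<in> sets \<mu> \<and> snd v r \<subseteq> F) \<and> disjoint_family_on (snd v) {..<k}"
    if v: "v \<in> out_fam k A W" for v
  proof -
    obtain w t where w: "w \<in> W" "t < k" "v = (fst w, (snd w)(t := snd w t - A))"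
      using v unfolding out_fam_def by auto
    have "0 < fst w" "\<forall>r<k. snd w r \<in> sets \<mu> \<and> snd w r \<subseteq> F" using W w(1) unfolding rect_family_def by blast+
    then show ?thesis using *[OF w(1), of t] w(2) A unfolding w(3) by auto
  qed
  ultimately show ?thesis unfolding rect_family_def by blast
qed

lemma out_fam_bound: "(\<forall>w\<in>W. fst w \<le> b) \<Longrightarrow> w \<in> out_fam k A W \<Longrightarrow> fst w \<le> b"
  by (auto simp: out_fam_def)

lemma fam_step_cap: "fam_step k (cap_fam A W) x = fam_step k W x * indicator (PiE {..<k} (\<lambda>_. A)) x"
proof -
  have eq: "(x \<in> PiE {..<k} (\<lambda>r. B r \<inter> A)) = (x \<in> PiE {..<k} B \<and> x \<in> PiE {..<k} (\<lambda>_. A))" for B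
    by (auto simp: PiE_iff)
  have "fam_step k (cap_fam A W) x =
      (SUP w\<in>W. (ennreal (fst w) * indicator (PiE {..<k} (snd w)) x) * indicator (PiE {..<k} (\<lambda>_. A)) x)"
    unfolding fam_step_def cap_fam_def image_image
    by (rule SUP_cong[OF refl]) (simp add: indicator_def eq)
  also have "\<dots> = fam_step k W x * indicator (PiE {..<k} (\<lambda>_. A)) x"
    unfolding fam_step_def by (rule SUP_mult_right_ennreal[symmetric])
  finally show ?thesis .
qed

lemma fam_step_pos_iff:
  "0 < fam_step k W x \<longleftrightarrow> (\<exists>w\<in>W. 0 < fst w \<and> x \<in> PiE {..<k} (snd w))"
  unfolding fam_step_def by (simp add: less_SUP_iff indicator_def ennreal_zero_less_mult_iff) blast

lemma fam_step_out_pos: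
  assumes "0 < fam_step k (out_fam k A W) x"
  shows "0 < fam_step k W x \<and> x \<notin> PiE {..<k} (\<lambda>_. A)"
proof -
  obtain v where v: "v \<in> out_fam k A W" "0 < fst v" "x \<in> PiE {..<k} (snd v)"
    using assms unfolding fam_step_pos_iff by blast
  obtain w t where w: "w \<in> W" "t < k" "v = (fst w, (snd w)(t := snd w t - A))"
    using v(1) unfolding out_fam_def by auto
  have x: "x \<in> PiE {..<k} ((snd w)(t := snd w t - A))" using v(3) w(3) by simp
  have t: "x t \<in> snd w t - A" using x w(2) by (auto simp: PiE_iff dest!: bspec[where x=t])
  have "x r \<in> snd w r" if "r < k" for r
    using x that t by (cases "r = t") (auto simp: PiE_iff dest!: bspec[where x=r])
  then have "x \<in> PiE {..<k} (snd w)" using x by (auto simp: PiE_iff)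
  then show ?thesis using w v(2) t unfolding fam_step_pos_iff by (auto simp: PiE_iff)
qed

lemma prod_mono_ennreal:
  fixes f g :: "'i \<Rightarrow> ennreal"
  shows "(\<And>i. i \<in> I \<Longrightarrow> f i \<le> g i) \<Longrightarrow> prod f I \<le> prod g I"
  by (induction I rule: infinite_finite_induct) (auto intro!: mult_mono)

lemma fam_step_le:
  assumes "\<forall>w\<in>W. fst w \<le> b"
  shows "fam_step k W x \<le> ennreal b"
  unfolding fam_step_def
proof (rule SUP_least)
  fix w assume w: "w \<in> W"
  have "ennreal (fst w) * indicator (PiE {..<k} (snd w)) x \<le> ennreal (fst w)" by (simp add: indicator_def)
  also have "\<dots> \<le> ennreal b" using assms w by (intro ennreal_leI) auto
  finally show "ennreal (fst w) * indicator (PiE {..<k} (snd w)) x \<le> ennreal b" .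
qed

lemma fam_step_pos_subset:
  assumes "rect_family \<mu> k F W" "0 < fam_step k W x"
  shows "x \<in> PiE {..<k} (\<lambda>_. F)"
proof -
  obtain w where w: "w \<in> W" "x \<in> PiE {..<k} (snd w)" using assms(2) unfolding fam_step_pos_iff by blast
  then have "\<And>r. r < k \<Longrightarrow> snd w r \<subseteq> F" using assms(1) unfolding rect_family_def by blast
  then show ?thesis using w(2) by (auto simp: PiE_iff)
qed

text \<open>\<open>M\<close> of a side is the larger of its values inside and outside
  \<open>A\<close>. If the inner value is attained on every side, the product occurs in
  \<open>cap_fam\<close>; otherwise a side on which it is not attained can be replaced by its outer
  part, and the product occurs in \<open>out_fam\<close>.\<close>

lemma (in sup_measure) fam_val_split:
  assumes W: "rect_family \<mu> k F W" and A: "A \<in> sets \<mu>"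
  shows "AE \<omega> in P. fam_val M k W \<omega> \<le> max (fam_val M k (cap_fam A W) \<omega>) (fam_val M k (out_fam k A W) \<omega>) \<and>
     fam_val M k (cap_fam A W) \<omega> \<le> fam_val M k W \<omega>"
proof -
  have Wf: "finite W" using W by (simp add: rect_family_def)
  have Bm: "snd w r \<in> sets \<mu>" if "w \<in> W" "r < k" for w r using W that unfolding rect_family_def by blast
  have one: "AE \<omega> in P. M (snd w r) \<omega> = max (M (snd w r \<inter> A) \<omega>) (M (snd w r - A) \<omega>)" if "w \<in> W" "r < k" for w r
  proof -
    have "AE \<omega> in P. M (\<Union>i\<in>{snd w r \<inter> A, snd w r - A}. i) \<omega> = (SUP i\<in>{snd w r \<inter> A, snd w r - A}. M i \<omega>)"
      by (rule M_UN) (use Bm[OF that] A in auto)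
    moreover have "(snd w r \<inter> A) \<union> (snd w r - A) = snd w r" by blast
    ultimately show ?thesis by (simp add: sup_max)
  qed
  have "AE \<omega> in P. \<forall>w\<in>W. \<forall>r\<in>{..<k}. M (snd w r) \<omega> = max (M (snd w r \<inter> A) \<omega>) (M (snd w r - A) \<omega>)"
    using Wf one by (intro AE_finite_allI) auto
  then show ?thesis
  proof eventually_elim
    case (elim \<omega>)
    have mx: "M (snd w r) \<omega> = max (M (snd w r \<inter> A) \<omega>) (M (snd w r - A) \<omega>)" if "w \<in> W" "r < k" for w r
      using elim that by blast
    have "fam_val M k W \<omega> \<le> max (fam_val M k (cap_fam A W) \<omega>) (fam_val M k (out_fam k A W) \<omega>)"
      unfolding fam_val_def[of M k W]
    proof (rule SUP_least)
      fix w assume w: "w \<in> W"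
      show "ennreal (fst w) * (\<Prod>r<k. M (snd w r) \<omega>) \<le> max (fam_val M k (cap_fam A W) \<omega>) (fam_val M k (out_fam k A W) \<omega>)"
      proof (cases "\<forall>r<k. M (snd w r) \<omega> = M (snd w r \<inter> A) \<omega>")
        case True
        have i: "(fst w, \<lambda>r. snd w r \<inter> A) \<in> cap_fam A W" using w by (auto simp: cap_fam_def)
        have "(\<Prod>r<k. M (snd w r) \<omega>) = (\<Prod>r<k. M (snd w r \<inter> A) \<omega>)" using True by (intro prod.cong) auto
        then have "ennreal (fst w) * (\<Prod>r<k. M (snd w r) \<omega>) \<le> fam_val M k (cap_fam A W) \<omega>"
          using SUP_upper[OF i, of "\<lambda>w. ennreal (fst w) * (\<Prod>r<k. M (snd w r) \<omega>)"] by (simp add: fam_val_def)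
        then show ?thesis by (simp add: le_max_iff_disj)
      next
        case False
        then obtain t where t: "t < k" "M (snd w t) \<omega> \<noteq> M (snd w t \<inter> A) \<omega>" by blast
        then have tt: "M (snd w t) \<omega> = M (snd w t - A) \<omega>" using mx[OF w t(1)] by (simp add: max_def split: if_splits)
        let ?v = "(fst w, (snd w)(t := snd w t - A))"
        have i: "?v \<in> out_fam k A W" unfolding out_fam_def
          by (rule image_eqI[of _ _ "(w, t)"]) (use w t in auto)
        have "(\<Prod>r<k. M (snd w r) \<omega>) = (\<Prod>r<k. M (((snd w)(t := snd w t - A)) r) \<omega>)" using tt by (intro prod.cong) auto
        then have "ennreal (fst w) * (\<Prod>r<k. M (snd w r) \<omega>) \<le> fam_val M k (out_fam k A W) \<omega>"
          using SUP_upper[OF i, of "\<lambda>w. ennreal (fst w) * (\<Prod>r<k. M (snd w r) \<omega>)"] by (simp add: fam_val_def)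
        then show ?thesis by (simp add: le_max_iff_disj)
      qed
    qed
    moreover have "fam_val M k (cap_fam A W) \<omega> \<le> fam_val M k W \<omega>"
      unfolding fam_val_def[of M k "cap_fam A W"]
    proof (rule SUP_least)
      fix v assume "v \<in> cap_fam A W"
      then obtain w where w: "w \<in> W" "v = (fst w, \<lambda>r. snd w r \<inter> A)" by (auto simp: cap_fam_def)
      have "(\<Prod>r<k. M (snd v r) \<omega>) \<le> (\<Prod>r<k. M (snd w r) \<omega>)"
        using mx[OF w(1)] w(2) by (intro prod_mono_ennreal) simp
      then have "ennreal (fst v) * (\<Prod>r<k. M (snd v r) \<omega>) \<le> ennreal (fst w) * (\<Prod>r<k. M (snd w r) \<omega>)"
        using w(2) by (simp add: mult_left_mono)
      also have "\<dots> \<le> fam_val M k W \<omega>"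
        using SUP_upper[OF w(1), of "\<lambda>w. ennreal (fst w) * (\<Prod>r<k. M (snd w r) \<omega>)"] by (simp only: fam_val_def)
      finally show "ennreal (fst v) * (\<Prod>r<k. M (snd v r) \<omega>) \<le> fam_val M k W \<omega>" .
    qed
    ultimately show ?case by blast
  qed
qed

text \<open>\<open>fam_val_small\<close> applied to the outer family, whose step function is
  positive only on the support of the original one outside the power of \<open>A\<close>. As
  \<delta> is fixed before \<open>A\<close>, the set may be chosen in dependence on
  \<delta>.\<close>

lemma (in sup_measure) out_fam_small:
  assumes F: "F \<in> sets \<mu>" "emeasure \<mu> F < \<infinity>" and pos: "0 < e" "0 < \<eta>" "0 < b"
  shows "\<exists>\<delta>>0. \<forall>W A. rect_family \<mu> (Suc d) F W \<longrightarrow> (\<forall>w\<in>W. fst w \<le> b) \<longrightarrow> A \<in> sets \<mu> \<longrightarrow>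
    emeasure (power_measure \<mu> (Suc d)) {x\<in>space (power_measure \<mu> (Suc d)). 0 < fam_step (Suc d) W x \<and> x \<notin> PiE {..<Suc d} (\<lambda>_. A)} \<le> ennreal \<delta> \<longrightarrow>
    emeasure P {\<omega>\<in>space P. ennreal e < fam_val M (Suc d) (out_fam (Suc d) A W) \<omega>} \<le> ennreal \<eta>"
proof -
  let ?Pi = "power_measure \<mu> (Suc d)"
  obtain \<delta> where \<delta>: "0 < \<delta>" and sm: "\<And>W. rect_family \<mu> (Suc d) F W \<Longrightarrow> (\<forall>w\<in>W. fst w \<le> b) \<Longrightarrow>
    emeasure ?Pi {x\<in>space ?Pi. 0 < fam_step (Suc d) W x} \<le> ennreal \<delta> \<Longrightarrow>
    emeasure P {\<omega>\<in>space P. ennreal e < fam_val M (Suc d) W \<omega>} \<le> ennreal \<eta>"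
    using fam_val_small[OF F pos, of d] by blast
  show ?thesis
  proof (intro exI[of _ \<delta>] conjI \<delta> allI impI)
    fix W A
    assume W: "rect_family \<mu> (Suc d) F W" "\<forall>w\<in>W. fst w \<le> b" "A \<in> sets \<mu>"
      and le: "emeasure ?Pi {x\<in>space ?Pi. 0 < fam_step (Suc d) W x \<and> x \<notin> PiE {..<Suc d} (\<lambda>_. A)} \<le> ennreal \<delta>"
    have [measurable]: "fam_step (Suc d) W \<in> borel_measurable ?Pi" by (rule fam_step_measurable[OF W(1)])
    have [measurable]: "PiE {..<Suc d} (\<lambda>_. A) \<in> sets ?Pi" using W(3) by (intro sets_PiM_I_finite) auto
    show "emeasure P {\<omega>\<in>space P. ennreal e < fam_val M (Suc d) (out_fam (Suc d) A W) \<omega>} \<le> ennreal \<eta>"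
    proof (rule sm[OF rect_family_out[OF W(1,3)]])
      show "\<forall>w\<in>out_fam (Suc d) A W. fst w \<le> b" using out_fam_bound[OF W(2)] by blast
      have "emeasure ?Pi {x\<in>space ?Pi. 0 < fam_step (Suc d) (out_fam (Suc d) A W) x} \<le>
        emeasure ?Pi {x\<in>space ?Pi. 0 < fam_step (Suc d) W x \<and> x \<notin> PiE {..<Suc d} (\<lambda>_. A)}"
      proof (rule emeasure_mono)
        show "{x\<in>space ?Pi. 0 < fam_step (Suc d) (out_fam (Suc d) A W) x} \<subseteq>
          {x\<in>space ?Pi. 0 < fam_step (Suc d) W x \<and> x \<notin> PiE {..<Suc d} (\<lambda>_. A)}"
          using fam_step_out_pos by blast
      qed measurable
      then show "emeasure ?Pi {x\<in>space ?Pi. 0 < fam_step (Suc d) (out_fam (Suc d) A W) x} \<le> ennreal \<delta>"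
        using le by (rule order_trans)
    qed
  qed
qed

subsection \<open>Tail of an extremal integral\<close>

text \<open>On the window \<psi> has finitely many dyadic levels, as \<open>fam_val_tail\<close>
  requires, and \<open>m\<close> is bounded by a multiple of \<mu>, so that sets negligible for
  \<mu> remain negligible in integrals against \<open>m\<close>.\<close>

definition psi_window :: "'a measure \<Rightarrow> ('a \<Rightarrow> ennreal) \<Rightarrow> nat \<Rightarrow> 'a set" where
  "psi_window m \<psi> N = {z\<in>space m. ennreal (2 powr (- real N)) \<le> \<psi> z \<and> \<psi> z < ennreal (2 powr real N)}"

lemma psi_window_measurable:
  assumes [measurable]: "\<psi> \<in> borel_measurable m"
  shows "psi_window m \<psi> N \<in> sets m"
  unfolding psi_window_def by measurable

lemma psi_window_exhausts:
  assumes "0 < \<psi> z" "\<psi> z < \<infinity>" "z \<in> space m"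
  shows "\<exists>N0. \<forall>N\<ge>N0. z \<in> psi_window m \<psi> N"
proof -
  obtain r where r: "\<psi> z = ennreal r" "0 \<le> r" using assms(2) by (cases "\<psi> z") auto
  then have r0: "0 < r" using assms(1) by (simp add: ennreal_less_zero_iff)
  obtain N0 :: nat where N0: "\<bar>log 2 r\<bar> < real N0" using reals_Archimedean2 by blast
  have e: "2 powr (log 2 r) = r" using r0 by simp
  have w: "z \<in> psi_window m \<psi> N" if "N0 \<le> N" for N
  proof -
    have b: "- real N \<le> log 2 r" "log 2 r < real N" using N0 that by linarith+
    have "2 powr (- real N) \<le> 2 powr (log 2 r)" using b by (intro powr_mono) auto
    then have 1: "ennreal (2 powr (- real N)) \<le> \<psi> z" unfolding e r(1) by (rule ennreal_leI)
    have "2 powr (log 2 r) < 2 powr (real N)" using b by (intro powr_less_mono) auto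
    then have 2: "\<psi> z < ennreal (2 powr real N)" unfolding e r(1) using r(2) by (intro ennreal_lessI) auto
    show ?thesis unfolding psi_window_def by (intro CollectI conjI assms(3) 1 2)
  qed
  show ?thesis by (intro exI[of _ N0] allI impI w)
qed

definition psi_level :: "('a \<Rightarrow> ennreal) \<Rightarrow> 'a \<Rightarrow> int" where
  "psi_level \<psi> z = \<lfloor>log 2 (enn2real (\<psi> z))\<rfloor>"

lemma psi_level_measurable:
  assumes [measurable]: "\<psi> \<in> borel_measurable m"
  shows "psi_level \<psi> \<in> measurable m (count_space UNIV)"
  unfolding psi_level_def[abs_def] by measurable

lemma psi_level_bounds:
  assumes "z \<in> psi_window m \<psi> N"
  shows "ennreal (2 powr psi_level \<psi> z) \<le> \<psi> z" "\<psi> z \<le> ennreal (2 * 2 powr psi_level \<psi> z)"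
    "- int N \<le> psi_level \<psi> z" "psi_level \<psi> z \<le> int N"
proof -
  have "\<psi> z < top" using assms unfolding psi_window_def by (auto intro: less_trans ennreal_less_top)
  then obtain r where r: "\<psi> z = ennreal r" "0 \<le> r" by (cases "\<psi> z") auto
  have lo: "2 powr (- real N) \<le> r" and hi: "r < 2 powr real N"
    using assms r unfolding psi_window_def by (auto simp: ennreal_less_iff)
  have r0: "0 < r" using lo by (rule less_le_trans[rotated]) simp
  have lv: "psi_level \<psi> z = \<lfloor>log 2 r\<rfloor>" using r by (simp add: psi_level_def)
  have e: "2 powr (log 2 r) = r" using r0 by simp
  have "2 powr psi_level \<psi> z \<le> 2 powr (log 2 r)" unfolding lv by (intro powr_mono) auto
  then show "ennreal (2 powr psi_level \<psi> z) \<le> \<psi> z" unfolding r e by (intro ennreal_leI)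
  have "2 powr (log 2 r) \<le> 2 powr (1 + real_of_int \<lfloor>log 2 r\<rfloor>)" by (intro powr_mono) linarith+
  then show "\<psi> z \<le> ennreal (2 * 2 powr psi_level \<psi> z)" unfolding r e lv by (intro ennreal_leI) (simp add: powr_add)
  have "log 2 (2 powr (- real N)) \<le> log 2 r" using lo r0 by (subst log_le_cancel_iff) auto
  then show "- int N \<le> psi_level \<psi> z" unfolding lv by (simp add: le_floor_iff)
  have "log 2 r < log 2 (2 powr real N)" using hi r0 by (subst log_less_cancel_iff) auto
  then show "psi_level \<psi> z \<le> int N" unfolding lv by (simp add: floor_le_iff)
qed

text \<open>The coefficient of the integral in \<open>fam_val_tail\<close>.\<close>

definition tail_const :: "real \<Rightarrow> nat \<Rightarrow> real \<Rightarrow> real \<Rightarrow> real" where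
  "tail_const \<alpha> d K x = 2 ^ Suc d * 2 powr (\<alpha> * d) * (4 ^ d * x powr (- \<alpha>) * (1 + 2 * ln (max 1 (K ^ Suc d / x))) ^ d)"

locale tilted_sup_measure = sup_measure P \<mu> \<alpha> M
  for P :: "'w measure" and \<mu> :: "'a measure" and \<alpha> M +
  fixes m :: "'a measure" and \<psi> :: "'a \<Rightarrow> ennreal"
  assumes m: "prob_space m" "sets m = sets \<mu>" and psi[measurable]: "\<psi> \<in> borel_measurable m"
    and mu_eq: "\<mu> = density m \<psi>" and psi_fin: "AE x in m. 0 < \<psi> x \<and> \<psi> x < \<infinity>"
begin

sublocale m: prob_space m by (rule m(1))
sublocale m: product_sigma_finite "\<lambda>_::nat. m" by standard

lemma space_m: "space m = space \<mu>" using m(2) by (rule sets_eq_imp_space_eq)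

lemma sets_PiM_m: "sets (PiM {..<k::nat} (\<lambda>_. m)) = sets (power_measure \<mu> k)"
  using m(2) by (intro sets_PiM_cong) auto

lemma space_PiM_m: "space (PiM {..<k::nat} (\<lambda>_. m)) = space (power_measure \<mu> k)"
  by (rule sets_eq_imp_space_eq[OF sets_PiM_m])

lemma PiM_mu_eq: "PiM {..<k::nat} (\<lambda>_. \<mu>) = density (PiM {..<k} (\<lambda>_. m)) (\<lambda>x. \<Prod>i<k. \<psi> (x i))"
  using PiM_density[of "{..<k}" m \<psi>] m.sigma_finite_measure_axioms mu.sigma_finite_measure_axioms psi
  unfolding mu_eq[symmetric] by simp

lemma psi_prod_measurable[measurable]: "(\<lambda>x. \<Prod>i<k. \<psi> (x i)) \<in> borel_measurable (PiM {..<k::nat} (\<lambda>_. m))"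
proof (rule borel_measurable_prod_ennreal)
  fix i assume "i \<in> {..<k}"
  then have [measurable]: "(\<lambda>x. x i) \<in> measurable (PiM {..<k} (\<lambda>_. m)) m" by (rule measurable_component_singleton)
  show "(\<lambda>x. \<psi> (x i)) \<in> borel_measurable (PiM {..<k} (\<lambda>_. m))" by measurable
qed

text \<open>On the window each of the \<open>k\<close> factors of the product density is at least
  \<open>2 powr (- real N)\<close>. This bounds the exceptional sets, which are small for \<mu>,
  under \<open>m\<close>, where the integral of the tail bound is taken.\<close>

lemma emeasure_m_le:
  assumes S: "S \<in> sets (PiM {..<k::nat} (\<lambda>_. \<mu>))" and sub: "S \<subseteq> PiE {..<k} (\<lambda>_. psi_window m \<psi> N)"
  shows "emeasure (PiM {..<k} (\<lambda>_. m)) S \<le> ennreal ((2 powr real N) ^ k) * emeasure (power_measure \<mu> k) S"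
proof -
  have Sm: "S \<in> sets (PiM {..<k} (\<lambda>_. m))" using S unfolding sets_PiM_m .
  let ?c = "(2 powr (- real N)) ^ k"
  have "ennreal ?c * emeasure (PiM {..<k} (\<lambda>_. m)) S = (\<integral>\<^sup>+ x. ennreal ?c * indicator S x \<partial>PiM {..<k} (\<lambda>_. m))"
    using Sm by (simp add: nn_integral_cmult_indicator)
  also have "\<dots> \<le> (\<integral>\<^sup>+ x. (\<Prod>i<k. \<psi> (x i)) * indicator S x \<partial>PiM {..<k} (\<lambda>_. m))"
  proof (rule nn_integral_mono)
    fix x
    show "ennreal ?c * indicator S x \<le> (\<Prod>i<k. \<psi> (x i)) * indicator S x"
    proof (cases "x \<in> S")
      case True
      then have "ennreal (2 powr (- real N)) \<le> \<psi> (x i)" if "i < k" for i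
        using sub that unfolding psi_window_def by (auto simp: PiE_iff)
      then have "(\<Prod>i<k. ennreal (2 powr (- real N))) \<le> (\<Prod>i<k. \<psi> (x i))" by (intro prod_mono_ennreal) auto
      then show ?thesis using True by (simp add: ennreal_power)
    qed simp
  qed
  also have "\<dots> = emeasure (power_measure \<mu> k) S"
    unfolding PiM_mu_eq using Sm by (intro emeasure_density[symmetric]) auto
  finally have "ennreal ((2 powr real N) ^ k) * (ennreal ?c * emeasure (PiM {..<k} (\<lambda>_. m)) S)
      \<le> ennreal ((2 powr real N) ^ k) * emeasure (power_measure \<mu> k) S" by (rule mult_left_mono) simp
  moreover have "ennreal ((2 powr real N) ^ k) * (ennreal ?c * emeasure (PiM {..<k} (\<lambda>_. m)) S) = emeasure (PiM {..<k} (\<lambda>_. m)) S"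
  proof -
    have "(2 powr real N) ^ k * ?c = 1"
      unfolding power_mult_distrib[symmetric] by (simp add: powr_minus)
    then have "ennreal ((2 powr real N) ^ k) * ennreal ?c = 1" by (subst ennreal_mult[symmetric]) auto
    then show ?thesis by (simp add: mult.assoc[symmetric])
  qed
  ultimately show ?thesis by simp
qed

lemma window_dom:
  assumes A: "A \<in> sets \<mu>" and sub: "A \<subseteq> psi_window m \<psi> N \<inter> psi_level \<psi> -` {n}"
  shows "emeasure \<mu> A \<le> ennreal (2 * 2 powr (real_of_int n)) * emeasure m A"
proof -
  have Am: "A \<in> sets m" using A m(2) by simp
  have "emeasure \<mu> A = (\<integral>\<^sup>+ x. \<psi> x * indicator A x \<partial>m)"
    using Am emeasure_density[OF psi Am] mu_eq by simp
  also have "\<dots> \<le> (\<integral>\<^sup>+ x. ennreal (2 * 2 powr (real_of_int n)) * indicator A x \<partial>m)"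
  proof (rule nn_integral_mono)
    fix x
    show "\<psi> x * indicator A x \<le> ennreal (2 * 2 powr (real_of_int n)) * indicator A x"
    proof (cases "x \<in> A")
      case True
      then have "x \<in> psi_window m \<psi> N" "psi_level \<psi> x = n" using sub by auto
      then show ?thesis using psi_level_bounds(2)[of x m \<psi> N] True by simp
    qed simp
  qed
  also have "\<dots> = ennreal (2 * 2 powr (real_of_int n)) * emeasure m A" using Am by (simp add: nn_integral_cmult_indicator)
  finally show ?thesis .
qed

text \<open>Almost every point has \<psi> positive and finite, hence lies in all late windows. A
  point of the power of \<open>F\<close> that fails this has some coordinate in a \<mu>-null set;
  continuity from above, available since \<mu> of \<open>F\<close> is finite, gives the
  claim.\<close>

lemma window_complement_small:
  assumes F: "F \<in> sets \<mu>" "emeasure \<mu> F < \<infinity>" and "0 < \<delta>"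
  shows "\<exists>N. emeasure (PiM {..<k::nat} (\<lambda>_. \<mu>)) (PiE {..<k} (\<lambda>_. F) - PiE {..<k} (\<lambda>_. psi_window m \<psi> N)) \<le> ennreal \<delta>"
proof -
  let ?Pi = "power_measure \<mu> k" and ?Fk = "PiE {..<k} (\<lambda>_. F)"
  let ?W = "\<lambda>N. PiE {..<k} (\<lambda>_. \<Inter>n\<in>{N..}. psi_window m \<psi> n)"
  have Wm: "psi_window m \<psi> n \<in> sets \<mu>" for n using psi_window_measurable[OF psi] m(2) by blast
  have WI: "(\<Inter>n\<in>{N..}. psi_window m \<psi> n) \<in> sets \<mu>" for N using Wm by (intro sets.countable_INT) auto
  have Fk: "?Fk \<in> sets ?Pi" using F by (intro sets_PiM_I_finite) auto
  have Wk: "?W N \<in> sets ?Pi" for N using WI by (intro sets_PiM_I_finite) auto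
  have Ffin: "emeasure ?Pi ?Fk < \<infinity>"
    using F by (subst mu.emeasure_PiM) (simp_all add: power_less_top_ennreal)
  define Nl where "Nl = {z\<in>space \<mu>. \<not> (0 < \<psi> z \<and> \<psi> z < \<infinity>)}"
  have Nl: "Nl \<in> null_sets \<mu>"
  proof -
    have "{z\<in>space m. \<not> (0 < \<psi> z \<and> \<psi> z < \<infinity>)} \<in> sets m" by measurable
    then have "{z\<in>space m. \<not> (0 < \<psi> z \<and> \<psi> z < \<infinity>)} \<in> null_sets m"
      using psi_fin by (subst (asm) AE_iff_null) auto
    moreover have "absolutely_continuous m \<mu>" unfolding mu_eq by (rule absolutely_continuousI_density) measurable
    ultimately show ?thesis unfolding absolutely_continuous_def Nl_def space_m by (rule subsetD[rotated])
  qed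
  have FN: "F \<inter> Nl \<in> sets \<mu>" by (rule sets.Int[OF F(1) null_setsD2[OF Nl]])
  have Xm: "PiE {..<k} ((\<lambda>_. F)(r := F \<inter> Nl)) \<in> sets ?Pi" for r
  proof (rule sets_PiM_I_finite)
    show "((\<lambda>_. F)(r := F \<inter> Nl)) i \<in> sets \<mu>" if "i \<in> {..<k}" for i using F(1) FN by simp
  qed simp
  have "decseq (\<lambda>N. ?Fk - ?W N)"
  proof (rule decseq_SucI)
    fix N
    have "\<Inter> (psi_window m \<psi> ` {N..}) \<subseteq> \<Inter> (psi_window m \<psi> ` {Suc N..})" by (rule INF_superset_mono) auto
    then have "?W N \<subseteq> ?W (Suc N)" by (intro PiE_mono) simp
    then show "?Fk - ?W (Suc N) \<subseteq> ?Fk - ?W N" by blast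
  qed
  moreover have "emeasure ?Pi (?Fk - ?W N) \<noteq> \<infinity>" for N
    using le_less_trans[OF emeasure_mono[OF Diff_subset Fk, of "?W N"] Ffin] by (rule less_imp_neq)
  ultimately have lim: "(\<lambda>N. emeasure ?Pi (?Fk - ?W N)) \<longlonglongrightarrow> emeasure ?Pi (\<Inter>N. ?Fk - ?W N)"
    using Fk Wk by (intro Lim_emeasure_decseq) auto
  have c1: "emeasure ?Pi (\<Inter>N. ?Fk - ?W N) \<le> emeasure ?Pi (\<Union>r\<in>{..<k}. PiE {..<k} ((\<lambda>_. F)(r := F \<inter> Nl)))"
  proof (rule emeasure_mono)
    show "(\<Inter>N. ?Fk - ?W N) \<subseteq> (\<Union>r\<in>{..<k}. PiE {..<k} ((\<lambda>_. F)(r := F \<inter> Nl)))"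
    proof
      fix x assume x: "x \<in> (\<Inter>N. ?Fk - ?W N)"
      then have xF: "x \<in> ?Fk" by blast
      show "x \<in> (\<Union>r\<in>{..<k}. PiE {..<k} ((\<lambda>_. F)(r := F \<inter> Nl)))"
      proof (rule ccontr)
        assume no: "x \<notin> (\<Union>r\<in>{..<k}. PiE {..<k} ((\<lambda>_. F)(r := F \<inter> Nl)))"
        have good: "x r \<notin> Nl" if r: "r < k" for r
        proof
          assume "x r \<in> Nl"
          then have "x \<in> PiE {..<k} ((\<lambda>_. F)(r := F \<inter> Nl))" using xF by (simp add: PiE_iff)
          then show False using no r by blast
        qed
        have "\<exists>N0. \<forall>N\<ge>N0. x r \<in> psi_window m \<psi> N" if r: "r < k" for r
        proof -
          have "x r \<in> space \<mu>" using xF r F(1) sets.sets_into_space by (auto simp: PiE_iff)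
          then have "0 < \<psi> (x r)" "\<psi> (x r) < \<infinity>" "x r \<in> space m" using good[OF r]
            by (auto simp: space_m Nl_def zero_less_iff_neq_zero)
          then show ?thesis by (rule psi_window_exhausts)
        qed
        then have "\<forall>r\<in>{..<k}. \<exists>N0. \<forall>N\<ge>N0. x r \<in> psi_window m \<psi> N" by simp
        then obtain N0 where N0: "\<forall>r\<in>{..<k}. \<forall>N\<ge>N0 r. x r \<in> psi_window m \<psi> N" by (rule bchoice[THEN exE])
        define N where "N = Max (insert 0 (N0 ` {..<k}))"
        have NN: "N0 r \<le> N" if "r < k" for r using that by (simp add: N_def)
        have xW: "x r \<in> (\<Inter>n\<in>{N..}. psi_window m \<psi> n)" if r: "r < k" for r
        proof (rule INT_I)
          fix n assume "n \<in> {N..}"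
          then have "N0 r \<le> n" using NN[OF r] by simp
          then show "x r \<in> psi_window m \<psi> n" using N0 r by blast
        qed
        have "x \<in> extensional {..<k}" using xF by (simp add: PiE_iff)
        then have "x \<in> ?W N" using xW by (simp add: PiE_iff del: INT_iff)
        then show False using x by blast
      qed
    qed
    show "(\<Union>r\<in>{..<k}. PiE {..<k} ((\<lambda>_. F)(r := F \<inter> Nl))) \<in> sets ?Pi"
      by (intro sets.finite_UN Xm) simp
  qed
  have c2: "emeasure ?Pi (\<Union>r\<in>{..<k}. PiE {..<k} ((\<lambda>_. F)(r := F \<inter> Nl))) \<le> (\<Sum>r\<in>{..<k}. emeasure ?Pi (PiE {..<k} ((\<lambda>_. F)(r := F \<inter> Nl))))"
  proof (rule emeasure_subadditive_finite)
    show "(\<lambda>r. PiE {..<k} ((\<lambda>_. F)(r := F \<inter> Nl))) ` {..<k} \<subseteq> sets ?Pi"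
      using Xm by blast
  qed simp
  have c3: "(\<Sum>r\<in>{..<k}. emeasure ?Pi (PiE {..<k} ((\<lambda>_. F)(r := F \<inter> Nl)))) = 0"
  proof (rule sum.neutral, rule ballI)
    fix r assume r: "r \<in> {..<k}"
    have "F \<inter> Nl \<in> null_sets \<mu>" using null_set_Int1[OF Nl F(1)] by (simp only: Int_commute)
    then have z: "emeasure \<mu> (F \<inter> Nl) = 0" by (rule null_setsD1)
    have "emeasure ?Pi (PiE {..<k} ((\<lambda>_. F)(r := F \<inter> Nl))) = (\<Prod>i<k. emeasure \<mu> (((\<lambda>_. F)(r := F \<inter> Nl)) i))"
      by (rule mu.emeasure_PiM) (simp_all add: F(1) FN)
    moreover have "(\<Prod>i<k. emeasure \<mu> (((\<lambda>_. F)(r := F \<inter> Nl)) i)) = 0"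
      by (rule prod_zero, simp, rule bexI[of _ r]) (use r z in simp_all)
    ultimately show "emeasure ?Pi (PiE {..<k} ((\<lambda>_. F)(r := F \<inter> Nl))) = 0" by simp
  qed
  have "emeasure ?Pi (\<Inter>N. ?Fk - ?W N) = 0" using order_trans[OF c1 c2] unfolding c3 by simp
  with lim have "(\<lambda>N. emeasure ?Pi (?Fk - ?W N)) \<longlonglongrightarrow> 0" by simp
  then have "\<forall>\<^sub>F N in sequentially. emeasure ?Pi (?Fk - ?W N) < ennreal \<delta>"
    by (rule order_tendstoD) (use assms in simp)
  then obtain N where N: "emeasure ?Pi (?Fk - ?W N) < ennreal \<delta>" by (auto simp: eventually_sequentially)
  have "emeasure ?Pi (?Fk - PiE {..<k} (\<lambda>_. psi_window m \<psi> N)) \<le> emeasure ?Pi (?Fk - ?W N)"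
  proof (rule emeasure_mono)
    have "?W N \<subseteq> PiE {..<k} (\<lambda>_. psi_window m \<psi> N)" by (rule PiE_mono) auto
    then show "?Fk - PiE {..<k} (\<lambda>_. psi_window m \<psi> N) \<subseteq> ?Fk - ?W N" by blast
    show "?Fk - ?W N \<in> sets ?Pi" using Fk Wk by auto
  qed
  then show ?thesis using N by (meson less_imp_le order_trans)
qed

definition tilted_norm :: "nat \<Rightarrow> ((nat \<Rightarrow> 'a) \<Rightarrow> ennreal) \<Rightarrow> ennreal" where
  "tilted_norm d f = (\<integral>\<^sup>+ z. phi \<alpha> d (f z * enn_powr (\<Prod>i<Suc d. \<psi> (z i)) (1 / \<alpha>)) \<partial>PiM {..<Suc d} (\<lambda>_. m))"

text \<open>Levels round \<psi> down, so the level weight stays below the tilting factor of the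
  integrability assumption. The crude second bound serves on the exceptional sets, where any finite
  constant will do.\<close>

lemma level_weight_le:
  assumes z: "\<And>r. r < k \<Longrightarrow> z r \<in> psi_window m \<psi> N"
  shows "ennreal (\<Prod>r<k. 2 powr (real_of_int (psi_level \<psi> (z r)) / \<alpha>)) \<le> enn_powr (\<Prod>r<k. \<psi> (z r)) (1 / \<alpha>)"
    "(\<Prod>r<k. 2 powr (real_of_int (psi_level \<psi> (z r)) / \<alpha>)) \<le> (2 powr (real N / \<alpha>)) ^ k"
proof -
  let ?L = "\<lambda>r. real_of_int (psi_level \<psi> (z r))"
  have "(\<Prod>r<k. ennreal (2 powr ?L r)) \<le> (\<Prod>r<k. \<psi> (z r))"
    using psi_level_bounds(1)[OF z] by (intro prod_mono_ennreal) auto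
  then have "ennreal (\<Prod>r<k. 2 powr ?L r) \<le> (\<Prod>r<k. \<psi> (z r))" by (subst (asm) prod_ennreal) auto
  then have 1: "enn_powr (ennreal (\<Prod>r<k. 2 powr ?L r)) (1 / \<alpha>) \<le> enn_powr (\<Prod>r<k. \<psi> (z r)) (1 / \<alpha>)"
    using alpha_pos by (intro enn_powr_mono) auto
  have "(\<Prod>r<k. 2 powr ?L r) powr (1 / \<alpha>) = (\<Prod>r<k. (2 powr ?L r) powr (1 / \<alpha>))"
    by (rule prod_powr_distrib)
  also have "\<dots> = (\<Prod>r<k. 2 powr (?L r / \<alpha>))" by (intro prod.cong refl) (simp add: powr_powr)
  finally have 2: "(\<Prod>r<k. 2 powr ?L r) powr (1 / \<alpha>) = (\<Prod>r<k. 2 powr (?L r / \<alpha>))" .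
  have "0 \<le> (\<Prod>r<k. 2 powr ?L r)" by (intro prod_nonneg) auto
  then show "ennreal (\<Prod>r<k. 2 powr (?L r / \<alpha>)) \<le> enn_powr (\<Prod>r<k. \<psi> (z r)) (1 / \<alpha>)"
    using 1 by (simp add: enn_powr_def 2)
  have "(\<Prod>r<k. 2 powr (?L r / \<alpha>)) \<le> (\<Prod>r<k. 2 powr (real N / \<alpha>))"
  proof (intro prod_mono conjI)
    fix r assume "r \<in> {..<k}"
    then have "?L r \<le> real N" using psi_level_bounds(4)[OF z[of r]] by simp
    then show "2 powr (?L r / \<alpha>) \<le> 2 powr (real N / \<alpha>)"
      using alpha_pos by (intro powr_mono divide_right_mono) auto
  qed simp
  then show "(\<Prod>r<k. 2 powr (?L r / \<alpha>)) \<le> (2 powr (real N / \<alpha>)) ^ k" by simp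
qed

text \<open>The families are split along the power of a window. The outer part is small by
  \<open>out_fam_small\<close>. On the inner part \<open>fam_val_tail\<close> applies, and its step
  function is below \<open>f\<close> except on \<open>S l\<close>, whose contribution is at most a
  constant times a vanishing measure. The window is chosen before \<open>l\<close> tends to
  infinity, and \<eta> is removed last.\<close>

lemma elem_tail:
  assumes el: "elem_approx (Suc d) s Z"
    and f[measurable]: "f \<in> borel_measurable (power_measure \<mu> (Suc d))"
    and sf: "AE x in power_measure \<mu> (Suc d). s x \<le> f x"
    and pos: "0 < K" "0 < x"
  shows "emeasure P {\<omega>\<in>space P. ennreal (2 * x) < Z \<omega>} \<le>
    ennreal (2 * K powr (- \<alpha>)) + ennreal (tail_const \<alpha> d K x) * tilted_norm d f"
proof (rule ennreal_le_epsilon)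
  fix \<eta> :: real assume eta: "0 < \<eta>"
  let ?k = "Suc d"
  let ?Pi = "power_measure \<mu> ?k" and ?Pm = "PiM {..<?k} (\<lambda>_. m)"
  obtain F b W where s[measurable]: "s \<in> borel_measurable ?Pi" and Z[measurable]: "Z \<in> borel_measurable P"
    and F: "F \<in> sets \<mu>" "emeasure \<mu> F < \<infinity>" and b: "0 < b"
    and W0: "\<forall>l::nat. rect_family \<mu> ?k F (W l) \<and> (\<forall>w\<in>W l. fst w \<le> b)"
    and lim1: "(\<lambda>l. emeasure ?Pi {x\<in>space ?Pi. fam_step ?k (W l) x \<noteq> s x}) \<longlonglongrightarrow> 0"
    and lim2: "\<forall>e>0. (\<lambda>l. emeasure P {\<omega>\<in>space P. \<not> close e (fam_val M ?k (W l) \<omega>) (Z \<omega>)}) \<longlonglongrightarrow> 0"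
    using el unfolding elem_approx_def by (elim conjE exE)
  have W: "rect_family \<mu> ?k F (W l)" "\<forall>w\<in>W l. fst w \<le> b" for l using W0 by blast+
  obtain \<delta> where \<delta>: "0 < \<delta>" and sm: "\<forall>V A. rect_family \<mu> ?k F V \<longrightarrow> (\<forall>w\<in>V. fst w \<le> b) \<longrightarrow> A \<in> sets \<mu> \<longrightarrow>
    emeasure ?Pi {x\<in>space ?Pi. 0 < fam_step ?k V x \<and> x \<notin> PiE {..<?k} (\<lambda>_. A)} \<le> ennreal \<delta> \<longrightarrow>
    emeasure P {\<omega>\<in>space P. ennreal x < fam_val M ?k (out_fam ?k A V) \<omega>} \<le> ennreal \<eta>"
    using out_fam_small[OF F pos(2) eta b, of d] by (elim exE conjE)
  obtain N where N: "emeasure ?Pi (PiE {..<?k} (\<lambda>_. F) - PiE {..<?k} (\<lambda>_. psi_window m \<psi> N)) \<le> ennreal \<delta>"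
    using window_complement_small[OF F \<delta>, of ?k] by (elim exE)
  define E where "E = psi_window m \<psi> N"
  have Em: "E \<in> sets \<mu>" using psi_window_measurable[OF psi] m(2) unfolding E_def by blast
  have Ek: "PiE {..<?k} (\<lambda>_. E) \<in> sets ?Pi" using Em by (intro sets_PiM_I_finite) auto
  have Fk: "PiE {..<?k} (\<lambda>_. F) \<in> sets ?Pi" using F by (intro sets_PiM_I_finite) auto
  have out: "emeasure P {\<omega>\<in>space P. ennreal x < fam_val M ?k (out_fam ?k E (W l)) \<omega>} \<le> ennreal \<eta>" for l
  proof -
    have "emeasure ?Pi {x\<in>space ?Pi. 0 < fam_step ?k (W l) x \<and> x \<notin> PiE {..<?k} (\<lambda>_. E)} \<le>
        emeasure ?Pi (PiE {..<?k} (\<lambda>_. F) - PiE {..<?k} (\<lambda>_. E))"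
    proof (rule emeasure_mono)
      show "{x\<in>space ?Pi. 0 < fam_step ?k (W l) x \<and> x \<notin> PiE {..<?k} (\<lambda>_. E)} \<subseteq> PiE {..<?k} (\<lambda>_. F) - PiE {..<?k} (\<lambda>_. E)"
        using fam_step_pos_subset[OF W(1)] by blast
      show "PiE {..<?k} (\<lambda>_. F) - PiE {..<?k} (\<lambda>_. E) \<in> sets ?Pi" using Fk Ek by (rule sets.Diff)
    qed
    then have "emeasure ?Pi {x\<in>space ?Pi. 0 < fam_step ?k (W l) x \<and> x \<notin> PiE {..<?k} (\<lambda>_. E)} \<le> ennreal \<delta>"
      using N unfolding E_def by (rule order_trans)
    then show ?thesis using sm W[of l] Em by blast
  qed
  \<comment> \<open>The two ways in which the step function can fail to stay below \<open>f\<close>: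
    it differs from \<open>s\<close>, which happens on a set of vanishing measure, or
    \<open>s\<close> itself exceeds \<open>f\<close>, which happens on a null set.\<close>
  define S where "S l = {x\<in>space ?Pi. fam_step ?k (W l) x \<noteq> s x} \<union> {x\<in>space ?Pi. \<not> s x \<le> f x}" for l
  have stm[measurable]: "fam_step ?k (W l) \<in> borel_measurable ?Pi" for l by (rule fam_step_measurable[OF W(1)])
  have S1: "{x\<in>space ?Pi. fam_step ?k (W l) x \<noteq> s x} \<in> sets ?Pi" for l by (rule borel_measurable_neq[OF stm s])
  have S2: "{x\<in>space ?Pi. \<not> s x \<le> f x} \<in> sets ?Pi" using borel_measurable_less[OF f s] by (simp add: not_le)
  have Sm: "S l \<in> sets ?Pi" for l unfolding S_def using S1 S2 by (rule sets.Un)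
  have S0: "emeasure ?Pi (S l) = emeasure ?Pi {x\<in>space ?Pi. fam_step ?k (W l) x \<noteq> s x}" for l
  proof -
    have "{x\<in>space ?Pi. \<not> s x \<le> f x} \<in> null_sets ?Pi"
      using sf S2 by (subst (asm) AE_iff_null) auto
    then show ?thesis unfolding S_def by (rule emeasure_Un_null_set[OF S1])
  qed
  \<comment> \<open>On the window \<open>cc\<close> bounds the step function times the level weight.
    The resulting constant \<open>cn\<close> depends on \<open>N\<close> but not on
    \<open>l\<close>, and it is finite, so its product with the vanishing measure of
    \<open>S l\<close> tends to 0.\<close>
  define cc where "cc = b * (2 powr (real N / \<alpha>)) ^ ?k"
  have cc0: "0 \<le> cc" unfolding cc_def using b by simp
  define cn where "cn = ennreal (cc powr \<alpha> * (1 + ln (max 1 cc) ^ d)) * ennreal ((2 powr real N) ^ ?k)"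
  have cn_fin: "cn < top" unfolding cn_def by (simp add: ennreal_mult_less_top)
  define I where "I l = (\<integral>\<^sup>+ z. phi \<alpha> d (fam_step ?k (cap_fam E (W l)) z * ennreal (\<Prod>r<?k. 2 powr (real_of_int (psi_level \<psi> (z r)) / \<alpha>))) \<partial>?Pm)" for l
  have SEm: "S l \<inter> PiE {..<?k} (\<lambda>_. E) \<in> sets ?Pm" for l
    unfolding sets_PiM_m using Sm Ek by (rule sets.Int)
  have Ile: "I l \<le> tilted_norm d f + cn * emeasure ?Pi (S l)" for l
  proof -
    have fm: "f \<in> borel_measurable ?Pm"
      using f by (simp only: measurable_cong_sets[OF sets_PiM_m[symmetric] refl])
    have gm: "(\<lambda>z. phi \<alpha> d (f z * enn_powr (\<Prod>i<?k. \<psi> (z i)) (1 / \<alpha>))) \<in> borel_measurable ?Pm"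
      using fm psi_prod_measurable[of ?k] by measurable
    have "I l \<le> (\<integral>\<^sup>+ z. phi \<alpha> d (f z * enn_powr (\<Prod>i<?k. \<psi> (z i)) (1 / \<alpha>)) +
        phi \<alpha> d (ennreal cc) * indicator (S l \<inter> PiE {..<?k} (\<lambda>_. E)) z \<partial>?Pm)"
      unfolding I_def
    proof (rule nn_integral_mono)
      fix z assume "z \<in> space ?Pm"
      then have zs: "z \<in> space ?Pi" unfolding space_PiM_m .
      let ?w = "\<Prod>r<?k. 2 powr (real_of_int (psi_level \<psi> (z r)) / \<alpha>)"
      show "phi \<alpha> d (fam_step ?k (cap_fam E (W l)) z * ennreal ?w) \<le>
         phi \<alpha> d (f z * enn_powr (\<Prod>i<?k. \<psi> (z i)) (1 / \<alpha>)) + phi \<alpha> d (ennreal cc) * indicator (S l \<inter> PiE {..<?k} (\<lambda>_. E)) z"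
      proof (cases "z \<in> PiE {..<?k} (\<lambda>_. E)")
        case False
        then have "fam_step ?k (cap_fam E (W l)) z = 0" by (simp add: fam_step_cap)
        then have "phi \<alpha> d (fam_step ?k (cap_fam E (W l)) z * ennreal ?w) = 0"
          using alpha_pos by (simp add: phi_def enn_powr_def)
        then show ?thesis by simp
      next
        case True
        then have cap: "fam_step ?k (cap_fam E (W l)) z = fam_step ?k (W l) z" by (simp add: fam_step_cap)
        have zE: "z r \<in> psi_window m \<psi> N" if "r < ?k" for r using True that by (simp add: PiE_iff E_def)
        note lw = level_weight_le[of ?k z N, OF zE]
        show ?thesis
        proof (cases "z \<in> S l")
          case True
          have "fam_step ?k (W l) z * ennreal ?w \<le> ennreal b * ennreal ((2 powr (real N / \<alpha>)) ^ ?k)"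
            by (intro mult_mono ennreal_leI fam_step_le[OF W(2)] lw(2)) auto
          also have "\<dots> = ennreal cc" unfolding cc_def using b by (intro ennreal_mult[symmetric]) auto
          finally have "phi \<alpha> d (fam_step ?k (cap_fam E (W l)) z * ennreal ?w) \<le> phi \<alpha> d (ennreal cc)"
            unfolding cap using alpha_pos by (intro phi_mono) auto
          also have "\<dots> \<le> phi \<alpha> d (f z * enn_powr (\<Prod>i<?k. \<psi> (z i)) (1 / \<alpha>)) + phi \<alpha> d (ennreal cc) * indicator (S l \<inter> PiE {..<?k} (\<lambda>_. E)) z"
            using True \<open>z \<in> PiE {..<?k} (\<lambda>_. E)\<close> by (simp add: add_increasing)
          finally show ?thesis .
        next
          case False
          then have "fam_step ?k (W l) z \<le> f z" using zs unfolding S_def by simp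
          then have "fam_step ?k (cap_fam E (W l)) z * ennreal ?w \<le> f z * enn_powr (\<Prod>i<?k. \<psi> (z i)) (1 / \<alpha>)"
            unfolding cap by (intro mult_mono lw(1)) auto
          then have "phi \<alpha> d (fam_step ?k (cap_fam E (W l)) z * ennreal ?w) \<le> phi \<alpha> d (f z * enn_powr (\<Prod>i<?k. \<psi> (z i)) (1 / \<alpha>))"
            using alpha_pos by (intro phi_mono) auto
          then show ?thesis by (simp add: add_increasing2)
        qed
      qed
    qed
    also have "\<dots> = tilted_norm d f + phi \<alpha> d (ennreal cc) * emeasure ?Pm (S l \<inter> PiE {..<?k} (\<lambda>_. E))"
      unfolding tilted_norm_def using gm SEm by (subst nn_integral_add) (auto simp: nn_integral_cmult_indicator)
    finally have 1: "I l \<le> tilted_norm d f + phi \<alpha> d (ennreal cc) * emeasure ?Pm (S l \<inter> PiE {..<?k} (\<lambda>_. E))" .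
    have "emeasure ?Pm (S l \<inter> PiE {..<?k} (\<lambda>_. E)) \<le> ennreal ((2 powr real N) ^ ?k) * emeasure ?Pi (S l \<inter> PiE {..<?k} (\<lambda>_. E))"
      by (rule emeasure_m_le) (use Sm Ek in \<open>auto simp: E_def intro: sets.Int\<close>)
    then have "emeasure ?Pm (S l \<inter> PiE {..<?k} (\<lambda>_. E)) \<le> ennreal ((2 powr real N) ^ ?k) * emeasure ?Pi (S l)"
      by (rule order_trans[OF _ mult_left_mono[OF emeasure_mono[OF Int_lower1 Sm] zero_le]])
    then have "phi \<alpha> d (ennreal cc) * emeasure ?Pm (S l \<inter> PiE {..<?k} (\<lambda>_. E)) \<le> phi \<alpha> d (ennreal cc) * (ennreal ((2 powr real N) ^ ?k) * emeasure ?Pi (S l))"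
      by (rule mult_left_mono) simp
    then have "phi \<alpha> d (ennreal cc) * emeasure ?Pm (S l \<inter> PiE {..<?k} (\<lambda>_. E)) \<le> cn * emeasure ?Pi (S l)"
      unfolding cn_def phi_ennreal[OF cc0] by (simp only: mult.assoc)
    then show ?thesis by (rule order_trans[OF 1 add_left_mono])
  qed
  have mE: "measure m (F \<inter> E) \<le> 1" by (rule m.prob_le_1)
  have capt: "emeasure P {\<omega>\<in>space P. ennreal x < fam_val M ?k (cap_fam E (W l)) \<omega>} \<le>
      ennreal (2 * K powr (- \<alpha>)) + ennreal (tail_const \<alpha> d K x) * I l" for l
  proof -
    have FE: "F \<inter> E \<in> sets \<mu>" using F(1) Em by (rule sets.Int)
    have "psi_level \<psi> ` (F \<inter> E) \<subseteq> {- int N..int N}"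
      using psi_level_bounds(3,4)[of _ m \<psi> N] unfolding E_def by auto
    then have fin: "finite (psi_level \<psi> ` (F \<inter> E))" by (rule finite_subset) simp
    have lm: "psi_level \<psi> \<in> measurable \<mu> (count_space UNIV)"
      using psi_level_measurable[OF psi] by (simp only: measurable_cong_sets[OF m(2) refl])
    have mf: "emeasure m (F \<inter> E) < \<infinity>" by (simp add: m.emeasure_eq_measure)
    have "emeasure P {\<omega>\<in>space P. ennreal x < fam_val M ?k (cap_fam E (W l)) \<omega>} \<le>
      ennreal (2 * measure m (F \<inter> E) * K powr (- \<alpha>)) + ennreal (tail_const \<alpha> d K x) * I l"
      unfolding tail_const_def I_def
    proof (rule fam_val_tail[OF rect_family_cap[OF W(1) Em] FE m.sigma_finite_measure_axioms m(2) mf lm fin _ pos])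
      show "emeasure \<mu> A \<le> ennreal (2 * 2 powr (real_of_int n)) * emeasure m A"
        if "A \<in> sets \<mu>" "A \<subseteq> F \<inter> E \<inter> psi_level \<psi> -` {n}" for n A
        by (rule window_dom[OF that(1)]) (use that(2) in \<open>auto simp: E_def\<close>)
    qed
    moreover have "ennreal (2 * measure m (F \<inter> E) * K powr (- \<alpha>)) \<le> ennreal (2 * K powr (- \<alpha>))"
      using mE by (intro ennreal_leI mult_right_mono) auto
    ultimately show ?thesis by (rule order_trans[OF _ add_right_mono])
  qed
  let ?T = "ennreal (tail_const \<alpha> d K x)"
  let ?B = "\<lambda>l. emeasure P {\<omega>\<in>space P. \<not> close x (fam_val M ?k (W l) \<omega>) (Z \<omega>)} +
      (ennreal (2 * K powr (- \<alpha>)) + ?T * (tilted_norm d f + cn * emeasure ?Pi (S l)) + ennreal \<eta>)"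
  have bound: "emeasure P {\<omega>\<in>space P. ennreal (2 * x) < Z \<omega>} \<le> ?B l" for l
  proof -
    have vm[measurable]: "fam_val M ?k V \<in> borel_measurable P" if "rect_family \<mu> ?k G V" for G V
      by (rule fam_val_measurable[OF _ that]) simp
    note m1[measurable] = vm[OF W(1)[of l]] vm[OF rect_family_cap[OF W(1)[of l] Em]] vm[OF rect_family_out[OF W(1)[of l] Em]]
    let ?X = "{\<omega>\<in>space P. \<not> close x (fam_val M ?k (W l) \<omega>) (Z \<omega>)}"
    let ?Y = "{\<omega>\<in>space P. ennreal x < fam_val M ?k (cap_fam E (W l)) \<omega>}"
    let ?V = "{\<omega>\<in>space P. ennreal x < fam_val M ?k (out_fam ?k E (W l)) \<omega>}"
    have ms: "?X \<in> sets P" "?Y \<in> sets P" "?V \<in> sets P" by measurable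
    \<comment> \<open>Origin of the level \<open>2 * x\<close>: one \<open>x\<close> is granted to
      the distance between \<open>Z\<close> and the family value, the other to the family value
      itself.\<close>
    have "AE \<omega> in P. \<omega> \<in> {\<omega>\<in>space P. ennreal (2 * x) < Z \<omega>} \<longrightarrow> \<omega> \<in> ?X \<union> (?Y \<union> ?V)"
      using fam_val_split[OF W(1)[of l] Em]
    proof eventually_elim
      case (elim \<omega>)
      show ?case
      proof (intro impI, rule ccontr)
        assume o: "\<omega> \<in> {\<omega>\<in>space P. ennreal (2 * x) < Z \<omega>}" and no: "\<omega> \<notin> ?X \<union> (?Y \<union> ?V)"
        then have c: "close x (fam_val M ?k (W l) \<omega>) (Z \<omega>)" and
          v: "fam_val M ?k (cap_fam E (W l)) \<omega> \<le> ennreal x" "fam_val M ?k (out_fam ?k E (W l)) \<omega> \<le> ennreal x"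
          by (auto simp: not_less)
        have "fam_val M ?k (W l) \<omega> \<le> ennreal x" by (rule order_trans[OF conjunct1[OF elim] max.boundedI[OF v]])
        then have "fam_val M ?k (W l) \<omega> + ennreal x \<le> ennreal x + ennreal x" by (rule add_right_mono)
        moreover have "Z \<omega> \<le> fam_val M ?k (W l) \<omega> + ennreal x" using c by (simp add: close_def)
        ultimately have "Z \<omega> \<le> ennreal x + ennreal x" by (rule order_trans[rotated])
        also have "\<dots> = ennreal (2 * x)" using pos by (simp add: ennreal_plus[symmetric] del: ennreal_plus)
        finally have zz: "Z \<omega> \<le> ennreal (2 * x)" .
        show False using o leD[OF zz] by blast
      qed
    qed
    then have e1: "emeasure P {\<omega>\<in>space P. ennreal (2 * x) < Z \<omega>} \<le> emeasure P (?X \<union> (?Y \<union> ?V))"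
      by (rule emeasure_mono_AE) (intro sets.Un ms)
    have e2: "emeasure P (?X \<union> (?Y \<union> ?V)) \<le> emeasure P ?X + emeasure P (?Y \<union> ?V)"
      by (rule emeasure_subadditive[OF ms(1) sets.Un[OF ms(2,3)]])
    have e3: "emeasure P (?Y \<union> ?V) \<le> emeasure P ?Y + emeasure P ?V"
      by (rule emeasure_subadditive[OF ms(2,3)])
    have e4: "emeasure P ?Y \<le> ennreal (2 * K powr (- \<alpha>)) + ?T * (tilted_norm d f + cn * emeasure ?Pi (S l))"
      by (rule order_trans[OF capt add_left_mono[OF mult_left_mono[OF Ile zero_le]]])
    show ?thesis
      by (rule order_trans[OF e1 order_trans[OF e2 add_left_mono[OF order_trans[OF e3 add_mono[OF e4 out]]]]])
  qed
  have "?B \<longlonglongrightarrow> 0 + (ennreal (2 * K powr (- \<alpha>)) + ?T * (tilted_norm d f + cn * 0) + ennreal \<eta>)"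
  proof (intro tendsto_add tendsto_const)
    show "(\<lambda>l. emeasure P {\<omega>\<in>space P. \<not> close x (fam_val M ?k (W l) \<omega>) (Z \<omega>)}) \<longlonglongrightarrow> 0" using lim2 pos by blast
    show "(\<lambda>l. ?T * (tilted_norm d f + cn * emeasure ?Pi (S l))) \<longlonglongrightarrow> ?T * (tilted_norm d f + cn * 0)"
      unfolding S0 using cn_fin lim1 by (intro ennreal_tendsto_cmult tendsto_add tendsto_const) auto
  qed
  then have "emeasure P {\<omega>\<in>space P. ennreal (2 * x) < Z \<omega>} \<le> 0 + (ennreal (2 * K powr (- \<alpha>)) + ?T * (tilted_norm d f + cn * 0) + ennreal \<eta>)"
    by (rule LIMSEQ_le_const) (use bound in blast)
  then show "emeasure P {\<omega>\<in>space P. ennreal (2 * x) < Z \<omega>} \<le> ennreal (2 * K powr (- \<alpha>)) + ?T * tilted_norm d f + ennreal \<eta>" by simp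
qed

end

section \<open>From the integrability class to the tail of the integral\<close>

lemma enn_abs_ln_measurable[measurable]: "enn_abs_ln \<in> borel_measurable borel"
  unfolding enn_abs_ln_def[abs_def] by measurable

text \<open>Only \<open>Suc d = 2\<close> needs an argument, because there the class weight carries
  an additional iterated logarithm. If \<open>ln h\<close> exceeds \<open>exp 1\<close>, that factor
  is at least 1; otherwise the positive part of \<open>ln h\<close> is at most 3 and the left-hand
  factor at most 4. An infinite \<open>h\<close> is covered by the conventions at infinity.\<close>

lemma phi_le_class_weight:
  "phi \<alpha> d h \<le> 4 * (enn_powr h \<alpha> *
        (if Suc d = 1 then 1
         else if Suc d = 2 then 1 + enn_ln_plus h * enn_ln_plus (enn_abs_ln h)
         else 1 + enn_ln_plus h ^ (Suc d - 1)))"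
proof -
  let ?w = "if Suc d = 1 then 1 else if Suc d = 2 then 1 + enn_ln_plus h * enn_ln_plus (enn_abs_ln h)
         else 1 + enn_ln_plus h ^ (Suc d - 1)"
  have four: "x \<le> 4 * x" for x :: ennreal
  proof -
    have "1 * x \<le> 4 * x" by (rule mult_right_mono) simp_all
    then show ?thesis by simp
  qed
  have "1 + enn_ln_plus h ^ d \<le> 4 * ?w"
  proof (cases "d = 0")
    case True
    then show ?thesis by simp
  next
    case False
    show ?thesis
    proof (cases "d = 1")
      case True
      have "1 + enn_ln_plus h \<le> 4 * (1 + enn_ln_plus h * enn_ln_plus (enn_abs_ln h))"
      proof (cases h)
        case (real r)
        show ?thesis
        proof (cases "ln (max r 1) \<le> exp 1")
          case True
          have "exp 1 \<le> (3::real)" using e_less_272 by simp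
          then have "ln (max r 1) \<le> 3" using True by simp
          then have "ennreal (ln (max r 1)) \<le> ennreal 3" by (rule ennreal_leI)
          moreover have "enn_ln_plus h = ennreal (ln (max r 1))" using real by (simp add: enn_ln_plus_def)
          ultimately have "enn_ln_plus h \<le> ennreal 3" by (simp only:)
          then have "1 + enn_ln_plus h \<le> 1 + ennreal 3" by (rule add_left_mono)
          also have "\<dots> = 4 * 1" by simp
          also have "\<dots> \<le> 4 * (1 + enn_ln_plus h * enn_ln_plus (enn_abs_ln h))" by (rule mult_left_mono) auto
          finally show ?thesis .
        next
          case False
          then have r1: "1 < r" by (cases "r \<le> 1") (auto simp: max_def)
          then have lr: "exp 1 < ln r" using False by (simp add: max_def)
          have "1 = ln (exp (1::real))" by simp
          also have "\<dots> \<le> ln (ln r)" using lr by (subst ln_le_cancel_iff) (auto intro: less_trans[OF exp_gt_zero])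
          finally have l1: "1 \<le> ln (ln r)" .
          have lr1: "1 \<le> ln r" using lr exp_ge_add_one_self[of 1] by linarith
          have "enn_abs_ln h = ennreal (ln r)" using real r1 lr1 by (simp add: enn_abs_ln_def)
          then have "enn_ln_plus (enn_abs_ln h) = ennreal (ln (ln r))" using lr1 by (simp add: enn_ln_plus_def max_def)
          then have "1 \<le> enn_ln_plus (enn_abs_ln h)" using l1 by simp
          then have "enn_ln_plus h * 1 \<le> enn_ln_plus h * enn_ln_plus (enn_abs_ln h)" by (rule mult_left_mono) simp
          then have "1 + enn_ln_plus h \<le> 1 + enn_ln_plus h * enn_ln_plus (enn_abs_ln h)" by (simp add: add_left_mono)
          then show ?thesis using four by (rule order_trans)
        qed
      next
        case top
        then show ?thesis by (simp add: enn_ln_plus_def enn_abs_ln_def ennreal_mult_top)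
      qed
      then show ?thesis using True by simp
    next
      case F: False
      then show ?thesis using False four[of "1 + enn_ln_plus h ^ d"] by simp
    qed
  qed
  then have "enn_powr h \<alpha> * (1 + enn_ln_plus h ^ d) \<le> enn_powr h \<alpha> * (4 * ?w)" by (rule mult_left_mono) simp
  then show ?thesis unfolding phi_def by (simp only: mult_ac)
qed

context tilted_sup_measure begin

lemma tilted_norm_finite:
  assumes "(\<lambda>x. f x * enn_powr (\<Prod>i<Suc d. \<psi> (x i)) (1 / \<alpha>)) \<in> class_L_plus \<alpha> m (Suc d)"
  shows "tilted_norm d f < \<infinity>"
proof -
  let ?h = "\<lambda>x. f x * enn_powr (\<Prod>i<Suc d. \<psi> (x i)) (1 / \<alpha>)"
  let ?w = "\<lambda>h. enn_powr h \<alpha> *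
        (if Suc d = 1 then 1
         else if Suc d = 2 then 1 + enn_ln_plus h * enn_ln_plus (enn_abs_ln h)
         else 1 + enn_ln_plus h ^ (Suc d - 1))"
  have hm: "?h \<in> borel_measurable (PiM {..<Suc d} (\<lambda>_. m))" and
    fin: "(\<integral>\<^sup>+ x. ?w (?h x) \<partial>PiM {..<Suc d} (\<lambda>_. m)) < \<infinity>"
    using assms unfolding class_L_plus_def class_L_def by blast+
  have wm: "?w \<in> borel_measurable borel" by measurable
  have "tilted_norm d f \<le> (\<integral>\<^sup>+ x. 4 * ?w (?h x) \<partial>PiM {..<Suc d} (\<lambda>_. m))"
    unfolding tilted_norm_def by (intro nn_integral_mono phi_le_class_weight)
  also have "\<dots> = 4 * (\<integral>\<^sup>+ x. ?w (?h x) \<partial>PiM {..<Suc d} (\<lambda>_. m))"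
    by (rule nn_integral_cmult) (rule measurable_compose[OF hm wm])
  also have "\<dots> < \<infinity>" using fin by (simp add: ennreal_mult_less_top)
  finally show ?thesis .
qed

text \<open>The bound of \<open>elem_tail\<close> is uniform in the approximations, so it only has
  to be carried through two limits. The exceedance events increase with \<open>R\<close>. In
  \<open>n\<close> there is almost sure convergence, and strict exceedance by the limit forces
  exceedance for all large \<open>n\<close>, that is, membership in the lower limit of the
  events.\<close>

lemma integral_tail:
  assumes E: "is_borel_space \<mu>" and X: "has_extremal_integral P \<mu> \<alpha> M (Suc d) f X"
    and f: "f \<in> borel_measurable (power_measure \<mu> (Suc d))" and pos: "0 < K" "0 < x"
  shows "emeasure P {\<omega>\<in>space P. ennreal (2 * x) < X \<omega>} \<le>
    ennreal (2 * K powr (- \<alpha>)) + ennreal (tail_const \<alpha> d K x) * tilted_norm d f" (is "_ \<le> ?B")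
proof (rule extremal_integral_approx[OF E X])
  fix s Z s' Z'
  let ?Pi = "power_measure \<mu> (Suc d)"
  assume el: "\<And>n R::nat. elem_approx (Suc d) (s' (n::nat) R) (Z' n R)"
    and le: "\<And>n x R. x \<in> space ?Pi \<Longrightarrow> s' n R x \<le> s n x"
    and sf: "\<And>n. AE x in ?Pi. s n x \<le> f x"
    and Zm: "\<And>n. Z n \<in> borel_measurable P"
    and mono: "\<And>n \<omega>. mono (\<lambda>R. Z' n R \<omega>)"
    and Zsup: "\<And>n. AE \<omega> in P. Z n \<omega> = (SUP R. Z' n R \<omega>)"
    and lim: "AE \<omega> in P. (\<lambda>n. Z n \<omega>) \<longlonglongrightarrow> X \<omega>"
  have Z'm: "Z' n R \<in> borel_measurable P" for n R using el[of n R] by (simp add: elem_approx_def)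
  let ?A = "\<lambda>n R. {\<omega>\<in>space P. ennreal (2 * x) < Z' n R \<omega>}"
  have Am: "?A n R \<in> sets P" for n R using Z'm[of n R] by measurable
  have A: "emeasure P (?A n R) \<le> ?B" for n R
  proof (rule elem_tail[OF el f _ pos])
    show "AE x in ?Pi. s' n R x \<le> f x"
      using sf[of n] AE_space by eventually_elim (use le order_trans in blast)
  qed
  let ?G = "\<lambda>n. {\<omega>\<in>space P. ennreal (2 * x) < Z n \<omega>}"
  have Gm: "?G n \<in> sets P" for n using Zm[of n] by measurable
  have G: "emeasure P (?G n) \<le> ?B" for n
  proof -
    have "AE \<omega> in P. \<omega> \<in> ?G n \<longrightarrow> \<omega> \<in> (\<Union>R. ?A n R)"
      using Zsup[of n] by eventually_elim (auto simp: less_SUP_iff)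
    then have "emeasure P (?G n) \<le> emeasure P (\<Union>R. ?A n R)"
      by (rule emeasure_mono_AE) (use Am in blast)
    moreover have "emeasure P (\<Union>R. ?A n R) = (SUP R. emeasure P (?A n R))"
    proof (rule SUP_emeasure_incseq[symmetric])
      show "range (?A n) \<subseteq> sets P" using Am by blast
      have m: "Z' n R \<omega> \<le> Z' n (Suc R) \<omega>" for R \<omega> using monoD[OF mono[of n \<omega>], of R "Suc R"] by simp
      show "incseq (?A n)" by (rule incseq_SucI) (use m less_le_trans in blast)
    qed
    moreover have "(SUP R. emeasure P (?A n R)) \<le> ?B" by (rule SUP_least) (rule A)
    ultimately show ?thesis by simp
  qed
  let ?H = "\<lambda>N. \<Inter>n\<in>{N..}. ?G n"
  have Hm: "?H N \<in> sets P" for N using Gm by (intro sets.countable_INT) auto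
  have "AE \<omega> in P. \<omega> \<in> {\<omega>\<in>space P. ennreal (2 * x) < X \<omega>} \<longrightarrow> \<omega> \<in> (\<Union>N. ?H N)"
    using lim
  proof eventually_elim
    case (elim \<omega>)
    show ?case
    proof
      assume o: "\<omega> \<in> {\<omega>\<in>space P. ennreal (2 * x) < X \<omega>}"
      then have "\<forall>\<^sub>F n in sequentially. ennreal (2 * x) < Z n \<omega>" using elim by (intro order_tendstoD) auto
      then obtain N where "\<forall>n\<ge>N. ennreal (2 * x) < Z n \<omega>" unfolding eventually_sequentially by blast
      then have "\<omega> \<in> ?H N" using o by simp
      then show "\<omega> \<in> (\<Union>N. ?H N)" by blast
    qed
  qed
  then have "emeasure P {\<omega>\<in>space P. ennreal (2 * x) < X \<omega>} \<le> emeasure P (\<Union>N. ?H N)"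
    by (rule emeasure_mono_AE) (use Hm in blast)
  moreover have "emeasure P (\<Union>N. ?H N) = (SUP N. emeasure P (?H N))"
  proof (rule SUP_emeasure_incseq[symmetric])
    show "range ?H \<subseteq> sets P" using Hm by blast
    show "incseq ?H" by (rule incseq_SucI, rule INF_superset_mono) auto
  qed
  moreover have "(SUP N. emeasure P (?H N)) \<le> ?B"
  proof (rule SUP_least)
    fix N
    have "emeasure P (?H N) \<le> emeasure P (?G N)" by (rule emeasure_mono[OF _ Gm]) auto
    then show "emeasure P (?H N) \<le> ?B" using G by (rule order_trans)
  qed
  ultimately show "emeasure P {\<omega>\<in>space P. ennreal (2 * x) < X \<omega>} \<le> ?B" by simp
qed

text \<open>Any exponent between \<open>\<alpha>/2\<close> and \<open>\<alpha>\<close> would do below: the product of two such tails is of smaller order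
  than \<open>y\<close> to the power \<open>-\<alpha>\<close>. The gap to \<open>\<alpha>\<close> absorbs the logarithms of the tail bound.\<close>

lemma integral_tail_power:
  assumes E: "is_borel_space \<mu>" and X: "has_extremal_integral P \<mu> \<alpha> M (Suc d) f X"
    and f: "f \<in> borel_measurable (power_measure \<mu> (Suc d))" and fin: "tilted_norm d f < \<infinity>"
  shows "\<exists>C. \<forall>x\<ge>1. P.prob {\<omega>\<in>space P. ennreal (2 * x) < X \<omega>} \<le> C * x powr (- (3 / 4 * \<alpha>))"
proof -
  define k where "k = Suc d"
  \<comment> \<open>Exponent in the bound \<open>ln x \<le> x powr \<beta> / \<beta>\<close>: after
    the \<open>d\<close>-th power the logarithm costs at most
    \<open>x powr (\<alpha> / 4)\<close>.\<close>
  define \<beta> where "\<beta> = \<alpha> / (4 * (real d + 1))"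
  have b0: "0 < \<beta>" using alpha_pos by (simp add: \<beta>_def)
  obtain \<Xi> where Xi: "tilted_norm d f = ennreal \<Xi>" "0 \<le> \<Xi>" using fin by (cases "tilted_norm d f") auto
  define c0 where "c0 = 2 ^ Suc d * 2 powr (\<alpha> * d) * 4 ^ d"
  define c1 where "c1 = (1 + 2 * real k / \<beta>) ^ d"
  have c0p: "0 \<le> c0" "0 \<le> c1" using b0 by (auto simp: c0_def c1_def)
  have "P.prob {\<omega>\<in>space P. ennreal (2 * x) < X \<omega>} \<le> (2 + c0 * c1 * \<Xi>) * x powr (- (3 / 4 * \<alpha>))" if x: "1 \<le> x" for x
  proof -
    \<comment> \<open>With this cutoff the first term of \<open>integral_tail\<close> has exactly
      the order claimed, and since \<open>K\<close> is a power of \<open>x\<close>, the second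
      acquires only a power of \<open>ln x\<close>.\<close>
    define K where "K = x powr (3 / 4)"
    have K: "0 < K" using x by (simp add: K_def)
    have "K \<le> x powr 1" unfolding K_def using x by (intro powr_mono) auto
    then have Kx: "K \<le> x" using x by simp
    have "K ^ k / x \<le> K ^ k / 1" using x K by (intro divide_left_mono) auto
    also have "\<dots> \<le> x ^ k" using Kx K by (auto intro: power_mono)
    finally have "max 1 (K ^ k / x) \<le> x ^ k" using x by simp
    then have "ln (max 1 (K ^ k / x)) \<le> ln (x ^ k)" using x by (subst ln_le_cancel_iff) auto
    also have "\<dots> = real k * ln x" using x by (simp add: ln_realpow)
    also have "\<dots> \<le> real k * (x powr \<beta> / \<beta>)" using ln_powr_bound[OF x b0] by (intro mult_left_mono) auto
    finally have "1 + 2 * ln (max 1 (K ^ k / x)) \<le> x powr \<beta> + 2 * (real k * (x powr \<beta> / \<beta>))"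
      using x b0 by (intro add_mono) (auto intro: ge_one_powr_ge_zero)
    also have "\<dots> = (1 + 2 * real k / \<beta>) * x powr \<beta>" by (simp add: algebra_simps)
    finally have "(1 + 2 * ln (max 1 (K ^ k / x))) ^ d \<le> ((1 + 2 * real k / \<beta>) * x powr \<beta>) ^ d"
      by (intro power_mono) auto
    also have "\<dots> = c1 * x powr (\<beta> * d)" using x by (simp add: c1_def power_mult_distrib powr_powr[symmetric] powr_realpow)
    also have "\<dots> \<le> c1 * x powr (\<alpha> / 4)"
    proof (intro mult_left_mono powr_mono)
      have "real d / (real d + 1) \<le> 1" by simp
      then have "\<alpha> / 4 * (real d / (real d + 1)) \<le> \<alpha> / 4 * 1" using alpha_pos by (intro mult_left_mono) auto
      then show "\<beta> * real d \<le> \<alpha> / 4" by (simp add: \<beta>_def)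
    qed (use x c0p in auto)
    finally have L: "(1 + 2 * ln (max 1 (K ^ k / x))) ^ d \<le> c1 * x powr (\<alpha> / 4)" .
    have "tail_const \<alpha> d K x = c0 * (x powr (- \<alpha>) * (1 + 2 * ln (max 1 (K ^ k / x))) ^ d)"
      unfolding tail_const_def c0_def k_def by (simp only: mult_ac)
    also have "\<dots> \<le> c0 * (x powr (- \<alpha>) * (c1 * x powr (\<alpha> / 4)))" using L c0p by (intro mult_left_mono) auto
    also have "\<dots> = c0 * c1 * (x powr (- \<alpha>) * x powr (\<alpha> / 4))" by (simp only: mult_ac)
    also have "x powr (- \<alpha>) * x powr (\<alpha> / 4) = x powr (- (3 / 4 * \<alpha>))" by (simp add: powr_add[symmetric])
    finally have T: "tail_const \<alpha> d K x \<le> c0 * c1 * x powr (- (3 / 4 * \<alpha>))" .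
    have K2: "2 * K powr (- \<alpha>) = 2 * x powr (- (3 / 4 * \<alpha>))" by (simp add: K_def powr_powr)
    have "emeasure P {\<omega>\<in>space P. ennreal (2 * x) < X \<omega>} \<le>
        ennreal (2 * K powr (- \<alpha>)) + ennreal (tail_const \<alpha> d K x) * ennreal \<Xi>"
      using integral_tail[OF E X f K, of x] x unfolding Xi(1) by simp
    also have "\<dots> \<le> ennreal (2 * x powr (- (3 / 4 * \<alpha>))) + ennreal (c0 * c1 * x powr (- (3 / 4 * \<alpha>))) * ennreal \<Xi>"
      unfolding K2 by (intro add_left_mono mult_right_mono ennreal_leI T) simp
    also have "\<dots> = ennreal (2 * x powr (- (3 / 4 * \<alpha>)) + c0 * c1 * x powr (- (3 / 4 * \<alpha>)) * \<Xi>)"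
      using c0p Xi(2) by (simp add: ennreal_mult)
    also have "2 * x powr (- (3 / 4 * \<alpha>)) + c0 * c1 * x powr (- (3 / 4 * \<alpha>)) * \<Xi> = (2 + c0 * c1 * \<Xi>) * x powr (- (3 / 4 * \<alpha>))"
      by (simp add: algebra_simps)
    finally show ?thesis using c0p Xi(2) by (simp add: P.emeasure_eq_measure)
  qed
  then show ?thesis by blast
qed

end

subsection \<open>Lower bound for the joint tail\<close>

text \<open>Lower counterpart of \<open>M_tail_le\<close>: a Frechet tail is comparable with its
  first-order term, with a constant that is uniform for \<open>u\<close> up to \<open>l\<close>. It
  follows from \<open>1 + u \<le> exp u\<close>.\<close>

lemma one_minus_exp_ge:
  fixes u l :: real
  assumes "0 \<le> u" "u \<le> l" shows "exp (- l) * u \<le> 1 - exp (- u)"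
proof -
  have "(1 + u) * exp (- u) \<le> exp u * exp (- u)" by (intro mult_right_mono exp_ge_add_one_self) auto
  also have "\<dots> = 1" by (simp add: exp_minus)
  finally have 1: "u * exp (- u) \<le> 1 - exp (- u)" by (simp add: algebra_simps)
  have "exp (- l) * u \<le> exp (- u) * u" using assms by (intro mult_right_mono) auto
  then show ?thesis using 1 by (simp add: mult.commute)
qed

text \<open>The common factors are at most 1, so counting them twice only decreases the product.
  This covers cells that occur in both tuples of \<open>joint_lower\<close>.\<close>

lemma prod_Un_ge:
  fixes g :: "'i \<Rightarrow> real"
  assumes "finite A" "finite B" "\<And>i. i \<in> A \<union> B \<Longrightarrow> 0 \<le> g i \<and> g i \<le> 1"
  shows "prod g A * prod g B \<le> prod g (A \<union> B)"
proof -
  have "prod g A * prod g B = prod g (A \<union> B) * prod g (A \<inter> B)"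
    using prod.union_inter[OF assms(1,2), of g] by simp
  also have "\<dots> \<le> prod g (A \<union> B) * 1"
    using assms(3) by (intro mult_left_mono prod_le_1 prod_nonneg) auto
  finally show ?thesis by simp
qed

context sup_measure begin

text \<open>The measure on pairs of points from the two powers that share one coordinate: the first
  component is to be placed at position \<open>r\<close> of one point and at position
  \<open>r'\<close> of the other, the remaining coordinates being free.\<close>

definition glue_measure :: "nat \<Rightarrow> nat \<Rightarrow> nat \<Rightarrow> nat \<Rightarrow> ('a \<times> ((nat \<Rightarrow> 'a) \<times> (nat \<Rightarrow> 'a))) measure" where
  "glue_measure p r q r' = \<mu> \<Otimes>\<^sub>M (PiM ({..<p} - {r}) (\<lambda>_. \<mu>) \<Otimes>\<^sub>M PiM ({..<q} - {r'}) (\<lambda>_. \<mu>))"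

lemma glue_measure_rect:
  assumes "A \<in> sets \<mu>" "\<And>t. t \<in> {..<p} - {r} \<Longrightarrow> B t \<in> sets \<mu>" "\<And>t. t \<in> {..<q} - {r'} \<Longrightarrow> C t \<in> sets \<mu>"
  shows "emeasure (glue_measure p r q r') (A \<times> (PiE ({..<p} - {r}) B \<times> PiE ({..<q} - {r'}) C)) =
    emeasure \<mu> A * ((\<Prod>t\<in>{..<p} - {r}. emeasure \<mu> (B t)) * (\<Prod>t\<in>{..<q} - {r'}. emeasure \<mu> (C t)))"
proof -
  have s1: "sigma_finite_measure (PiM ({..<p} - {r}) (\<lambda>_. \<mu>))" by (rule mu.sigma_finite) simp
  have s2: "sigma_finite_measure (PiM ({..<q} - {r'}) (\<lambda>_. \<mu>))" by (rule mu.sigma_finite) simp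
  interpret Q: pair_sigma_finite "PiM ({..<p} - {r}) (\<lambda>_. \<mu>)" "PiM ({..<q} - {r'}) (\<lambda>_. \<mu>)"
    using s1 s2 by (simp add: pair_sigma_finite_def)
  have B: "PiE ({..<p} - {r}) B \<in> sets (PiM ({..<p} - {r}) (\<lambda>_. \<mu>))" using assms by (intro sets_PiM_I_finite) auto
  have C: "PiE ({..<q} - {r'}) C \<in> sets (PiM ({..<q} - {r'}) (\<lambda>_. \<mu>))" using assms by (intro sets_PiM_I_finite) auto
  have "emeasure (glue_measure p r q r') (A \<times> (PiE ({..<p} - {r}) B \<times> PiE ({..<q} - {r'}) C)) =
    emeasure \<mu> A * (emeasure (PiM ({..<p} - {r}) (\<lambda>_. \<mu>)) (PiE ({..<p} - {r}) B) * emeasure (PiM ({..<q} - {r'}) (\<lambda>_. \<mu>)) (PiE ({..<q} - {r'}) C))"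
    unfolding glue_measure_def using assms(1) B C
    by (simp add: Q.emeasure_pair_measure_Times sigma_finite_measure.emeasure_pair_measure_Times[OF s2])
  then show ?thesis using assms by (simp add: mu.emeasure_PiM)
qed

lemma exceed_prob_ge:
  assumes F: "F \<in> sets \<mu>" "emeasure \<mu> F < \<infinity>" and A: "A \<in> sets \<mu>" "A \<subseteq> F" and y: "1 \<le> y"
  shows "exp (- measure \<mu> F) * (measure \<mu> A * y powr (- \<alpha>)) \<le> P.prob {\<omega>\<in>space P. ennreal y < M A \<omega>}"
proof -
  have fin: "emeasure \<mu> A < \<infinity>" using emeasure_mono[OF A(2) F(1)] F(2) by (rule le_less_trans)
  have "measure \<mu> A \<le> measure \<mu> F" using A F by (intro measure_mono_fmeasurable) (auto simp: fmeasurable_def)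
  moreover have "y powr (- \<alpha>) \<le> 1 powr (- \<alpha>)" using y alpha_pos by (intro powr_mono2') auto
  ultimately have "measure \<mu> A * y powr (- \<alpha>) \<le> measure \<mu> F * 1" by (intro mult_mono) auto
  then show ?thesis
    using one_minus_exp_ge[of "measure \<mu> A * y powr (- \<alpha>)" "measure \<mu> F"] M_tail[OF A(1) fin, of y] y by simp
qed

lemma cover_cells:
  assumes W: "rect_family \<mu> k F W" and D: "partition_for \<mu> k W I D" and x: "0 < fam_step k W x"
  shows "\<exists>j\<in>fam_cells k I D W. x \<in> PiE {..<k} (\<lambda>t. D (j t))"
proof -
  obtain w where w: "w \<in> W" "x \<in> PiE {..<k} (snd w)" using x unfolding fam_step_pos_iff by blast
  have "\<forall>t\<in>{..<k}. \<exists>i. i \<in> I \<and> D i \<subseteq> snd w t \<and> x t \<in> D i"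
  proof
    fix t assume t: "t \<in> {..<k}"
    then have "x t \<in> snd w t" using w(2) by (auto simp: PiE_iff)
    moreover have "snd w t = (\<Union>i\<in>{i\<in>I. D i \<subseteq> snd w t}. D i)" using D w(1) t unfolding partition_for_def by blast
    ultimately have "x t \<in> (\<Union>i\<in>{i\<in>I. D i \<subseteq> snd w t}. D i)" by (simp only:)
    then show "\<exists>i. i \<in> I \<and> D i \<subseteq> snd w t \<and> x t \<in> D i" by blast
  qed
  then obtain j where j: "\<forall>t\<in>{..<k}. j t \<in> I \<and> D (j t) \<subseteq> snd w t \<and> x t \<in> D (j t)" by (rule bchoice[THEN exE])
  define j' where "j' = restrict j {..<k}"
  have "j' \<in> PiE {..<k} (\<lambda>t. {i\<in>I. D i \<subseteq> snd w t})" using j by (auto simp: j'_def)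
  then have "j' \<in> fam_cells k I D W" using w(1) unfolding fam_cells_def by blast
  moreover have "x \<in> PiE {..<k} (\<lambda>t. D (j' t))" using j w(2) by (auto simp: j'_def PiE_iff)
  ultimately show ?thesis by blast
qed

text \<open>One cell value above \<open>y\<close>, used by both integrands, together with values
  above 1 in the remaining cells pushes both family values above \<open>a * y\<close>. For one tuple
  this has probability of order \<open>y powr (- \<alpha>)\<close> times the glued mass of the
  cells, but the events of different tuples overlap. On the event \<open>TE\<close> at most
  \<open>t\<close> cells exceed 1, so at most \<open>t ^ Suc d\<close> of these events occur
  together; hence the union has at least the summed probability inside \<open>TE\<close> divided by
  this number. Restricting to \<open>TE\<close> costs a factor 2, and no constant depends on the
  partition.\<close>

lemma joint_lower:
  fixes p q r r' :: nat
  assumes F: "F \<in> sets \<mu>" "emeasure \<mu> F < \<infinity>"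
    and U: "rect_family \<mu> p F \<U>" "\<forall>w\<in>\<U>. a \<le> fst w" and V: "rect_family \<mu> q F \<V>" "\<forall>w\<in>\<V>. a \<le> fst w"
    and a: "0 < a" and r: "r < p" "r' < q" and y: "1 \<le> y" and \<theta>: "0 \<le> \<theta>"
    and ov: "ennreal \<theta> \<le> emeasure (glue_measure p r q r') {(s, x, z). s \<in> space \<mu> \<and>
       0 < fam_step p \<U> (x(r := s)) \<and> 0 < fam_step q \<V> (z(r' := s)) \<and>
       x \<in> extensional ({..<p} - {r}) \<and> z \<in> extensional ({..<q} - {r'})}"
    and d: "d = (p - 1) + (q - 1)"
  shows "exp (- measure \<mu> F) ^ Suc d / (2 * (real d + 2 + 2 * measure \<mu> F) ^ Suc d) * \<theta> * y powr (- \<alpha>) \<le>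
    P.prob {\<omega>\<in>space P. ennreal (a * y) < fam_val M p \<U> \<omega> \<and> ennreal (a * y) < fam_val M q \<V> \<omega>}"
proof -
  let ?I' = "{..<p} - {r}" and ?J' = "{..<q} - {r'}"
  define L where "L = measure \<mu> F"
  have L0: "0 \<le> L" by (simp add: L_def)
  \<comment> \<open>The sum of \<open>2 * L + 1\<close>, granted to the cells outside a given tuple,
    and \<open>d + 1\<close>, which bounds the number of cells in the tuple.\<close>
  define t where "t = real d + 2 + 2 * L"
  have t0: "0 < t" using L0 by (simp add: t_def)
  have cI: "card ?I' = p - 1" "card ?J' = q - 1" using r by simp_all
  let ?B = "(\<Union>w\<in>\<U>. snd w ` {..<p}) \<union> (\<Union>w\<in>\<V>. snd w ` {..<q})"
  obtain I :: "('a set set \<times> int) set" and D where D: "finite I" "disjoint_family_on D I"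
    "\<And>i. i \<in> I \<Longrightarrow> D i \<in> sets \<mu>" "\<And>i. i \<in> I \<Longrightarrow> D i \<noteq> {}" "(\<Union>i\<in>I. D i) = F"
    "\<And>b. b \<in> ?B \<Longrightarrow> b = (\<Union>i\<in>{i\<in>I. D i \<subseteq> b}. D i)" "\<And>i z. i \<in> I \<Longrightarrow> z \<in> D i \<Longrightarrow> (\<lambda>_. 0) z = snd i"
  proof (rule partition_exists[of ?B \<mu> F "\<lambda>_. 0 :: int"])
    show "finite ?B" using U V by (auto simp: rect_family_def)
    show "?B \<subseteq> sets \<mu>" using U V by (auto simp: rect_family_def)
    show "b \<subseteq> F" if "b \<in> ?B" for b
      using that U(1) V(1) unfolding rect_family_def by blast
    show "finite ((\<lambda>_. 0 :: int) ` F)" by (rule finite_subset[of _ "{0}"]) auto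
  qed (use F in \<open>simp_all\<close>)
  have pU: "partition_for \<mu> p \<U> I D" unfolding partition_for_def
  proof (intro conjI ballI allI impI)
    show "snd w r = (\<Union>i\<in>{i\<in>I. D i \<subseteq> snd w r}. D i)" if "w \<in> \<U>" "r < p" for w r
      by (rule D(6)) (use that in blast)
  qed (simp_all add: D(1-4))
  have pV: "partition_for \<mu> q \<V> I D" unfolding partition_for_def
  proof (intro conjI ballI allI impI)
    show "snd w r = (\<Union>i\<in>{i\<in>I. D i \<subseteq> snd w r}. D i)" if "w \<in> \<V>" "r < q" for w r
      by (rule D(6)) (use that in blast)
  qed (simp_all add: D(1-4))
  have DF: "D i \<subseteq> F" if "i \<in> I" for i using D(5) that by blast
  have Dfin: "emeasure \<mu> (D i) < \<infinity>" if "i \<in> I" for i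
    using emeasure_mono[OF DF[OF that] F(1)] F(2) by (rule le_less_trans)
  have DE: "emeasure \<mu> (D i) = ennreal (measure \<mu> (D i))" if "i \<in> I" for i
    using Dfin[OF that] by (intro emeasure_eq_ennreal_measure) (simp add: less_top)
  have sumD: "(\<Sum>i\<in>I. measure \<mu> (D i)) = L"
    unfolding L_def D(5)[symmetric] using D Dfin by (intro measure_finite_Union[symmetric]) (auto simp: less_top)
  have Mm[measurable]: "M (D i) \<in> borel_measurable P" if "i \<in> I" for i using D(3)[OF that] by simp
  have ind: "P.indep_vars (\<lambda>_. borel) (\<lambda>i. M (D i)) I" using M_indep[OF D(1,2,3)] .
  define TT where "TT = {(i, j, k). i \<in> I \<and> j \<in> PiE ?I' (\<lambda>_. I) \<and> k \<in> PiE ?J' (\<lambda>_. I) \<and>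
     j(r := i) \<in> fam_cells p I D \<U> \<and> k(r' := i) \<in> fam_cells q I D \<V>}"
  have fTT: "finite TT"
  proof (rule finite_subset)
    show "TT \<subseteq> I \<times> (PiE ?I' (\<lambda>_. I) \<times> PiE ?J' (\<lambda>_. I))" by (auto simp: TT_def)
    show "finite (I \<times> (PiE ?I' (\<lambda>_. I) \<times> PiE ?J' (\<lambda>_. I)))" using D(1) by (intro finite_cartesian_product finite_PiE) auto
  qed
  \<comment> \<open>The mass under \<open>glue_measure\<close> of the glued product of
    cells.\<close>
  define mm where "mm = (\<lambda>(i, j, k). measure \<mu> (D i) * ((\<Prod>s\<in>?I'. measure \<mu> (D (j s))) * (\<Prod>s\<in>?J'. measure \<mu> (D (k s)))))"
  have sum_mm: "\<theta> \<le> (\<Sum>\<tau>\<in>TT. mm \<tau>)"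
  proof -
    let ?box = "\<lambda>(i, j, k). D i \<times> (PiE ?I' (\<lambda>s. D (j s)) \<times> PiE ?J' (\<lambda>s. D (k s)))"
    let ?H = "{(s, x, z). s \<in> space \<mu> \<and>
       0 < fam_step p \<U> (x(r := s)) \<and> 0 < fam_step q \<V> (z(r' := s)) \<and> x \<in> extensional ?I' \<and> z \<in> extensional ?J'}"
    have boxm: "?box \<tau> \<in> sets (glue_measure p r q r')" if "\<tau> \<in> TT" for \<tau>
    proof -
      obtain i j k where tau: "\<tau> = (i, j, k)" by (cases \<tau>) auto
      have ijk: "i \<in> I" "\<And>s. s \<in> ?I' \<Longrightarrow> j s \<in> I" "\<And>s. s \<in> ?J' \<Longrightarrow> k s \<in> I"
        using that unfolding TT_def tau by (auto simp: PiE_iff)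
      show ?thesis unfolding tau glue_measure_def prod.case
        by (intro pair_measureI sets_PiM_I_finite D(3) ijk) auto
    qed
    have cov: "?H \<subseteq> (\<Union>\<tau>\<in>TT. ?box \<tau>)"
    proof
      fix h assume "h \<in> ?H"
      then obtain s x z where h: "h = (s, x, z)" and hs: "0 < fam_step p \<U> (x(r := s))" "0 < fam_step q \<V> (z(r' := s))"
        "x \<in> extensional ?I'" "z \<in> extensional ?J'" by blast
      obtain j where j: "j \<in> fam_cells p I D \<U>" "x(r := s) \<in> PiE {..<p} (\<lambda>t. D (j t))"
        using cover_cells[OF U(1) pU hs(1)] by blast
      obtain k where k: "k \<in> fam_cells q I D \<V>" "z(r' := s) \<in> PiE {..<q} (\<lambda>t. D (k t))"
        using cover_cells[OF V(1) pV hs(2)] by blast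
      have jI: "j \<in> PiE {..<p} (\<lambda>_. I)" and kI: "k \<in> PiE {..<q} (\<lambda>_. I)"
        using fam_cells_props(1)[OF U(1) pU j(1)] fam_cells_props(1)[OF V(1) pV k(1)] by auto
      have xj: "(x(r := s)) t \<in> D (j t)" if "t < p" for t using j(2) that by (auto simp: PiE_iff)
      have zk: "(z(r' := s)) t \<in> D (k t)" if "t < q" for t using k(2) that by (auto simp: PiE_iff)
      have sj: "s \<in> D (j r)" and sk: "s \<in> D (k r')" using xj[OF r(1)] zk[OF r(2)] by simp_all
      have "j r \<in> I" "k r' \<in> I" using jI kI r by (auto simp: PiE_iff)
      \<comment> \<open>The common coordinate \<open>s\<close> lies in both cells and the cells are
        disjoint, so the two points share the cell as well as the coordinate.\<close>
      then have jk: "k r' = j r" using D(2) sj sk unfolding disjoint_family_on_def by blast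
      define j' where "j' = restrict j ?I'"
      define k' where "k' = restrict k ?J'"
      have "j'(r := j r) = j" using jI r unfolding j'_def by (auto simp: fun_eq_iff PiE_iff extensional_def restrict_def)
      moreover have "k'(r' := j r) = k" using kI r jk unfolding k'_def by (auto simp: fun_eq_iff PiE_iff extensional_def restrict_def)
      moreover have "j' \<in> PiE ?I' (\<lambda>_. I)" "k' \<in> PiE ?J' (\<lambda>_. I)" using jI kI by (auto simp: j'_def k'_def PiE_iff)
      ultimately have "(j r, j', k') \<in> TT" using j(1) k(1) \<open>j r \<in> I\<close> by (simp add: TT_def)
      moreover have "x \<in> PiE ?I' (\<lambda>s. D (j' s))"
        unfolding PiE_iff
      proof (intro conjI ballI hs(3))
        fix t assume t: "t \<in> ?I'"
        then show "x t \<in> D (j' t)" using xj[of t] by (simp add: j'_def)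
      qed
      moreover have "z \<in> PiE ?J' (\<lambda>s. D (k' s))"
        unfolding PiE_iff
      proof (intro conjI ballI hs(4))
        fix t assume t: "t \<in> ?J'"
        then show "z t \<in> D (k' t)" using zk[of t] by (simp add: k'_def)
      qed
      ultimately show "h \<in> (\<Union>\<tau>\<in>TT. ?box \<tau>)" unfolding h using sj by (intro UN_I[of "(j r, j', k')"]) auto
    qed
    have box: "emeasure (glue_measure p r q r') (?box \<tau>) = ennreal (mm \<tau>)" if "\<tau> \<in> TT" for \<tau>
    proof -
      obtain i j k where tau: "\<tau> = (i, j, k)" by (cases \<tau>) auto
      have ijk: "i \<in> I" "\<And>s. s \<in> ?I' \<Longrightarrow> j s \<in> I" "\<And>s. s \<in> ?J' \<Longrightarrow> k s \<in> I"
        using that unfolding TT_def tau by (auto simp: PiE_iff)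
      have "emeasure (glue_measure p r q r') (?box \<tau>) =
        emeasure \<mu> (D i) * ((\<Prod>t\<in>?I'. emeasure \<mu> (D (j t))) * (\<Prod>t\<in>?J'. emeasure \<mu> (D (k t))))"
        unfolding tau prod.case by (rule glue_measure_rect) (use D(3) ijk in auto)
      also have "(\<Prod>t\<in>?I'. emeasure \<mu> (D (j t))) = (\<Prod>t\<in>?I'. ennreal (measure \<mu> (D (j t))))"
        by (intro prod.cong refl DE ijk)
      also have "\<dots> = ennreal (\<Prod>t\<in>?I'. measure \<mu> (D (j t)))" by (rule prod_ennreal) simp
      also have "(\<Prod>t\<in>?J'. emeasure \<mu> (D (k t))) = (\<Prod>t\<in>?J'. ennreal (measure \<mu> (D (k t))))"
        by (intro prod.cong refl DE ijk)
      also have "\<dots> = ennreal (\<Prod>t\<in>?J'. measure \<mu> (D (k t)))" by (rule prod_ennreal) simp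
      finally show ?thesis unfolding mm_def tau prod.case DE[OF ijk(1)]
        by (simp add: ennreal_mult prod_nonneg)
    qed
    have "ennreal \<theta> \<le> emeasure (glue_measure p r q r') ?H" by (rule ov)
    also have "\<dots> \<le> emeasure (glue_measure p r q r') (\<Union>\<tau>\<in>TT. ?box \<tau>)"
      by (rule emeasure_mono[OF cov]) (intro sets.finite_UN fTT boxm)
    also have "\<dots> \<le> (\<Sum>\<tau>\<in>TT. emeasure (glue_measure p r q r') (?box \<tau>))"
      by (rule emeasure_subadditive_finite[OF fTT]) (use boxm in blast)
    also have "\<dots> = (\<Sum>\<tau>\<in>TT. ennreal (mm \<tau>))" by (rule sum.cong[OF refl box])
    also have "\<dots> = ennreal (\<Sum>\<tau>\<in>TT. mm \<tau>)"
      by (rule sum_ennreal) (auto simp: mm_def intro!: mult_nonneg_nonneg prod_nonneg)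
    finally show ?thesis
      by (subst (asm) ennreal_le_iff) (auto simp: mm_def intro!: sum_nonneg mult_nonneg_nonneg prod_nonneg)
  qed
  define A where "A = (\<lambda>(i, j, k). {\<omega>\<in>space P. ennreal y < M (D i) \<omega> \<and> (\<forall>s\<in>?I'. 1 < M (D (j s)) \<omega>) \<and> (\<forall>s\<in>?J'. 1 < M (D (k s)) \<omega>)})"
  define T where "T S \<omega> = (\<Sum>i\<in>S. of_bool (1 < M (D i) \<omega>) :: real)" for S \<omega>
  define TE where "TE = {\<omega>\<in>space P. T I \<omega> \<le> t}"
  have Tm: "T S \<in> borel_measurable P" if "S \<subseteq> I" for S
  proof -
    have "(\<lambda>\<omega>. of_bool (1 < M (D i) \<omega>) :: real) \<in> borel_measurable P" if "i \<in> S" for i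
    proof -
      have [measurable]: "M (D i) \<in> borel_measurable P" using Mm \<open>S \<subseteq> I\<close> that by blast
      show ?thesis unfolding of_bool_def by measurable
    qed
    then show ?thesis unfolding T_def[abs_def] by (intro borel_measurable_sum)
  qed
  have TEm: "TE \<in> sets P" unfolding TE_def using Tm[OF order_refl] by measurable
  have key: "exp (- L) ^ Suc d * y powr (- \<alpha>) * mm \<tau> / 2 \<le> P.prob (A \<tau> \<inter> TE) \<and> A \<tau> \<in> sets P" if tT: "\<tau> \<in> TT" for \<tau>
  proof -
    obtain i j k where tau: "\<tau> = (i, j, k)" by (cases \<tau>) auto
    have i: "i \<in> I" and jc: "j(r := i) \<in> fam_cells p I D \<U>" and kc: "k(r' := i) \<in> fam_cells q I D \<V>"
      using tT unfolding TT_def tau by blast+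
    have jI: "j s \<in> I" if "s \<in> ?I'" for s using tT that unfolding TT_def tau by (auto simp: PiE_iff)
    have kI: "k s \<in> I" if "s \<in> ?J'" for s using tT that unfolding TT_def tau by (auto simp: PiE_iff)
    have ji: "inj_on (j(r := i)) {..<p}" by (rule fam_cells_props(3)[OF U(1) pU jc])
    have ki: "inj_on (k(r' := i)) {..<q}" by (rule fam_cells_props(3)[OF V(1) pV kc])
    have jne: "j s \<noteq> i" if s: "s \<in> ?I'" for s
    proof
      assume "j s = i"
      then have "(j(r := i)) s = (j(r := i)) r" by simp
      then have "s = r" by (rule inj_onD[OF ji]) (use s r(1) in simp_all)
      then show False using s by simp
    qed
    have kne: "k s \<noteq> i" if s: "s \<in> ?J'" for s
    proof
      assume "k s = i"
      then have "(k(r' := i)) s = (k(r' := i)) r'" by simp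
      then have "s = r'" by (rule inj_onD[OF ki]) (use s r(2) in simp_all)
      then show False using s by simp
    qed
    have jinj: "inj_on j ?I'"
    proof (rule inj_onI)
      fix u v assume "u \<in> ?I'" "v \<in> ?I'" "j u = j v"
      then show "u = v" using inj_onD[OF ji, of u v] by simp
    qed
    have kinj: "inj_on k ?J'"
    proof (rule inj_onI)
      fix u v assume "u \<in> ?J'" "v \<in> ?J'" "k u = k v"
      then show "u = v" using inj_onD[OF ki, of u v] by simp
    qed
    \<comment> \<open>The tuples \<open>j\<close> and \<open>k\<close> may have values in common.
      Independence concerns distinct cells, so they are collected in a set.\<close>
    define S where "S = insert i (j ` ?I' \<union> k ` ?J')"
    have SI: "S \<subseteq> I" using i jI kI unfolding S_def by blast
    have fS: "finite S" by (simp add: S_def)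
    have cS: "card S \<le> Suc d"
    proof -
      have "card (j ` ?I' \<union> k ` ?J') \<le> card (j ` ?I') + card (k ` ?J')" by (rule card_Un_le)
      also have "\<dots> \<le> d" unfolding d card_image[OF jinj] card_image[OF kinj] cI by simp
      finally have "card (j ` ?I' \<union> k ` ?J') \<le> d" .
      moreover have "card (insert i (j ` ?I' \<union> k ` ?J')) \<le> Suc (card (j ` ?I' \<union> k ` ?J'))" by (rule card_insert_le_m1[of "Suc _", simplified]) simp_all
      ultimately show ?thesis unfolding S_def by linarith
    qed
    define th where "th u = (if u = i then y else 1)" for u
    have Aeq: "A \<tau> = {\<omega>\<in>space P. \<forall>u\<in>S. ennreal (th u) < M (D u) \<omega>}"
    proof -
      have q: "(\<forall>u\<in>S. Q u) \<longleftrightarrow> Q i \<and> (\<forall>s\<in>?I'. Q (j s)) \<and> (\<forall>s\<in>?J'. Q (k s))" for Q unfolding S_def by blast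
      have t1: "th i = y" by (simp add: th_def)
      have t2: "th (j s) = 1" if "s \<in> ?I'" for s using jne[OF that] by (simp add: th_def)
      have t3: "th (k s) = 1" if "s \<in> ?J'" for s using kne[OF that] by (simp add: th_def)
      show ?thesis unfolding A_def tau prod.case q by (simp only: t1 t2 t3 ennreal_1 cong: ball_cong)
    qed
    define pr where "pr u = P.prob {\<omega>\<in>space P. ennreal (th u) < M (D u) \<omega>}" for u
    have Am: "A \<tau> \<in> sets P"
    proof -
      have "{\<omega>\<in>space P. \<forall>u\<in>S. ennreal (th u) < M (D u) \<omega>} \<in> sets P"
      proof (rule sets.sets_Collect_finite_All[OF _ fS])
        fix u assume "u \<in> S"
        then have [measurable]: "M (D u) \<in> borel_measurable P" using Mm SI by blast
        show "{\<omega>\<in>space P. ennreal (th u) < M (D u) \<omega>} \<in> sets P" by measurable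
      qed
      then show ?thesis unfolding Aeq .
    qed
    have pA: "P.prob (A \<tau>) = (\<Prod>u\<in>S. pr u)"
    proof -
      have "A \<tau> = (\<Inter>u\<in>S. M (D u) -` {ennreal (th u)<..} \<inter> space P)"
        unfolding Aeq by (auto simp: S_def)
      then have "P.prob (A \<tau>) = (\<Prod>u\<in>S. P.prob (M (D u) -` {ennreal (th u)<..} \<inter> space P))"
        using P.indep_varsD[OF ind, of S "\<lambda>u. {ennreal (th u)<..}"] fS SI by (auto simp: S_def)
      moreover have "M (D u) -` {ennreal (th u)<..} \<inter> space P = {\<omega>\<in>space P. ennreal (th u) < M (D u) \<omega>}" for u by auto
      ultimately show ?thesis by (simp add: pr_def)
    qed
    have prge: "exp (- L) * (measure \<mu> (D u) * th u powr (- \<alpha>)) \<le> pr u" if "u \<in> I" for u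
      unfolding pr_def L_def using y by (intro exceed_prob_ge F D(3) DF that) (simp add: th_def)
    have pr01: "0 \<le> pr u \<and> pr u \<le> 1" for u unfolding pr_def by simp
    have "exp (- L) ^ Suc d * y powr (- \<alpha>) * mm \<tau> =
       (exp (- L) * (measure \<mu> (D i) * y powr (- \<alpha>))) *
       ((\<Prod>s\<in>?I'. exp (- L) * measure \<mu> (D (j s))) * (\<Prod>s\<in>?J'. exp (- L) * measure \<mu> (D (k s))))"
      unfolding mm_def tau prod.case prod.distrib d prod_constant cI
      by (simp add: power_add mult_ac)
    also have "\<dots> \<le> pr i * ((\<Prod>s\<in>?I'. pr (j s)) * (\<Prod>s\<in>?J'. pr (k s)))"
    proof (intro mult_mono prod_mono conjI mult_nonneg_nonneg prod_nonneg)
      show "exp (- L) * (measure \<mu> (D i) * y powr (- \<alpha>)) \<le> pr i" using prge[OF i] by (simp add: th_def)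
      show "exp (- L) * measure \<mu> (D (j s)) \<le> pr (j s)" if "s \<in> ?I'" for s
        using prge[OF jI[OF that]] jne[OF that] by (simp add: th_def)
      show "exp (- L) * measure \<mu> (D (k s)) \<le> pr (k s)" if "s \<in> ?J'" for s
        using prge[OF kI[OF that]] kne[OF that] by (simp add: th_def)
    qed (use pr01 in auto)
    also have "\<dots> = pr i * (prod pr (j ` ?I') * prod pr (k ` ?J'))"
      by (simp add: prod.reindex[OF jinj] prod.reindex[OF kinj])
    also have "\<dots> \<le> pr i * prod pr (j ` ?I' \<union> k ` ?J')"
      using pr01 by (intro mult_left_mono prod_Un_ge) auto
    also have "\<dots> = prod pr S"
    proof -
      have "i \<notin> j ` ?I' \<union> k ` ?J'" using jne kne by auto
      then show ?thesis unfolding S_def by (subst prod.insert) auto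
    qed
    finally have lowA: "exp (- L) ^ Suc d * y powr (- \<alpha>) * mm \<tau> \<le> P.prob (A \<tau>)" unfolding pA .
    let ?R = "I - S"
    \<comment> \<open>\<open>TE\<close> is not independent of \<open>A \<tau>\<close>, but the count
      over the cells outside \<open>S\<close> is. Adding the cells of \<open>S\<close> raises the
      count by at most \<open>Suc d\<close>, so \<open>RE\<close> lies inside
      \<open>TE\<close>.\<close>
    define RE where "RE = {\<omega>\<in>space P. T ?R \<omega> \<le> 2 * L + 1}"
    have REm: "RE \<in> sets P" unfolding RE_def using Tm[of ?R] by measurable
    \<comment> \<open>A cell exceeds 1 with probability at most its measure, so the expected count
      is at most \<open>L\<close>, and Markov's inequality at \<open>2 * L + 1\<close> leaves
      probability at least 1/2.\<close>
    have half: "1 / 2 \<le> P.prob RE"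
    proof -
      have iT: "integrable P (\<lambda>\<omega>. of_bool (1 < M (D u) \<omega>) :: real)" if "u \<in> I" for u
      proof (rule P.integrable_const_bound[of _ 1])
        have [measurable]: "M (D u) \<in> borel_measurable P" using Mm that by blast
        show "(\<lambda>\<omega>. of_bool (1 < M (D u) \<omega>) :: real) \<in> borel_measurable P" unfolding of_bool_def by measurable
      qed auto
      have eT: "P.expectation (\<lambda>\<omega>. of_bool (1 < M (D u) \<omega>) :: real) \<le> measure \<mu> (D u)" if "u \<in> I" for u
      proof -
        have "P.expectation (\<lambda>\<omega>. of_bool (1 < M (D u) \<omega>) :: real) = P.expectation (indicator {\<omega>\<in>space P. 1 < M (D u) \<omega>})"
          by (intro Bochner_Integration.integral_cong) (auto simp: indicator_def)
        also have "\<dots> = P.prob ({\<omega>\<in>space P. 1 < M (D u) \<omega>} \<inter> space P)" by simp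
        also have "P.prob ({\<omega>\<in>space P. 1 < M (D u) \<omega>} \<inter> space P) = P.prob {\<omega>\<in>space P. ennreal 1 < M (D u) \<omega>}"
          by (rule arg_cong[where f=P.prob]) auto
        also have "\<dots> \<le> measure \<mu> (D u) * 1 powr (- \<alpha>)" by (rule M_tail_le[OF D(3)[OF that] Dfin[OF that]]) simp
        finally show ?thesis by simp
      qed
      have "P.expectation (T ?R) = (\<Sum>u\<in>?R. P.expectation (\<lambda>\<omega>. of_bool (1 < M (D u) \<omega>) :: real))"
        unfolding T_def[abs_def] using iT by (intro Bochner_Integration.integral_sum) auto
      also have "\<dots> \<le> (\<Sum>u\<in>?R. measure \<mu> (D u))" using eT by (intro sum_mono) auto
      also have "\<dots> \<le> L" unfolding sumD[symmetric] using D(1) by (intro sum_mono2) auto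
      finally have ET: "P.expectation (T ?R) \<le> L" .
      have "P.prob {\<omega>\<in>space P. 2 * L + 1 \<le> T ?R \<omega>} \<le> P.expectation (T ?R) / (2 * L + 1)"
      proof (rule integral_Markov_inequality_measure[where A="space P - {}"])
        show "integrable P (T ?R)" unfolding T_def[abs_def] using iT by (intro Bochner_Integration.integrable_sum) auto
        show "AE \<omega> in P. 0 \<le> T ?R \<omega>" by (auto simp: T_def intro!: sum_nonneg)
      qed (use L0 in auto)
      also have "\<dots> \<le> L / (2 * L + 1)" using ET L0 by (intro divide_right_mono) auto
      also have "\<dots> \<le> 1 / 2" using L0 by (simp add: field_simps)
      finally have b: "P.prob {\<omega>\<in>space P. 2 * L + 1 \<le> T ?R \<omega>} \<le> 1 / 2" .
      have "P.prob (space P - RE) \<le> P.prob {\<omega>\<in>space P. 2 * L + 1 \<le> T ?R \<omega>}"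
        using Tm[of ?R] by (intro P.finite_measure_mono) (auto simp: RE_def)
      then show ?thesis using b REm by (simp add: P.prob_compl)
    qed
    have indAR: "P.prob (A \<tau> \<inter> RE) = P.prob (A \<tau>) * P.prob RE"
    proof -
      let ?XA = "{f\<in>space (PiM S (\<lambda>_. borel :: ennreal measure)). \<forall>u\<in>S. ennreal (th u) < f u}"
      let ?XB = "{f\<in>space (PiM ?R (\<lambda>_. borel :: ennreal measure)). (\<Sum>u\<in>?R. of_bool (1 < f u) :: real) \<le> 2 * L + 1}"
      have iv: "P.indep_var (PiM S (\<lambda>_. borel)) (\<lambda>\<omega>. restrict (\<lambda>i. M (D i) \<omega>) S) (PiM ?R (\<lambda>_. borel)) (\<lambda>\<omega>. restrict (\<lambda>i. M (D i) \<omega>) ?R)"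
        by (rule P.indep_var_restrict[OF ind _ SI]) auto
      have XA: "?XA \<in> sets (PiM S (\<lambda>_. borel))"
      proof (rule sets.sets_Collect_finite_All[OF _ fS])
        fix u assume "u \<in> S"
        then have [measurable]: "(\<lambda>f. f u) \<in> borel_measurable (PiM S (\<lambda>_. borel :: ennreal measure))" by (rule measurable_component_singleton)
        show "{f\<in>space (PiM S (\<lambda>_. borel :: ennreal measure)). ennreal (th u) < f u} \<in> sets (PiM S (\<lambda>_. borel))" by measurable
      qed
      have "(\<lambda>f. \<Sum>u\<in>?R. of_bool (1 < f u) :: real) \<in> borel_measurable (PiM ?R (\<lambda>_. borel :: ennreal measure))"
      proof (rule borel_measurable_sum)
        fix u assume "u \<in> ?R"
        then have [measurable]: "(\<lambda>f. f u) \<in> borel_measurable (PiM ?R (\<lambda>_. borel :: ennreal measure))" by (rule measurable_component_singleton)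
        show "(\<lambda>f. of_bool (1 < f u) :: real) \<in> borel_measurable (PiM ?R (\<lambda>_. borel :: ennreal measure))" unfolding of_bool_def by measurable
      qed
      then have XB: "?XB \<in> sets (PiM ?R (\<lambda>_. borel))" by measurable
      have sp: "restrict g S \<in> space (PiM S (\<lambda>_. borel :: ennreal measure))" "restrict g ?R \<in> space (PiM ?R (\<lambda>_. borel :: ennreal measure))" for g
        by (auto simp: space_PiM)
      have A1: "(\<lambda>\<omega>. restrict (\<lambda>i. M (D i) \<omega>) S) -` ?XA \<inter> space P = A \<tau>" unfolding Aeq using sp(1) by auto
      have R1: "(\<lambda>\<omega>. restrict (\<lambda>i. M (D i) \<omega>) ?R) -` ?XB \<inter> space P = RE" unfolding RE_def T_def using sp(2) by auto
      have AR: "(\<lambda>\<omega>. (restrict (\<lambda>i. M (D i) \<omega>) S, restrict (\<lambda>i. M (D i) \<omega>) ?R)) -` (?XA \<times> ?XB) \<inter> space P = A \<tau> \<inter> RE"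
        using A1 R1 by blast
      show ?thesis using P.indep_varD[OF iv XA XB] unfolding A1 R1 AR .
    qed
    have "RE \<subseteq> TE"
    proof
      fix \<omega> assume w: "\<omega> \<in> RE"
      have "T I \<omega> = T ?R \<omega> + T S \<omega>" unfolding T_def using SI D(1) by (rule sum.subset_diff)
      moreover have "T S \<omega> \<le> real (card S)" unfolding T_def using sum_bounded_above[of S "\<lambda>i. of_bool (1 < M (D i) \<omega>) :: real" 1] by simp
      moreover have "T ?R \<omega> \<le> 2 * L + 1" using w by (simp add: RE_def)
      ultimately have "T I \<omega> \<le> t" using cS unfolding t_def by linarith
      then show "\<omega> \<in> TE" using w by (simp add: TE_def RE_def)
    qed
    then have "P.prob (A \<tau> \<inter> RE) \<le> P.prob (A \<tau> \<inter> TE)" using Am TEm by (intro P.finite_measure_mono) auto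
    moreover have "P.prob (A \<tau>) * (1 / 2) \<le> P.prob (A \<tau>) * P.prob RE" using half by (intro mult_left_mono) auto
    ultimately show ?thesis using lowA indAR Am by simp
  qed
  let ?UA = "\<Union>\<tau>\<in>TT. A \<tau>"
  have UAm: "?UA \<in> sets P" using key by (intro sets.finite_UN fTT) auto
  \<comment> \<open>If the event of a tuple occurs, all cells of the tuple exceed 1, the shared one
    because \<open>y \<ge> 1\<close>. Such tuples are choices of \<open>Suc d\<close> cells out of
    at most \<open>t\<close>.\<close>
  have count: "(\<Sum>\<tau>\<in>TT. indicator (A \<tau> \<inter> TE) \<omega>) \<le> t ^ Suc d * indicator ?UA \<omega>" for \<omega>
  proof (cases "\<omega> \<in> ?UA \<inter> TE")
    case False
    then have "(\<Sum>\<tau>\<in>TT. indicator (A \<tau> \<inter> TE) \<omega> :: real) = 0" by (intro sum.neutral) (auto simp: indicator_def)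
    then show ?thesis using t0 by simp
  next
    case True
    define G where "G = {i\<in>I. 1 < M (D i) \<omega>}"
    have fG: "finite G" using D(1) by (simp add: G_def)
    have "T I \<omega> = real (card (I \<inter> {i. 1 < M (D i) \<omega>}))" unfolding T_def by (simp add: D(1) Int_def)
    moreover have "I \<inter> {i. 1 < M (D i) \<omega>} = G" unfolding G_def by blast
    ultimately have "T I \<omega> = real (card G)" by (simp only:)
    then have cG: "real (card G) \<le> t" using True by (simp add: TE_def)
    have "(\<Sum>\<tau>\<in>TT. indicator (A \<tau> \<inter> TE) \<omega> :: real) = real (card {\<tau>\<in>TT. \<omega> \<in> A \<tau> \<inter> TE})"
    proof -
      have "(\<Sum>\<tau>\<in>TT. indicator (A \<tau> \<inter> TE) \<omega> :: real) = (\<Sum>\<tau>\<in>TT. of_bool (\<omega> \<in> A \<tau> \<inter> TE))"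
        by (intro sum.cong refl) (simp only: indicator_def of_bool_def)
      also have "\<dots> = real (card (TT \<inter> {\<tau>. \<omega> \<in> A \<tau> \<inter> TE}))"
        by (rule sum_of_bool_eq) (rule fTT)+
      also have "card (TT \<inter> {\<tau>. \<omega> \<in> A \<tau> \<inter> TE}) = card {\<tau>\<in>TT. \<omega> \<in> A \<tau> \<inter> TE}" by (rule arg_cong[where f=card]) blast
      finally show ?thesis .
    qed
    also have "card {\<tau>\<in>TT. \<omega> \<in> A \<tau> \<inter> TE} \<le> card (G \<times> (PiE ?I' (\<lambda>_. G) \<times> PiE ?J' (\<lambda>_. G)))"
    proof (rule card_mono)
      show "finite (G \<times> (PiE ?I' (\<lambda>_. G) \<times> PiE ?J' (\<lambda>_. G)))" using fG by (intro finite_cartesian_product finite_PiE) auto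
      show "{\<tau>\<in>TT. \<omega> \<in> A \<tau> \<inter> TE} \<subseteq> G \<times> (PiE ?I' (\<lambda>_. G) \<times> PiE ?J' (\<lambda>_. G))"
      proof
        fix \<tau> assume "\<tau> \<in> {\<tau>\<in>TT. \<omega> \<in> A \<tau> \<inter> TE}"
        then have tT: "\<tau> \<in> TT" and oA: "\<omega> \<in> A \<tau>" by auto
        obtain i j k where tau: "\<tau> = (i, j, k)" by (cases \<tau>) auto
        have h: "i \<in> I" "j \<in> PiE ?I' (\<lambda>_. I)" "k \<in> PiE ?J' (\<lambda>_. I)" using tT unfolding TT_def tau by blast+
        have g: "ennreal y < M (D i) \<omega>" "\<forall>s\<in>?I'. 1 < M (D (j s)) \<omega>" "\<forall>s\<in>?J'. 1 < M (D (k s)) \<omega>"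
          using oA unfolding A_def tau by auto
        have "1 \<le> ennreal y" using y by simp
        then have "1 < M (D i) \<omega>" using g(1) by (rule le_less_trans)
        then have "i \<in> G" using h by (simp add: G_def)
        moreover have "j \<in> PiE ?I' (\<lambda>_. G)" using h(2) g(2) by (simp add: G_def PiE_iff)
        moreover have "k \<in> PiE ?J' (\<lambda>_. G)" using h(3) g(3) by (simp add: G_def PiE_iff)
        ultimately show "\<tau> \<in> G \<times> (PiE ?I' (\<lambda>_. G) \<times> PiE ?J' (\<lambda>_. G))" unfolding tau by simp
      qed
    qed
    also have "card (G \<times> (PiE ?I' (\<lambda>_. G) \<times> PiE ?J' (\<lambda>_. G))) = card G ^ Suc d"
      unfolding card_cartesian_product by (simp add: card_PiE cI[simplified] d power_add)
    also have "real (card G ^ Suc d) \<le> t ^ Suc d" unfolding of_nat_power using cG by (intro power_mono) auto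
    finally show ?thesis using True by simp
  qed
  have "(\<Sum>\<tau>\<in>TT. P.prob (A \<tau> \<inter> TE)) \<le> t ^ Suc d * P.prob ?UA"
  proof -
    have AT: "A \<tau> \<inter> TE \<in> sets P" if "\<tau> \<in> TT" for \<tau> using key[OF that] TEm by auto
    have "(\<Sum>\<tau>\<in>TT. P.prob (A \<tau> \<inter> TE)) = (\<Sum>\<tau>\<in>TT. P.expectation (indicator (A \<tau> \<inter> TE)))"
      using AT sets.sets_into_space by (intro sum.cong refl) (simp add: Int_absorb2)
    also have "\<dots> = P.expectation (\<lambda>\<omega>. \<Sum>\<tau>\<in>TT. indicator (A \<tau> \<inter> TE) \<omega>)"
      using AT by (intro Bochner_Integration.integral_sum[symmetric]) (auto intro!: integrable_real_indicator simp: P.emeasure_eq_measure)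
    also have "\<dots> \<le> P.expectation (\<lambda>\<omega>. t ^ Suc d * indicator ?UA \<omega>)"
    proof (rule integral_mono)
      show "integrable P (\<lambda>\<omega>. \<Sum>\<tau>\<in>TT. indicator (A \<tau> \<inter> TE) \<omega> :: real)"
        using AT by (intro Bochner_Integration.integrable_sum) (auto intro!: integrable_real_indicator simp: P.emeasure_eq_measure)
      show "integrable P (\<lambda>\<omega>. t ^ Suc d * indicator ?UA \<omega>)"
        using UAm by (intro integrable_mult_right integrable_real_indicator) (auto simp: P.emeasure_eq_measure)
    qed (rule count)
    also have "\<dots> = t ^ Suc d * P.prob ?UA" using UAm sets.sets_into_space[OF UAm] by (simp add: Int_absorb2)
    finally show ?thesis .
  qed
  moreover have "(\<Sum>\<tau>\<in>TT. exp (- L) ^ Suc d * y powr (- \<alpha>) * mm \<tau> / 2) \<le> (\<Sum>\<tau>\<in>TT. P.prob (A \<tau> \<inter> TE))"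
    using key by (intro sum_mono) blast
  moreover have "(\<Sum>\<tau>\<in>TT. exp (- L) ^ Suc d * y powr (- \<alpha>) * mm \<tau> / 2) = exp (- L) ^ Suc d * y powr (- \<alpha>) / 2 * (\<Sum>\<tau>\<in>TT. mm \<tau>)"
    by (simp add: sum_distrib_left)
  moreover have "exp (- L) ^ Suc d * y powr (- \<alpha>) / 2 * \<theta> \<le> exp (- L) ^ Suc d * y powr (- \<alpha>) / 2 * (\<Sum>\<tau>\<in>TT. mm \<tau>)"
    using sum_mm by (intro mult_left_mono) auto
  ultimately have fin1: "exp (- L) ^ Suc d * y powr (- \<alpha>) / 2 * \<theta> \<le> t ^ Suc d * P.prob ?UA" by linarith
  have fin2: "P.prob ?UA \<le> P.prob {\<omega>\<in>space P. ennreal (a * y) < fam_val M p \<U> \<omega> \<and> ennreal (a * y) < fam_val M q \<V> \<omega>}"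
  proof -
    \<comment> \<open>The shared cell contributes more than \<open>y\<close> and every other cell
      more than 1. Enlarging the cells to the sides of a rectangle, and \<open>a\<close> to its
      weight, can only increase the product.\<close>
    have one: "ennreal (a * y) < fam_val M k' \<W> \<omega>"
      if W: "rect_family \<mu> k' F \<W>" "\<forall>w\<in>\<W>. a \<le> fst w" and pW: "partition_for \<mu> k' \<W> I D" and jc: "j(\<rho> := i) \<in> fam_cells k' I D \<W>"
        and \<rho>: "\<rho> < k'" and ce: "\<forall>w\<in>\<W>. \<forall>r<k'. M (snd w r) \<omega> = (SUP i\<in>{i\<in>I. D i \<subseteq> snd w r}. M (D i) \<omega>)"
        and e: "ennreal y < M (D i) \<omega>" "\<forall>s\<in>{..<k'} - {\<rho>}. 1 < M (D (j s)) \<omega>" for k' \<W> j \<rho> i \<omega>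
    proof -
      obtain w where w: "w \<in> \<W>" "\<forall>t<k'. D ((j(\<rho> := i)) t) \<subseteq> snd w t" using fam_cells_props(4)[OF W(1) pW jc] by blast
      have jI: "(j(\<rho> := i)) t \<in> I" if "t < k'" for t using fam_cells_props(1)[OF W(1) pW jc] that by (auto simp: PiE_iff)
      have le: "M (D ((j(\<rho> := i)) t)) \<omega> \<le> M (snd w t) \<omega>" if "t < k'" for t
      proof -
        have "(j(\<rho> := i)) t \<in> {i\<in>I. D i \<subseteq> snd w t}" using jI[OF that] w(2) that by blast
        from SUP_upper[OF this, of "\<lambda>i. M (D i) \<omega>"] show ?thesis using ce w(1) that by simp
      qed
      have "(\<Prod>t<k'. M (D ((j(\<rho> := i)) t)) \<omega>) = M (D i) \<omega> * (\<Prod>t\<in>{..<k'} - {\<rho>}. M (D ((j(\<rho> := i)) t)) \<omega>)"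
        using \<rho> by (subst prod.remove[of _ \<rho>]) auto
      also have "(\<Prod>t\<in>{..<k'} - {\<rho>}. M (D ((j(\<rho> := i)) t)) \<omega>) = (\<Prod>t\<in>{..<k'} - {\<rho>}. M (D (j t)) \<omega>)"
        by (intro prod.cong) auto
      finally have pe: "(\<Prod>t<k'. M (D ((j(\<rho> := i)) t)) \<omega>) = M (D i) \<omega> * (\<Prod>t\<in>{..<k'} - {\<rho>}. M (D (j t)) \<omega>)" .
      have "(\<Prod>t\<in>{..<k'} - {\<rho>}. 1) \<le> (\<Prod>t\<in>{..<k'} - {\<rho>}. M (D (j t)) \<omega>)"
        using e(2) by (intro prod_mono_ennreal) (auto intro: less_imp_le)
      then have "M (D i) \<omega> * 1 \<le> M (D i) \<omega> * (\<Prod>t\<in>{..<k'} - {\<rho>}. M (D (j t)) \<omega>)" by (intro mult_left_mono) auto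
      then have "ennreal y < (\<Prod>t<k'. M (D ((j(\<rho> := i)) t)) \<omega>)" unfolding pe using e(1) by (simp add: less_le_trans)
      moreover have "(\<Prod>t<k'. M (D ((j(\<rho> := i)) t)) \<omega>) \<le> (\<Prod>t<k'. M (snd w t) \<omega>)"
        using le by (intro prod_mono_ennreal) auto
      ultimately have "ennreal y < (\<Prod>t<k'. M (snd w t) \<omega>)" by (rule less_le_trans)
      then have "ennreal a * ennreal y < ennreal a * (\<Prod>t<k'. M (snd w t) \<omega>)"
        using a by (intro ennreal_mult_strict_left_mono) auto
      also have "\<dots> \<le> ennreal (fst w) * (\<Prod>t<k'. M (snd w t) \<omega>)"
        using W(2) w(1) by (intro mult_right_mono ennreal_leI) auto
      finally have s1: "ennreal (a * y) < ennreal (fst w) * (\<Prod>t<k'. M (snd w t) \<omega>)" using a y by (simp add: ennreal_mult)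
      have s2: "ennreal (fst w) * (\<Prod>t<k'. M (snd w t) \<omega>) \<le> fam_val M k' \<W> \<omega>"
        using SUP_upper[OF w(1), of "\<lambda>w. ennreal (fst w) * (\<Prod>t<k'. M (snd w t) \<omega>)"] by (simp only: fam_val_def)
      show ?thesis by (rule less_le_trans[OF s1 s2])
    qed
    have "AE \<omega> in P. \<omega> \<in> ?UA \<longrightarrow> \<omega> \<in> {\<omega>\<in>space P. ennreal (a * y) < fam_val M p \<U> \<omega> \<and> ennreal (a * y) < fam_val M q \<V> \<omega>}"
      using fam_val_cells[OF U(1) pU] fam_val_cells[OF V(1) pV]
    proof eventually_elim
      case (elim \<omega>)
      show ?case
      proof
        assume "\<omega> \<in> ?UA"
        then obtain \<tau> where tT: "\<tau> \<in> TT" and oA: "\<omega> \<in> A \<tau>" by blast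
        obtain i j k where tau: "\<tau> = (i, j, k)" by (cases \<tau>) auto
        have h: "j(r := i) \<in> fam_cells p I D \<U>" "k(r' := i) \<in> fam_cells q I D \<V>" using tT unfolding TT_def tau by blast+
        have g: "\<omega> \<in> space P" "ennreal y < M (D i) \<omega>" "\<forall>s\<in>?I'. 1 < M (D (j s)) \<omega>" "\<forall>s\<in>?J'. 1 < M (D (k s)) \<omega>"
          using oA unfolding A_def tau by auto
        show "\<omega> \<in> {\<omega>\<in>space P. ennreal (a * y) < fam_val M p \<U> \<omega> \<and> ennreal (a * y) < fam_val M q \<V> \<omega>}"
          using one[OF U pU h(1) r(1) elim(1) g(2,3)] one[OF V pV h(2) r(2) elim(2) g(2,4)] g(1) by simp
      qed
    qed
    moreover have "{\<omega>\<in>space P. ennreal (a * y) < fam_val M p \<U> \<omega> \<and> ennreal (a * y) < fam_val M q \<V> \<omega>} \<in> sets P"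
    proof -
      have [measurable]: "fam_val M p \<U> \<in> borel_measurable P" "fam_val M q \<V> \<in> borel_measurable P"
        by (rule fam_val_measurable[OF _ U(1)], simp) (rule fam_val_measurable[OF _ V(1)], simp)
      show ?thesis by measurable
    qed
    ultimately show ?thesis by (rule P.finite_measure_mono_AE)
  qed
  have "exp (- L) ^ Suc d * y powr (- \<alpha>) / 2 * \<theta> / t ^ Suc d \<le> P.prob ?UA"
  proof -
    have "0 < t ^ Suc d" using t0 by simp
    then show ?thesis using fin1 by (simp only: pos_divide_le_eq mult.commute[of "P.prob ?UA"])
  qed
  moreover have "exp (- L) ^ Suc d / (2 * t ^ Suc d) * \<theta> * y powr (- \<alpha>) = exp (- L) ^ Suc d * y powr (- \<alpha>) / 2 * \<theta> / t ^ Suc d"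
    by simp
  ultimately show ?thesis using fin2 unfolding L_def[symmetric] t_def[symmetric] by linarith
qed

end

text \<open>The sets \<open>R - B i\<close> need not be monotone. The points of \<open>R\<close>
  missed by some \<open>B j\<close> with \<open>j \<ge> i\<close> form a decreasing sequence with
  null intersection, and continuity from above applies to these.\<close>

lemma emeasure_Diff_tendsto_0:
  fixes B :: "nat \<Rightarrow> 'b set"
  assumes R: "R \<in> sets N" "emeasure N R < \<infinity>" and B: "\<And>i. B i \<in> sets N"
    and ev: "AE x in N. x \<in> R \<longrightarrow> eventually (\<lambda>i. x \<in> B i) sequentially"
  shows "(\<lambda>i. emeasure N (R - B i)) \<longlonglongrightarrow> 0"
proof -
  let ?D = "\<lambda>i. R - (\<Inter>j\<in>{i..}. B j)"
  have BI: "(\<Inter>j\<in>{i..}. B j) \<in> sets N" for i using B by (intro sets.countable_INT) auto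
  have Dm: "?D i \<in> sets N" for i using R(1) BI by (rule sets.Diff)
  have dec: "decseq ?D"
  proof (rule decseq_SucI)
    fix i
    have "(\<Inter>j\<in>{i..}. B j) \<subseteq> (\<Inter>j\<in>{Suc i..}. B j)" by (rule INF_superset_mono) auto
    then show "?D (Suc i) \<subseteq> ?D i" by blast
  qed
  have "emeasure N (?D i) \<noteq> \<infinity>" for i
    using le_less_trans[OF emeasure_mono[OF Diff_subset R(1)] R(2)] by (rule less_imp_neq)
  then have lim: "(\<lambda>i. emeasure N (?D i)) \<longlonglongrightarrow> emeasure N (\<Inter>i. ?D i)"
    using Dm dec by (intro Lim_emeasure_decseq) auto
  have "emeasure N (\<Inter>i. ?D i) = 0"
  proof -
    have AEn: "AE x in N. x \<notin> (\<Inter>i. ?D i)" using ev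
    proof eventually_elim
      case (elim x)
      show ?case
      proof
        assume x: "x \<in> (\<Inter>i. ?D i)"
        then have "x \<in> R" by blast
        then obtain i where "\<forall>j\<ge>i. x \<in> B j" using elim unfolding eventually_sequentially by blast
        then have "x \<in> (\<Inter>j\<in>{i..}. B j)" by simp
        then show False using x by blast
      qed
    qed
    have "(\<Inter>i. ?D i) \<in> sets N" using Dm by (intro sets.countable_INT) auto
    then have "(\<Inter>i. ?D i) \<in> null_sets N" using AEn AE_iff_null_sets by blast
    then show ?thesis by (rule null_setsD1)
  qed
  with lim have lim0: "(\<lambda>i. emeasure N (?D i)) \<longlonglongrightarrow> 0" by simp
  show ?thesis
  proof (rule tendsto_sandwich[OF _ _ tendsto_const lim0])
    show "\<forall>\<^sub>F i in sequentially. emeasure N (R - B i) \<le> emeasure N (?D i)"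
      by (intro always_eventually allI emeasure_mono Dm) auto
  qed simp
qed

section \<open>Families that exhaust a given part of the support\<close>

context sup_measure begin

lemma elem_good_family:
  assumes el: "elem_approx k s Z" and R: "R \<in> sets (power_measure \<mu> k)"
    and small: "emeasure (power_measure \<mu> k) (R - {x\<in>space (power_measure \<mu> k). a < s x}) < ennreal \<delta>"
    and pos: "0 < e" "0 < \<eta>"
  shows "\<exists>F W. rect_family \<mu> k F W \<and>
     emeasure (power_measure \<mu> k) (R - {x\<in>space (power_measure \<mu> k). a < fam_step k W x}) < ennreal \<delta> \<and>
     emeasure P {\<omega>\<in>space P. \<not> close e (fam_val M k W \<omega>) (Z \<omega>)} < ennreal \<eta>"
proof -
  let ?Pi = "power_measure \<mu> k"
  obtain F b W where s[measurable]: "s \<in> borel_measurable ?Pi"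
    and W0: "\<forall>l::nat. rect_family \<mu> k F (W l) \<and> (\<forall>w\<in>W l. fst w \<le> b)"
    and lim1: "(\<lambda>l. emeasure ?Pi {x\<in>space ?Pi. fam_step k (W l) x \<noteq> s x}) \<longlonglongrightarrow> 0"
    and lim2: "\<forall>e>0. (\<lambda>l. emeasure P {\<omega>\<in>space P. \<not> close e (fam_val M k (W l) \<omega>) (Z \<omega>)}) \<longlonglongrightarrow> 0"
    using el unfolding elem_approx_def by (elim conjE exE)
  have W: "rect_family \<mu> k F (W l)" for l using W0 by blast
  have stm: "fam_step k (W l) \<in> borel_measurable ?Pi" for l by (rule fam_step_measurable[OF W])
  let ?A = "R - {x\<in>space ?Pi. a < s x}" and ?D = "\<lambda>l. {x\<in>space ?Pi. fam_step k (W l) x \<noteq> s x}"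
  have Dm: "?D l \<in> sets ?Pi" for l by (rule borel_measurable_neq[OF stm s])
  have Sm: "{x\<in>space ?Pi. a < s x} \<in> sets ?Pi" by measurable
  have Am: "?A \<in> sets ?Pi" using R Sm by (rule sets.Diff)
  have lim3: "(\<lambda>l. emeasure ?Pi ?A + emeasure ?Pi (?D l)) \<longlonglongrightarrow> emeasure ?Pi ?A + 0"
    by (intro tendsto_add tendsto_const lim1)
  have lim4: "(\<lambda>l. emeasure P {\<omega>\<in>space P. \<not> close e (fam_val M k (W l) \<omega>) (Z \<omega>)}) \<longlonglongrightarrow> 0" using lim2 pos by blast
  have "\<forall>\<^sub>F l in sequentially. emeasure ?Pi ?A + emeasure ?Pi (?D l) < ennreal \<delta>"
    by (rule order_tendstoD[OF lim3]) (use small in simp)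
  moreover have "\<forall>\<^sub>F l in sequentially. emeasure P {\<omega>\<in>space P. \<not> close e (fam_val M k (W l) \<omega>) (Z \<omega>)} < ennreal \<eta>"
    by (rule order_tendstoD[OF lim4]) (use pos in simp)
  ultimately have "\<forall>\<^sub>F l in sequentially. emeasure ?Pi ?A + emeasure ?Pi (?D l) < ennreal \<delta> \<and>
    emeasure P {\<omega>\<in>space P. \<not> close e (fam_val M k (W l) \<omega>) (Z \<omega>)} < ennreal \<eta>" by (rule eventually_conj)
  then obtain l where l: "emeasure ?Pi ?A + emeasure ?Pi (?D l) < ennreal \<delta>"
    "emeasure P {\<omega>\<in>space P. \<not> close e (fam_val M k (W l) \<omega>) (Z \<omega>)} < ennreal \<eta>"
    by (auto simp: eventually_sequentially)
  have "emeasure ?Pi (R - {x\<in>space ?Pi. a < fam_step k (W l) x}) \<le> emeasure ?Pi (?A \<union> ?D l)"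
  proof (rule emeasure_mono)
    have "R \<subseteq> space ?Pi" by (rule sets.sets_into_space[OF R])
    then show "R - {x\<in>space ?Pi. a < fam_step k (W l) x} \<subseteq> ?A \<union> ?D l" by auto
    show "?A \<union> ?D l \<in> sets ?Pi" using Am Dm by (rule sets.Un)
  qed
  also have "emeasure ?Pi (?A \<union> ?D l) \<le> emeasure ?Pi ?A + emeasure ?Pi (?D l)" by (rule emeasure_subadditive[OF Am Dm])
  finally have "emeasure ?Pi (R - {x\<in>space ?Pi. a < fam_step k (W l) x}) < ennreal \<delta>" using l(1) by (rule le_less_trans)
  then show ?thesis using W l(2) by blast
qed

text \<open>For a lower bound one needs single families that are large on most of \<open>S\<close>
  and whose value is close to \<open>Z'\<close>. The thresholds are nested in the order of the
  limits, \<open>n\<close>, then \<open>R\<close>, then the family, with the accuracies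
  \<open>e\<close> and \<eta> left free to the end. In this form two integrals can be handled with
  the same \<open>n\<close> and \<open>R\<close> by taking maxima of the thresholds.\<close>

lemma integral_good_family:
  assumes E: "is_borel_space \<mu>" and X: "has_extremal_integral P \<mu> \<alpha> M k f X"
  obtains Z Z' where
    "\<And>n. Z n \<in> borel_measurable P" "\<And>n R::nat. Z' (n::nat) R \<in> borel_measurable P"
    "\<And>n R. AE \<omega> in P. Z' n R \<omega> \<le> Z n \<omega>" "AE \<omega> in P. (\<lambda>n. Z n \<omega>) \<longlonglongrightarrow> X \<omega>"
    "\<And>S a \<delta>. S \<in> sets (power_measure \<mu> k) \<Longrightarrow> emeasure (power_measure \<mu> k) S < \<infinity> \<Longrightarrow> (\<And>x. x \<in> S \<Longrightarrow> a < f x) \<Longrightarrow> 0 < \<delta> \<Longrightarrow>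
      \<exists>n0. \<forall>n\<ge>n0. \<exists>R0. \<forall>R\<ge>R0. \<forall>e>0. \<forall>\<eta>>0. \<exists>F W. rect_family \<mu> k F W \<and>
       emeasure (power_measure \<mu> k) (S - {x\<in>space (power_measure \<mu> k). a < fam_step k W x}) < ennreal \<delta> \<and>
       emeasure P {\<omega>\<in>space P. \<not> close e (fam_val M k W \<omega>) (Z' n R \<omega>)} < ennreal \<eta>"
proof (rule extremal_integral_approx[OF E X])
  fix s Z s' Z'
  let ?Pi = "power_measure \<mu> k"
  assume el: "\<And>n R::nat. elem_approx k (s' (n::nat) R) (Z' n R)"
    and sm: "\<And>n. s n \<in> borel_measurable ?Pi"
    and ev: "\<And>n x. x \<in> space ?Pi \<Longrightarrow> \<exists>R0. \<forall>R\<ge>R0. s' n R x = s n x"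
    and sl: "AE x in ?Pi. (\<lambda>n. s n x) \<longlonglongrightarrow> f x"
    and Zm: "\<And>n. Z n \<in> borel_measurable P"
    and Zsup: "\<And>n. AE \<omega> in P. Z n \<omega> = (SUP R. Z' n R \<omega>)"
    and lim: "AE \<omega> in P. (\<lambda>n. Z n \<omega>) \<longlonglongrightarrow> X \<omega>"
  have Z'm: "Z' n R \<in> borel_measurable P" for n R using el[of n R] by (simp add: elem_approx_def)
  have s'm: "s' n R \<in> borel_measurable ?Pi" for n R using el[of n R] by (simp add: elem_approx_def)
  have Zle: "AE \<omega> in P. Z' n R \<omega> \<le> Z n \<omega>" for n R
    using Zsup[of n]
  proof eventually_elim
    case (elim \<omega>)
    show ?case using SUP_upper[of R UNIV "\<lambda>R. Z' n R \<omega>"] unfolding elim by simp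
  qed
  have main: "\<exists>n0. \<forall>n\<ge>n0. \<exists>R0. \<forall>R\<ge>R0. \<forall>e>0. \<forall>\<eta>>0. \<exists>F W. rect_family \<mu> k F W \<and>
       emeasure ?Pi (S - {x\<in>space ?Pi. a < fam_step k W x}) < ennreal \<delta> \<and>
       emeasure P {\<omega>\<in>space P. \<not> close e (fam_val M k W \<omega>) (Z' n R \<omega>)} < ennreal \<eta>"
    if S: "S \<in> sets ?Pi" "emeasure ?Pi S < \<infinity>" "\<And>x. x \<in> S \<Longrightarrow> a < f x" and d: "0 < \<delta>" for S a \<delta>
  proof -
    have dd: "0 < ennreal (\<delta> / 2)" "ennreal (\<delta> / 2) + ennreal (\<delta> / 2) = ennreal \<delta>"
      using d by (simp_all add: ennreal_plus[symmetric] del: ennreal_plus)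
    have Bm: "{x\<in>space ?Pi. a < s n x} \<in> sets ?Pi" for n using sm[of n] by measurable
    have "(\<lambda>n. emeasure ?Pi (S - {x\<in>space ?Pi. a < s n x})) \<longlonglongrightarrow> 0"
    proof (rule emeasure_Diff_tendsto_0[OF S(1,2) Bm])
      show "AE x in ?Pi. x \<in> S \<longrightarrow> (\<forall>\<^sub>F i in sequentially. x \<in> {x\<in>space ?Pi. a < s i x})"
        using sl AE_space
      proof eventually_elim
        case (elim x)
        show ?case
        proof
          assume "x \<in> S"
          then have "\<forall>\<^sub>F i in sequentially. a < s i x" using S(3) elim(1) by (intro order_tendstoD(1)) auto
          then show "\<forall>\<^sub>F i in sequentially. x \<in> {x\<in>space ?Pi. a < s i x}" using elim(2) by simp
        qed
      qed
    qed
    then have "\<forall>\<^sub>F n in sequentially. emeasure ?Pi (S - {x\<in>space ?Pi. a < s n x}) < ennreal (\<delta> / 2)"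
      by (rule order_tendstoD) (rule dd)
    then obtain n0 where n0: "\<And>n. n \<ge> n0 \<Longrightarrow> emeasure ?Pi (S - {x\<in>space ?Pi. a < s n x}) < ennreal (\<delta> / 2)"
      unfolding eventually_sequentially by blast
    have step2: "\<exists>R0. \<forall>R\<ge>R0. emeasure ?Pi (S - {x\<in>space ?Pi. a < s' n R x}) < ennreal \<delta>" if n: "n \<ge> n0" for n
    proof -
      let ?S = "S \<inter> {x\<in>space ?Pi. a < s n x}"
      have Sm: "?S \<in> sets ?Pi" using S(1) Bm by (rule sets.Int)
      have Sf: "emeasure ?Pi ?S < \<infinity>" using emeasure_mono[OF Int_lower1 S(1)] S(2) by (rule le_less_trans)
      have Cm: "{x\<in>space ?Pi. a < s' n R x} \<in> sets ?Pi" for R using s'm[of n R] by measurable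
      have "(\<lambda>R. emeasure ?Pi (?S - {x\<in>space ?Pi. a < s' n R x})) \<longlonglongrightarrow> 0"
      proof (rule emeasure_Diff_tendsto_0[OF Sm Sf Cm], rule AE_I2, rule impI)
        fix x assume x: "x \<in> space ?Pi" "x \<in> ?S"
        obtain R0 where "\<forall>R\<ge>R0. s' n R x = s n x" using ev[OF x(1)] by blast
        then show "\<forall>\<^sub>F R in sequentially. x \<in> {x\<in>space ?Pi. a < s' n R x}"
          unfolding eventually_sequentially using x by (intro exI[of _ R0]) auto
      qed
      then have "\<forall>\<^sub>F R in sequentially. emeasure ?Pi (?S - {x\<in>space ?Pi. a < s' n R x}) < ennreal (\<delta> / 2)"
        by (rule order_tendstoD) (rule dd)
      then obtain R0 where R0: "\<And>R. R \<ge> R0 \<Longrightarrow> emeasure ?Pi (?S - {x\<in>space ?Pi. a < s' n R x}) < ennreal (\<delta> / 2)"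
        unfolding eventually_sequentially by blast
      have "emeasure ?Pi (S - {x\<in>space ?Pi. a < s' n R x}) < ennreal \<delta>" if R: "R \<ge> R0" for R
      proof -
        let ?A = "S - {x\<in>space ?Pi. a < s n x}" and ?B = "?S - {x\<in>space ?Pi. a < s' n R x}"
        have AB: "?A \<in> sets ?Pi" "?B \<in> sets ?Pi" using S(1) Bm Sm Cm by (auto intro: sets.Diff)
        have "emeasure ?Pi (S - {x\<in>space ?Pi. a < s' n R x}) \<le> emeasure ?Pi (?A \<union> ?B)"
          by (rule emeasure_mono[OF _ sets.Un[OF AB]]) auto
        also have "emeasure ?Pi (?A \<union> ?B) \<le> emeasure ?Pi ?A + emeasure ?Pi ?B" by (rule emeasure_subadditive[OF AB])
        finally have 1: "emeasure ?Pi (S - {x\<in>space ?Pi. a < s' n R x}) \<le> emeasure ?Pi ?A + emeasure ?Pi ?B" .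
        have "emeasure ?Pi ?A + emeasure ?Pi ?B < ennreal (\<delta> / 2) + ennreal (\<delta> / 2)"
          by (rule add_strict_mono[OF n0[OF n] R0[OF R]])
        then show ?thesis using 1 unfolding dd(2) by (rule le_less_trans[rotated])
      qed
      then show ?thesis by blast
    qed
    show ?thesis
    proof (rule exI[of _ n0], intro allI impI)
      fix n assume "n0 \<le> n"
      then obtain R0 where R0: "\<forall>R\<ge>R0. emeasure ?Pi (S - {x\<in>space ?Pi. a < s' n R x}) < ennreal \<delta>" using step2 by blast
      show "\<exists>R0. \<forall>R\<ge>R0. \<forall>e>0. \<forall>\<eta>>0. \<exists>F W. rect_family \<mu> k F W \<and>
       emeasure ?Pi (S - {x\<in>space ?Pi. a < fam_step k W x}) < ennreal \<delta> \<and>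
       emeasure P {\<omega>\<in>space P. \<not> close e (fam_val M k W \<omega>) (Z' n R \<omega>)} < ennreal \<eta>"
      proof (rule exI[of _ R0], intro allI impI)
        fix R e \<eta> assume "R0 \<le> R" and e: "(0::real) < e" "(0::real) < \<eta>"
        then have "emeasure ?Pi (S - {x\<in>space ?Pi. a < s' n R x}) < ennreal \<delta>" using R0 by blast
        then show "\<exists>F W. rect_family \<mu> k F W \<and>
          emeasure ?Pi (S - {x\<in>space ?Pi. a < fam_step k W x}) < ennreal \<delta> \<and>
          emeasure P {\<omega>\<in>space P. \<not> close e (fam_val M k W \<omega>) (Z' n R \<omega>)} < ennreal \<eta>"
          by (rule elem_good_family[OF el S(1) _ e])
      qed
    qed
  qed
  show ?thesis by (rule that[OF Zm Z'm Zle lim main])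
qed

lemma fam_step_filter_pos:
  assumes "ennreal a < fam_step k W x" "x \<in> PiE {..<k} (\<lambda>_. F)" "0 \<le> a" "rect_family \<mu> k F' W"
  shows "0 < fam_step k (cap_fam F {w\<in>W. a \<le> fst w}) x"
proof -
  obtain w where w: "w \<in> W" "ennreal a < ennreal (fst w) * indicator (PiE {..<k} (snd w)) x"
    using assms(1) unfolding fam_step_def less_SUP_iff by blast
  have xw: "x \<in> PiE {..<k} (snd w)" using w(2) by (cases "x \<in> PiE {..<k} (snd w)") simp_all
  then have "a < fst w" using w(2) assms(3) by (simp add: ennreal_less_iff)
  moreover have "0 < fst w" using assms(4) w(1) by (simp add: rect_family_def)
  ultimately have "0 < fam_step k {w\<in>W. a \<le> fst w} x" unfolding fam_step_pos_iff using w(1) xw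
    by (intro bexI[of _ w]) simp_all
  then show ?thesis unfolding fam_step_cap using assms(2) by simp
qed

text \<open>\<open>joint_lower\<close> asks for weights bounded below by \<open>a\<close> and for a
  frame \<open>F\<close> of finite measure fixed in advance. Dropping rectangles and shrinking sides
  provides both and can only lower the value.\<close>

lemma fam_val_filter_le:
  assumes W: "rect_family \<mu> k F' W" and F: "F \<in> sets \<mu>"
  shows "AE \<omega> in P. fam_val M k (cap_fam F {w\<in>W. a \<le> fst w}) \<omega> \<le> fam_val M k W \<omega>"
    "rect_family \<mu> k F (cap_fam F {w\<in>W. a \<le> fst w})"
proof -
  have W': "rect_family \<mu> k F' {w\<in>W. a \<le> fst w}" using W unfolding rect_family_def by auto
  show "rect_family \<mu> k F (cap_fam F {w\<in>W. a \<le> fst w})"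
    by (rule rect_family_mono[OF rect_family_cap[OF W' F]]) simp
  show "AE \<omega> in P. fam_val M k (cap_fam F {w\<in>W. a \<le> fst w}) \<omega> \<le> fam_val M k W \<omega>"
    using fam_val_split[OF W' F]
  proof eventually_elim
    case (elim \<omega>)
    have "fam_val M k {w\<in>W. a \<le> fst w} \<omega> \<le> fam_val M k W \<omega>"
      unfolding fam_val_def by (rule SUP_subset_mono) auto
    then show ?case using elim by (meson order_trans)
  qed
qed

section \<open>Gluing two product spaces along a common coordinate\<close>

lemma glue_update_measurable:
  assumes "r < p" "r' < q"
  shows "(\<lambda>(s, x, z). x(r := s)) \<in> measurable (glue_measure p r q r') (power_measure \<mu> p)"
    "(\<lambda>(s, x, z). z(r' := s)) \<in> measurable (glue_measure p r q r') (power_measure \<mu> q)"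
proof -
  have ins: "insert r ({..<p} - {r}) = {..<p}" "insert r' ({..<q} - {r'}) = {..<q}" using assms by auto
  have a1: "(\<lambda>(f, y). f(r := y)) \<in> measurable (PiM ({..<p} - {r}) (\<lambda>_. \<mu>) \<Otimes>\<^sub>M \<mu>) (power_measure \<mu> p)"
    using measurable_add_dim[of r "{..<p} - {r}" "\<lambda>_. \<mu>"] unfolding ins .
  have a2: "(\<lambda>(f, y). f(r' := y)) \<in> measurable (PiM ({..<q} - {r'}) (\<lambda>_. \<mu>) \<Otimes>\<^sub>M \<mu>) (power_measure \<mu> q)"
    using measurable_add_dim[of r' "{..<q} - {r'}" "\<lambda>_. \<mu>"] unfolding ins .
  have b1: "(\<lambda>w. (fst (snd w), fst w)) \<in> measurable (glue_measure p r q r') (PiM ({..<p} - {r}) (\<lambda>_. \<mu>) \<Otimes>\<^sub>M \<mu>)"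
    and b2: "(\<lambda>w. (snd (snd w), fst w)) \<in> measurable (glue_measure p r q r') (PiM ({..<q} - {r'}) (\<lambda>_. \<mu>) \<Otimes>\<^sub>M \<mu>)"
    unfolding glue_measure_def by measurable
  show "(\<lambda>(s, x, z). x(r := s)) \<in> measurable (glue_measure p r q r') (power_measure \<mu> p)"
    using measurable_compose[OF b1 a1] by (simp add: case_prod_beta')
  show "(\<lambda>(s, x, z). z(r' := s)) \<in> measurable (glue_measure p r q r') (power_measure \<mu> q)"
    using measurable_compose[OF b2 a2] by (simp add: case_prod_beta')
qed

definition glue_set :: "nat \<Rightarrow> nat \<Rightarrow> nat \<Rightarrow> nat \<Rightarrow> (nat \<Rightarrow> 'a) set \<Rightarrow> (nat \<Rightarrow> 'a) set \<Rightarrow> ('a \<times> ((nat \<Rightarrow> 'a) \<times> (nat \<Rightarrow> 'a))) set" where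
  "glue_set p r q r' A B = {w\<in>space (glue_measure p r q r').
     (fst (snd w))(r := fst w) \<in> A \<and> (snd (snd w))(r' := fst w) \<in> B}"

lemma glue_set_measurable:
  assumes r: "r < p" "r' < q" and A: "A \<in> sets (power_measure \<mu> p)" and B: "B \<in> sets (power_measure \<mu> q)"
  shows "glue_set p r q r' A B \<in> sets (glue_measure p r q r')"
proof -
  have "glue_set p r q r' A B =
    ((\<lambda>(s, x, z). x(r := s)) -` A \<inter> space (glue_measure p r q r')) \<inter> ((\<lambda>(s, x, z). z(r' := s)) -` B \<inter> space (glue_measure p r q r'))"
    unfolding glue_set_def by auto
  then show ?thesis
    using measurable_sets[OF glue_update_measurable(1)[OF r] A] measurable_sets[OF glue_update_measurable(2)[OF r] B] by auto
qed

lemma glue_nn_integral: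
  assumes H: "H \<in> sets (glue_measure p r q r')"
  shows "emeasure (glue_measure p r q r') H =
    (\<integral>\<^sup>+ s. \<integral>\<^sup>+ x. \<integral>\<^sup>+ z. indicator H (s, x, z) \<partial>PiM ({..<q} - {r'}) (\<lambda>_. \<mu>) \<partial>PiM ({..<p} - {r}) (\<lambda>_. \<mu>) \<partial>\<mu>)"
proof -
  have s1: "sigma_finite_measure (PiM ({..<p} - {r}) (\<lambda>_. \<mu>))" by (rule mu.sigma_finite) simp
  interpret s2: sigma_finite_measure "PiM ({..<q} - {r'}) (\<lambda>_. \<mu>)" by (rule mu.sigma_finite) simp
  interpret Q: pair_sigma_finite "PiM ({..<p} - {r}) (\<lambda>_. \<mu>)" "PiM ({..<q} - {r'}) (\<lambda>_. \<mu>)"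
    using s1 s2.sigma_finite_measure_axioms by (simp add: pair_sigma_finite_def)
  let ?Q = "PiM ({..<p} - {r}) (\<lambda>_. \<mu>) \<Otimes>\<^sub>M PiM ({..<q} - {r'}) (\<lambda>_. \<mu>)"
  have ind: "(indicator H :: _ \<Rightarrow> ennreal) \<in> borel_measurable (\<mu> \<Otimes>\<^sub>M ?Q)" using H unfolding glue_measure_def by simp
  have "emeasure (glue_measure p r q r') H = (\<integral>\<^sup>+ w. indicator H w \<partial>(\<mu> \<Otimes>\<^sub>M ?Q))"
    using H unfolding glue_measure_def by simp
  also have "\<dots> = (\<integral>\<^sup>+ s. \<integral>\<^sup>+ v. indicator H (s, v) \<partial>?Q \<partial>\<mu>)"
    by (rule Q.nn_integral_fst[OF ind, symmetric])
  also have "\<dots> = (\<integral>\<^sup>+ s. \<integral>\<^sup>+ x. \<integral>\<^sup>+ z. indicator H (s, x, z) \<partial>PiM ({..<q} - {r'}) (\<lambda>_. \<mu>) \<partial>PiM ({..<p} - {r}) (\<lambda>_. \<mu>) \<partial>\<mu>)"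
  proof (rule nn_integral_cong)
    fix s assume "s \<in> space \<mu>"
    then have "(\<lambda>v. (indicator H (s, v) :: ennreal)) \<in> borel_measurable ?Q"
      using measurable_compose[OF measurable_Pair1'[of s \<mu> ?Q] ind] by simp
    then show "(\<integral>\<^sup>+ v. indicator H (s, v) \<partial>?Q) = (\<integral>\<^sup>+ x. \<integral>\<^sup>+ z. indicator H (s, x, z) \<partial>PiM ({..<q} - {r'}) (\<lambda>_. \<mu>) \<partial>PiM ({..<p} - {r}) (\<lambda>_. \<mu>))"
      by (rule s2.nn_integral_fst[symmetric])
  qed
  finally show ?thesis .
qed

text \<open>The measure of the section of \<open>A\<close> over the value \<open>s\<close> of
  coordinate \<open>r\<close>.\<close>

definition section_mass :: "nat \<Rightarrow> nat \<Rightarrow> (nat \<Rightarrow> 'a) set \<Rightarrow> 'a \<Rightarrow> ennreal" where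
  "section_mass p r A s = (\<integral>\<^sup>+ x. indicator A (x(r := s)) \<partial>PiM ({..<p} - {r}) (\<lambda>_. \<mu>))"

lemma section_update_measurable:
  assumes "r < p" "s \<in> space \<mu>"
  shows "(\<lambda>x. x(r := s)) \<in> measurable (PiM ({..<p} - {r}) (\<lambda>_. \<mu>)) (power_measure \<mu> p)"
proof -
  have ins: "insert r ({..<p} - {r}) = {..<p}" using assms by auto
  have "(\<lambda>x. (x, s)) \<in> measurable (PiM ({..<p} - {r}) (\<lambda>_. \<mu>)) (PiM ({..<p} - {r}) (\<lambda>_. \<mu>) \<Otimes>\<^sub>M \<mu>)"
    using assms(2) by measurable
  from measurable_compose[OF this measurable_add_dim[of r "{..<p} - {r}" "\<lambda>_. \<mu>"]]
  show ?thesis unfolding ins by simp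
qed

lemma section_mass_measurable:
  assumes r: "r < p" and A: "A \<in> sets (power_measure \<mu> p)"
  shows "section_mass p r A \<in> borel_measurable \<mu>"
proof -
  interpret s1: sigma_finite_measure "PiM ({..<p} - {r}) (\<lambda>_. \<mu>)" by (rule mu.sigma_finite) simp
  have ins: "insert r ({..<p} - {r}) = {..<p}" using r by auto
  have "(\<lambda>w. (snd w, fst w)) \<in> measurable (\<mu> \<Otimes>\<^sub>M PiM ({..<p} - {r}) (\<lambda>_. \<mu>)) (PiM ({..<p} - {r}) (\<lambda>_. \<mu>) \<Otimes>\<^sub>M \<mu>)"
    by measurable
  from measurable_compose[OF this measurable_add_dim[of r "{..<p} - {r}" "\<lambda>_. \<mu>"]]
  have "(\<lambda>w. (snd w)(r := fst w)) \<in> measurable (\<mu> \<Otimes>\<^sub>M PiM ({..<p} - {r}) (\<lambda>_. \<mu>)) (power_measure \<mu> p)"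
    unfolding ins by simp
  then have "(\<lambda>w. indicator A ((snd w)(r := fst w)) :: ennreal) \<in> borel_measurable (\<mu> \<Otimes>\<^sub>M PiM ({..<p} - {r}) (\<lambda>_. \<mu>))"
    by (rule measurable_compose) (use A in simp)
  then have "(\<lambda>(s, x). indicator A (x(r := s)) :: ennreal) \<in> borel_measurable (\<mu> \<Otimes>\<^sub>M PiM ({..<p} - {r}) (\<lambda>_. \<mu>))"
    by (simp add: case_prod_beta')
  then show ?thesis unfolding section_mass_def[abs_def] by (rule s1.borel_measurable_nn_integral)
qed

lemma emeasure_section:
  assumes r: "r < p" and A: "A \<in> sets (power_measure \<mu> p)"
  shows "emeasure (power_measure \<mu> p) A = (\<integral>\<^sup>+ s. section_mass p r A s \<partial>\<mu>)"
proof -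
  have ins: "insert r ({..<p} - {r}) = {..<p}" using r by auto
  have "emeasure (power_measure \<mu> p) A = (\<integral>\<^sup>+ x. indicator A x \<partial>power_measure \<mu> p)" using A by simp
  also have "\<dots> = (\<integral>\<^sup>+ s. \<integral>\<^sup>+ x. indicator A (x(r := s)) \<partial>PiM ({..<p} - {r}) (\<lambda>_. \<mu>) \<partial>\<mu>)"
    using mu.product_nn_integral_insert_rev[of "{..<p} - {r}" r "indicator A"] A unfolding ins by simp
  finally show ?thesis by (simp only: section_mass_def)
qed

text \<open>Fubini: once the shared coordinate is fixed, the two conditions concern different
  factors, and the inner integral splits.\<close>

lemma emeasure_glue_set:
  assumes r: "r < p" "r' < q" and A: "A \<in> sets (power_measure \<mu> p)" and B: "B \<in> sets (power_measure \<mu> q)"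
  shows "emeasure (glue_measure p r q r') (glue_set p r q r' A B) = (\<integral>\<^sup>+ s. section_mass p r A s * section_mass q r' B s \<partial>\<mu>)"
  unfolding glue_nn_integral[OF glue_set_measurable[OF r A B]]
proof (rule nn_integral_cong)
  fix s assume s: "s \<in> space \<mu>"
  let ?P1 = "PiM ({..<p} - {r}) (\<lambda>_. \<mu>)" and ?P2 = "PiM ({..<q} - {r'}) (\<lambda>_. \<mu>)"
  have m1: "(\<lambda>x. indicator A (x(r := s)) :: ennreal) \<in> borel_measurable ?P1"
    by (rule measurable_compose[OF section_update_measurable[OF r(1) s]]) (use A in simp)
  have m2: "(\<lambda>x. indicator B (x(r' := s)) :: ennreal) \<in> borel_measurable ?P2"
    by (rule measurable_compose[OF section_update_measurable[OF r(2) s]]) (use B in simp)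
  have "(\<integral>\<^sup>+ x. \<integral>\<^sup>+ z. indicator (glue_set p r q r' A B) (s, x, z) \<partial>?P2 \<partial>?P1) =
     (\<integral>\<^sup>+ x. \<integral>\<^sup>+ z. indicator A (x(r := s)) * indicator B (z(r' := s)) \<partial>?P2 \<partial>?P1)"
  proof (intro nn_integral_cong)
    fix x z assume "x \<in> space ?P1" "z \<in> space ?P2"
    then have "(s, x, z) \<in> space (glue_measure p r q r')" using s unfolding glue_measure_def by (simp add: space_pair_measure)
    then have "((s, x, z) \<in> glue_set p r q r' A B) = (x(r := s) \<in> A \<and> z(r' := s) \<in> B)" unfolding glue_set_def by simp
    then show "indicator (glue_set p r q r' A B) (s, x, z) = (indicator A (x(r := s)) * indicator B (z(r' := s)) :: ennreal)"
      by (simp add: indicator_def)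
  qed
  also have "\<dots> = (\<integral>\<^sup>+ x. indicator A (x(r := s)) * section_mass q r' B s \<partial>?P1)"
    unfolding section_mass_def by (intro nn_integral_cong nn_integral_cmult m2)
  also have "\<dots> = section_mass p r A s * section_mass q r' B s"
    unfolding section_mass_def by (rule nn_integral_multc[OF m1])
  finally show "(\<integral>\<^sup>+ x. \<integral>\<^sup>+ z. indicator (glue_set p r q r' A B) (s, x, z) \<partial>?P2 \<partial>?P1) = section_mass p r A s * section_mass q r' B s" .
qed

lemma section_mass_le:
  assumes F: "F \<in> sets \<mu>" and r: "r < p" and A: "A \<subseteq> PiE {..<p} (\<lambda>_. F)"
  shows "section_mass p r A s \<le> emeasure \<mu> F ^ (p - 1)"
proof -
  let ?P1 = "PiM ({..<p} - {r}) (\<lambda>_. \<mu>)"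
  have "section_mass p r A s \<le> (\<integral>\<^sup>+ x. indicator (PiE ({..<p} - {r}) (\<lambda>_. F)) x \<partial>?P1)"
    unfolding section_mass_def
  proof (rule nn_integral_mono)
    fix x assume x: "x \<in> space ?P1"
    show "indicator A (x(r := s)) \<le> (indicator (PiE ({..<p} - {r}) (\<lambda>_. F)) x :: ennreal)"
    proof (cases "x(r := s) \<in> A")
      case True
      then have xs: "x(r := s) \<in> PiE {..<p} (\<lambda>_. F)" using A by blast
      have "x t \<in> F" if "t \<in> {..<p} - {r}" for t
      proof -
        have "(x(r := s)) t \<in> F" using xs that by (auto simp only: PiE_iff)
        then show ?thesis using that by simp
      qed
      then have "x \<in> PiE ({..<p} - {r}) (\<lambda>_. F)" using x by (simp add: space_PiM PiE_iff)
      then show ?thesis using True by simp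
    qed simp
  qed
  also have "\<dots> = emeasure ?P1 (PiE ({..<p} - {r}) (\<lambda>_. F))"
    using F by (intro nn_integral_indicator sets_PiM_I_finite) auto
  also have "\<dots> = emeasure \<mu> F ^ (p - 1)" using F r by (subst mu.emeasure_PiM) simp_all
  finally show ?thesis .
qed

text \<open>A set of small measure keeps a small measure after gluing, because the sections of the
  other set lie in a power of \<open>F\<close> and have bounded mass.\<close>

lemma glue_set_diff_bound:
  assumes r: "r < p" "r' < q" and F: "F \<in> sets \<mu>"
    and A: "A \<in> sets (power_measure \<mu> p)" "A \<subseteq> PiE {..<p} (\<lambda>_. F)" and B: "B \<in> sets (power_measure \<mu> q)" "B \<subseteq> PiE {..<q} (\<lambda>_. F)"
  shows "emeasure (glue_measure p r q r') (glue_set p r q r' A B) \<le> emeasure (power_measure \<mu> p) A * emeasure \<mu> F ^ (q - 1)"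
    "emeasure (glue_measure p r q r') (glue_set p r q r' A B) \<le> emeasure (power_measure \<mu> q) B * emeasure \<mu> F ^ (p - 1)"
proof -
  have "(\<integral>\<^sup>+ s. section_mass p r A s * section_mass q r' B s \<partial>\<mu>) \<le> (\<integral>\<^sup>+ s. section_mass p r A s * emeasure \<mu> F ^ (q - 1) \<partial>\<mu>)"
    by (intro nn_integral_mono mult_left_mono section_mass_le F r B) simp
  also have "\<dots> = (\<integral>\<^sup>+ s. section_mass p r A s \<partial>\<mu>) * emeasure \<mu> F ^ (q - 1)"
    by (rule nn_integral_multc[OF section_mass_measurable[OF r(1) A(1)]])
  finally show "emeasure (glue_measure p r q r') (glue_set p r q r' A B) \<le> emeasure (power_measure \<mu> p) A * emeasure \<mu> F ^ (q - 1)"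
    unfolding emeasure_glue_set[OF r A(1) B(1)] emeasure_section[OF r(1) A(1)] .
  have "(\<integral>\<^sup>+ s. section_mass p r A s * section_mass q r' B s \<partial>\<mu>) \<le> (\<integral>\<^sup>+ s. section_mass q r' B s * emeasure \<mu> F ^ (p - 1) \<partial>\<mu>)"
    unfolding mult.commute[of "section_mass p r A _"]
    by (intro nn_integral_mono mult_left_mono section_mass_le F r A) simp
  also have "\<dots> = (\<integral>\<^sup>+ s. section_mass q r' B s \<partial>\<mu>) * emeasure \<mu> F ^ (p - 1)"
    by (rule nn_integral_multc[OF section_mass_measurable[OF r(2) B(1)]])
  finally show "emeasure (glue_measure p r q r') (glue_set p r q r' A B) \<le> emeasure (power_measure \<mu> q) B * emeasure \<mu> F ^ (p - 1)"
    unfolding emeasure_glue_set[OF r A(1) B(1)] emeasure_section[OF r(2) B(1)] .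
qed

text \<open>Carries \<open>joint_lower\<close> to the integrals. The families capture
  \<open>A\<close> and \<open>B\<close> up to sets of measure below \<delta>; each of the two losses
  costs at most \<theta> of the glued mass, which is at least three times \<theta>, so \<theta>
  remains and the constant \<open>c\<close> is the same for all families. In the limits the level
  \<open>a * y\<close> drops to half of it and strict inequalities become weak.\<close>

lemma overlap_joint_tail:
  assumes E: "is_borel_space \<mu>"
    and X: "has_extremal_integral P \<mu> \<alpha> M p f X" and Y: "has_extremal_integral P \<mu> \<alpha> M q g Y"
    and Xm: "X \<in> borel_measurable P" and Ym: "Y \<in> borel_measurable P"
    and r: "r < p" "r' < q" and F: "F \<in> sets \<mu>" "emeasure \<mu> F < \<infinity>" and a: "0 < (a::real)"
    and A: "A \<in> sets (power_measure \<mu> p)" "A \<subseteq> PiE {..<p} (\<lambda>_. F)" "\<And>x. x \<in> A \<Longrightarrow> ennreal a < f x"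
    and B: "B \<in> sets (power_measure \<mu> q)" "B \<subseteq> PiE {..<q} (\<lambda>_. F)" "\<And>x. x \<in> B \<Longrightarrow> ennreal a < g x"
    and ov: "emeasure (glue_measure p r q r') (glue_set p r q r' A B) \<noteq> 0"
  shows "\<exists>c>0. \<forall>y\<ge>1. c * y powr (- \<alpha>) \<le> P.prob {\<omega>\<in>space P. ennreal (a * y / 2) \<le> X \<omega> \<and> ennreal (a * y / 2) \<le> Y \<omega>}"
proof -
  let ?G = "glue_measure p r q r'"
  obtain \<theta> :: real where \<theta>: "0 < \<theta>" "ennreal (3 * \<theta>) \<le> emeasure ?G (glue_set p r q r' A B)"
  proof (cases "emeasure ?G (glue_set p r q r' A B)")
    case (real x)
    then have "0 < x" using ov by (simp add: less_le)
    then show ?thesis using real by (intro that[of "x / 3"]) auto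
  next
    case top
    then show ?thesis by (intro that[of 1]) auto
  qed
  define L where "L = measure \<mu> F"
  have FL: "emeasure \<mu> F = ennreal L" "0 \<le> L"
    using F(2) unfolding L_def by (auto intro!: emeasure_eq_ennreal_measure simp: less_top)
  \<comment> \<open>The powers of \<open>L\<close> that arise as masses of sections have exponents
    below \<open>p + q\<close>. Since \<open>L + 1 \<ge> 1\<close>, they are all bounded by this
    denominator, so \<delta> times any of them is at most \<theta>.\<close>
  define \<delta> where "\<delta> = \<theta> / ((L + 1) ^ (p + q))"
  have Lp: "0 < (L + 1) ^ (p + q)" using FL by simp
  have d0: "0 < \<delta>" using \<theta> Lp by (simp add: \<delta>_def)
  have cancel: "\<theta> / z * z = \<theta>" if "0 < z" for z :: real using that by simp
  have small: "ennreal \<delta> * emeasure \<mu> F ^ n \<le> ennreal \<theta>" if "n \<le> p + q" for n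
  proof -
    have "L ^ n \<le> (L + 1) ^ n" using FL by (intro power_mono) auto
    also have "\<dots> \<le> (L + 1) ^ (p + q)" using FL that by (intro power_increasing) auto
    finally have "\<delta> * L ^ n \<le> \<delta> * (L + 1) ^ (p + q)" using d0 by (intro mult_left_mono) auto
    also have "\<dots> = \<theta>" unfolding \<delta>_def by (rule cancel[OF Lp])
    finally have "ennreal (\<delta> * L ^ n) \<le> ennreal \<theta>" by (rule ennreal_leI)
    then show ?thesis unfolding FL(1) using d0 FL(2) by (simp add: ennreal_mult ennreal_power)
  qed
  define d where "d = (p - 1) + (q - 1)"
  define c where "c = exp (- measure \<mu> F) ^ Suc d / (2 * (real d + 2 + 2 * measure \<mu> F) ^ Suc d) * \<theta>"
  have c0: "0 < c" using \<theta>(1) by (simp add: c_def add_pos_nonneg)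
  have fam_bound: "c * y powr (- \<alpha>) \<le> P.prob {\<omega>\<in>space P. ennreal (a * y) < fam_val M p U \<omega> \<and> ennreal (a * y) < fam_val M q V \<omega>}"
    if U: "rect_family \<mu> p F1 U" and V: "rect_family \<mu> q F2 V"
      and dU: "emeasure (power_measure \<mu> p) (A - {x\<in>space (power_measure \<mu> p). ennreal a < fam_step p U x}) < ennreal \<delta>"
      and dV: "emeasure (power_measure \<mu> q) (B - {x\<in>space (power_measure \<mu> q). ennreal a < fam_step q V x}) < ennreal \<delta>"
      and y: "1 \<le> y" for U V F1 F2 y
  proof -
    let ?U = "cap_fam F {w\<in>U. a \<le> fst w}" and ?V = "cap_fam F {w\<in>V. a \<le> fst w}"
    have rU: "rect_family \<mu> p F ?U" and rV: "rect_family \<mu> q F ?V"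
      by (rule fam_val_filter_le(2)[OF U F(1)], rule fam_val_filter_le(2)[OF V F(1)])
    let ?SU = "{x\<in>space (power_measure \<mu> p). ennreal a < fam_step p U x}"
    let ?SV = "{x\<in>space (power_measure \<mu> q). ennreal a < fam_step q V x}"
    have SU: "?SU \<in> sets (power_measure \<mu> p)" using fam_step_measurable[OF U] by measurable
    have SV: "?SV \<in> sets (power_measure \<mu> q)" using fam_step_measurable[OF V] by measurable
    have AU: "A - ?SU \<in> sets (power_measure \<mu> p)" "A \<inter> ?SU \<in> sets (power_measure \<mu> p)" using A(1) SU by auto
    have BV: "B - ?SV \<in> sets (power_measure \<mu> q)" "B \<inter> ?SV \<in> sets (power_measure \<mu> q)" using B(1) SV by auto
    let ?g1 = "glue_set p r q r' (A \<inter> ?SU) (B \<inter> ?SV)"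
    let ?g2 = "glue_set p r q r' (A - ?SU) B"
    let ?g3 = "glue_set p r q r' A (B - ?SV)"
    have gm: "?g1 \<in> sets ?G" "?g2 \<in> sets ?G" "?g3 \<in> sets ?G"
      by (rule glue_set_measurable[OF r AU(2) BV(2)], rule glue_set_measurable[OF r AU(1) B(1)], rule glue_set_measurable[OF r A(1) BV(1)])
    have "emeasure ?G (glue_set p r q r' A B) \<le> emeasure ?G (?g1 \<union> (?g2 \<union> ?g3))"
    proof (rule emeasure_mono)
      show "glue_set p r q r' A B \<subseteq> ?g1 \<union> (?g2 \<union> ?g3)" unfolding glue_set_def by blast
      show "?g1 \<union> (?g2 \<union> ?g3) \<in> sets ?G" using gm by (intro sets.Un)
    qed
    also have "emeasure ?G (?g1 \<union> (?g2 \<union> ?g3)) \<le> emeasure ?G ?g1 + emeasure ?G (?g2 \<union> ?g3)"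
      by (rule emeasure_subadditive[OF gm(1) sets.Un[OF gm(2,3)]])
    finally have s1: "emeasure ?G (glue_set p r q r' A B) \<le> emeasure ?G ?g1 + emeasure ?G (?g2 \<union> ?g3)" .
    have s2: "emeasure ?G (?g2 \<union> ?g3) \<le> emeasure ?G ?g2 + emeasure ?G ?g3" by (rule emeasure_subadditive[OF gm(2,3)])
    have AS: "A - ?SU \<subseteq> PiE {..<p} (\<lambda>_. F)" "B - ?SV \<subseteq> PiE {..<q} (\<lambda>_. F)" using A(2) B(2) by blast+
    have "emeasure ?G ?g2 \<le> emeasure (power_measure \<mu> p) (A - ?SU) * emeasure \<mu> F ^ (q - 1)"
      by (rule glue_set_diff_bound(1)[OF r F(1) AU(1) AS(1) B(1,2)])
    also have "\<dots> \<le> ennreal \<delta> * emeasure \<mu> F ^ (q - 1)" using dU by (intro mult_right_mono) auto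
    also have "\<dots> \<le> ennreal \<theta>" by (rule small) simp
    finally have g2: "emeasure ?G ?g2 \<le> ennreal \<theta>" .
    have "emeasure ?G ?g3 \<le> emeasure (power_measure \<mu> q) (B - ?SV) * emeasure \<mu> F ^ (p - 1)"
      by (rule glue_set_diff_bound(2)[OF r F(1) A(1,2) BV(1) AS(2)])
    also have "\<dots> \<le> ennreal \<delta> * emeasure \<mu> F ^ (p - 1)" using dV by (intro mult_right_mono) auto
    also have "\<dots> \<le> ennreal \<theta>" by (rule small) simp
    finally have g3: "emeasure ?G ?g3 \<le> ennreal \<theta>" .
    have "ennreal (3 * \<theta>) \<le> emeasure ?G ?g1 + (ennreal \<theta> + ennreal \<theta>)"
      by (rule order_trans[OF \<theta>(2) order_trans[OF s1 add_left_mono[OF order_trans[OF s2 add_mono[OF g2 g3]]]]])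
    then have g1: "ennreal \<theta> \<le> emeasure ?G ?g1"
      using \<theta>(1) by (cases "emeasure ?G ?g1") (auto simp: ennreal_plus[symmetric] simp del: ennreal_plus)
    let ?H = "{(s, x, z). s \<in> space \<mu> \<and> 0 < fam_step p ?U (x(r := s)) \<and> 0 < fam_step q ?V (z(r' := s)) \<and>
        x \<in> extensional ({..<p} - {r}) \<and> z \<in> extensional ({..<q} - {r'})}"
    have sub: "?g1 \<subseteq> ?H \<inter> space ?G"
    proof
      fix w assume w: "w \<in> ?g1"
      obtain s x z where wd: "w = (s, x, z)" by (cases w) auto
      have sp: "w \<in> space ?G" and xA: "x(r := s) \<in> A \<inter> ?SU" and zB: "z(r' := s) \<in> B \<inter> ?SV"
        using w unfolding glue_set_def wd by auto
      have ssp: "s \<in> space \<mu>" "x \<in> extensional ({..<p} - {r})" "z \<in> extensional ({..<q} - {r'})"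
        using sp unfolding wd glue_measure_def by (auto simp: space_pair_measure space_PiM PiE_iff)
      have "0 < fam_step p ?U (x(r := s))"
        by (rule fam_step_filter_pos[OF _ _ _ U]) (use xA A(2) a in auto)
      moreover have "0 < fam_step q ?V (z(r' := s))"
        by (rule fam_step_filter_pos[OF _ _ _ V]) (use zB B(2) a in auto)
      ultimately show "w \<in> ?H \<inter> space ?G" using ssp sp unfolding wd by simp
    qed
    have Hm: "?H \<inter> space ?G \<in> sets ?G"
    proof -
      have PU: "{x\<in>space (power_measure \<mu> p). 0 < fam_step p ?U x} \<in> sets (power_measure \<mu> p)"
        using fam_step_measurable[OF rU] by measurable
      have PV: "{x\<in>space (power_measure \<mu> q). 0 < fam_step q ?V x} \<in> sets (power_measure \<mu> q)"
        using fam_step_measurable[OF rV] by measurable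
      have "?H \<inter> space ?G = glue_set p r q r' {x\<in>space (power_measure \<mu> p). 0 < fam_step p ?U x} {x\<in>space (power_measure \<mu> q). 0 < fam_step q ?V x}"
      proof (intro set_eqI)
        fix w :: "'a \<times> ((nat \<Rightarrow> 'a) \<times> (nat \<Rightarrow> 'a))"
        obtain s x z where wd: "w = (s, x, z)" by (cases w) auto
        have "x(r := s) \<in> space (power_measure \<mu> p)" "z(r' := s) \<in> space (power_measure \<mu> q)"
          "s \<in> space \<mu>" "x \<in> extensional ({..<p} - {r})" "z \<in> extensional ({..<q} - {r'})" if w: "w \<in> space ?G"
        proof -
          show "x(r := s) \<in> space (power_measure \<mu> p)" "z(r' := s) \<in> space (power_measure \<mu> q)"
            using measurable_space[OF glue_update_measurable(1)[OF r] w] measurable_space[OF glue_update_measurable(2)[OF r] w]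
            unfolding wd by simp_all
          show "s \<in> space \<mu>" "x \<in> extensional ({..<p} - {r})" "z \<in> extensional ({..<q} - {r'})"
            using w unfolding wd glue_measure_def by (auto simp: space_pair_measure space_PiM PiE_iff)
        qed
        then show "(w \<in> ?H \<inter> space ?G) = (w \<in> glue_set p r q r' {x\<in>space (power_measure \<mu> p). 0 < fam_step p ?U x} {x\<in>space (power_measure \<mu> q). 0 < fam_step q ?V x})"
          unfolding glue_set_def wd by auto
      qed
      then show ?thesis using glue_set_measurable[OF r PU PV] by simp
    qed
    have H1: "ennreal \<theta> \<le> emeasure ?G (?H \<inter> space ?G)"
      by (rule order_trans[OF g1 emeasure_mono[OF sub Hm]])
    have jl: "c * y powr (- \<alpha>) \<le> P.prob {\<omega>\<in>space P. ennreal (a * y) < fam_val M p ?U \<omega> \<and> ennreal (a * y) < fam_val M q ?V \<omega>}"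
      unfolding c_def
    proof (rule joint_lower[OF F rU _ rV _ a r y _ _ d_def])
      show "\<forall>w\<in>?U. a \<le> fst w" "\<forall>w\<in>?V. a \<le> fst w" by (auto simp: cap_fam_def)
      show "0 \<le> \<theta>" using \<theta>(1) by simp
      \<comment> \<open>\<open>joint_lower\<close> speaks of all extensional triples. Positivity of
        the step functions puts every coordinate into \<open>F\<close>, so no triple falls outside
        the space.\<close>
      have "?H \<subseteq> space ?G"
      proof
        fix w assume "w \<in> ?H"
        then obtain s x z where w: "w = (s, x, z)" "s \<in> space \<mu>" "0 < fam_step p ?U (x(r := s))" "0 < fam_step q ?V (z(r' := s))"
          "x \<in> extensional ({..<p} - {r})" "z \<in> extensional ({..<q} - {r'})" by blast
        have Fs: "F \<subseteq> space \<mu>" by (rule sets.sets_into_space[OF F(1)])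
        have x1: "(x(r := s)) t \<in> F" if "t < p" for t using fam_step_pos_subset[OF rU w(3)] that by (auto simp only: PiE_iff)
        have z1: "(z(r' := s)) t \<in> F" if "t < q" for t using fam_step_pos_subset[OF rV w(4)] that by (auto simp only: PiE_iff)
        have "x t \<in> space \<mu>" if "t \<in> {..<p} - {r}" for t using x1[of t] that Fs by auto
        moreover have "z t \<in> space \<mu>" if "t \<in> {..<q} - {r'}" for t using z1[of t] that Fs by auto
        ultimately show "w \<in> space ?G" unfolding w(1) glue_measure_def
          using w(2,5,6) by (simp add: space_pair_measure space_PiM PiE_iff)
      qed
      then have "?H \<inter> space ?G = ?H" by blast
      then show "ennreal \<theta> \<le> emeasure ?G ?H" using H1 by simp
    qed
    have vm: "fam_val M p U \<in> borel_measurable P" "fam_val M q V \<in> borel_measurable P"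
      by (rule fam_val_measurable[OF _ U], simp) (rule fam_val_measurable[OF _ V], simp)
    have "P.prob {\<omega>\<in>space P. ennreal (a * y) < fam_val M p ?U \<omega> \<and> ennreal (a * y) < fam_val M q ?V \<omega>} \<le>
      P.prob {\<omega>\<in>space P. ennreal (a * y) < fam_val M p U \<omega> \<and> ennreal (a * y) < fam_val M q V \<omega>}"
    proof (rule P.finite_measure_mono_AE)
      show "AE \<omega> in P. \<omega> \<in> {\<omega>\<in>space P. ennreal (a * y) < fam_val M p ?U \<omega> \<and> ennreal (a * y) < fam_val M q ?V \<omega>} \<longrightarrow>
         \<omega> \<in> {\<omega>\<in>space P. ennreal (a * y) < fam_val M p U \<omega> \<and> ennreal (a * y) < fam_val M q V \<omega>}"
        using fam_val_filter_le(1)[OF U F(1), of a] fam_val_filter_le(1)[OF V F(1), of a]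
        by eventually_elim (auto intro: less_le_trans)
      show "{\<omega>\<in>space P. ennreal (a * y) < fam_val M p U \<omega> \<and> ennreal (a * y) < fam_val M q V \<omega>} \<in> sets P"
        using vm by measurable
    qed
    then show ?thesis using jl by linarith
  qed
  show ?thesis
  proof (rule exI[of _ c], intro conjI c0 allI impI)
    fix y :: real assume y: "1 \<le> y"
    let ?b = "ennreal (a * y / 2)"
    \<comment> \<open>Half of the level \<open>a * y\<close> is reserved for the error of
      approximating \<open>Zf'\<close> and \<open>Zg'\<close> by family values.\<close>
    define e where "e = a * y / 2"
    have e0: "0 < e" using a y by (simp add: e_def)
    have ee: "ennreal (a * y) = ennreal e + ennreal e" using e0 by (simp add: e_def ennreal_plus[symmetric] del: ennreal_plus)
    show "c * y powr (- \<alpha>) \<le> P.prob {\<omega>\<in>space P. ?b \<le> X \<omega> \<and> ?b \<le> Y \<omega>}"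
    proof (rule integral_good_family[OF E X], rule integral_good_family[OF E Y])
      fix Zf Zf' Zg Zg'
      assume Zfm: "\<And>n. Zf n \<in> borel_measurable P" and Zf'm: "\<And>n R::nat. Zf' (n::nat) R \<in> borel_measurable P"
        and Zfle: "\<And>n R. AE \<omega> in P. Zf' n R \<omega> \<le> Zf n \<omega>" and limf: "AE \<omega> in P. (\<lambda>n. Zf n \<omega>) \<longlonglongrightarrow> X \<omega>"
        and gf: "\<And>S a \<delta>. S \<in> sets (power_measure \<mu> p) \<Longrightarrow> emeasure (power_measure \<mu> p) S < \<infinity> \<Longrightarrow> (\<And>x. x \<in> S \<Longrightarrow> a < f x) \<Longrightarrow> 0 < \<delta> \<Longrightarrow>
          \<exists>n0. \<forall>n\<ge>n0. \<exists>R0. \<forall>R\<ge>R0. \<forall>e>0. \<forall>\<eta>>0. \<exists>F W. rect_family \<mu> p F W \<and>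
          emeasure (power_measure \<mu> p) (S - {x\<in>space (power_measure \<mu> p). a < fam_step p W x}) < ennreal \<delta> \<and>
          emeasure P {\<omega>\<in>space P. \<not> close e (fam_val M p W \<omega>) (Zf' n R \<omega>)} < ennreal \<eta>"
        and Zgm: "\<And>n. Zg n \<in> borel_measurable P" and Zg'm: "\<And>n R::nat. Zg' (n::nat) R \<in> borel_measurable P"
        and Zgle: "\<And>n R. AE \<omega> in P. Zg' n R \<omega> \<le> Zg n \<omega>" and limg: "AE \<omega> in P. (\<lambda>n. Zg n \<omega>) \<longlonglongrightarrow> Y \<omega>"
        and gg: "\<And>S a \<delta>. S \<in> sets (power_measure \<mu> q) \<Longrightarrow> emeasure (power_measure \<mu> q) S < \<infinity> \<Longrightarrow> (\<And>x. x \<in> S \<Longrightarrow> a < g x) \<Longrightarrow> 0 < \<delta> \<Longrightarrow>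
          \<exists>n0. \<forall>n\<ge>n0. \<exists>R0. \<forall>R\<ge>R0. \<forall>e>0. \<forall>\<eta>>0. \<exists>F W. rect_family \<mu> q F W \<and>
          emeasure (power_measure \<mu> q) (S - {x\<in>space (power_measure \<mu> q). a < fam_step q W x}) < ennreal \<delta> \<and>
          emeasure P {\<omega>\<in>space P. \<not> close e (fam_val M q W \<omega>) (Zg' n R \<omega>)} < ennreal \<eta>"
      have Ffin: "emeasure (PiM {..<n::nat} (\<lambda>_. \<mu>)) (PiE {..<n} (\<lambda>_. F)) < \<infinity>" for n
        using F by (subst mu.emeasure_PiM) (simp_all add: power_less_top_ennreal)
      have FP: "PiE {..<n::nat} (\<lambda>_. F) \<in> sets (power_measure \<mu> n)" for n using F by (intro sets_PiM_I_finite) auto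
      have Afin: "emeasure (power_measure \<mu> p) A < \<infinity>" using emeasure_mono[OF A(2) FP] Ffin by (rule le_less_trans)
      have Bfin: "emeasure (power_measure \<mu> q) B < \<infinity>" using emeasure_mono[OF B(2) FP] Ffin by (rule le_less_trans)
      obtain nf where nf: "\<forall>n\<ge>nf. \<exists>R0. \<forall>R\<ge>R0. \<forall>e>0. \<forall>\<eta>>0. \<exists>F W. rect_family \<mu> p F W \<and>
          emeasure (power_measure \<mu> p) (A - {x\<in>space (power_measure \<mu> p). ennreal a < fam_step p W x}) < ennreal \<delta> \<and>
          emeasure P {\<omega>\<in>space P. \<not> close e (fam_val M p W \<omega>) (Zf' n R \<omega>)} < ennreal \<eta>"
        by (rule exE[OF gf[OF A(1) Afin _ d0]], rule A(3))
      obtain ng where ng: "\<forall>n\<ge>ng. \<exists>R0. \<forall>R\<ge>R0. \<forall>e>0. \<forall>\<eta>>0. \<exists>F W. rect_family \<mu> q F W \<and>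
          emeasure (power_measure \<mu> q) (B - {x\<in>space (power_measure \<mu> q). ennreal a < fam_step q W x}) < ennreal \<delta> \<and>
          emeasure P {\<omega>\<in>space P. \<not> close e (fam_val M q W \<omega>) (Zg' n R \<omega>)} < ennreal \<eta>"
        by (rule exE[OF gg[OF B(1) Bfin _ d0]], rule B(3))
      let ?Gn = "\<lambda>n. {\<omega>\<in>space P. ?b < Zf n \<omega> \<and> ?b < Zg n \<omega>}"
      have Gm: "?Gn n \<in> sets P" for n using Zfm[of n] Zgm[of n] by measurable
      have Gn: "c * y powr (- \<alpha>) \<le> P.prob (?Gn n)" if n: "nf \<le> n" "ng \<le> n" for n
      proof (rule field_le_epsilon)
        fix \<eta>' :: real assume "0 < \<eta>'"
        define \<eta> where "\<eta> = \<eta>' / 2"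
        have eta: "0 < \<eta>" using \<open>0 < \<eta>'\<close> by (simp add: \<eta>_def)
        obtain Rf where Rf: "\<forall>R\<ge>Rf. \<forall>e>0. \<forall>\<eta>>0. \<exists>F W. rect_family \<mu> p F W \<and>
          emeasure (power_measure \<mu> p) (A - {x\<in>space (power_measure \<mu> p). ennreal a < fam_step p W x}) < ennreal \<delta> \<and>
          emeasure P {\<omega>\<in>space P. \<not> close e (fam_val M p W \<omega>) (Zf' n R \<omega>)} < ennreal \<eta>"
          using nf n(1) by blast
        obtain Rg where Rg: "\<forall>R\<ge>Rg. \<forall>e>0. \<forall>\<eta>>0. \<exists>F W. rect_family \<mu> q F W \<and>
          emeasure (power_measure \<mu> q) (B - {x\<in>space (power_measure \<mu> q). ennreal a < fam_step q W x}) < ennreal \<delta> \<and>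
          emeasure P {\<omega>\<in>space P. \<not> close e (fam_val M q W \<omega>) (Zg' n R \<omega>)} < ennreal \<eta>"
          using ng n(2) by blast
        define R where "R = max Rf Rg"
        obtain F1 U where U: "rect_family \<mu> p F1 U"
          "emeasure (power_measure \<mu> p) (A - {x\<in>space (power_measure \<mu> p). ennreal a < fam_step p U x}) < ennreal \<delta>"
          "emeasure P {\<omega>\<in>space P. \<not> close e (fam_val M p U \<omega>) (Zf' n R \<omega>)} < ennreal \<eta>"
          using Rf e0 eta unfolding R_def by (meson max.cobounded1)
        obtain F2 V where V: "rect_family \<mu> q F2 V"
          "emeasure (power_measure \<mu> q) (B - {x\<in>space (power_measure \<mu> q). ennreal a < fam_step q V x}) < ennreal \<delta>"
          "emeasure P {\<omega>\<in>space P. \<not> close e (fam_val M q V \<omega>) (Zg' n R \<omega>)} < ennreal \<eta>"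
          using Rg e0 eta unfolding R_def by (meson max.cobounded2)
        have vm: "fam_val M p U \<in> borel_measurable P" "fam_val M q V \<in> borel_measurable P"
          by (rule fam_val_measurable[OF _ U(1)], simp) (rule fam_val_measurable[OF _ V(1)], simp)
        let ?X1 = "{\<omega>\<in>space P. \<not> close e (fam_val M p U \<omega>) (Zf' n R \<omega>)}"
        let ?X2 = "{\<omega>\<in>space P. \<not> close e (fam_val M q V \<omega>) (Zg' n R \<omega>)}"
        have Xs: "?X1 \<in> sets P" "?X2 \<in> sets P" using vm Zf'm[of n R] Zg'm[of n R] by measurable
        have xb: "ennreal e < z" if "close e v z" "ennreal (a * y) < v" for v z
        proof (rule ccontr)
          assume "\<not> ennreal e < z"
          then have "z + ennreal e \<le> ennreal e + ennreal e" by (intro add_right_mono) (simp add: not_less)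
          moreover have "v \<le> z + ennreal e" using that(1) by (simp add: close_def)
          ultimately have "v \<le> ennreal (a * y)" unfolding ee by (rule order_trans[rotated])
          then show False using that(2) by simp
        qed
        have "P.prob {\<omega>\<in>space P. ennreal (a * y) < fam_val M p U \<omega> \<and> ennreal (a * y) < fam_val M q V \<omega>} \<le> P.prob (?Gn n \<union> (?X1 \<union> ?X2))"
        proof (rule P.finite_measure_mono_AE)
          show "AE \<omega> in P. \<omega> \<in> {\<omega>\<in>space P. ennreal (a * y) < fam_val M p U \<omega> \<and> ennreal (a * y) < fam_val M q V \<omega>} \<longrightarrow> \<omega> \<in> ?Gn n \<union> (?X1 \<union> ?X2)"
            using Zfle[of n R] Zgle[of n R]
          proof eventually_elim
            case (elim \<omega>)
            show ?case
            proof (intro impI, rule ccontr)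
              assume h: "\<omega> \<in> {\<omega>\<in>space P. ennreal (a * y) < fam_val M p U \<omega> \<and> ennreal (a * y) < fam_val M q V \<omega>}" and no: "\<omega> \<notin> ?Gn n \<union> (?X1 \<union> ?X2)"
              then have "close e (fam_val M p U \<omega>) (Zf' n R \<omega>)" "close e (fam_val M q V \<omega>) (Zg' n R \<omega>)" by blast+
              then have "ennreal e < Zf' n R \<omega>" "ennreal e < Zg' n R \<omega>" using xb h by blast+
              then have "ennreal e < Zf n \<omega>" "ennreal e < Zg n \<omega>" using elim by (auto intro: less_le_trans)
              then show False using no h unfolding e_def by blast
            qed
          qed
          show "?Gn n \<union> (?X1 \<union> ?X2) \<in> sets P" using Gm Xs by (intro sets.Un)
        qed
        also have "\<dots> \<le> P.prob (?Gn n) + P.prob (?X1 \<union> ?X2)" by (rule measure_Un_le[OF Gm sets.Un[OF Xs]])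
        also have "\<dots> \<le> P.prob (?Gn n) + (P.prob ?X1 + P.prob ?X2)" by (rule add_left_mono[OF measure_Un_le[OF Xs]])
        finally have fin: "P.prob {\<omega>\<in>space P. ennreal (a * y) < fam_val M p U \<omega> \<and> ennreal (a * y) < fam_val M q V \<omega>} \<le> P.prob (?Gn n) + (P.prob ?X1 + P.prob ?X2)" .
        have "P.prob ?X1 \<le> \<eta>" "P.prob ?X2 \<le> \<eta>"
          using U(3) V(3) eta by (auto simp: P.emeasure_eq_measure ennreal_less_iff intro: less_imp_le)
        then show "c * y powr (- \<alpha>) \<le> P.prob (?Gn n) + \<eta>'"
          using fam_bound[OF U(1) V(1) U(2) V(2) y] fin unfolding \<eta>_def by linarith
      qed
      \<comment> \<open>The bound holds for every large \<open>n\<close>, hence for the upper limit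
        of the events; infinitely many joint exceedances force the weak inequalities for both
        limits.\<close>
      let ?T = "\<lambda>N. \<Union>n\<in>{N..}. ?Gn n"
      have Tm: "?T N \<in> sets P" for N using Gm by (intro sets.countable_UN') auto
      have "(\<lambda>N. P.prob (?T N)) \<longlonglongrightarrow> P.prob (\<Inter>N. ?T N)"
      proof (rule P.finite_Lim_measure_decseq)
        show "range ?T \<subseteq> sets P" using Tm by blast
        show "decseq ?T" by (rule decseq_SucI, rule UN_mono) auto
      qed
      moreover have "c * y powr (- \<alpha>) \<le> P.prob (?T N)" if "max nf ng \<le> N" for N
      proof -
        have "c * y powr (- \<alpha>) \<le> P.prob (?Gn N)" using that by (intro Gn) auto
        also have "\<dots> \<le> P.prob (?T N)" by (rule P.finite_measure_mono[OF _ Tm]) auto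
        finally show ?thesis .
      qed
      ultimately have "c * y powr (- \<alpha>) \<le> P.prob (\<Inter>N. ?T N)"
        by (intro LIMSEQ_le_const[where X="\<lambda>N. P.prob (?T N)"]) blast+
      also have "\<dots> \<le> P.prob {\<omega>\<in>space P. ?b \<le> X \<omega> \<and> ?b \<le> Y \<omega>}"
      proof (rule P.finite_measure_mono_AE)
        show "AE \<omega> in P. \<omega> \<in> (\<Inter>N. ?T N) \<longrightarrow> \<omega> \<in> {\<omega>\<in>space P. ?b \<le> X \<omega> \<and> ?b \<le> Y \<omega>}"
          using limf limg
        proof eventually_elim
          case (elim \<omega>)
          show ?case
          proof
            assume w: "\<omega> \<in> (\<Inter>N. ?T N)"
            then have wsp: "\<omega> \<in> space P" by blast
            have fr: "\<exists>n\<ge>N. ?b < Zf n \<omega> \<and> ?b < Zg n \<omega>" for N using w by auto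
            have "?b \<le> X \<omega>"
            proof (rule ccontr)
              assume "\<not> ?b \<le> X \<omega>"
              then have "\<forall>\<^sub>F n in sequentially. Zf n \<omega> < ?b" using elim(1) by (intro order_tendstoD(2)) (auto simp: not_le)
              then obtain N where "\<forall>n\<ge>N. Zf n \<omega> < ?b" unfolding eventually_sequentially by blast
              then show False using fr[of N] by (meson less_asym)
            qed
            moreover have "?b \<le> Y \<omega>"
            proof (rule ccontr)
              assume "\<not> ?b \<le> Y \<omega>"
              then have "\<forall>\<^sub>F n in sequentially. Zg n \<omega> < ?b" using elim(2) by (intro order_tendstoD(2)) (auto simp: not_le)
              then obtain N where "\<forall>n\<ge>N. Zg n \<omega> < ?b" unfolding eventually_sequentially by blast
              then show False using fr[of N] by (meson less_asym)
            qed
            ultimately show "\<omega> \<in> {\<omega>\<in>space P. ?b \<le> X \<omega> \<and> ?b \<le> Y \<omega>}" using wsp by blast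
          qed
        qed
        show "{\<omega>\<in>space P. ?b \<le> X \<omega> \<and> ?b \<le> Y \<omega>} \<in> sets P" using Xm Ym by measurable
      qed
      finally show ?thesis .
    qed
  qed
qed

end

subsection \<open>Locality of extremal integrals\<close>

lemma close_tendsto:
  fixes v :: ennreal
  assumes c: "\<forall>\<^sub>F l in sequentially. close (e l) (u l) v" and e: "(\<lambda>l. ennreal (e l)) \<longlonglongrightarrow> 0"
  shows "u \<longlonglongrightarrow> v"
proof (rule tendsto_sandwich[of "\<lambda>l. v - ennreal (e l)" u sequentially "\<lambda>l. v + ennreal (e l)"])
  show "\<forall>\<^sub>F l in sequentially. v - ennreal (e l) \<le> u l"
    using c by eventually_elim (auto simp: close_def ennreal_minus_le_iff add.commute)
  show "\<forall>\<^sub>F l in sequentially. u l \<le> v + ennreal (e l)"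
    using c by eventually_elim (auto simp: close_def)
  have "(\<lambda>l. v + ennreal (e l)) \<longlonglongrightarrow> v + 0" by (intro tendsto_add tendsto_const e)
  then show "(\<lambda>l. v + ennreal (e l)) \<longlonglongrightarrow> v" by simp
  show "(\<lambda>l. v - ennreal (e l)) \<longlonglongrightarrow> v"
  proof (cases "v = top")
    case True
    then show ?thesis by (simp add: ennreal_top_minus)
  next
    case False
    have "(\<lambda>l. v - ennreal (e l)) \<longlonglongrightarrow> v - 0" by (rule tendsto_diff_ennreal[OF tendsto_const e False]) simp
    then show ?thesis by simp
  qed
qed

context sup_measure begin

text \<open>Finitely many conditions on values of \<open>M\<close> inside \<open>A\<close>. These
  events are stable under intersection and generate \<open>local_sigma A\<close>, so independence of
  the generated sigma-algebras can be checked on them.\<close>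

definition local_events :: "'a set \<Rightarrow> 'w set set" where
  "local_events A = {{\<omega>\<in>space P. \<forall>C\<in>\<C>. M C \<omega> \<in> S C} | \<C> S.
     finite \<C> \<and> (\<forall>C\<in>\<C>. C \<in> sets \<mu> \<and> C \<subseteq> A) \<and> (\<forall>C. S C \<in> sets borel)}"

definition local_sigma :: "'a set \<Rightarrow> 'w measure" where
  "local_sigma A = sigma (space P) (local_events A)"

text \<open>Up to null sets, because the integrals are determined only almost surely and
  \<open>local_sigma A\<close> need not contain all null sets.\<close>

definition local_var :: "'a set \<Rightarrow> ('w \<Rightarrow> ennreal) \<Rightarrow> bool" where
  "local_var A Z \<longleftrightarrow> (\<exists>Z'\<in>borel_measurable (local_sigma A). AE \<omega> in P. Z \<omega> = Z' \<omega>)"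

lemma local_eventsI:
  "finite \<C> \<Longrightarrow> (\<And>C. C \<in> \<C> \<Longrightarrow> C \<in> sets \<mu> \<and> C \<subseteq> A) \<Longrightarrow> (\<And>C. S C \<in> sets borel) \<Longrightarrow>
    {\<omega>\<in>space P. \<forall>C\<in>\<C>. M C \<omega> \<in> S C} \<in> local_events A"
  unfolding local_events_def by blast

lemma local_eventsE:
  assumes "a \<in> local_events A"
  obtains \<C> S where "a = {\<omega>\<in>space P. \<forall>C\<in>\<C>. M C \<omega> \<in> S C}" "finite \<C>" "\<forall>C\<in>\<C>. C \<in> sets \<mu>"
    "\<forall>C\<in>\<C>. C \<subseteq> A" "\<forall>C. S C \<in> sets borel"
  using assms unfolding local_events_def by blast

lemma local_events_measurable: "local_events A \<subseteq> sets P"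
proof
  fix a assume "a \<in> local_events A"
  then obtain \<C> S where a0: "a = {\<omega>\<in>space P. \<forall>C\<in>\<C>. M C \<omega> \<in> S C}" "finite \<C>" "\<forall>C\<in>\<C>. C \<in> sets \<mu>"
    "\<forall>C\<in>\<C>. C \<subseteq> A" "\<forall>C. S C \<in> sets borel" by (rule local_eventsE)
  note a = a0(1,2) bspec[OF a0(3)] bspec[OF a0(4)] spec[OF a0(5)]
  have "{\<omega>\<in>space P. M C \<omega> \<in> S C} \<in> sets P" if "C \<in> \<C>" for C
    using measurable_sets[OF M_measurable[OF a(3)[OF that]] a(5)[of C]] by (simp add: vimage_def Int_def conj_commute)
  then show "a \<in> sets P" unfolding a(1) using a(2) by (intro sets.sets_Collect_finite_All) auto
qed

lemma local_sigma_space[simp]: "space (local_sigma A) = space P"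
  unfolding local_sigma_def using local_events_measurable[of A] sets.sets_into_space
  by (intro space_measure_of) blast

lemma local_sigma_sets: "sets (local_sigma A) = sigma_sets (space P) (local_events A)"
  unfolding local_sigma_def using local_events_measurable[of A] sets.sets_into_space
  by (intro sets_measure_of) blast

lemma local_sigma_subset: "sets (local_sigma A) \<subseteq> sets P"
  unfolding local_sigma_sets by (rule sets.sigma_sets_subset[OF local_events_measurable])

lemma local_sigma_borel: "Z \<in> borel_measurable (local_sigma A) \<Longrightarrow> Z \<in> borel_measurable P"
  by (rule measurable_from_subalg[of P "local_sigma A"]) (simp_all add: subalgebra_def local_sigma_subset)

lemma local_events_Int_stable: "Int_stable (local_events A)"
proof (rule Int_stableI)
  fix a b assume ab: "a \<in> local_events A" "b \<in> local_events A"
  obtain \<C> S where a0: "a = {\<omega>\<in>space P. \<forall>C\<in>\<C>. M C \<omega> \<in> S C}" "finite \<C>" "\<forall>C\<in>\<C>. C \<in> sets \<mu>"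
    "\<forall>C\<in>\<C>. C \<subseteq> A" "\<forall>C. S C \<in> sets borel" using ab(1) by (rule local_eventsE)
  note a = a0(1,2) bspec[OF a0(3)] bspec[OF a0(4)] spec[OF a0(5)]
  obtain \<D> T where b0: "b = {\<omega>\<in>space P. \<forall>C\<in>\<D>. M C \<omega> \<in> T C}" "finite \<D>" "\<forall>C\<in>\<D>. C \<in> sets \<mu>"
    "\<forall>C\<in>\<D>. C \<subseteq> A" "\<forall>C. T C \<in> sets borel" using ab(2) by (rule local_eventsE)
  note b = b0(1,2) bspec[OF b0(3)] bspec[OF b0(4)] spec[OF b0(5)]
  let ?S = "\<lambda>C. (if C \<in> \<C> then S C else UNIV) \<inter> (if C \<in> \<D> then T C else UNIV)"
  have "{\<omega>\<in>space P. \<forall>C\<in>\<C>\<union>\<D>. M C \<omega> \<in> ?S C} \<in> local_events A"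
  proof (rule local_eventsI)
    show "finite (\<C> \<union> \<D>)" using a(2) b(2) by simp
    show "C \<in> sets \<mu> \<and> C \<subseteq> A" if "C \<in> \<C> \<union> \<D>" for C using that a(3,4) b(3,4) by blast
    show "?S C \<in> sets borel" for C using a(5)[of C] b(5)[of C] by (intro sets.Int) auto
  qed
  moreover have "a \<inter> b = {\<omega>\<in>space P. \<forall>C\<in>\<C>\<union>\<D>. M C \<omega> \<in> ?S C}" unfolding a(1) b(1) by auto
  ultimately show "a \<inter> b \<in> local_events A" by simp
qed

lemma M_local:
  assumes C: "C \<in> sets \<mu>" "C \<subseteq> A"
  shows "M C \<in> borel_measurable (local_sigma A)"
proof (rule measurableI)
  fix U :: "ennreal set" assume U: "U \<in> sets borel"
  have "{\<omega>\<in>space P. \<forall>C\<in>{C}. M C \<omega> \<in> U} \<in> local_events A"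
    by (rule local_eventsI) (use C U in auto)
  moreover have "M C -` U \<inter> space (local_sigma A) = {\<omega>\<in>space P. \<forall>C\<in>{C}. M C \<omega> \<in> U}" by auto
  ultimately show "M C -` U \<inter> space (local_sigma A) \<in> sets (local_sigma A)"
    unfolding local_sigma_sets by (simp add: sigma_sets.Basic)
qed simp

lemma fam_val_local:
  assumes W: "rect_family \<mu> k (F \<inter> A) W"
  shows "fam_val M k W \<in> borel_measurable (local_sigma A)"
proof -
  have "countable W" using W by (auto simp: rect_family_def intro: countable_finite)
  moreover have "M (snd w r) \<in> borel_measurable (local_sigma A)" if "w \<in> W" "r < k" for w r
    using W that unfolding rect_family_def by (intro M_local) blast+
  ultimately show ?thesis unfolding fam_val_def[abs_def]
    by (intro borel_measurable_SUP borel_measurable_times borel_measurable_prod_ennreal) auto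
qed

text \<open>All sets occurring in the two events are refined into common cells. A nonempty cell
  cannot lie in both \<open>A\<close> and \<open>B\<close>, so the events are almost surely
  functions of disjoint groups of independent cell values.\<close>

lemma local_events_indep:
  assumes AB: "A \<in> sets \<mu>" "B \<in> sets \<mu>" "A \<inter> B = {}"
  shows "P.indep_set (local_events A) (local_events B)"
proof (rule P.indep_setI[OF local_events_measurable local_events_measurable])
  fix a b assume ab: "a \<in> local_events A" "b \<in> local_events B"
  obtain \<C> S where a0: "a = {\<omega>\<in>space P. \<forall>C\<in>\<C>. M C \<omega> \<in> S C}" "finite \<C>" "\<forall>C\<in>\<C>. C \<in> sets \<mu>"
    "\<forall>C\<in>\<C>. C \<subseteq> A" "\<forall>C. S C \<in> sets borel" using ab(1) by (rule local_eventsE)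
  note a = a0(1,2) bspec[OF a0(3)] bspec[OF a0(4)] spec[OF a0(5)]
  obtain \<D> T where b0: "b = {\<omega>\<in>space P. \<forall>C\<in>\<D>. M C \<omega> \<in> T C}" "finite \<D>" "\<forall>C\<in>\<D>. C \<in> sets \<mu>"
    "\<forall>C\<in>\<D>. C \<subseteq> B" "\<forall>C. T C \<in> sets borel" using ab(2) by (rule local_eventsE)
  note b = b0(1,2) bspec[OF b0(3)] bspec[OF b0(4)] spec[OF b0(5)]
  obtain I :: "('a set set \<times> int) set" and D where D: "finite I" "disjoint_family_on D I"
    "\<And>i. i \<in> I \<Longrightarrow> D i \<in> sets \<mu>" "\<And>i. i \<in> I \<Longrightarrow> D i \<noteq> {}" "(\<Union>i\<in>I. D i) = A \<union> B"
    "\<And>b. b \<in> \<C> \<union> \<D> \<Longrightarrow> b = (\<Union>i\<in>{i\<in>I. D i \<subseteq> b}. D i)" "\<And>i z. i \<in> I \<Longrightarrow> z \<in> D i \<Longrightarrow> (\<lambda>_. 0) z = snd i"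
  proof (rule partition_exists[of "\<C> \<union> \<D>" \<mu> "A \<union> B" "\<lambda>_. 0 :: int"])
    show "finite (\<C> \<union> \<D>)" "\<C> \<union> \<D> \<subseteq> sets \<mu>" using a b by auto
    show "c \<subseteq> A \<union> B" if "c \<in> \<C> \<union> \<D>" for c using a(4) b(4) that by blast
    show "finite ((\<lambda>_. 0 :: int) ` (A \<union> B))" by (rule finite_subset[of _ "{0}"]) auto
  qed (use AB in \<open>simp_all\<close>)
  define J where "J C = {i\<in>I. D i \<subseteq> C}" for C
  define I1 where "I1 = (\<Union>C\<in>\<C>. J C)"
  define I2 where "I2 = (\<Union>C\<in>\<D>. J C)"
  have sub: "I1 \<subseteq> I" "I2 \<subseteq> I" by (auto simp: I1_def I2_def J_def)
  have dis: "I1 \<inter> I2 = {}"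
  proof (rule equals0I)
    fix i assume "i \<in> I1 \<inter> I2"
    then have "i \<in> I" "D i \<subseteq> A" "D i \<subseteq> B" using a(4) b(4) unfolding I1_def I2_def J_def by blast+
    then show False using D(4) AB(3) by blast
  qed
  have "AE \<omega> in P. M C \<omega> = (SUP i\<in>J C. M (D i) \<omega>)" if "C \<in> \<C> \<union> \<D>" for C
  proof -
    have "AE \<omega> in P. M (\<Union>i\<in>J C. D i) \<omega> = (SUP i\<in>J C. M (D i) \<omega>)"
      by (rule M_UN) (use D(1,3) in \<open>auto simp: J_def\<close>)
    moreover have "(\<Union>i\<in>J C. D i) = C" using D(6)[OF that] unfolding J_def by simp
    ultimately show ?thesis by simp
  qed
  then have eq: "AE \<omega> in P. \<forall>C\<in>\<C> \<union> \<D>. M C \<omega> = (SUP i\<in>J C. M (D i) \<omega>)"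
    using a(2) b(2) by (intro AE_finite_allI) auto
  define G where "G \<C>' S' I' = {v\<in>space (PiM I' (\<lambda>_. borel)). \<forall>C\<in>\<C>'. (SUP i\<in>J C. v i) \<in> S' C}"
    for \<C>' :: "'a set set" and S' :: "'a set \<Rightarrow> ennreal set" and I' :: "('a set set \<times> int) set"
  have Gm: "G \<C>' S' I' \<in> sets (PiM I' (\<lambda>_. borel))"
    if "finite \<C>'" "\<And>C. C \<in> \<C>' \<Longrightarrow> J C \<subseteq> I'" "\<And>C. S' C \<in> sets borel" for \<C>' S' I'
    unfolding G_def
  proof (rule sets.sets_Collect_finite_All[OF _ that(1)])
    fix C assume C: "C \<in> \<C>'"
    have "(\<lambda>v. SUP i\<in>J C. v i) \<in> borel_measurable (PiM I' (\<lambda>_. borel :: ennreal measure))"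
      by (intro borel_measurable_SUP measurable_component_singleton countable_finite)
        (use D(1) that(2)[OF C] in \<open>auto simp: J_def\<close>)
    from measurable_sets[OF this that(3)[of C]]
    show "{v\<in>space (PiM I' (\<lambda>_. borel)). (SUP i\<in>J C. v i) \<in> S' C} \<in> sets (PiM I' (\<lambda>_. borel))"
      by (simp add: vimage_def Int_def conj_commute)
  qed
  define V where "V I' \<omega> = restrict (\<lambda>i. M (D i) \<omega>) I'" for I' \<omega>
  have Vm: "V I' \<in> measurable P (PiM I' (\<lambda>_. borel))" if "I' \<subseteq> I" for I'
    unfolding V_def[abs_def] using that D(3) by (intro measurable_restrict) auto
  have Vsup: "(SUP i\<in>J C. V I' \<omega> i) = (SUP i\<in>J C. M (D i) \<omega>)" if "J C \<subseteq> I'" for C I' \<omega>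
    by (rule SUP_cong[OF refl]) (use that in \<open>auto simp: V_def\<close>)
  have J1: "\<And>C. C \<in> \<C> \<Longrightarrow> J C \<subseteq> I1" and J2: "\<And>C. C \<in> \<D> \<Longrightarrow> J C \<subseteq> I2" by (auto simp: I1_def I2_def)
  have G1: "G \<C> S I1 \<in> sets (PiM I1 (\<lambda>_. borel))" by (rule Gm[OF a(2) J1 a(5)])
  have G2: "G \<D> T I2 \<in> sets (PiM I2 (\<lambda>_. borel))" by (rule Gm[OF b(2) J2 b(5)])
  let ?a = "V I1 -` G \<C> S I1 \<inter> space P" and ?b = "V I2 -` G \<D> T I2 \<inter> space P"
  have abm: "?a \<in> sets P" "?b \<in> sets P"
    using measurable_sets[OF Vm[OF sub(1)] G1] measurable_sets[OF Vm[OF sub(2)] G2] by blast+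
  have am: "a \<in> sets P" "b \<in> sets P"
    using local_events_measurable ab by blast+
  have ae: "AE \<omega> in P. (\<omega> \<in> a \<longleftrightarrow> \<omega> \<in> ?a) \<and> (\<omega> \<in> b \<longleftrightarrow> \<omega> \<in> ?b)"
    using eq AE_space
  proof eventually_elim
    case (elim \<omega>)
    have "(\<omega> \<in> a) = (\<forall>C\<in>\<C>. (SUP i\<in>J C. V I1 \<omega> i) \<in> S C)"
      unfolding a(1) using elim Vsup[OF J1] by simp
    moreover have "(\<omega> \<in> b) = (\<forall>C\<in>\<D>. (SUP i\<in>J C. V I2 \<omega> i) \<in> T C)"
      unfolding b(1) using elim Vsup[OF J2] by simp
    ultimately show ?case
      using measurable_space[OF Vm[OF sub(1)] elim(2)] measurable_space[OF Vm[OF sub(2)] elim(2)] elim(2)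
      unfolding G_def by simp
  qed
  have "P.indep_var (PiM I1 (\<lambda>_. borel)) (V I1) (PiM I2 (\<lambda>_. borel)) (V I2)"
    unfolding V_def[abs_def] by (rule P.indep_var_restrict[OF M_indep[OF D(1,2,3)] dis sub])
  note iv = P.indep_varD[OF this G1 G2]
  have pre: "(\<lambda>\<omega>. (V I1 \<omega>, V I2 \<omega>)) -` (G \<C> S I1 \<times> G \<D> T I2) \<inter> space P = ?a \<inter> ?b"
    unfolding set_eq_iff vimage_eq Int_iff mem_Sigma_iff
    by (rule allI, rule iffI; elim conjE; intro conjI; assumption)
  have prod: "P.prob (?a \<inter> ?b) = P.prob ?a * P.prob ?b" using iv unfolding pre .
  have "P.prob (a \<inter> b) = P.prob (?a \<inter> ?b)"
    by (rule P.finite_measure_eq_AE[OF _ sets.Int[OF am] sets.Int[OF abm]]) (use ae in eventually_elim, blast)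
  moreover have "P.prob a = P.prob ?a"
    by (rule P.finite_measure_eq_AE[OF _ am(1) abm(1)]) (use ae in eventually_elim, blast)
  moreover have "P.prob b = P.prob ?b"
    by (rule P.finite_measure_eq_AE[OF _ am(2) abm(2)]) (use ae in eventually_elim, blast)
  ultimately show "P.prob (a \<inter> b) = P.prob a * P.prob b" using prod by simp
qed

lemma local_vars_indep:
  assumes AB: "A \<in> sets \<mu>" "B \<in> sets \<mu>" "A \<inter> B = {}"
    and X: "local_var A X" "X \<in> borel_measurable P" and Y: "local_var B Y" "Y \<in> borel_measurable P"
  shows "P.indep_var borel X borel Y"
proof -
  obtain X' where X': "X' \<in> borel_measurable (local_sigma A)" "AE \<omega> in P. X \<omega> = X' \<omega>"
    using X(1) unfolding local_var_def by blast
  obtain Y' where Y': "Y' \<in> borel_measurable (local_sigma B)" "AE \<omega> in P. Y \<omega> = Y' \<omega>"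
    using Y(1) unfolding local_var_def by blast
  have ind: "P.indep_set (sets (local_sigma A)) (sets (local_sigma B))"
    unfolding local_sigma_sets
    by (rule P.indep_set_sigma_sets[OF local_events_indep[OF AB] local_events_Int_stable local_events_Int_stable])
  let ?GX = "{X -` U \<inter> space P | U. U \<in> sets borel}" and ?GY = "{Y -` U \<inter> space P | U. U \<in> sets borel}"
  have st: "Int_stable {Z -` U \<inter> space P | U. U \<in> sets borel}" for Z :: "'w \<Rightarrow> ennreal"
  proof (rule Int_stableI)
    fix a b assume "a \<in> {Z -` U \<inter> space P | U. U \<in> sets borel}" "b \<in> {Z -` U \<inter> space P | U. U \<in> sets borel}"
    then obtain U V where UV: "U \<in> sets borel" "V \<in> sets borel" "a = Z -` U \<inter> space P" "b = Z -` V \<inter> space P" by blast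
    then have "a \<inter> b = Z -` (U \<inter> V) \<inter> space P" "U \<inter> V \<in> sets borel" by auto
    then show "a \<inter> b \<in> {Z -` U \<inter> space P | U. U \<in> sets borel}" by blast
  qed
  have "P.indep_set ?GX ?GY"
  proof (rule P.indep_setI)
    show "?GX \<subseteq> sets P" "?GY \<subseteq> sets P" using measurable_sets[OF X(2)] measurable_sets[OF Y(2)] by blast+
    fix a b assume "a \<in> ?GX" "b \<in> ?GY"
    then obtain U V where UV: "U \<in> sets borel" "V \<in> sets borel" "a = X -` U \<inter> space P" "b = Y -` V \<inter> space P" by blast
    have am: "a \<in> sets P" "b \<in> sets P" using measurable_sets[OF X(2) UV(1)] measurable_sets[OF Y(2) UV(2)] UV(3,4) by auto
    let ?a = "X' -` U \<inter> space P" and ?b = "Y' -` V \<inter> space P"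
    have aL: "?a \<in> sets (local_sigma A)" "?b \<in> sets (local_sigma B)"
      using measurable_sets[OF X'(1) UV(1)] measurable_sets[OF Y'(1) UV(2)] by simp_all
    then have abm: "?a \<in> sets P" "?b \<in> sets P" using local_sigma_subset by blast+
    have ae: "AE \<omega> in P. (\<omega> \<in> a \<longleftrightarrow> \<omega> \<in> ?a) \<and> (\<omega> \<in> b \<longleftrightarrow> \<omega> \<in> ?b)"
      using X'(2) Y'(2) by eventually_elim (simp add: UV(3,4))
    have "P.prob (a \<inter> b) = P.prob (?a \<inter> ?b)"
      by (rule P.finite_measure_eq_AE[OF _ sets.Int[OF am] sets.Int[OF abm]]) (use ae in eventually_elim, blast)
    moreover have "P.prob a = P.prob ?a"
      by (rule P.finite_measure_eq_AE[OF _ am(1) abm(1)]) (use ae in eventually_elim, blast)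
    moreover have "P.prob b = P.prob ?b"
      by (rule P.finite_measure_eq_AE[OF _ am(2) abm(2)]) (use ae in eventually_elim, blast)
    ultimately show "P.prob (a \<inter> b) = P.prob a * P.prob b" using P.indep_setD[OF ind aL] by simp
  qed
  then have "P.indep_set (sigma_sets (space P) ?GX) (sigma_sets (space P) ?GY)"
    by (rule P.indep_set_sigma_sets[OF _ st st])
  then show ?thesis unfolding P.indep_var_eq using X(2) Y(2) by blast
qed

lemma local_var_lim:
  assumes Z: "\<And>n::nat. local_var A (Zn n)" and lim: "AE \<omega> in P. (\<lambda>n. Zn n \<omega>) \<longlonglongrightarrow> Z \<omega>"
  shows "local_var A Z"
proof -
  have "\<forall>n. \<exists>Z'. Z' \<in> borel_measurable (local_sigma A) \<and> (AE \<omega> in P. Zn n \<omega> = Z' \<omega>)"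
    using Z unfolding local_var_def by blast
  then obtain Z' where Z': "\<forall>n. Z' n \<in> borel_measurable (local_sigma A) \<and> (AE \<omega> in P. Zn n \<omega> = Z' n \<omega>)"
    by (rule choice[THEN exE])
  \<comment> \<open>The upper limit is measurable whether or not the sequence converges, and it
    equals \<open>Z\<close> almost surely.\<close>
  have "(\<lambda>\<omega>. limsup (\<lambda>n. Z' n \<omega>)) \<in> borel_measurable (local_sigma A)"
    using Z' by (intro borel_measurable_limsup) blast
  moreover have "AE \<omega> in P. \<forall>n. Zn n \<omega> = Z' n \<omega>" using Z' by (simp add: AE_all_countable)
  with lim have "AE \<omega> in P. Z \<omega> = limsup (\<lambda>n. Z' n \<omega>)"
  proof eventually_elim
    case (elim \<omega>)
    then have "(\<lambda>n. Z' n \<omega>) \<longlonglongrightarrow> Z \<omega>" by simp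
    then show ?case by (simp add: lim_imp_Limsup)
  qed
  ultimately show ?thesis unfolding local_var_def by (intro bexI[of _ "\<lambda>\<omega>. limsup (\<lambda>n. Z' n \<omega>)"])
qed

text \<open>Borel-Cantelli along a subsequence whose errors and error probabilities are at most
  \<open>(1 / 2) ^ j\<close> turns convergence in probability into almost sure convergence.\<close>

lemma local_var_prob_limit:
  assumes Z: "\<And>l::nat. Zn l \<in> borel_measurable (local_sigma A)" and Zm: "Z \<in> borel_measurable P"
    and lim: "\<And>e. 0 < e \<Longrightarrow> (\<lambda>l. emeasure P {\<omega>\<in>space P. \<not> close e (Zn l \<omega>) (Z \<omega>)}) \<longlonglongrightarrow> 0"
  shows "local_var A Z"
proof -
  have "\<exists>l. emeasure P {\<omega>\<in>space P. \<not> close ((1 / 2) ^ j) (Zn l \<omega>) (Z \<omega>)} < ennreal ((1 / 2) ^ j)" for j :: nat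
  proof -
    have "\<forall>\<^sub>F l in sequentially. emeasure P {\<omega>\<in>space P. \<not> close ((1 / 2) ^ j) (Zn l \<omega>) (Z \<omega>)} < ennreal ((1 / 2) ^ j)"
      by (rule order_tendstoD(2)[OF lim]) simp_all
    then show ?thesis by (rule eventually_happens'[OF sequentially_bot])
  qed
  then have "\<forall>j. \<exists>l. emeasure P {\<omega>\<in>space P. \<not> close ((1 / 2) ^ j) (Zn l \<omega>) (Z \<omega>)} < ennreal ((1 / 2) ^ j)" by blast
  then obtain l where l: "\<forall>j. emeasure P {\<omega>\<in>space P. \<not> close ((1 / 2) ^ j) (Zn (l j) \<omega>) (Z \<omega>)} < ennreal ((1 / 2) ^ j)"
    by (rule choice[THEN exE])
  let ?A = "\<lambda>j. {\<omega>\<in>space P. \<not> close ((1 / 2) ^ j) (Zn (l j) \<omega>) (Z \<omega>)}"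
  have Am: "?A j \<in> sets P" for j
    using close_measurable[OF local_sigma_borel[OF Z] Zm, of "(1 / 2) ^ j" "l j"] by measurable
  have "AE \<omega> in P. eventually (\<lambda>j. \<omega> \<in> space P - ?A j) sequentially"
  proof (rule borel_cantelli_AE1[OF Am])
    show "emeasure P (?A j) < \<infinity>" for j by (simp add: P.emeasure_eq_measure)
    have le: "P.prob (?A j) \<le> (1 / 2) ^ j" for j
      using l[rule_format, of j] by (simp add: P.emeasure_eq_measure ennreal_less_iff)
    show "summable (\<lambda>j. P.prob (?A j))"
      by (rule summable_comparison_test'[OF summable_geometric[of "1 / 2 :: real"]]) (use le in auto)
  qed
  then have conv: "AE \<omega> in P. (\<lambda>j. Zn (l j) \<omega>) \<longlonglongrightarrow> Z \<omega>"
  proof eventually_elim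
    case (elim \<omega>)
    have "(\<lambda>j. ennreal ((1 / 2) ^ j)) \<longlonglongrightarrow> ennreal 0" by (intro tendsto_ennrealI LIMSEQ_realpow_zero) auto
    then have e0: "(\<lambda>j. ennreal ((1 / 2) ^ j)) \<longlonglongrightarrow> 0" by simp
    show ?case
      by (rule close_tendsto[OF _ e0]) (use elim in \<open>auto elim!: eventually_mono\<close>)
  qed
  have "local_var A (Zn (l j))" for j unfolding local_var_def using Z by (intro bexI[of _ "Zn (l j)"]) auto
  from local_var_lim[OF this conv] show ?thesis .
qed

text \<open>The inner families \<open>cap_fam A\<close> have values measurable for
  \<open>local_sigma A\<close>. Passing to them is harmless: since \<open>s\<close> almost surely
  vanishes outside the power of \<open>A\<close>, the outer part of a step function lives where the
  step function differs from \<open>s\<close>, and there \<open>out_fam_small\<close>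
  applies.\<close>

lemma elem_approx_local:
  assumes el: "elem_approx (Suc d) s Z" and A: "A \<in> sets \<mu>"
    and s: "AE x in power_measure \<mu> (Suc d). 0 < s x \<longrightarrow> x \<in> PiE {..<Suc d} (\<lambda>_. A)"
  shows "local_var A Z"
proof -
  let ?Pi = "power_measure \<mu> (Suc d)" and ?k = "Suc d"
  obtain F b W where sm: "s \<in> borel_measurable ?Pi" and Zm: "Z \<in> borel_measurable P"
    and F: "F \<in> sets \<mu>" "emeasure \<mu> F < \<infinity>" and b: "0 < b"
    and W0: "\<forall>l::nat. rect_family \<mu> ?k F (W l) \<and> (\<forall>w\<in>W l. fst w \<le> b)"
    and lim1: "(\<lambda>l. emeasure ?Pi {x\<in>space ?Pi. fam_step ?k (W l) x \<noteq> s x}) \<longlonglongrightarrow> 0"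
    and lim2: "\<forall>e>0. (\<lambda>l. emeasure P {\<omega>\<in>space P. \<not> close e (fam_val M ?k (W l) \<omega>) (Z \<omega>)}) \<longlonglongrightarrow> 0"
    using el unfolding elem_approx_def by (elim conjE exE)
  have W: "rect_family \<mu> ?k F (W l)" "\<forall>w\<in>W l. fst w \<le> b" for l using W0 by blast+
  let ?O = "\<lambda>l. {x\<in>space ?Pi. 0 < fam_step ?k (W l) x \<and> x \<notin> PiE {..<?k} (\<lambda>_. A)}"
  let ?D = "\<lambda>l. {x\<in>space ?Pi. fam_step ?k (W l) x \<noteq> s x}"
  have Ole: "emeasure ?Pi (?O l) \<le> emeasure ?Pi (?D l)" for l
  proof (rule emeasure_mono_AE)
    show "AE x in ?Pi. x \<in> ?O l \<longrightarrow> x \<in> ?D l" using s by eventually_elim auto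
    show "?D l \<in> sets ?Pi" using borel_measurable_neq[OF fam_step_measurable[OF W(1)[of l]] sm] .
  qed
  have outlim: "(\<lambda>l. emeasure P {\<omega>\<in>space P. ennreal e < fam_val M ?k (out_fam ?k A (W l)) \<omega>}) \<longlonglongrightarrow> 0"
    if e: "0 < e" for e
  proof (rule order_tendstoI)
    fix u :: ennreal assume u: "0 < u"
    obtain \<eta> where eta: "0 < \<eta>" "ennreal \<eta> < u"
    proof -
      obtain y where y: "0 < y" "y < u" using dense[OF u] by blast
      then have "y \<noteq> top" by auto
      then show ?thesis using y by (intro that[of "enn2real y"]) (auto simp: enn2real_positive_iff less_top)
    qed
    obtain \<delta> where \<delta>: "0 < \<delta>" and sm': "\<forall>W A. rect_family \<mu> ?k F W \<longrightarrow> (\<forall>w\<in>W. fst w \<le> b) \<longrightarrow> A \<in> sets \<mu> \<longrightarrow>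
      emeasure ?Pi {x\<in>space ?Pi. 0 < fam_step ?k W x \<and> x \<notin> PiE {..<?k} (\<lambda>_. A)} \<le> ennreal \<delta> \<longrightarrow>
      emeasure P {\<omega>\<in>space P. ennreal e < fam_val M ?k (out_fam ?k A W) \<omega>} \<le> ennreal \<eta>"
      using out_fam_small[OF F e eta(1) b, of d] by (elim exE conjE)
    have "\<forall>\<^sub>F l in sequentially. emeasure ?Pi (?D l) < ennreal \<delta>"
      by (rule order_tendstoD(2)[OF lim1]) (use \<delta> in simp)
    then show "\<forall>\<^sub>F l in sequentially. emeasure P {\<omega>\<in>space P. ennreal e < fam_val M ?k (out_fam ?k A (W l)) \<omega>} < u"
    proof eventually_elim
      case (elim l)
      have "emeasure ?Pi (?O l) \<le> ennreal \<delta>" by (rule order_trans[OF Ole less_imp_le[OF elim]])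
      from sm'[rule_format, OF W(1) bspec[OF W(2)] A this] show ?case using eta(2) by (rule le_less_trans)
    qed
  qed simp
  let ?c = "\<lambda>l. fam_val M ?k (cap_fam A (W l))" and ?o = "\<lambda>l. fam_val M ?k (out_fam ?k A (W l))" and ?v = "\<lambda>l. fam_val M ?k (W l)"
  have cl: "?c l \<in> borel_measurable (local_sigma A)" for l by (rule fam_val_local[OF rect_family_cap[OF W(1) A]])
  have om: "?o l \<in> borel_measurable P" for l by (rule fam_val_measurable[OF _ rect_family_out[OF W(1) A]]) simp
  have vm: "?v l \<in> borel_measurable P" for l by (rule fam_val_measurable[OF _ W(1)]) simp
  show ?thesis
  proof (rule local_var_prob_limit[OF cl Zm])
    fix e :: real assume e: "0 < e"
    let ?B = "\<lambda>l. {\<omega>\<in>space P. \<not> close (e / 2) (?v l \<omega>) (Z \<omega>)}" and ?E = "\<lambda>l. {\<omega>\<in>space P. ennreal (e / 2) < ?o l \<omega>}"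
    have BE: "?B l \<in> sets P" "?E l \<in> sets P" for l
      using close_measurable[OF vm Zm, of "e / 2" l] om[of l] by measurable
    have ee: "ennreal e = ennreal (e / 2) + ennreal (e / 2)" using e by (simp add: ennreal_plus[symmetric] del: ennreal_plus)
    have le: "emeasure P {\<omega>\<in>space P. \<not> close e (?c l \<omega>) (Z \<omega>)} \<le> emeasure P (?B l) + emeasure P (?E l)" for l
    proof -
      have "emeasure P {\<omega>\<in>space P. \<not> close e (?c l \<omega>) (Z \<omega>)} \<le> emeasure P (?B l \<union> ?E l)"
      proof (rule emeasure_mono_AE)
        show "AE \<omega> in P. \<omega> \<in> {\<omega>\<in>space P. \<not> close e (?c l \<omega>) (Z \<omega>)} \<longrightarrow> \<omega> \<in> ?B l \<union> ?E l"
          using fam_val_split[OF W(1)[of l] A]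
        proof eventually_elim
          case (elim \<omega>)
          have "close e (?c l \<omega>) (Z \<omega>)" if h: "close (e / 2) (?v l \<omega>) (Z \<omega>)" "?o l \<omega> \<le> ennreal (e / 2)"
          proof -
            have v1: "?v l \<omega> \<le> Z \<omega> + ennreal (e / 2)" and v2: "Z \<omega> \<le> ?v l \<omega> + ennreal (e / 2)"
              using h(1) unfolding close_def by blast+
            have "max (?c l \<omega>) (?o l \<omega>) \<le> ?c l \<omega> + ennreal (e / 2)"
              using h(2) by (auto simp: add_increasing intro: order_trans)
            then have v3: "?v l \<omega> \<le> ?c l \<omega> + ennreal (e / 2)" using elim by (meson order_trans)
            have "Z \<omega> \<le> ?c l \<omega> + ennreal (e / 2) + ennreal (e / 2)"
              by (rule order_trans[OF v2 add_right_mono[OF v3]])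
            moreover have "Z \<omega> + ennreal (e / 2) \<le> Z \<omega> + ennreal e" using e by (intro add_left_mono ennreal_leI) simp
            then have "?c l \<omega> \<le> Z \<omega> + ennreal e" using elim v1 by (meson order_trans)
            ultimately show ?thesis unfolding close_def ee by (simp add: add.assoc)
          qed
          then show ?case using linorder_not_le by blast
        qed
      qed (use BE in auto)
      also have "emeasure P (?B l \<union> ?E l) \<le> emeasure P (?B l) + emeasure P (?E l)" by (rule emeasure_subadditive[OF BE])
      finally show ?thesis .
    qed
    have "(\<lambda>l. emeasure P (?B l) + emeasure P (?E l)) \<longlonglongrightarrow> 0 + 0"
      by (rule tendsto_add[OF lim2[rule_format] outlim]) (use e in simp_all)
    then have up: "(\<lambda>l. emeasure P (?B l) + emeasure P (?E l)) \<longlonglongrightarrow> 0" by simp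
    show "(\<lambda>l. emeasure P {\<omega>\<in>space P. \<not> close e (?c l \<omega>) (Z \<omega>)}) \<longlonglongrightarrow> 0"
      by (rule tendsto_sandwich[OF always_eventually always_eventually tendsto_const up]) (use le in simp_all)
  qed
qed

lemma integral_local:
  assumes E: "is_borel_space \<mu>" and X: "has_extremal_integral P \<mu> \<alpha> M (Suc d) f X"
    and f: "f \<in> borel_measurable (power_measure \<mu> (Suc d))"
    and A: "A \<in> sets \<mu>" "support_within \<mu> (Suc d) f A"
  shows "local_var A X"
proof (rule extremal_integral_approx[OF E X])
  fix s Z s' Z'
  let ?Pi = "power_measure \<mu> (Suc d)"
  assume el: "\<And>n R::nat. elem_approx (Suc d) (s' (n::nat) R) (Z' n R)"
    and le: "\<And>n x R. x \<in> space ?Pi \<Longrightarrow> s' n R x \<le> s n x" and sf: "\<And>n. AE x in ?Pi. s n x \<le> f x"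
    and mono: "\<And>n \<omega>. mono (\<lambda>R. Z' n R \<omega>)" and Zsup: "\<And>n. AE \<omega> in P. Z n \<omega> = (SUP R. Z' n R \<omega>)"
    and lim: "AE \<omega> in P. (\<lambda>n. Z n \<omega>) \<longlonglongrightarrow> X \<omega>"
  have "{x \<in> space ?Pi. f x > 0} - PiE {..<Suc d} (\<lambda>_. A) \<in> sets ?Pi"
    using f A(1) by (intro sets.Diff sets_PiM_I_finite) (measurable, auto)
  then have "{x \<in> space ?Pi. f x > 0} - PiE {..<Suc d} (\<lambda>_. A) \<in> null_sets ?Pi"
    using A(2) unfolding support_within_def by auto
  then have fA: "AE x in ?Pi. 0 < f x \<longrightarrow> x \<in> PiE {..<Suc d} (\<lambda>_. A)"
    by (rule AE_not_in[THEN AE_mp]) (use AE_space in eventually_elim, blast)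
  have "local_var A (Z' n R)" for n R
  proof (rule elem_approx_local[OF el A(1)])
    show "AE x in ?Pi. 0 < s' n R x \<longrightarrow> x \<in> PiE {..<Suc d} (\<lambda>_. A)"
      using fA sf[of n] AE_space
    proof eventually_elim
      case (elim x)
      have "s' n R x \<le> f x" by (rule order_trans[OF le[OF elim(3)] elim(2)])
      then show ?case using elim(1) by (metis less_le_trans)
    qed
  qed
  then have "local_var A (Z n)" for n
  proof (rule local_var_lim)
    show "AE \<omega> in P. (\<lambda>R. Z' n R \<omega>) \<longlonglongrightarrow> Z n \<omega>"
      using Zsup[of n]
    proof eventually_elim
      case (elim \<omega>)
      then show ?case using LIMSEQ_SUP[of "\<lambda>R. Z' n R \<omega>"] mono[of n \<omega>] by simp
    qed
  qed
  then show "local_var A X" by (rule local_var_lim[OF _ lim])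
qed

subsection \<open>Essential projections of the support\<close>

definition essential_proj :: "nat \<Rightarrow> ((nat \<Rightarrow> 'a) \<Rightarrow> ennreal) \<Rightarrow> nat \<Rightarrow> 'a set" where
  "essential_proj p f r = {s\<in>space \<mu>. 0 < section_mass p r {x\<in>space (power_measure \<mu> p). 0 < f x} s}"

lemma positive_set_measurable:
  "f \<in> borel_measurable (power_measure \<mu> p) \<Longrightarrow> {x\<in>space (power_measure \<mu> p). 0 < f x} \<in> sets (power_measure \<mu> p)"
  for f :: "(nat \<Rightarrow> 'a) \<Rightarrow> ennreal"
  by (rule borel_measurable_less) simp_all

lemma essential_proj_measurable:
  assumes "f \<in> borel_measurable (power_measure \<mu> p)" "r < p"
  shows "essential_proj p f r \<in> sets \<mu>"
  unfolding essential_proj_def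
  by (rule borel_measurable_less[OF _ section_mass_measurable[OF assms(2) positive_set_measurable[OF assms(1)]]]) simp

text \<open>By Fubini: over a point outside the essential projection the section of the support is
  null, and over a point inside it the exceptional set has no points at all.\<close>

lemma essential_proj_support:
  assumes f: "f \<in> borel_measurable (power_measure \<mu> p)" and r: "r < p"
  shows "AE x in power_measure \<mu> p. 0 < f x \<longrightarrow> x r \<in> essential_proj p f r"
proof -
  let ?Pi = "power_measure \<mu> p" and ?S = "{x\<in>space (power_measure \<mu> p). 0 < f x}"
  let ?N = "{x\<in>?S. x r \<notin> essential_proj p f r}"
  note Sm = positive_set_measurable[OF f]
  have "{x\<in>space ?Pi. x r \<in> essential_proj p f r} \<in> sets ?Pi"
    using measurable_sets[OF measurable_component_singleton[of r "{..<p}" "\<lambda>_. \<mu>"] essential_proj_measurable[OF f r]] r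
    by (simp add: vimage_def Int_def conj_commute)
  then have "?S - {x\<in>space ?Pi. x r \<in> essential_proj p f r} \<in> sets ?Pi" using Sm by (rule sets.Diff[rotated])
  moreover have "?S - {x\<in>space ?Pi. x r \<in> essential_proj p f r} = ?N" by blast
  ultimately have Nm: "?N \<in> sets ?Pi" by simp
  have "section_mass p r ?N s = 0" if s: "s \<in> space \<mu>" for s
  proof (cases "s \<in> essential_proj p f r")
    case True
    then have "indicator ?N (x(r := s)) = (0 :: ennreal)" for x by (simp add: indicator_def)
    then show ?thesis by (simp add: section_mass_def)
  next
    case False
    have "section_mass p r ?N s \<le> section_mass p r ?S s"
      unfolding section_mass_def by (intro nn_integral_mono) (simp add: indicator_def)
    then show ?thesis using False s by (simp add: essential_proj_def)
  qed
  then have "emeasure ?Pi ?N = 0"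
    unfolding emeasure_section[OF r Nm] by (simp cong: nn_integral_cong)
  then have "?N \<in> null_sets ?Pi" using Nm by blast
  from AE_not_in[OF this] AE_space show ?thesis by eventually_elim blast
qed

text \<open>The freedom to remove a null set \<open>N\<close> serves to turn almost disjoint
  projections into disjoint ones. It is harmless because points with some coordinate in
  \<open>N\<close> form a null set of the power.\<close>

lemma support_within_essential_proj:
  assumes f: "f \<in> borel_measurable (power_measure \<mu> p)" and N: "N \<in> null_sets \<mu>"
  shows "support_within \<mu> p f ((\<Union>r<p. essential_proj p f r) - N)"
proof -
  let ?Pi = "power_measure \<mu> p" and ?A = "(\<Union>r<p. essential_proj p f r) - N"
  have Nr: "AE x in ?Pi. x r \<notin> N" if r: "r < p" for r
  proof -
    let ?T = "{x\<in>space ?Pi. x r \<in> N}"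
    have Tm: "?T \<in> sets ?Pi"
      using measurable_sets[OF measurable_component_singleton[of r "{..<p}" "\<lambda>_. \<mu>"] null_setsD2[OF N]] r
      by (simp add: vimage_def Int_def conj_commute)
    have "AE s in \<mu>. section_mass p r ?T s = 0"
      using AE_not_in[OF N] by eventually_elim (simp add: section_mass_def)
    then have "(\<integral>\<^sup>+ s. section_mass p r ?T s \<partial>\<mu>) = (\<integral>\<^sup>+ s. 0 \<partial>\<mu>)" by (rule nn_integral_cong_AE)
    then have "?T \<in> null_sets ?Pi" using Tm emeasure_section[OF r Tm] by (intro null_setsI) simp_all
    from AE_not_in[OF this] AE_space show ?thesis by eventually_elim blast
  qed
  have "AE x in ?Pi. \<forall>r\<in>{..<p}. (0 < f x \<longrightarrow> x r \<in> essential_proj p f r) \<and> x r \<notin> N"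
    using essential_proj_support[OF f] Nr by (intro AE_finite_allI) auto
  then have ae: "AE x in ?Pi. x \<notin> {x \<in> space ?Pi. 0 < f x} - PiE {..<p} (\<lambda>_. ?A)"
    using AE_space by eventually_elim (auto simp: space_PiM PiE_iff zero_less_iff_neq_zero)
  have Am: "?A \<in> sets \<mu>"
  proof (rule sets.Diff[OF _ null_setsD2[OF N]], rule sets.finite_UN)
    show "essential_proj p f r \<in> sets \<mu>" if "r \<in> {..<p}" for r
      using that by (intro essential_proj_measurable[OF f]) simp
  qed simp
  have "{x \<in> space ?Pi. 0 < f x} - PiE {..<p} (\<lambda>_. ?A) \<in> sets ?Pi"
    by (rule sets.Diff[OF positive_set_measurable[OF f] sets_PiM_I_finite[OF finite_lessThan Am]])
  from AE_iff_null_sets[OF this] ae show ?thesis unfolding support_within_def by blast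
qed

text \<open>Otherwise the glued limit set would be covered by countably many null sets. Monotonicity
  of both sequences allows one index for both.\<close>

lemma glue_set_incseq:
  assumes r: "r < p" "r' < q"
    and A: "incseq A" "\<And>n. A n \<in> sets (power_measure \<mu> p)" and B: "incseq B" "\<And>n. B n \<in> sets (power_measure \<mu> q)"
    and pos: "emeasure (glue_measure p r q r') (glue_set p r q r' (\<Union>n. A n) (\<Union>n. B n)) \<noteq> 0"
  shows "\<exists>n. emeasure (glue_measure p r q r') (glue_set p r q r' (A n) (B n)) \<noteq> 0"
proof (rule ccontr)
  assume "\<not> ?thesis"
  then have z: "\<And>n. emeasure (glue_measure p r q r') (glue_set p r q r' (A n) (B n)) = 0" by blast
  have "glue_set p r q r' (\<Union>n. A n) (\<Union>n. B n) \<subseteq> (\<Union>n. glue_set p r q r' (A n) (B n))"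
  proof
    fix w assume "w \<in> glue_set p r q r' (\<Union>n. A n) (\<Union>n. B n)"
    then obtain i j where w: "w \<in> space (glue_measure p r q r')" "(fst (snd w))(r := fst w) \<in> A i" "(snd (snd w))(r' := fst w) \<in> B j"
      unfolding glue_set_def by blast
    have "(fst (snd w))(r := fst w) \<in> A (max i j)" "(snd (snd w))(r' := fst w) \<in> B (max i j)"
      using w(2,3) incseqD[OF A(1), of i "max i j"] incseqD[OF B(1), of j "max i j"] by auto
    then show "w \<in> (\<Union>n. glue_set p r q r' (A n) (B n))" using w(1) unfolding glue_set_def by blast
  qed
  note sub = this
  have null: "(\<Union>n. glue_set p r q r' (A n) (B n)) \<in> null_sets (glue_measure p r q r')"
    by (rule null_sets_UN, rule null_setsI[OF z glue_set_measurable[OF r A(2) B(2)]])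
  have UA: "(\<Union>n. A n) \<in> sets (power_measure \<mu> p)" by (rule sets.countable_UN'') (use A(2) in auto)
  have UB: "(\<Union>n. B n) \<in> sets (power_measure \<mu> q)" by (rule sets.countable_UN'') (use B(2) in auto)
  from null_setsD1[OF null_sets_subset[OF null glue_set_measurable[OF r UA UB] sub]] pos
  show False by (rule notE[rotated])
qed

text \<open>The glued measure of the two supports is the integral of the product of their section
  masses, which is positive exactly on the intersection of the projections. Hence it is nonzero, and
  so is the glued measure of the parts where the functions exceed \<open>1 / Suc n\<close> inside a
  set of finite measure, for some \<open>n\<close>; this gives the level
  \<open>a = 1 / Suc n\<close>.\<close>

lemma essential_proj_overlap:
  assumes E: "is_borel_space \<mu>"
    and X: "has_extremal_integral P \<mu> \<alpha> M p f X" and Y: "has_extremal_integral P \<mu> \<alpha> M q g Y"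
    and Xm: "X \<in> borel_measurable P" and Ym: "Y \<in> borel_measurable P"
    and f: "f \<in> borel_measurable (power_measure \<mu> p)" and g: "g \<in> borel_measurable (power_measure \<mu> q)"
    and r: "r < p" "r' < q" and ov: "emeasure \<mu> (essential_proj p f r \<inter> essential_proj q g r') \<noteq> 0"
  shows "\<exists>a>0. \<exists>c>0. \<forall>y\<ge>1. c * y powr (- \<alpha>) \<le> P.prob {\<omega>\<in>space P. ennreal (a * y / 2) \<le> X \<omega> \<and> ennreal (a * y / 2) \<le> Y \<omega>}"
proof -
  obtain F :: "nat \<Rightarrow> 'a set" where F: "range F \<subseteq> sets \<mu>" "(\<Union>i. F i) = space \<mu>" "\<And>i. emeasure \<mu> (F i) \<noteq> \<infinity>" "incseq F"
    using mu.sigma_finite_incseq by blast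
  have Fm: "F n \<in> sets \<mu>" for n using F(1) by blast
  define S where "S p f n = {x\<in>space (power_measure \<mu> p). ennreal (1 / Suc n) < f x} \<inter> PiE {..<p} (\<lambda>_. F n)"
    for p and f :: "(nat \<Rightarrow> 'a) \<Rightarrow> ennreal" and n
  have S: "S p f n \<in> sets (power_measure \<mu> p)" "incseq (S p f)" "(\<Union>n. S p f n) = {x\<in>space (power_measure \<mu> p). 0 < f x}"
    if fm: "f \<in> borel_measurable (power_measure \<mu> p)" for p f n
  proof -
    show "S p f n \<in> sets (power_measure \<mu> p)" unfolding S_def
      by (intro sets.Int borel_measurable_less[OF _ fm] sets_PiM_I_finite) (use Fm in auto)
    show inc: "incseq (S p f)"
    proof (rule incseq_SucI, rule subsetI)
      fix i x assume x: "x \<in> S p f i"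
      have "ennreal (1 / Suc (Suc i)) \<le> ennreal (1 / Suc i)" by (intro ennreal_leI) (simp add: field_simps)
      moreover have "ennreal (1 / Suc i) < f x" using x by (simp add: S_def)
      ultimately have "ennreal (1 / Suc (Suc i)) < f x" by (rule le_less_trans)
      moreover have "F i \<subseteq> F (Suc i)" using F(4) by (simp add: incseq_Suc_iff)
      ultimately show "x \<in> S p f (Suc i)" using x unfolding S_def by (auto simp: PiE_iff)
    qed
    show "(\<Union>n. S p f n) = {x\<in>space (power_measure \<mu> p). 0 < f x}"
    proof (intro set_eqI iffI)
      fix x assume "x \<in> (\<Union>n. S p f n)"
      then obtain n where "x \<in> space (power_measure \<mu> p)" "ennreal (1 / Suc n) < f x" unfolding S_def by blast
      then show "x \<in> {x\<in>space (power_measure \<mu> p). 0 < f x}" by (auto intro: le_less_trans[OF zero_le])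
    next
      fix x assume x: "x \<in> {x\<in>space (power_measure \<mu> p). 0 < f x}"
      have "(\<lambda>n. ennreal (1 / Suc n)) \<longlonglongrightarrow> ennreal 0"
        using LIMSEQ_inverse_real_of_nat by (intro tendsto_ennrealI) (simp add: inverse_eq_divide)
      then have e1: "\<forall>\<^sub>F n in sequentially. ennreal (1 / Suc n) < f x"
        using x by (intro order_tendstoD(2)) auto
      have "\<forall>\<^sub>F n in sequentially. x t \<in> F n" if "t < p" for t
      proof -
        have "x t \<in> space \<mu>" using x that by (auto simp: space_PiM PiE_iff)
        then obtain i where "x t \<in> F i" using F(2) by blast
        then have "x t \<in> F n" if "i \<le> n" for n using incseqD[OF F(4) that] by blast
        then show ?thesis unfolding eventually_sequentially by blast
      qed
      then have e2: "\<forall>\<^sub>F n in sequentially. \<forall>t\<in>{..<p}. x t \<in> F n" by (intro eventually_ball_finite) auto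
      obtain n where "ennreal (1 / Suc n) < f x" "\<forall>t\<in>{..<p}. x t \<in> F n"
        using eventually_happens'[OF sequentially_bot eventually_conj[OF e1 e2]] by blast
      then show "x \<in> (\<Union>n. S p f n)" using x unfolding S_def by (auto simp: PiE_iff space_PiM)
    qed
  qed
  let ?SX = "{x\<in>space (power_measure \<mu> p). 0 < f x}" and ?SY = "{x\<in>space (power_measure \<mu> q). 0 < g x}"
  have em: "emeasure (glue_measure p r q r') (glue_set p r q r' ?SX ?SY) = (\<integral>\<^sup>+ s. section_mass p r ?SX s * section_mass q r' ?SY s \<partial>\<mu>)"
    by (rule emeasure_glue_set[OF r positive_set_measurable[OF f] positive_set_measurable[OF g]])
  have "emeasure (glue_measure p r q r') (glue_set p r q r' ?SX ?SY) \<noteq> 0"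
  proof
    assume "emeasure (glue_measure p r q r') (glue_set p r q r' ?SX ?SY) = 0"
    then have "AE s in \<mu>. section_mass p r ?SX s * section_mass q r' ?SY s = 0"
      unfolding em
      by (subst (asm) nn_integral_0_iff_AE)
        (use section_mass_measurable[OF r(1) positive_set_measurable[OF f]] section_mass_measurable[OF r(2) positive_set_measurable[OF g]] in auto)
    then have "AE s in \<mu>. s \<notin> essential_proj p f r \<inter> essential_proj q g r'"
      by eventually_elim (auto simp: essential_proj_def)
    then have "essential_proj p f r \<inter> essential_proj q g r' \<in> null_sets \<mu>"
      using AE_iff_null_sets[OF sets.Int[OF essential_proj_measurable[OF f r(1)] essential_proj_measurable[OF g r(2)]]] by (rule iffD2[rotated])
    then show False using ov null_setsD1 by blast
  qed
  then have "emeasure (glue_measure p r q r') (glue_set p r q r' (\<Union>n. S p f n) (\<Union>n. S q g n)) \<noteq> 0"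
    unfolding S(3)[OF f] S(3)[OF g] .
  from glue_set_incseq[OF r S(2)[OF f] S(1)[OF f] S(2)[OF g] S(1)[OF g] this]
  obtain n where n: "emeasure (glue_measure p r q r') (glue_set p r q r' (S p f n) (S q g n)) \<noteq> 0" by (rule exE)
  have "\<exists>c>0. \<forall>y\<ge>1. c * y powr (- \<alpha>) \<le> P.prob {\<omega>\<in>space P. ennreal (1 / Suc n * y / 2) \<le> X \<omega> \<and> ennreal (1 / Suc n * y / 2) \<le> Y \<omega>}"
    by (rule overlap_joint_tail[OF E X Y Xm Ym r Fm _ _ S(1)[OF f] _ _ S(1)[OF g] _ _ n])
      (use F(3) in \<open>auto simp: S_def less_top\<close>)
  then show ?thesis by (intro exI[of _ "1 / real (Suc n)"]) simp
qed

end

text \<open>The two marginal bounds multiply to the order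
  \<open>y powr (- (3 / 2 * \<alpha>))\<close>. Dividing by \<open>y powr (- \<alpha>)\<close>
  leaves a negative power of \<open>y\<close>, and letting \<open>y\<close> tend to infinity forces
  \<open>c \<le> 0\<close>.\<close>

lemma power_tail_contradiction:
  fixes \<alpha> a c C D :: real
  assumes pos: "0 < \<alpha>" "0 < a" "0 < c"
    and le: "\<And>x y. 1 \<le> x \<Longrightarrow> x = a * y / 8 \<Longrightarrow> 1 \<le> y \<Longrightarrow> c * y powr (- \<alpha>) \<le> (C * x powr (- (3 / 4 * \<alpha>))) * (D * x powr (- (3 / 4 * \<alpha>)))"
  shows False
proof -
  have "\<forall>\<^sub>F y in at_top. c \<le> C * D * (a / 8) powr (- (3 / 2 * \<alpha>)) * y powr (- (\<alpha> / 2))"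
    using eventually_ge_at_top[of 1] eventually_ge_at_top[of "8 / a"]
  proof eventually_elim
    case (elim y)
    have y0: "0 < y" using elim by simp
    have x: "1 \<le> a * y / 8" using elim pos by (simp add: field_simps)
    have "c * y powr (- \<alpha>) \<le> (C * (a * y / 8) powr (- (3 / 4 * \<alpha>))) * (D * (a * y / 8) powr (- (3 / 4 * \<alpha>)))"
      by (rule le[OF x refl elim(1)])
    also have "\<dots> = C * D * ((a / 8 * y) powr (- (3 / 4 * \<alpha>)) * (a / 8 * y) powr (- (3 / 4 * \<alpha>)))" by (simp add: mult_ac)
    also have "(a / 8 * y) powr (- (3 / 4 * \<alpha>)) * (a / 8 * y) powr (- (3 / 4 * \<alpha>)) = (a / 8 * y) powr (- (3 / 2 * \<alpha>))"
      by (simp add: powr_add[symmetric])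
    also have "\<dots> = (a / 8) powr (- (3 / 2 * \<alpha>)) * y powr (- (3 / 2 * \<alpha>))" by (rule powr_mult)
    also have "y powr (- (3 / 2 * \<alpha>)) = y powr (- (\<alpha> / 2)) * y powr (- \<alpha>)" by (simp add: powr_add[symmetric])
    finally have "c * y powr (- \<alpha>) \<le> (C * D * (a / 8) powr (- (3 / 2 * \<alpha>)) * y powr (- (\<alpha> / 2))) * y powr (- \<alpha>)"
      by (simp add: mult.assoc)
    then show ?case using y0 by (simp add: mult_le_cancel_right)
  qed
  moreover have "((\<lambda>y. C * D * (a / 8) powr (- (3 / 2 * \<alpha>)) * y powr (- (\<alpha> / 2))) \<longlongrightarrow> C * D * (a / 8) powr (- (3 / 2 * \<alpha>)) * 0) at_top"
    by (intro tendsto_mult_left tendsto_neg_powr filterlim_ident) (use pos in simp)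
  ultimately have "c \<le> C * D * (a / 8) powr (- (3 / 2 * \<alpha>)) * 0"
    by (intro tendsto_lowerbound[of _ _ at_top]) auto
  then show False using pos by simp
qed

section \<open>Independence and disjoint supports\<close>

context tilted_sup_measure begin

lemma independent_essential_proj:
  assumes E: "is_borel_space \<mu>"
    and X: "has_extremal_integral P \<mu> \<alpha> M (Suc d) f X" and Y: "has_extremal_integral P \<mu> \<alpha> M (Suc d') g Y"
    and Xm: "X \<in> borel_measurable P" and Ym: "Y \<in> borel_measurable P"
    and f: "f \<in> borel_measurable (power_measure \<mu> (Suc d))" "tilted_norm d f < \<infinity>"
    and g: "g \<in> borel_measurable (power_measure \<mu> (Suc d'))" "tilted_norm d' g < \<infinity>"
    and ind: "P.indep_var borel X borel Y" and r: "r < Suc d" "r' < Suc d'"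
  shows "emeasure \<mu> (essential_proj (Suc d) f r \<inter> essential_proj (Suc d') g r') = 0"
proof (rule ccontr)
  assume ov: "emeasure \<mu> (essential_proj (Suc d) f r \<inter> essential_proj (Suc d') g r') \<noteq> 0"
  obtain a c where ac: "0 < a" "0 < c"
    and low: "\<forall>y\<ge>1. c * y powr (- \<alpha>) \<le> P.prob {\<omega>\<in>space P. ennreal (a * y / 2) \<le> X \<omega> \<and> ennreal (a * y / 2) \<le> Y \<omega>}"
    using essential_proj_overlap[OF E X Y Xm Ym f(1) g(1) r ov] by (elim exE conjE)
  obtain C where C: "\<forall>x\<ge>1. P.prob {\<omega>\<in>space P. ennreal (2 * x) < X \<omega>} \<le> C * x powr (- (3 / 4 * \<alpha>))"
    using integral_tail_power[OF E X f] by (rule exE)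
  obtain D where D: "\<forall>x\<ge>1. P.prob {\<omega>\<in>space P. ennreal (2 * x) < Y \<omega>} \<le> D * x powr (- (3 / 4 * \<alpha>))"
    using integral_tail_power[OF E Y g] by (rule exE)
  show False
  proof (rule power_tail_contradiction[OF alpha_pos ac])
    fix x y :: real assume x: "1 \<le> x" "x = a * y / 8" and y: "1 \<le> y"
    let ?t = "ennreal (a * y / 2)"
    \<comment> \<open>Reason for the divisor 8: \<open>2 * x = a * y / 4\<close> lies strictly below
      \<open>a * y / 2\<close>, so the weak exceedance in the joint event implies the strict one in
      the marginal tails.\<close>
    have lt: "ennreal (2 * x) < ?t" using x by (simp add: ennreal_less_iff)
    have "P.prob ((\<lambda>\<omega>. (X \<omega>, Y \<omega>)) -` ({?t..} \<times> {?t..}) \<inter> space P) = P.prob (X -` {?t..} \<inter> space P) * P.prob (Y -` {?t..} \<inter> space P)"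
      by (rule P.indep_varD[OF ind]) simp_all
    moreover have "(\<lambda>\<omega>. (X \<omega>, Y \<omega>)) -` ({?t..} \<times> {?t..}) \<inter> space P = {\<omega>\<in>space P. ?t \<le> X \<omega> \<and> ?t \<le> Y \<omega>}" by auto
    ultimately have eq: "P.prob {\<omega>\<in>space P. ?t \<le> X \<omega> \<and> ?t \<le> Y \<omega>} = P.prob (X -` {?t..} \<inter> space P) * P.prob (Y -` {?t..} \<inter> space P)"
      by simp
    have b: "P.prob (Z -` {?t..} \<inter> space P) \<le> P.prob {\<omega>\<in>space P. ennreal (2 * x) < Z \<omega>}" if "Z \<in> borel_measurable P" for Z
    proof (rule P.finite_measure_mono)
      show "Z -` {?t..} \<inter> space P \<subseteq> {\<omega>\<in>space P. ennreal (2 * x) < Z \<omega>}" using lt by (auto intro: less_le_trans)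
      show "{\<omega>\<in>space P. ennreal (2 * x) < Z \<omega>} \<in> sets P" by (rule borel_measurable_less[OF _ that]) simp
    qed
    have bX: "P.prob (X -` {?t..} \<inter> space P) \<le> C * x powr (- (3 / 4 * \<alpha>))"
      by (rule order_trans[OF b[OF Xm] C[rule_format, OF x(1)]])
    have bY: "P.prob (Y -` {?t..} \<inter> space P) \<le> D * x powr (- (3 / 4 * \<alpha>))"
      by (rule order_trans[OF b[OF Ym] D[rule_format, OF x(1)]])
    have "c * y powr (- \<alpha>) \<le> P.prob (X -` {?t..} \<inter> space P) * P.prob (Y -` {?t..} \<inter> space P)"
      using low[rule_format, OF y] unfolding eq .
    also have "\<dots> \<le> (C * x powr (- (3 / 4 * \<alpha>))) * (D * x powr (- (3 / 4 * \<alpha>)))"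
      by (rule mult_mono[OF bX bY order_trans[OF measure_nonneg bX] measure_nonneg])
    finally show "c * y powr (- \<alpha>) \<le> (C * x powr (- (3 / 4 * \<alpha>))) * (D * x powr (- (3 / 4 * \<alpha>)))" .
  qed
qed

lemma independent_iff:
  assumes E: "is_borel_space \<mu>"
    and X: "has_extremal_integral P \<mu> \<alpha> M (Suc d) f X" and Y: "has_extremal_integral P \<mu> \<alpha> M (Suc d') g Y"
    and f: "f \<in> borel_measurable (power_measure \<mu> (Suc d))" "tilted_norm d f < \<infinity>"
    and g: "g \<in> borel_measurable (power_measure \<mu> (Suc d'))" "tilted_norm d' g < \<infinity>"
  shows "P.indep_var borel X borel Y \<longleftrightarrow>
    (\<exists>A B. A \<in> sets \<mu> \<and> B \<in> sets \<mu> \<and> A \<inter> B = {} \<and> support_within \<mu> (Suc d) f A \<and> support_within \<mu> (Suc d') g B)"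
proof
  have Xm: "X \<in> borel_measurable P" and Ym: "Y \<in> borel_measurable P"
    using X Y unfolding has_extremal_integral_def by blast+
  {
    assume ind: "P.indep_var borel X borel Y"
    let ?A = "\<Union>r<Suc d. essential_proj (Suc d) f r" and ?B = "\<Union>r<Suc d'. essential_proj (Suc d') g r"
    have m: "?A \<in> sets \<mu>" "?B \<in> sets \<mu>"
      using essential_proj_measurable[OF f(1)] essential_proj_measurable[OF g(1)] by (intro sets.finite_UN; simp)+
    have "essential_proj (Suc d) f r \<inter> essential_proj (Suc d') g r' \<in> null_sets \<mu>" if "r < Suc d" "r' < Suc d'" for r r'
      using independent_essential_proj[OF E X Y Xm Ym f g ind that]
        sets.Int[OF essential_proj_measurable[OF f(1) that(1)] essential_proj_measurable[OF g(1) that(2)]] by blast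
    then have "(\<Union>r<Suc d. \<Union>r'<Suc d'. essential_proj (Suc d) f r \<inter> essential_proj (Suc d') g r') \<in> null_sets \<mu>"
      by (intro null_sets.finite_UN) auto
    moreover have "(\<Union>r<Suc d. \<Union>r'<Suc d'. essential_proj (Suc d) f r \<inter> essential_proj (Suc d') g r') = ?A \<inter> ?B" by blast
    ultimately have N: "?A \<inter> ?B \<in> null_sets \<mu>" by simp
    have "support_within \<mu> (Suc d) f ?A" using support_within_essential_proj[OF f(1), of "{}"] by simp
    \<comment> \<open>The two unions of projections meet in a null set only; taking it away from one
      of them yields genuinely disjoint sets.\<close>
    moreover have "support_within \<mu> (Suc d') g (?B - ?A \<inter> ?B)" by (rule support_within_essential_proj[OF g(1) N])
    ultimately show "\<exists>A B. A \<in> sets \<mu> \<and> B \<in> sets \<mu> \<and> A \<inter> B = {} \<and> support_within \<mu> (Suc d) f A \<and> support_within \<mu> (Suc d') g B"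
      using m by (intro exI[of _ ?A] exI[of _ "?B - ?A \<inter> ?B"]) blast
  }
  {
    assume "\<exists>A B. A \<in> sets \<mu> \<and> B \<in> sets \<mu> \<and> A \<inter> B = {} \<and> support_within \<mu> (Suc d) f A \<and> support_within \<mu> (Suc d') g B"
    then obtain A B where AB: "A \<in> sets \<mu>" "B \<in> sets \<mu>" "A \<inter> B = {}" "support_within \<mu> (Suc d) f A" "support_within \<mu> (Suc d') g B"
      by (elim exE conjE)
    show "P.indep_var borel X borel Y"
      by (rule local_vars_indep[OF AB(1,2,3) integral_local[OF E X f(1) AB(1,4)] Xm integral_local[OF E Y g(1) AB(2,5)] Ym])
  }
qed

end

theorem theorem6p5:
  fixes \<mu> :: "'a measure" and P :: "'w measure" and \<alpha> :: real
    and M :: "'a set \<Rightarrow> 'w \<Rightarrow> ennreal"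
    and p q :: nat
    and f g :: "(nat \<Rightarrow> 'a) \<Rightarrow> ennreal"
    and X Y :: "'w \<Rightarrow> ennreal"
  assumes "0 < \<alpha>"
    and "is_borel_space \<mu>" and "sigma_finite_measure \<mu>" and "emeasure \<mu> (space \<mu>) \<noteq> 0"
    and "prob_space P" and "frechet_sup_measure P \<mu> \<alpha> M"
    and "1 \<le> p" and "1 \<le> q"
    and "f \<in> class_L \<mu> p" and "symmetric_fun \<mu> p f"
    and "g \<in> class_L \<mu> q" and "symmetric_fun \<mu> q g"
    and "\<exists>(m :: 'a measure) (\<psi> :: 'a \<Rightarrow> ennreal).
           prob_space m \<and> sets m = sets \<mu> \<and>
           absolutely_continuous m \<mu> \<and> absolutely_continuous \<mu> m \<and>
           \<psi> \<in> borel_measurable m \<and> \<mu> = density m \<psi> \<and>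
           (AE x in m. 0 < \<psi> x \<and> \<psi> x < \<infinity>) \<and>
           (\<lambda>x. f x * enn_powr (\<Prod>i<p. \<psi> (x i)) (1 / \<alpha>)) \<in> class_L_plus \<alpha> m p \<and>
           (\<lambda>x. g x * enn_powr (\<Prod>i<q. \<psi> (x i)) (1 / \<alpha>)) \<in> class_L_plus \<alpha> m q"
    and "has_extremal_integral P \<mu> \<alpha> M p f X"
    and "has_extremal_integral P \<mu> \<alpha> M q g Y"
  shows "prob_space.indep_var P borel X borel Y \<longleftrightarrow>
    (\<exists>A B. A \<in> sets \<mu> \<and> B \<in> sets \<mu> \<and> A \<inter> B = {} \<and>
       support_within \<mu> p f A \<and> support_within \<mu> q g B)"
proof -
  obtain d where p: "p = Suc d" using \<open>1 \<le> p\<close> by (cases p) auto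
  obtain d' where q: "q = Suc d'" using \<open>1 \<le> q\<close> by (cases q) auto
  obtain m \<psi> where m: "prob_space m" "sets m = sets \<mu>" "\<psi> \<in> borel_measurable m" "\<mu> = density m \<psi>"
    "AE x in m. 0 < \<psi> x \<and> \<psi> x < \<infinity>"
    and L: "(\<lambda>x. f x * enn_powr (\<Prod>i<p. \<psi> (x i)) (1 / \<alpha>)) \<in> class_L_plus \<alpha> m p"
      "(\<lambda>x. g x * enn_powr (\<Prod>i<q. \<psi> (x i)) (1 / \<alpha>)) \<in> class_L_plus \<alpha> m q"
    using assms(13) by (elim exE conjE)
  interpret tilted_sup_measure P \<mu> \<alpha> M m \<psi>
  proof (intro tilted_sup_measure.intro sup_measure.intro sup_measure_axioms.intro tilted_sup_measure_axioms.intro)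
    show "prob_space P" "sigma_finite_measure \<mu>" "0 < \<alpha>" "frechet_sup_measure P \<mu> \<alpha> M" by fact+
  qed (fact m)+
  have fg: "f \<in> borel_measurable (power_measure \<mu> (Suc d))" "g \<in> borel_measurable (power_measure \<mu> (Suc d'))"
    using \<open>f \<in> class_L \<mu> p\<close> \<open>g \<in> class_L \<mu> q\<close> by (simp_all add: class_L_def p q)
  show ?thesis
    using independent_iff[OF \<open>is_borel_space \<mu>\<close> assms(14,15)[unfolded p q] fg(1) tilted_norm_finite[OF L(1)[unfolded p]]
        fg(2) tilted_norm_finite[OF L(2)[unfolded q]]]
    unfolding p q .
qed

end
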